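(* Let $k\ge2$ be a positive integer, let $\mathrm{Re}(\sqrt\alpha)\ge\mathrm{Re}(\sqrt\beta)>0$, and let $\mathrm{Re}(\nu)>-1$. Then $$\sum_{n=1}^{\infty}r_k(n)\,I_{\nu}\big(\pi(\sqrt{n\alpha}-\sqrt{n\beta})\big)K_{\nu}\big(\pi(\sqrt{n\alpha}+\sqrt{n\beta})\big)$$ $$=-\frac{1}{2\nu}\left(\frac{\sqrt{\alpha}-\sqrt{\beta}}{\sqrt{\alpha}+\sqrt{\beta}}\right)^{\nu}+\frac{2^{-2\nu-1}(\alpha-\beta)^{\nu}\,\Gamma\left(\nu+\frac{1}{2}k\right)}{\pi^{k/2}\,\Gamma(\nu+1)}\,\zeta_k\!\left(\nu+\tfrac{k}{2}\right)$$ $$+\frac{\Gamma\left(\nu+\frac{k}{2}\right)}{\pi^{\frac{k}{2}}2^{k-1}\Gamma(\nu+1)\sqrt{\alpha\beta}}\left(\frac{\sqrt{\alpha}-\sqrt{\beta}}{\sqrt{\alpha}+\sqrt{\beta}}\right)^{\nu}\left(\frac{1}{\sqrt{\alpha}}+\frac{1}{\sqrt{\beta}}\right)^{k-2}{}_2F_1\left(\nu+1-\tfrac{k}{2},\,1-\tfrac{k}{2};\,\nu+1;\,\left(\frac{\sqrt{\alpha}-\sqrt{\beta}}{\sqrt{\alpha}+\sqrt{\beta}}\right)^{2}\right)$$ $$+\frac{\Gamma\left(\nu+\frac{k}{2}\right)}{\pi^{\frac{k}{2}}2^{k-1}\Gamma(\nu+1)}\sum_{n=1}^{\infty}r_{k}(n)\Bigg\{\frac{1}{\sqrt{n+\alpha}\sqrt{n+\beta}}\left(\frac{\sqrt{n+\alpha}-\sqrt{n+\beta}}{\sqrt{n+\alpha}+\sqrt{n+\beta}}\right)^{\nu}\left(\frac{1}{\sqrt{n+\alpha}}+\frac{1}{\sqrt{n+\beta}}\right)^{k-2}$$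 $$\times{}_2F_1\left(\nu+1-\tfrac{k}{2},\,1-\tfrac{k}{2};\,\nu+1;\,\left(\frac{\sqrt{n+\alpha}-\sqrt{n+\beta}}{\sqrt{n+\alpha}+\sqrt{n+\beta}}\right)^{2}\right)-\frac{2^{k-2-2\nu}(\alpha-\beta)^{\nu}}{n^{\nu+k/2}}\Bigg\},$$ where for $\nu=0$ the sum of the first two terms on the right-hand side is understood as its limit as $\nu\to0$.
   Context: $r_k(n)$ is the number of representations of the positive integer $n$ as a sum of $k$ squares, where different signs and different orders of the summands give distinct representations. $\zeta_k(s)=\sum_{n=1}^{\infty}r_k(n)n^{-s}$ for $\mathrm{Re}(s)>k/2$, and $\zeta_k(s)$ is defined elsewhere by analytic continuation. $I_\nu$ and $K_\nu$ are the modified Bessel functions of the first and second kind, respectively, of order $\nu$. $\Gamma$ is the gamma function. ${}_2F_1(a,b;c;z)=\sum_{n=0}^{\infty}\frac{(a)_n(b)_n}{(c)_n\,n!}z^n$ for $|z|<1$, where $(a)_0=1$ and $(a)_n=a(a+1)\cdots(a+n-1)$ for $n\ge1$.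
   Formalization: For α=β the formal theorem assumes Re(ν)>0, since otherwise 0^ν, I_ν(0) or the limit ν→0 is undefined or gives a false identity; and √(αβ) is read as √α·√β, because the principal root of αβ would give the wrong sign when |arg α+arg β|>π. *)

theory Defs
  imports "HOL-Complex_Analysis.Complex_Analysis"
begin

definition sum_squares_count :: "nat \<Rightarrow> nat \<Rightarrow> nat" where
  "sum_squares_count k n =
     card {xs :: int list. length xs = k \<and> (\<Sum>x\<leftarrow>xs. x\<^sup>2) = int n}"

text \<open>
  The continuation below is unique on the whole of its domain: \<open>- {k/2}\<close> is connected, and the
  only singularity of \<open>\<zeta>\<^sub>k\<close> is the simple pole at \<open>k/2\<close>. The value at \<open>k/2\<close> itself
  is meaningless.
\<close>

definition sum_squares_zeta :: "nat \<Rightarrow> complex \<Rightarrow> complex" where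
  "sum_squares_zeta k s =
    (let D = (\<lambda>s. \<Sum>n. of_nat (sum_squares_count k (Suc n)) / of_nat (Suc n) powr s)
     in if Re s > real k / 2 then D s
        else (SOME f. f holomorphic_on (- {of_nat k / 2}) \<and>
                      (\<forall>w. Re w > real k / 2 \<longrightarrow> f w = D w)) s)"

text \<open>
  The test for \<open>\<nu> = 0\<close> is needed since \<open>0 powr 0 = 0\<close>, whereas \<open>I\<^sub>0(0) = 1\<close>. For \<open>z \<noteq> 0\<close>
  this is the principal branch.
\<close>

definition bessel_I :: "complex \<Rightarrow> complex \<Rightarrow> complex" where
  "bessel_I \<nu> z =
     (if \<nu> = 0 then 1 else (z / 2) powr \<nu>) *
     (\<Sum>m. rGamma (\<nu> + of_nat m + 1) * (z / 2) ^ (2 * m) / fact m)"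

definition bessel_K :: "complex \<Rightarrow> complex \<Rightarrow> complex" where
  "bessel_K \<nu> z =
    (let Q = (\<lambda>\<mu>. of_real pi / 2 * (bessel_I (- \<mu>) z - bessel_I \<mu> z) / sin (of_real pi * \<mu>))
     in if \<nu> \<in> \<int> then Lim (at \<nu>) Q else Q \<nu>)"

text \<open>
  Gauss's hypergeometric function: the power series in the unit disc, and its (unique) analytic
  continuation to the plane cut along \<open>[1, \<infinity>)\<close>. The continuation is needed because
  \<open>\<bar>(\<surd>\<alpha> - \<surd>\<beta>) / (\<surd>\<alpha> + \<surd>\<beta>)\<bar> \<ge> 1\<close> is possible for complex \<open>\<alpha>\<close>, \<open>\<beta>\<close> with
  \<open>Re (\<surd>\<alpha>), Re (\<surd>\<beta>) > 0\<close>; the square of this quotient never lies on the cut.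
\<close>

definition hypergeo_2F1 :: "complex \<Rightarrow> complex \<Rightarrow> complex \<Rightarrow> complex \<Rightarrow> complex" where
  "hypergeo_2F1 a b c z =
    (let F = (\<lambda>z. \<Sum>n. pochhammer a n * pochhammer b n / (pochhammer c n * fact n) * z ^ n)
     in if norm z < 1 then F z
        else (SOME f. f holomorphic_on (- {w. Im w = 0 \<and> Re w \<ge> 1}) \<and>
                      (\<forall>w. norm w < 1 \<longrightarrow> f w = F w)) z)"

end

theory Submission
  imports Defs "HOL-Real_Asymp.Real_Asymp"
begin

text \<open>
Write \<open>a\<close>, \<open>b\<close> for the principal square roots of \<open>\<alpha>\<close>, \<open>\<beta>\<close>. The identity is an average of
simpler ones, each attached to a single point \<open>\<gamma>\<close>: inserting the transformation formula of \<open>\<theta>\<^sup>k\<close> under a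
Mellin type integral gives, for real \<open>\<gamma>, \<nu> > 0\<close> and \<open>\<sigma> = \<nu> + k/2\<close>,

  \<open>\<Sum> r\<^sub>k(n) (\<pi> n)\<^sup>\<nu> M(\<pi>\<^sup>2 n \<gamma>) = \<Gamma>(\<sigma>) \<pi>\<^bsup>-\<sigma>\<^esup> (\<gamma>\<^bsup>-\<sigma>\<^esup> + \<Sum> r\<^sub>k(n) (n + \<gamma>)\<^bsup>-\<sigma>\<^esup>) - \<Gamma>(\<nu>) \<pi>\<^bsup>-\<nu>\<^esup> \<gamma>\<^bsup>-\<nu>\<^esup>\<close>

with \<open>M(y) = 2 y\<^bsup>-\<nu>/2\<^esup> K\<^sub>\<nu>(2 \<surd>y)\<close> (\<open>diagonal_identity\<close>). Now let \<open>\<gamma>\<close> run over the segment from \<open>b\<^sup>2\<close>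
to \<open>a\<^sup>2\<close> and integrate against the weight \<open>(1 - x\<^sup>2)\<^bsup>\<nu> - 1/2\<^esup>\<close>. Up to a factor, \<open>\<gamma>\<close> is
\<open>1 + \<rho>\<^sup>2 + 2 \<rho> x\<close> with \<open>\<rho> = (a - b) / (a + b)\<close>, the squared length of a unit vector plus \<open>\<rho>\<close> times a point of the
unit sphere in dimension \<open>2 \<nu> + 2\<close>; so the integrals are spherical means of radial functions, and Darboux's
equation turns them into solutions of ordinary differential equations in \<open>\<rho>\<close>. The function \<open>M\<close> is an
eigenfunction of the radial Laplacian and its mean is a product \<open>I K\<close> (\<open>macdonald_sphere_average\<close>);
\<open>\<gamma>\<^bsup>-\<sigma>\<^esup>\<close> gives the hypergeometric function (\<open>power_sphere_average\<close>); \<open>\<gamma>\<^bsup>-\<nu>\<^esup>\<close> is harmonic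
and gives the elementary term (\<open>power_sphere_average_harmonic\<close>). Subtracting and adding the leading terms of
the summands for large \<open>n\<close>, which sum to the \<open>\<zeta>\<^sub>k\<close> term, yields the theorem for real \<open>\<nu> > 1/2\<close> and positive \<open>a\<close>, \<open>b\<close>
that are close to each other (\<open>base_identity\<close>).

The rest is analytic continuation. After division by \<open>(\<alpha> - \<beta>)\<^sup>\<nu>\<close> all terms are holomorphic in each of \<open>\<nu>\<close>, \<open>a\<close>, \<open>b\<close>
on \<open>Re \<nu> > -1\<close>, \<open>Re a > 0\<close>, \<open>Re b > 0\<close>, apart from a removable singularity at \<open>\<nu> = 0\<close> in the sum of the first two
terms; the subtracted term makes the series on the right converge up to \<open>Re \<nu> = -1\<close>. Continuing first in \<open>\<nu>\<close>, then in
\<open>a\<close>, then in \<open>b\<close> gives \<open>normalised_identity\<close>. It remains to show that the powers in the theorem are taken on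
matching branches. This uses \<open>Re a \<ge> Re b\<close>: the quotients \<open>(a\<^sub>n - b\<^sub>n) / (a\<^sub>n + b\<^sub>n)\<close>, where \<open>a\<^sub>n\<close>, \<open>b\<^sub>n\<close> are the roots of
\<open>n + \<alpha>\<close>, \<open>n + \<beta>\<close>, never meet the negative axis as \<open>n\<close> runs through the nonnegative reals (\<open>Ln_shifted_quotient\<close>).
\<close>

section \<open>Analytic continuation and dominated integrals and series\<close>

lemma islimpt_of_real_image:
  assumes "open S" "x \<in> S"
  shows "complex_of_real x islimpt of_real ` S"
proof -
  have "x islimpt S" using assms by (simp add: interior_limit_point interior_open)
  thus ?thesis unfolding islimpt_approachable by (auto simp: dist_of_real)
qed

text \<open>
The identity theorem, with the set of agreement \<open>U\<close> typically an interval of the real axis.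
\<close>

lemma analytic_continuation_eq:
  assumes "f holomorphic_on S" "g holomorphic_on S" "open S" "connected S" "U \<subseteq> S" "\<xi> \<in> S" "\<xi> islimpt U"
    and "\<And>z. z \<in> U \<Longrightarrow> f z = g z" "w \<in> S"
  shows "f w = g w"
  using analytic_continuation[of "\<lambda>z. f z - g z" S U \<xi> w] assms by (auto intro: holomorphic_on_diff)

text \<open>
By Cauchy's inequality the bound for the integrand yields one for its derivative on a smaller disc, and hence for the
difference quotients, to which dominated convergence applies.
\<close>

lemma has_field_derivative_integral_dominated:
  fixes f :: "complex \<Rightarrow> 'a \<Rightarrow> complex"
  assumes "open S" and z0: "z0 \<in> S"
    and hol: "\<And>x. x \<in> space M \<Longrightarrow> (\<lambda>z. f z x) holomorphic_on S"
    and meas: "\<And>z. z \<in> S \<Longrightarrow> f z \<in> borel_measurable M"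
    and dom: "\<And>z. z \<in> S \<Longrightarrow> \<exists>r>0. \<exists>g. integrable M g \<and>
                (\<forall>w\<in>S. dist z w < r \<longrightarrow> (\<forall>x\<in>space M. norm (f w x) \<le> g x))"
  shows "((\<lambda>z. \<integral>x. f z x \<partial>M) has_field_derivative (\<integral>x. deriv (\<lambda>z. f z x) z0 \<partial>M)) (at z0)"
proof -
    obtain r1 g where r1: "r1 > 0" and g: "integrable M g"
      and gb: "\<And>w x. w \<in> S \<Longrightarrow> dist z0 w < r1 \<Longrightarrow> x \<in> space M \<Longrightarrow> norm (f w x) \<le> g x"
      using dom[OF z0] by blast
    obtain r2 where r2: "r2 > 0" "ball z0 r2 \<subseteq> S"
      using \<open>open S\<close> z0 openE by blast
    define r where "r = min r1 r2 / 3"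
    have r: "r > 0" "\<And>w. dist z0 w < 3 * r \<Longrightarrow> w \<in> S \<and> dist z0 w < r1"
      using r1 r2 by (auto simp: r_def)
    have fb: "norm (f w x) \<le> g x" if "dist z0 w < 3 * r" "x \<in> space M" for w x
      using gb r that by blast
    have int: "integrable M (f w)" if "dist z0 w < 3 * r" for w
      by (rule Bochner_Integration.integrable_bound[OF g])
         (use that r meas fb in \<open>auto intro!: AE_I2 order.trans[OF _ abs_ge_self]\<close>)
    define D where "D = (\<lambda>x. deriv (\<lambda>z. f z x) z0)"
    have hf: "((\<lambda>z. f z x) has_field_derivative deriv (\<lambda>z. f z x) w) (at w)"
      if "dist z0 w < 3 * r" "x \<in> space M" for w x
      using hol[OF that(2)] r(2)[OF that(1)] \<open>open S\<close> holomorphic_derivI by blast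
    have dq: "norm (f w x - f z0 x) \<le> (g x / r) * norm (w - z0)"
      if "dist z0 w < r" "x \<in> space M" for w x
    proof (rule field_differentiable_bound[of "ball z0 r"])
      fix u assume u: "u \<in> ball z0 r"
      show "((\<lambda>z. f z x) has_field_derivative deriv (\<lambda>z. f z x) u) (at u within ball z0 r)"
        using hf[of u x] u r that by (auto intro: has_field_derivative_at_within)
      have sub: "dist z0 v < 3 * r" if "dist u v \<le> r" for v
        using u that dist_triangle[of z0 v u] r(1) by auto
      have "norm ((deriv ^^ 1) (\<lambda>z. f z x) u) \<le> fact 1 * g x / r ^ 1"
      proof (rule Cauchy_inequality)
        show "(\<lambda>z. f z x) holomorphic_on ball u r"
          using hol[OF that(2)] r(2) sub by (auto intro: holomorphic_on_subset)
        show "continuous_on (cball u r) (\<lambda>z. f z x)"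
          using r(2) sub by (intro holomorphic_on_imp_continuous_on holomorphic_on_subset[OF hol[OF that(2)]]) auto
        show "norm (f v x) \<le> g x" if "norm (u - v) = r" for v
          by (rule fb) (use sub[of v] that \<open>x \<in> space M\<close> in \<open>auto simp: dist_norm\<close>)
      qed (use r in auto)
      thus "norm (deriv (\<lambda>z. f z x) u) \<le> g x / r" by simp
    qed (use that r in auto)
    have key: "(\<lambda>n. (\<integral>x. (f (X n) x - f z0 x) / (X n - z0) \<partial>M)) \<longlonglongrightarrow> (\<integral>x. D x \<partial>M)"
      if X: "X \<longlonglongrightarrow> z0" "\<And>n. X n \<noteq> z0" "\<And>n. dist z0 (X n) < r" for X :: "nat \<Rightarrow> complex"
    proof -
      have lim: "(\<lambda>n. (f (X n) x - f z0 x) / (X n - z0)) \<longlonglongrightarrow> D x" if "x \<in> space M" for x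
      proof -
        have "((\<lambda>w. (f w x - f z0 x) / (w - z0)) \<longlongrightarrow> D x) (at z0)"
          using hf[of z0 x] that r(1) by (simp add: D_def has_field_derivative_iff)
        moreover have "filterlim X (at z0) sequentially"
          using X by (auto simp: filterlim_at)
        ultimately show ?thesis by (rule filterlim_compose)
      qed
      have m: "(\<lambda>x. (f (X n) x - f z0 x) / (X n - z0)) \<in> borel_measurable M" for n
        using meas[of "X n"] meas[OF z0] r(2)[of "X n"] X(3)[of n] r(1) by auto
      show ?thesis
      proof (rule integral_dominated_convergence[where w = "\<lambda>x. g x / r"])
        show "D \<in> borel_measurable M"
          by (rule borel_measurable_LIMSEQ_metric[where f = "\<lambda>n x. (f (X n) x - f z0 x) / (X n - z0)", OF m lim])
        show "integrable M (\<lambda>x. g x / r)" using g by simp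
        show "AE x in M. norm ((f (X n) x - f z0 x) / (X n - z0)) \<le> g x / r" for n
        proof (rule AE_I2)
          fix x assume "x \<in> space M"
          from dq[OF X(3) this, of n] show "norm ((f (X n) x - f z0 x) / (X n - z0)) \<le> g x / r"
            using X(2)[of n] by (simp add: norm_divide field_simps)
        qed
      qed (rule m, rule AE_I2, rule lim)
    qed
    have "((\<lambda>w. ((\<integral>x. f w x \<partial>M) - (\<integral>x. f z0 x \<partial>M)) / (w - z0)) \<longlongrightarrow> (\<integral>x. D x \<partial>M)) (at z0)"
      unfolding tendsto_at_iff_sequentially comp_def
    proof (intro allI impI)
      fix X :: "nat \<Rightarrow> complex" assume X: "\<forall>i. X i \<in> UNIV - {z0}" "X \<longlonglongrightarrow> z0"
      have "eventually (\<lambda>n. dist (X n) z0 < r) sequentially"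
        using X(2) r(1) by (rule tendstoD)
      then obtain N where N: "\<And>n. n \<ge> N \<Longrightarrow> dist (X n) z0 < r"
        by (auto simp: eventually_sequentially)
      have e: "(\<integral>x. (f (X n) x - f z0 x) / (X n - z0) \<partial>M) =
                 ((\<integral>x. f (X n) x \<partial>M) - (\<integral>x. f z0 x \<partial>M)) / (X n - z0)" if "n \<ge> N" for n
        using int[of "X n"] int[of z0] N[OF that] r(1) by (simp add: dist_commute)
      have "(\<lambda>n. (\<integral>x. (f (X (n + N)) x - f z0 x) / (X (n + N) - z0) \<partial>M)) \<longlonglongrightarrow> (\<integral>x. D x \<partial>M)"
        by (rule key) (use X N in \<open>auto simp: dist_commute intro: LIMSEQ_ignore_initial_segment\<close>)
      hence "(\<lambda>n. ((\<integral>x. f (X (n + N)) x \<partial>M) - (\<integral>x. f z0 x \<partial>M)) / (X (n + N) - z0)) \<longlonglongrightarrow> (\<integral>x. D x \<partial>M)"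
        by (subst (asm) e) auto
      thus "(\<lambda>n. ((\<integral>x. f (X n) x \<partial>M) - (\<integral>x. f z0 x \<partial>M)) / (X n - z0)) \<longlonglongrightarrow> (\<integral>x. D x \<partial>M)"
        by (rule LIMSEQ_offset)
    qed
    thus ?thesis
      by (simp add: has_field_derivative_iff D_def)
qed

lemma holomorphic_integral_dominated:
  fixes f :: "complex \<Rightarrow> 'a \<Rightarrow> complex"
  assumes "open S"
    and "\<And>x. x \<in> space M \<Longrightarrow> (\<lambda>z. f z x) holomorphic_on S"
    and "\<And>z. z \<in> S \<Longrightarrow> f z \<in> borel_measurable M"
    and "\<And>z. z \<in> S \<Longrightarrow> \<exists>r>0. \<exists>g. integrable M g \<and>
                (\<forall>w\<in>S. dist z w < r \<longrightarrow> (\<forall>x\<in>space M. norm (f w x) \<le> g x))"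
  shows "(\<lambda>z. \<integral>x. f z x \<partial>M) holomorphic_on S"
  using has_field_derivative_integral_dominated[OF assms(1) _ assms(2-4)] assms(1)
  by (auto simp: holomorphic_on_open)

text \<open>
Series are integrals for the counting measure.
\<close>

lemma holomorphic_suminf_dominated:
  fixes f :: "complex \<Rightarrow> nat \<Rightarrow> complex"
  assumes "open S"
    and hol: "\<And>n. (\<lambda>z. f z n) holomorphic_on S"
    and dom: "\<And>z. z \<in> S \<Longrightarrow> \<exists>r>0. \<exists>g. summable g \<and>
                (\<forall>w\<in>S. dist z w < r \<longrightarrow> (\<forall>n. norm (f w n) \<le> g n))"
  shows "(\<lambda>z. \<Sum>n. f z n) holomorphic_on S"
proof -
  have "(\<lambda>z. \<integral>n. f z n \<partial>count_space UNIV) holomorphic_on S"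
  proof (rule holomorphic_integral_dominated)
    fix z assume "z \<in> S"
    then obtain r g where *: "r > 0" "summable g"
      "\<And>w n. w \<in> S \<Longrightarrow> dist z w < r \<Longrightarrow> norm (f w n) \<le> g n" using dom[OF \<open>z \<in> S\<close>] by blast
    have "g n \<ge> 0" for n using order_trans[OF norm_ge_zero *(3)[OF \<open>z \<in> S\<close>, of n]] *(1) by simp
    hence "integrable (count_space UNIV) g"
      using *(2) by (simp add: integrable_count_space_nat_iff)
    thus "\<exists>r>0. \<exists>g. integrable (count_space UNIV) g \<and>
      (\<forall>w\<in>S. dist z w < r \<longrightarrow> (\<forall>x\<in>space (count_space UNIV). norm (f w x) \<le> g x))"
      using * by auto
  qed (use assms in auto)
  moreover have "(\<integral>n. f z n \<partial>count_space UNIV) = (\<Sum>n. f z n)" if z: "z \<in> S" for z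
  proof -
    obtain r g where *: "r > 0" "summable g"
      "\<And>w n. w \<in> S \<Longrightarrow> dist z w < r \<Longrightarrow> norm (f w n) \<le> g n" using dom[OF z] by blast
    have "summable (\<lambda>n. norm (f z n))"
      by (rule summable_comparison_test'[OF *(2), of 0]) (use *(1,3) z in auto)
    thus ?thesis by (simp add: integral_count_space_nat integrable_count_space_nat_iff)
  qed
  ultimately show ?thesis by (simp cong: holomorphic_cong)
qed

section \<open>The theta function and its inversion formula\<close>

definition theta :: "real \<Rightarrow> real" where
  "theta t = 1 + 2 * (\<Sum>n. exp (- pi * t * real (Suc n) ^ 2))"

lemma summable_theta:
  assumes "c > 0"
  shows "summable (\<lambda>n. exp (- c * real (Suc n) ^ 2))"
proof (rule summable_comparison_test'[of "\<lambda>n. exp (-c) ^ n" 0])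
  show "summable (\<lambda>n. exp (-c) ^ n)" using assms by (intro summable_geometric) auto
  show "norm (exp (- c * real (Suc n) ^ 2)) \<le> exp (-c) ^ n" for n
  proof -
    have "real n \<le> real (Suc n) ^ 2" by (simp add: power2_eq_square algebra_simps)
    hence "- c * real (Suc n) ^ 2 \<le> real n * (-c)" using assms by (simp add: mult.commute)
    thus ?thesis by (simp add: exp_of_nat_mult [symmetric])
  qed
qed

lemma theta_ge_1: "t > 0 \<Longrightarrow> theta t \<ge> 1"
  using suminf_nonneg[OF summable_theta[of "pi * t"]] by (simp add: theta_def)

lemma has_sum_theta:
  assumes "t > 0"
  shows "((\<lambda>x::int. exp (- pi * t * of_int x ^ 2)) has_sum theta t) UNIV"
proof -
  define f where "f = (\<lambda>x::int. exp (- pi * t * of_int x ^ 2))"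
  define S where "S = (\<Sum>n. exp (- pi * t * real (Suc n) ^ 2))"
  have S: "((\<lambda>n. exp (- pi * t * real (Suc n) ^ 2)) has_sum S) UNIV"
    unfolding S_def using summable_theta[of "pi * t"] assms
    by (intro sums_nonneg_imp_has_sum summable_sums) auto
  have 1: "(f has_sum S) (range (\<lambda>n. int (Suc n)))"
    using S by (subst has_sum_reindex) (auto simp: inj_on_def f_def o_def)
  have "(- 1 - real n)\<^sup>2 = (1 + real n)\<^sup>2" for n by (simp add: power2_eq_square algebra_simps)
  hence 2: "(f has_sum S) (range (\<lambda>n. - int (Suc n)))"
    using S by (subst has_sum_reindex) (auto simp: inj_on_def f_def o_def)
  have 3: "(f has_sum 1) {0}" by (rule has_sum_finiteI) (auto simp: f_def)
  have "(f has_sum (1 + (S + S))) ({0} \<union> (range (\<lambda>n. int (Suc n)) \<union> range (\<lambda>n. - int (Suc n))))"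
    by (intro has_sum_Un_disjoint 1 2 3) auto
  also have "{0} \<union> (range (\<lambda>n. int (Suc n)) \<union> range (\<lambda>n. - int (Suc n))) = (UNIV :: int set)"
  proof (intro equalityI subsetI)
    fix x :: int
    show "x \<in> {0} \<union> (range (\<lambda>n. int (Suc n)) \<union> range (\<lambda>n. - int (Suc n)))"
      by (cases x rule: int_cases3) (auto simp: image_iff gr0_conv_Suc)
  qed auto
  finally show ?thesis by (simp add: f_def theta_def S_def)
qed

text \<open>
Summing over lists of length \<open>k\<close> turns \<open>\<theta>\<^sup>k\<close> into a sum over lattice points, which is what the definition of
\<open>r\<^sub>k\<close> counts.
\<close>

lemma has_sum_prod_list:
  fixes f :: "int \<Rightarrow> real"
  assumes "(f has_sum S) UNIV" "\<And>x. f x \<ge> 0"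
  shows "((\<lambda>xs. \<Prod>x\<leftarrow>xs. f x) has_sum S ^ k) {xs. length xs = k}"
proof (induction k)
  case 0
  show ?case by (rule has_sum_finiteI) auto
next
  case (Suc k)
  have e: "{xs. length xs = Suc k} = (\<lambda>(x, xs). x # xs) ` (UNIV \<times> {xs :: int list. length xs = k})"
    by (auto simp: length_Suc_conv image_iff)
  have nn: "(\<Prod>x\<leftarrow>xs. f x) \<ge> 0" for xs using assms(2) by (induction xs) auto
  have 1: "((\<lambda>xs. case (x, xs) of (x, xs) \<Rightarrow> f x * (\<Prod>x\<leftarrow>xs. f x)) has_sum f x * S ^ k) {xs. length xs = k}" for x
    unfolding prod.case by (intro has_sum_cmult_right Suc)
  have 2: "((\<lambda>x. f x * S ^ k) has_sum S * S ^ k) UNIV"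
    by (intro has_sum_cmult_left assms)
  have "((\<lambda>(x, xs). f x * (\<Prod>x\<leftarrow>xs. f x)) has_sum S * S ^ k) (UNIV \<times> {xs. length xs = k})"
  proof (rule has_sum_SigmaI[OF 1 2], rule summable_on_SigmaI[OF 1])
    show "(\<lambda>x. f x * S ^ k) summable_on UNIV" using 2 by (rule has_sum_imp_summable)
  qed (use assms nn in auto)
  thus ?case unfolding e
    by (subst has_sum_reindex) (auto simp: inj_on_def o_def case_prod_unfold)
qed

text \<open>
The lattice points are grouped by their squared length.
\<close>

lemma sums_sum_squares_count:
  assumes "t > 0"
  shows "(\<lambda>n. real (sum_squares_count k n) * exp (- pi * t * real n)) sums theta t ^ k"
proof -
  define f where "f = (\<lambda>x::int. exp (- pi * t * of_int x ^ 2))"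
  define B where "B = (\<lambda>n. {xs :: int list. length xs = k \<and> (\<Sum>x\<leftarrow>xs. x\<^sup>2) = int n})"
  have fl: "(\<Prod>x\<leftarrow>xs. f x) = exp (- pi * t * of_int (\<Sum>x\<leftarrow>xs. x\<^sup>2))" for xs
    by (induction xs) (auto simp: f_def exp_add [symmetric] algebra_simps)
  have nn: "(\<Sum>x\<leftarrow>xs. x\<^sup>2) \<ge> (0::int)" for xs by (induction xs) auto
  have "((\<lambda>xs. \<Prod>x\<leftarrow>xs. f x) has_sum theta t ^ k) {xs. length xs = k}"
    by (rule has_sum_prod_list) (use has_sum_theta[OF assms] in \<open>auto simp: f_def\<close>)
  also have "{xs. length xs = k} = snd ` Sigma UNIV B"
    using nn by (auto simp: B_def image_iff) (metis zero_le_imp_eq_int)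
  finally have "((\<lambda>p. \<Prod>x\<leftarrow>snd p. f x) has_sum theta t ^ k) (Sigma UNIV B)"
    by (subst (asm) has_sum_reindex) (auto simp: inj_on_def B_def o_def)
  moreover have "finite (B n)" for n
  proof (rule finite_subset)
    have "x\<^sup>2 \<le> (\<Sum>x\<leftarrow>xs. x\<^sup>2)" if "x \<in> set xs" for x and xs :: "int list"
      using that nn by (induction xs) (auto intro: order.trans add_increasing)
    hence sq: "x\<^sup>2 \<le> int n" if "x \<in> set xs" "xs \<in> B n" for x xs
      using that by (metis (mono_tags, lifting) B_def mem_Collect_eq)
    have "\<bar>x\<bar> \<le> int n" if "x \<in> set xs" "xs \<in> B n" for x xs
    proof -
      have "\<bar>x\<bar> * 1 \<le> \<bar>x\<bar> * \<bar>x\<bar>" if "x \<noteq> 0" using that by (intro mult_left_mono) auto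
      hence "\<bar>x\<bar> \<le> x\<^sup>2" by (cases "x = 0") (auto simp: power2_eq_square abs_mult_self_eq)
      thus ?thesis using sq[OF that] by simp
    qed
    thus "B n \<subseteq> {xs. set xs \<subseteq> {- int n..int n} \<and> length xs = k}"
      by (fastforce simp: B_def)
    show "finite {xs. set xs \<subseteq> {- int n..int n} \<and> length xs = k}"
      by (rule finite_lists_length_eq) auto
  qed
  hence "((\<lambda>xs. \<Prod>x\<leftarrow>snd (n, xs). f x) has_sum real (sum_squares_count k n) * exp (- pi * t * real n)) (B n)" for n
    by (intro has_sum_finiteI) (auto simp: fl B_def sum_squares_count_def)
  ultimately have "((\<lambda>n. real (sum_squares_count k n) * exp (- pi * t * real n)) has_sum theta t ^ k) UNIV"
    by (rule has_sum_SigmaD)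
  thus ?thesis by (rule has_sum_imp_sums)
qed

lemma sum_squares_count_0 [simp]: "sum_squares_count k 0 = 1"
proof -
  have "(length xs = k \<and> (\<Sum>x\<leftarrow>xs. x\<^sup>2) = int 0) \<longleftrightarrow> xs = replicate k 0" for xs :: "int list"
  proof (induction k arbitrary: xs)
    case (Suc k)
    have nn: "(\<Sum>x\<leftarrow>xs. x\<^sup>2) \<ge> (0::int)" for xs by (induction xs) auto
    show ?case
    proof (cases xs)
      case (Cons y ys)
      have "y\<^sup>2 + (\<Sum>x\<leftarrow>ys. x\<^sup>2) = 0 \<longleftrightarrow> y = 0 \<and> (\<Sum>x\<leftarrow>ys. x\<^sup>2) = 0"
        using nn[of ys] by (subst add_nonneg_eq_0_iff) auto
      thus ?thesis using Cons Suc[of ys] by auto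
    qed auto
  qed auto
  hence "{xs :: int list. length xs = k \<and> (\<Sum>x\<leftarrow>xs. x\<^sup>2) = int 0} = {replicate k 0}" by blast
  thus ?thesis by (simp add: sum_squares_count_def)
qed

lemma sums_sum_squares_count_Suc:
  assumes "t > 0"
  shows "(\<lambda>n. real (sum_squares_count k (Suc n)) * exp (- pi * t * real (Suc n))) sums (theta t ^ k - 1)"
  using sums_sum_squares_count[OF assms, of k] by (subst sums_Suc_iff) simp

text \<open>
The inversion formula is obtained here from a finite identity, as the limit of discrete Fourier analysis:
the binomial distribution folded modulo \<open>l\<close> is expressed by powers of cosines at the multiples of \<open>\<pi> / l\<close>. Both
sides become theta series when \<open>N\<close> grows like \<open>l\<^sup>2\<close>.
\<close>

lemma sum_roots_of_unity:
  assumes "l > 0"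
  shows "(\<Sum>j<l. cis (2 * pi * of_int m * real j / real l)) = (if int l dvd m then of_nat l else 0)"
proof -
  define w where "w = cis (2 * pi * of_int m / real l)"
  have w: "cis (2 * pi * of_int m * real j / real l) = w ^ j" for j
    unfolding w_def Complex.DeMoivre by (rule arg_cong[of _ _ cis]) simp
  have wl: "w ^ l = 1"
    using assms by (simp add: w_def Complex.DeMoivre)
  show ?thesis
  proof (cases "int l dvd m")
    case True
    then obtain c where "m = int l * c" by auto
    hence "w = 1" using assms
      by (simp add: w_def) (metis cis_multiple_2pi Ints_of_int mult.assoc mult.commute)
    thus ?thesis using True by (simp add: w)
  next
    case False
    have "w \<noteq> 1"
    proof
      assume "w = 1"
      hence "exp (\<i> * (2 * pi * of_int m / real l)) = 1" by (simp add: w_def cis_conv_exp)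
      then obtain n :: int where "2 * pi * of_int m / real l = of_int (2 * n) * pi"
        by (auto simp: exp_eq_1)
      hence "of_int m = real_of_int (n * int l)" using assms by (simp add: field_simps)
      hence "m = n * int l" using of_int_eq_iff by blast
      thus False using False by simp
    qed
    thus ?thesis using False wl by (simp add: w sum_gp_strict)
  qed
qed

lemma sum_cos_power:
  assumes "l > 0"
  shows "(\<Sum>j<l. cos (pi * real j / real l) ^ (2 * N)) =
           real l / 4 ^ N * (\<Sum>r | r \<le> 2 * N \<and> int l dvd int r - int N. real ((2 * N) choose r))"
proof -
  have c: "(2 * complex_of_real (cos x)) ^ (2 * N) =
          (\<Sum>r\<le>2*N. of_nat ((2 * N) choose r) * cis (2 * of_int (int r - int N) * x))" for x
  proof -
    have "2 * complex_of_real (cos x) = cis x + cis (-x)" by (simp add: complex_eq_iff)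
    also have "\<dots> ^ (2 * N) = (\<Sum>r\<le>2*N. of_nat ((2 * N) choose r) * cis x ^ r * cis (-x) ^ (2 * N - r))"
      by (rule binomial_ring)
    also have "\<dots> = (\<Sum>r\<le>2*N. of_nat ((2 * N) choose r) * cis (2 * of_int (int r - int N) * x))"
    proof (intro sum.cong refl, goal_cases)
      case (1 r)
      have "cis x ^ r * cis (-x) ^ (2 * N - r) = cis (real r * x + real (2 * N - r) * (- x))"
        unfolding Complex.DeMoivre cis_mult ..
      also have "real r * x + real (2 * N - r) * (- x) = 2 * of_int (int r - int N) * x"
        using 1 by (simp add: of_nat_diff algebra_simps)
      finally show ?case by (simp add: mult.assoc)
    qed
    finally show ?thesis .
  qed
  have "complex_of_real (4 ^ N * (\<Sum>j<l. cos (pi * real j / real l) ^ (2 * N))) =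
        (\<Sum>j<l. (2 * complex_of_real (cos (pi * real j / real l))) ^ (2 * N))"
    by (simp add: sum_distrib_left power_mult_distrib power_mult)
  also have "\<dots> = (\<Sum>r\<le>2*N. of_nat ((2 * N) choose r) * (\<Sum>j<l. cis (2 * pi * of_int (int r - int N) * real j / real l)))"
    unfolding c by (subst sum.swap) (simp add: sum_distrib_left mult_ac)
  also have "\<dots> = (\<Sum>r\<le>2*N. if int l dvd int r - int N then of_nat l * of_nat ((2 * N) choose r) else 0)"
    unfolding sum_roots_of_unity[OF assms] by (intro sum.cong) auto
  also have "\<dots> = (\<Sum>r | r \<le> 2 * N \<and> int l dvd int r - int N. of_nat l * of_nat ((2 * N) choose r))"
    by (subst sum.inter_filter [symmetric]) auto
  also have "\<dots> = complex_of_real (real l * (\<Sum>r | r \<le> 2 * N \<and> int l dvd int r - int N. real ((2 * N) choose r)))"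
    by (simp add: sum_distrib_left)
  finally show ?thesis
    unfolding of_real_eq_iff by (simp add: field_simps)
qed

lemma sum_binomial_residue:
  assumes "l > 0"
  shows "(\<Sum>r | r \<le> 2 * N \<and> int l dvd int r - int N. real ((2 * N) choose r)) =
           real ((2 * N) choose N) + 2 * (\<Sum>i\<in>{1..N}. real ((2 * N) choose (N + l * i)))"
proof -
  let ?f = "\<lambda>r. real ((2 * N) choose r)"
  let ?A = "{r. N < r \<and> r \<le> 2 * N \<and> int l dvd int r - int N}"
  let ?B = "{r. r < N \<and> int l dvd int r - int N}"
  have A: "sum ?f ?A = (\<Sum>i\<in>{1..N}. ?f (N + l * i))"
  proof -
    have "(\<Sum>i\<in>{1..N}. ?f (N + l * i)) = (\<Sum>i\<in>{i\<in>{1..N}. l * i \<le> N}. ?f (N + l * i))"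
      by (rule sum.mono_neutral_right) auto
    also have "\<dots> = sum ?f ?A"
    proof (rule sum.reindex_bij_witness[of _ "\<lambda>r. (r - N) div l" "\<lambda>i. N + l * i"])
      fix r assume r: "r \<in> ?A"
      have "int l dvd int (r - N)" using r by (simp add: of_nat_diff)
      then obtain c where c: "r - N = l * c" by (auto simp: int_dvd_int_iff)
      hence "c > 0" using r by (cases c) auto
      moreover have "c \<le> l * c" using assms by simp
      moreover have "l * c \<le> N" using c r by auto
      moreover have "c \<le> N" using \<open>c \<le> l * c\<close> \<open>l * c \<le> N\<close> by (rule order.trans)
      ultimately show "(r - N) div l \<in> {i \<in> {1..N}. l * i \<le> N}" "N + l * ((r - N) div l) = r"
        using c r assms by auto
    qed (use assms in auto)
    finally show ?thesis by simp
  qed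
  have B: "sum ?f ?B = sum ?f ?A"
  proof (rule sum.reindex_bij_witness[of _ "\<lambda>r. 2 * N - r" "\<lambda>r. 2 * N - r"])
    fix r assume r: "r \<in> ?B"
    have e: "int (2 * N - r) - int N = - (int r - int N)" using r by (simp add: of_nat_diff)
    show "2 * N - r \<in> ?A" using r unfolding mem_Collect_eq e by (auto simp: dvd_diff_commute)
    show "?f (2 * N - r) = ?f r" using r by (subst binomial_symmetric) auto
  next
    fix r assume r: "r \<in> ?A"
    have e: "int (2 * N - r) - int N = - (int r - int N)" using r by (simp add: of_nat_diff)
    show "2 * N - r \<in> ?B" using r unfolding mem_Collect_eq e by (auto simp: dvd_diff_commute)
  qed auto
  have "{r. r \<le> 2 * N \<and> int l dvd int r - int N} = insert N (?A \<union> ?B)" by auto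
  hence "(\<Sum>r | r \<le> 2 * N \<and> int l dvd int r - int N. ?f r) = sum ?f (insert N (?A \<union> ?B))" by (simp only:)
  also have "\<dots> = ?f N + (sum ?f ?A + sum ?f ?B)"
  proof -
    have fin: "finite ?A" "finite ?B" by (rule finite_subset[of _ "{..2*N}"]; auto)+
    show ?thesis by (subst sum.insert, (use fin in auto)[2], subst sum.union_disjoint) (use fin in auto)
  qed
  finally show ?thesis by (simp add: A B)
qed

lemma sum_cos_power_symmetric:
  "(\<Sum>j<2*p+1. cos (pi * real j / real (2*p+1)) ^ (2 * N)) =
     1 + 2 * (\<Sum>j<p. cos (pi * real (Suc j) / real (2*p+1)) ^ (2 * N))"
proof -
  let ?f = "\<lambda>j. cos (pi * real j / real (2*p+1)) ^ (2 * N)"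
  have "{..<2*p+1} = insert 0 ({1..p} \<union> {p+1..2*p})" by auto
  hence "sum ?f {..<2*p+1} = sum ?f (insert 0 ({1..p} \<union> {p+1..2*p}))" by (simp only:)
  also have "\<dots> = 1 + (sum ?f {1..p} + sum ?f {p+1..2*p})"
    by (subst sum.insert) (auto simp: sum.union_disjoint)
  also have "sum ?f {p+1..2*p} = sum ?f {1..p}"
  proof (rule sum.reindex_bij_witness[of _ "\<lambda>j. 2*p+1-j" "\<lambda>j. 2*p+1-j"])
    fix j assume j: "j \<in> {p+1..2*p}"
    have "pi * real (2*p+1-j) / real (2*p+1) = pi - pi * real j / real (2*p+1)"
      using j by (simp add: of_nat_diff field_simps)
    thus "?f (2*p+1-j) = ?f j" by (simp add: power_mult)
  qed auto
  also have "sum ?f {1..p} = (\<Sum>j<p. ?f (Suc j))"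
    by (rule sum.reindex_bij_witness[of _ Suc "\<lambda>j. j - 1"]) auto
  finally show ?thesis by simp
qed

lemma cos_le_exp:
  assumes "0 \<le> x" "x \<le> pi / 2"
  shows "cos x \<le> exp (- x\<^sup>2 / 2)"
proof -
  have *: "y * cos y \<le> sin y" if "0 \<le> y" "y \<le> pi / 2" for y :: real
  proof -
    have "sin 0 - 0 * cos 0 \<le> sin y - y * cos y"
    proof (rule DERIV_nonneg_imp_nondecreasing[of 0 y "\<lambda>y. sin y - y * cos y"])
      fix u assume u: "0 \<le> u" "u \<le> y"
      show "\<exists>d. ((\<lambda>y. sin y - y * cos y) has_real_derivative d) (at u) \<and> 0 \<le> d"
        by (rule exI[of _ "u * sin u"], intro conjI derivative_eq_intros refl)
           (use u that in \<open>auto intro!: mult_nonneg_nonneg sin_ge_zero\<close>)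
    qed (use that in auto)
    thus ?thesis by simp
  qed
  have "cos x * exp (x\<^sup>2 / 2) \<le> cos 0 * exp (0\<^sup>2 / 2)"
  proof (rule DERIV_nonpos_imp_nonincreasing[of 0 x "\<lambda>x. cos x * exp (x\<^sup>2 / 2)"])
    fix u assume u: "0 \<le> u" "u \<le> x"
    show "\<exists>d. ((\<lambda>x. cos x * exp (x\<^sup>2 / 2)) has_real_derivative d) (at u) \<and> d \<le> 0"
      by (rule exI[of _ "exp (u\<^sup>2 / 2) * (u * cos u - sin u)"], intro conjI derivative_eq_intros refl)
         (use u assms * in \<open>auto simp: algebra_simps mult_le_0_iff\<close>)
  qed (use assms in auto)
  thus ?thesis by (simp add: exp_minus field_simps)
qed

lemma central_binomial_ratio_step:
  "real ((2 * N) choose (N + Suc r)) * (real N + real r + 1) = real ((2 * N) choose (N + r)) * (real N - real r)"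
proof (cases "r \<le> N")
  case True
  have "Suc (N + r) * ((2 * N) choose Suc (N + r)) = (2 * N - (N + r)) * ((2 * N) choose (N + r))"
    by (metis binomial_absorb_comp binomial_absorption mult.commute binomial_fact_lemma)
  hence "real (Suc (N + r)) * real ((2 * N) choose Suc (N + r)) = real (2 * N - (N + r)) * real ((2 * N) choose (N + r))"
    by (metis of_nat_mult)
  thus ?thesis using True by (simp add: of_nat_diff algebra_simps)
qed (auto simp: binomial_eq_0)

text \<open>
Successive ratios are \<open>(N - r) / (N + r + 1)\<close>, and \<open>1 - x \<le> exp (- x)\<close>. The slack parameter \<open>Q\<close> keeps the
denominator in the exponent constant along the induction. This is the Gaussian upper bound needed for domination.
\<close>

lemma central_binomial_ratio_le:
  assumes "r \<le> Q"
  shows "real ((2 * N) choose (N + r)) \<le> exp (- (real r)\<^sup>2 / (real N + real Q)) * real ((2 * N) choose N)"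
  using assms
proof (induction r)
  case (Suc r)
  show ?case
  proof (cases "r < N")
    case True
    have "(real N - real r) / (real N + real r + 1) = 1 + (- (2 * real r + 1) / (real N + real r + 1))"
      by (simp add: field_simps)
    also have "\<dots> \<le> exp (- (2 * real r + 1) / (real N + real r + 1))" by (rule exp_ge_add_one_self)
    also have "(2 * real r + 1) / (real N + real Q) \<le> (2 * real r + 1) / (real N + real r + 1)"
      using Suc.prems by (intro divide_left_mono) auto
    hence "exp (- (2 * real r + 1) / (real N + real r + 1)) \<le> exp (- (2 * real r + 1) / (real N + real Q))"
      by (simp only: exp_le_cancel_iff minus_divide_left [symmetric] neg_le_iff_le)
    finally have "real ((2 * N) choose (N + r)) * ((real N - real r) / (real N + real r + 1)) \<le>
        exp (- (real r)\<^sup>2 / (real N + real Q)) * real ((2 * N) choose N) * exp (- (2 * real r + 1) / (real N + real Q))"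
      using Suc True by (intro mult_mono) auto
    moreover have "real ((2 * N) choose (N + Suc r)) = real ((2 * N) choose (N + r)) * ((real N - real r) / (real N + real r + 1))"
      using central_binomial_ratio_step[of N r] by (simp add: field_simps)
    moreover have "exp (- (real r)\<^sup>2 / (real N + real Q)) * exp (- (2 * real r + 1) / (real N + real Q)) =
        exp (- (real (Suc r))\<^sup>2 / (real N + real Q))"
      by (simp add: exp_add [symmetric] add_divide_distrib [symmetric] power2_eq_square algebra_simps)
    ultimately show ?thesis by (simp add: mult_ac)
  qed (auto simp: binomial_eq_0)
qed auto

lemma central_binomial_ratio_ge:
  assumes "r \<le> Q" "Q < N"
  shows "real ((2 * N) choose (N + r)) \<ge> exp (- (real r)\<^sup>2 / (real N - real Q)) * real ((2 * N) choose N)"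
  using assms
proof (induction r)
  case (Suc r)
  have "(real N + real r + 1) / (real N - real r) = 1 + (2 * real r + 1) / (real N - real r)"
    using Suc.prems by (simp add: field_simps)
  also have "\<dots> \<le> exp ((2 * real r + 1) / (real N - real r))" by (rule exp_ge_add_one_self)
  also have "\<dots> \<le> exp ((2 * real r + 1) / (real N - real Q))"
    using Suc.prems by (auto intro!: divide_left_mono)
  finally have "inverse (exp ((2 * real r + 1) / (real N - real Q))) \<le> inverse ((real N + real r + 1) / (real N - real r))"
    using Suc.prems by (intro le_imp_inverse_le) auto
  hence "exp (- (2 * real r + 1) / (real N - real Q)) \<le> (real N - real r) / (real N + real r + 1)"
    by (simp only: exp_minus [symmetric] minus_divide_left inverse_divide)
  hence "real ((2 * N) choose (N + r)) * ((real N - real r) / (real N + real r + 1)) \<ge>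
      exp (- (real r)\<^sup>2 / (real N - real Q)) * real ((2 * N) choose N) * exp (- (2 * real r + 1) / (real N - real Q))"
    using Suc by (intro mult_mono) auto
  moreover have "real ((2 * N) choose (N + Suc r)) = real ((2 * N) choose (N + r)) * ((real N - real r) / (real N + real r + 1))"
    using central_binomial_ratio_step[of N r] by (simp add: field_simps)
  moreover have "exp (- (real r)\<^sup>2 / (real N - real Q)) * exp (- (2 * real r + 1) / (real N - real Q)) =
      exp (- (real (Suc r))\<^sup>2 / (real N - real Q))"
    by (simp add: exp_add [symmetric] add_divide_distrib [symmetric] diff_divide_distrib [symmetric] power2_eq_square algebra_simps)
  ultimately show ?case by (simp add: mult_ac)
qed auto

text \<open>
Euler's limit formula for \<open>\<Gamma>(1/2) = \<surd>\<pi>\<close>, since the quotient is \<open>(1/2)\<^sub>N / N!\<close>.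
\<close>

lemma central_binomial_asymp:
  "(\<lambda>N. sqrt (real N) * real ((2 * N) choose N) / 4 ^ N) \<longlonglongrightarrow> 1 / sqrt pi"
proof -
  have e: "real ((2 * N) choose N) / 4 ^ N = pochhammer (1/2) N / fact N" for N
    by (simp add: binomial_fact fact_double power_mult)
  have "(\<lambda>N. inverse (Gamma_series (1/2) N)) \<longlonglongrightarrow> inverse (sqrt pi)"
    using Gamma_series_LIMSEQ[of "1/2 :: real"] by (intro tendsto_inverse) (auto simp: Gamma_one_half_real)
  moreover have "(\<lambda>N. sqrt (real N) * sqrt (real N) / (real N + 1/2)) \<longlonglongrightarrow> 1" by real_asymp
  ultimately have "(\<lambda>N. inverse (Gamma_series (1/2) N) * (sqrt (real N) * sqrt (real N) / (real N + 1/2))) \<longlonglongrightarrow> inverse (sqrt pi) * 1"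
    by (rule tendsto_mult)
  moreover have "eventually (\<lambda>N. inverse (Gamma_series (1/2) N) * (sqrt (real N) * sqrt (real N) / (real N + 1/2)) =
      sqrt (real N) * real ((2 * N) choose N) / 4 ^ N) sequentially"
    using eventually_gt_at_top[of 0]
  proof eventually_elim
    case (elim N)
    have "exp (1/2 * ln (real N)) = sqrt (real N)"
      using elim by (simp add: ln_sqrt [symmetric])
    moreover have "pochhammer (1/2 :: real) N > 0" by (rule pochhammer_pos) auto
    moreover have "pochhammer p (N + 1) = pochhammer p N * (real N + p)" for p :: real
      by (simp add: pochhammer_Suc add.commute)
    ultimately have "inverse (Gamma_series (1/2) N) * (sqrt (real N) * sqrt (real N) / (real N + 1/2)) =
        inverse (fact N * sqrt (real N) / (pochhammer (1/2) N * (real N + 1/2))) * (sqrt (real N) * sqrt (real N) / (real N + 1/2))"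
      by (simp only: Gamma_series_def of_real_eq_id id_apply)
    also have "\<dots> = sqrt (real N) * (pochhammer (1/2) N / fact N)"
    proof -
      have "inverse (f * s / (p * c)) * (s * s / c) = s * (p / f)" if "s > 0" "c > 0" for f s p c :: real
        using that by (simp add: field_simps)
      from this[of "sqrt (real N)" "real N + 1 / 2"] show ?thesis using elim by (simp only: real_sqrt_gt_0_iff of_nat_0_less_iff)
    qed
    finally have "inverse (Gamma_series (1/2) N) * (sqrt (real N) * sqrt (real N) / (real N + 1/2)) =
        sqrt (real N) * (pochhammer (1/2) N / fact N)" .
    thus ?case by (simp only: e [symmetric] times_divide_eq_right)
  qed
  ultimately show ?thesis by (simp add: filterlim_cong inverse_eq_divide)
qed

text \<open>
Take \<open>l = 2 p + 1\<close> and \<open>N\<close> close to \<open>t l\<^sup>2 / \<pi>\<close> in the identity between cosine powers and binomial sums. As \<open>p\<close>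
grows, \<open>cos (\<pi> j / l)\<close> to the power \<open>2 N\<close> tends to \<open>exp (- \<pi> t j\<^sup>2)\<close> and the binomial coefficient at
distance \<open>l i\<close> from the centre, divided by the central one, tends to \<open>exp (- \<pi> i\<^sup>2 / t)\<close>. Gaussian bounds
allow passing to the limit termwise.
\<close>

theorem theta_inversion:
  assumes t: "t > 0"
  shows "theta t = theta (1 / t) / sqrt t"
proof -
  define l where "l = (\<lambda>p::nat. 2 * p + 1)"
  \<comment> \<open>this size of \<open>N\<close> makes \<open>N (\<pi> j / l)\<^sup>2\<close> tend to \<open>\<pi> t j\<^sup>2\<close>\<close>
  define N where "N = (\<lambda>p. nat \<lceil>t / pi * (real (l p))\<^sup>2\<rceil>)"
  have lpos: "l p > 0" for p by (simp add: l_def)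
  have Nge: "real (N p) \<ge> t / pi * (real (l p))\<^sup>2" for p
    unfolding N_def by (rule real_nat_ceiling_ge)
  have Nle: "real (N p) \<le> t / pi * (real (l p))\<^sup>2 + 1" for p
    unfolding N_def using t by (auto simp: of_nat_nat intro: order.trans[OF _ of_int_ceiling_le_add_one])
  have Npos: "N p > 0" for p
  proof -
    have "0 < t / pi * (real (l p))\<^sup>2" using t lpos[of p] by simp
    thus ?thesis using Nge[of p] by (cases "N p") auto
  qed
  have linf: "filterlim (\<lambda>p. real (l p)) at_top sequentially" unfolding l_def by real_asymp
  have Nl: "(\<lambda>p. real (N p) / (real (l p))\<^sup>2) \<longlonglongrightarrow> t / pi"
  proof (rule tendsto_sandwich[of "\<lambda>_. t / pi" _ _ "\<lambda>p. t / pi + 1 / (real (l p))\<^sup>2"])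
    show "(\<lambda>p. t / pi + 1 / (real (l p))\<^sup>2) \<longlonglongrightarrow> t / pi" unfolding l_def by real_asymp
  qed (use Nge Nle lpos in \<open>auto simp: field_simps power2_eq_square intro!: always_eventually\<close>)

  define a where "a = (\<lambda>j p. if j < p then cos (pi * real (Suc j) / real (l p)) ^ (2 * N p) else 0)"
  have a_le: "norm (a j p) \<le> exp (- pi * t * real (Suc j) ^ 2)" for j p
  proof (cases "j < p")
    case True
    define x where "x = pi * real (Suc j) / real (l p)"
    have "pi * (real (Suc j) / real (l p)) \<le> pi * (1 / 2)"
      using True by (intro mult_left_mono) (auto simp: l_def field_simps)
    hence x: "0 \<le> x" "x \<le> pi / 2" by (auto simp: x_def)
    have "0 \<le> cos x" using x by (intro cos_ge_zero) auto
    hence "cos x ^ (2 * N p) \<le> exp (- x\<^sup>2 / 2) ^ (2 * N p)"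
      using cos_le_exp[OF x] by (intro power_mono)
    also have "\<dots> = exp (- real (N p) * x\<^sup>2)" by (simp add: exp_of_nat_mult [symmetric])
    also have "\<dots> \<le> exp (- (t / pi * (real (l p))\<^sup>2) * x\<^sup>2)"
      using mult_right_mono[OF Nge[of p], of "x\<^sup>2"] by simp
    also have "- (t / pi * (real (l p))\<^sup>2) * x\<^sup>2 = - pi * t * real (Suc j) ^ 2"
      using lpos[of p] by (simp add: x_def power2_eq_square field_simps)
    finally show ?thesis using True by (simp add: a_def x_def power_mult)
  qed (auto simp: a_def)
  have a_lim: "(\<lambda>p. a j p) \<longlonglongrightarrow> exp (- pi * t * real (Suc j) ^ 2)" for j
  proof -
    define c where "c = pi * real (Suc j)"
    have c: "c > 0" by (simp add: c_def)
    have "((\<lambda>x::real. x\<^sup>2 * ln (cos (c / x))) \<longlongrightarrow> - (c * c / 2)) at_top"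
      using c by real_asymp
    from filterlim_compose[OF this linf]
    have "(\<lambda>p. 2 * (real (N p) / (real (l p))\<^sup>2) * ((real (l p))\<^sup>2 * ln (cos (c / real (l p))))) \<longlonglongrightarrow> 2 * (t / pi) * (- (c * c / 2))"
      by (intro tendsto_mult tendsto_const Nl)
    hence "(\<lambda>p. exp (2 * (real (N p) / (real (l p))\<^sup>2) * ((real (l p))\<^sup>2 * ln (cos (c / real (l p)))))) \<longlonglongrightarrow> exp (2 * (t / pi) * (- (c * c / 2)))"
      by (rule tendsto_exp)
    moreover have "2 * (t / pi) * (- (c * c / 2)) = - pi * t * real (Suc j) ^ 2"
      by (simp add: c_def power2_eq_square field_simps)
    moreover have "eventually (\<lambda>p. exp (2 * (real (N p) / (real (l p))\<^sup>2) * ((real (l p))\<^sup>2 * ln (cos (c / real (l p))))) = a j p) sequentially"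
      using eventually_gt_at_top[of j]
    proof eventually_elim
      case (elim p)
      have "pi * (real (Suc j) / real (l p)) < pi * (1 / 2)"
        using elim by (intro mult_strict_left_mono) (auto simp: l_def field_simps)
      hence "c / real (l p) < pi / 2" by (simp add: c_def)
      moreover have "c / real (l p) > 0" using c lpos[of p] by simp
      ultimately have "cos (c / real (l p)) > 0" by (intro cos_gt_zero)
      hence "cos (c / real (l p)) ^ (2 * N p) = exp (real (2 * N p) * ln (cos (c / real (l p))))"
        by (subst exp_of_nat_mult) simp
      thus ?case using elim lpos[of p] by (simp add: a_def c_def)
    qed
    ultimately show ?thesis by (simp add: filterlim_cong)
  qed
  have A: "(\<lambda>p. \<Sum>j. a j p) \<longlonglongrightarrow> (\<Sum>j. exp (- pi * t * real (Suc j) ^ 2))"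
    using tannerys_theorem[where a = a and F = sequentially and M = "\<lambda>j. exp (- pi * t * real (Suc j) ^ 2)", OF a_lim]
      summable_theta[of "pi * t"] t a_le by (auto simp: case_prod_unfold intro: always_eventually)

  define b where "b = (\<lambda>i p. real ((2 * N p) choose (N p + l p * Suc i)) / real ((2 * N p) choose N p))"
  define \<tau> where "\<tau> = t / pi"
  have \<tau>: "\<tau> > 0" using t by (simp add: \<tau>_def)
  have cb: "real ((2 * N p) choose N p) > 0" for p by (simp add: zero_less_binomial_iff)
  have b_le: "norm (b i p) \<le> exp (- (1 / (2 * (\<tau> + 1))) * real (Suc i) ^ 2)" for i p
  proof (cases "l p * Suc i \<le> N p")
    case True
    have "b i p \<le> exp (- (real (l p * Suc i))\<^sup>2 / (real (N p) + real (N p)))"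
      using central_binomial_ratio_le[OF True, of "N p"] cb[of p] by (simp add: b_def field_simps)
    also have "\<dots> \<le> exp (- (1 / (2 * (\<tau> + 1))) * real (Suc i) ^ 2)"
    proof -
      have "real (N p) \<le> \<tau> * (real (l p))\<^sup>2 + 1" using Nle by (simp add: \<tau>_def)
      also have "1 \<le> (real (l p))\<^sup>2" using lpos[of p] by (simp add: l_def)
      finally have "real (N p) \<le> (\<tau> + 1) * (real (l p))\<^sup>2" by (simp add: algebra_simps)
      hence le: "real (N p) * real (Suc i) ^ 2 \<le> (\<tau> + 1) * (real (l p))\<^sup>2 * real (Suc i) ^ 2"
        by (intro mult_right_mono) auto
      have "- (a * b) / (n + n) \<le> - (1 / (2 * c)) * b" if "n * b \<le> c * a * b" "n > 0" "c > 0" for n a b c :: real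
        using that by (simp add: field_simps)
      from this[OF le] show ?thesis
        using \<tau> Npos[of p] by (simp only: of_nat_mult power_mult_distrib of_nat_0_less_iff add_pos_pos zero_less_one exp_le_cancel_iff simp_thms)
    qed
    finally show ?thesis by (simp add: b_def)
  next
    case False
    hence "b i p = 0" by (simp add: b_def binomial_eq_0)
    thus ?thesis by simp
  qed
  have b_lim: "(\<lambda>p. b i p) \<longlonglongrightarrow> exp (- pi * (1 / t) * real (Suc i) ^ 2)" for i
  proof -
    define c where "c = real (Suc i)"
    have lim0: "(\<lambda>p. c / real (l p)) \<longlonglongrightarrow> 0" unfolding l_def by real_asymp
    have ev: "eventually (\<lambda>p. l p * Suc i < N p) sequentially"
    proof -
      have "eventually (\<lambda>p. c / real (l p) < \<tau>) sequentially"
        using order_tendstoD(2)[OF lim0 \<tau>] .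
      thus ?thesis
      proof eventually_elim
        case (elim p)
        hence "real (l p) * c < \<tau> * (real (l p))\<^sup>2" using lpos[of p] by (simp add: field_simps power2_eq_square)
        also have "\<dots> \<le> real (N p)" using Nge by (simp add: \<tau>_def)
        finally have "real (l p * Suc i) < real (N p)" by (simp only: c_def of_nat_mult)
        thus ?case by (simp only: of_nat_less_iff)
      qed
    qed
    have lims: "(\<lambda>p. exp (- c\<^sup>2 / (real (N p) / (real (l p))\<^sup>2 + c / real (l p)))) \<longlonglongrightarrow> exp (- c\<^sup>2 / (\<tau> + 0))"
               "(\<lambda>p. exp (- c\<^sup>2 / (real (N p) / (real (l p))\<^sup>2 - c / real (l p)))) \<longlonglongrightarrow> exp (- c\<^sup>2 / (\<tau> - 0))"
      using \<tau> by (intro tendsto_intros Nl[folded \<tau>_def] lim0; simp)+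
    have "(\<lambda>p. b i p) \<longlonglongrightarrow> exp (- c\<^sup>2 / \<tau>)"
    proof (rule tendsto_sandwich)
      show "eventually (\<lambda>p. b i p \<le> exp (- c\<^sup>2 / (real (N p) / (real (l p))\<^sup>2 + c / real (l p)))) sequentially"
      proof (intro always_eventually allI)
        fix p
        have "- (real (l p * Suc i))\<^sup>2 / (real (N p) + real (l p * Suc i)) =
                - c\<^sup>2 / (real (N p) / (real (l p))\<^sup>2 + c / real (l p))"
          using lpos[of p] Npos[of p] by (simp add: c_def power2_eq_square divide_simps) (simp add: algebra_simps)
        thus "b i p \<le> exp (- c\<^sup>2 / (real (N p) / (real (l p))\<^sup>2 + c / real (l p)))"
          using central_binomial_ratio_le[of "l p * Suc i" "l p * Suc i" "N p"] cb[of p] by (simp add: b_def field_simps)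
      qed
      show "eventually (\<lambda>p. exp (- c\<^sup>2 / (real (N p) / (real (l p))\<^sup>2 - c / real (l p))) \<le> b i p) sequentially"
        using ev
      proof eventually_elim
        case (elim p)
        have "real (l p * Suc i) < real (N p)" using elim by linarith
        hence "- (real (l p * Suc i))\<^sup>2 / (real (N p) - real (l p * Suc i)) =
                - c\<^sup>2 / (real (N p) / (real (l p))\<^sup>2 - c / real (l p))"
          using lpos[of p] by (simp add: c_def power2_eq_square divide_simps) (simp add: algebra_simps)
        thus ?case
          using central_binomial_ratio_ge[of "l p * Suc i" "l p * Suc i" "N p"] elim cb[of p] by (simp add: b_def field_simps)
      qed
    qed (use lims in simp_all)
    moreover have "- c\<^sup>2 / \<tau> = - pi * (1 / t) * real (Suc i) ^ 2" by (simp add: c_def \<tau>_def)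
    ultimately show ?thesis by simp
  qed
  have B: "(\<lambda>p. \<Sum>i. b i p) \<longlonglongrightarrow> (\<Sum>i. exp (- pi * (1 / t) * real (Suc i) ^ 2))"
    using tannerys_theorem[where a = b and F = sequentially and M = "\<lambda>i. exp (- (1 / (2 * (\<tau> + 1))) * real (Suc i) ^ 2)", OF b_lim]
      summable_theta[of "1 / (2 * (\<tau> + 1))"] \<tau> b_le by (auto simp: case_prod_unfold intro: always_eventually)

  define \<kappa> where "\<kappa> = (\<lambda>p. real (l p) * real ((2 * N p) choose N p) / 4 ^ N p)"
  have K: "\<kappa> \<longlonglongrightarrow> 1 / sqrt t"
  proof -
    have "filterlim (\<lambda>p. real (N p)) at_top sequentially"
    proof (rule filterlim_at_top_mono)
      show "filterlim (\<lambda>p. t / pi * (real (l p))\<^sup>2) at_top sequentially"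
        unfolding l_def using t by real_asymp
    qed (use Nge in auto)
    hence "filterlim N at_top sequentially"
      unfolding filterlim_at_top
    proof (intro allI)
      fix Z
      assume "\<forall>Z. eventually (\<lambda>p. Z \<le> real (N p)) sequentially"
      hence "eventually (\<lambda>p. real Z \<le> real (N p)) sequentially" by blast
      thus "eventually (\<lambda>p. Z \<le> N p) sequentially" by simp
    qed
    from tendsto_divide[OF filterlim_compose[OF central_binomial_asymp this] tendsto_real_sqrt[OF Nl]]
    have "(\<lambda>p. sqrt (real (N p)) * real ((2 * N p) choose N p) / 4 ^ N p / sqrt (real (N p) / (real (l p))\<^sup>2))
            \<longlonglongrightarrow> 1 / sqrt pi / sqrt (t / pi)"
      using t by simp
    moreover have "sqrt (real (N p)) * real ((2 * N p) choose N p) / 4 ^ N p / sqrt (real (N p) / (real (l p))\<^sup>2) = \<kappa> p" for p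
      using Npos[of p] lpos[of p] by (simp add: \<kappa>_def real_sqrt_divide)
    ultimately show ?thesis using t by (simp add: real_sqrt_divide)
  qed
  have id: "1 + 2 * (\<Sum>j. a j p) = \<kappa> p * (1 + 2 * (\<Sum>i. b i p))" for p
  proof -
    have 1: "(\<Sum>j. a j p) = (\<Sum>j<p. cos (pi * real (Suc j) / real (2*p+1)) ^ (2 * N p))"
      by (subst suminf_finite[of "{..<p}"]) (auto simp: a_def l_def)
    have 2: "(\<Sum>i. b i p) = (\<Sum>i\<in>{1..N p}. real ((2 * N p) choose (N p + l p * i)) / real ((2 * N p) choose N p))"
    proof -
      have "(\<Sum>i. b i p) = (\<Sum>i<N p. b i p)"
      proof (rule suminf_finite)
        fix i assume "i \<notin> {..<N p}"
        hence "N p < Suc i" by auto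
        also have "Suc i \<le> l p * Suc i" by (simp add: l_def)
        finally show "b i p = 0" by (simp add: b_def)
      qed auto
      also have "\<dots> = (\<Sum>i\<in>{1..N p}. real ((2 * N p) choose (N p + l p * i)) / real ((2 * N p) choose N p))"
        unfolding b_def by (rule sum.reindex_bij_witness[of _ "\<lambda>i. i - 1" Suc]) auto
      finally show ?thesis .
    qed
    have "1 + 2 * (\<Sum>j. a j p) = real (l p) / 4 ^ N p *
        (real ((2 * N p) choose N p) + 2 * (\<Sum>i\<in>{1..N p}. real ((2 * N p) choose (N p + l p * i))))"
      unfolding 1 sum_cos_power_symmetric [symmetric]
      using sum_cos_power[of "l p" "N p"] sum_binomial_residue[of "l p" "N p"] lpos[of p] by (simp add: l_def)
    also have "\<dots> = \<kappa> p * (1 + 2 * (\<Sum>i. b i p))"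
      unfolding 2 \<kappa>_def sum_divide_distrib [symmetric] using cb[of p] by (simp add: field_simps)
    finally show ?thesis .
  qed
  have "(\<lambda>p. 1 + 2 * (\<Sum>j. a j p)) \<longlonglongrightarrow> 1 + 2 * (\<Sum>j. exp (- pi * t * real (Suc j) ^ 2))"
    by (intro tendsto_intros A)
  moreover have "(\<lambda>p. 1 + 2 * (\<Sum>j. a j p)) \<longlonglongrightarrow> 1 / sqrt t * (1 + 2 * (\<Sum>i. exp (- pi * (1 / t) * real (Suc i) ^ 2)))"
    unfolding id by (intro tendsto_intros K B)
  ultimately have "1 + 2 * (\<Sum>j. exp (- pi * t * real (Suc j) ^ 2)) =
      1 / sqrt t * (1 + 2 * (\<Sum>i. exp (- pi * (1 / t) * real (Suc i) ^ 2)))"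
    by (rule LIMSEQ_unique)
  thus ?thesis unfolding theta_def by (simp only: times_divide_eq_left mult_1)
qed

section \<open>The Epstein zeta function of a sum of squares\<close>

lemma has_bochner_integral_lborel_of_absolutely_integrable:
  fixes f :: "real \<Rightarrow> 'a :: euclidean_space"
  assumes "f absolutely_integrable_on UNIV" "integral UNIV f = b" "f \<in> borel_measurable borel"
  shows "has_bochner_integral lborel f b"
proof -
  have "integrable lebesgue f" using assms(1) by (simp add: set_integrable_def)
  hence i: "integrable lborel f" using assms(3) by (simp add: integrable_completion)
  hence "(f has_integral integral\<^sup>L lborel f) UNIV" by (rule has_integral_integral_lborel)
  thus ?thesis using i assms(2) by (simp add: has_bochner_integral_iff integral_unique)
qed

text \<open>
Euler's integral after the substitution \<open>t = c exp v\<close>. All Mellin integrals below are written in the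
logarithmic variable, where the inversion \<open>t \<mapsto> 1 / t\<close> is the reflection \<open>v \<mapsto> - v\<close>.
\<close>

lemma has_bochner_integral_Gamma_log:
  assumes "s > 0" "c > (0::real)"
  shows "has_bochner_integral lborel (\<lambda>v. exp (s * v - c * exp v)) (Gamma s * c powr (-s))"
proof -
  have "(\<lambda>t. t powr (s - 1) / exp t) absolutely_integrable_on {0..}"
    using Gamma_integral_real[OF assms(1)]
    by (intro nonnegative_absolutely_integrable_1) (auto simp: has_integral_iff)
  hence "(\<lambda>t. t powr (s - 1) / exp t) absolutely_integrable_on {0<..}"
    by (rule set_integrable_subset) auto
  moreover have "integral {0<..} (\<lambda>t. t powr (s - 1) / exp t) = Gamma s"
  proof -
    have "integral {0<..} (\<lambda>t. t powr (s - 1) / exp t) = integral {0..} (\<lambda>t. t powr (s - 1) / exp t)"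
      by (rule integral_subset_negligible) (auto intro: negligible_subset[of "{0}"])
    thus ?thesis using Gamma_integral_real[OF assms(1)] by (simp add: integral_unique)
  qed
  moreover have "range exp = {0::real<..}" by (auto simp: image_iff, metis exp_ln)
  ultimately have "(\<lambda>v. \<bar>exp v\<bar> *\<^sub>R (exp v powr (s - 1) / exp (exp v))) absolutely_integrable_on UNIV \<and>
      integral UNIV (\<lambda>v. \<bar>exp v\<bar> *\<^sub>R (exp v powr (s - 1) / exp (exp v))) = Gamma s"
    by (subst has_absolute_integral_change_of_variables_real[where h = exp])
       (auto intro!: derivative_eq_intros simp: inj_on_def)
  moreover have "\<bar>exp v\<bar> *\<^sub>R (exp v powr (s - 1) / exp (exp v)) = exp (s * v - exp v)" for v
  proof -
    have "\<bar>exp v\<bar> *\<^sub>R (exp v powr (s - 1) / exp (exp v)) = exp v * exp ((s - 1) * v) / exp (exp v)"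
      by (simp add: powr_def)
    also have "\<dots> = exp (v + (s - 1) * v - exp v)" by (simp only: exp_add exp_diff)
    finally show ?thesis by (simp add: algebra_simps)
  qed
  ultimately have 1: "has_bochner_integral lborel (\<lambda>v. exp (s * v - exp v)) (Gamma s)"
    by (intro has_bochner_integral_lborel_of_absolutely_integrable) auto
  hence "has_bochner_integral lborel (\<lambda>v. exp (s * (ln c + 1 * v) - exp (ln c + 1 * v))) (Gamma s /\<^sub>R \<bar>1\<bar>)"
    by (subst lborel_has_bochner_integral_real_affine_iff [symmetric]) auto
  hence "has_bochner_integral lborel (\<lambda>v. c powr (-s) * exp (s * (ln c + v) - exp (ln c + v))) (c powr (-s) * Gamma s)"
    by (intro has_bochner_integral_mult_right) auto
  moreover have "c powr (-s) * exp (s * (ln c + v) - exp (ln c + v)) = exp (s * v - c * exp v)" for v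
    using assms by (simp add: powr_def exp_add [symmetric] algebra_simps) (simp add: exp_add)
  ultimately show ?thesis by (simp add: mult.commute)
qed

lemma integrable_double_exp:
  assumes "c > (0::real)"
  shows "integrable lborel (\<lambda>v. indicator {0<..} v * exp (s * v - c * exp v))"
proof (rule Bochner_Integration.integrable_bound)
  show "integrable lborel (\<lambda>v. exp ((\<bar>s\<bar> + 1) * v - c * exp v))"
    using has_bochner_integral_Gamma_log[of "\<bar>s\<bar> + 1" c] assms by (auto simp: has_bochner_integral_iff)
  have "s * v \<le> (\<bar>s\<bar> + 1) * v" if "v > 0" for v using that by (intro mult_right_mono) auto
  thus "AE v in lborel. norm (indicator {0<..} v * exp (s * v - c * exp v)) \<le> norm (exp ((\<bar>s\<bar> + 1) * v - c * exp v))"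
    by (auto simp: indicator_def)
qed auto

lemma has_bochner_integral_exp_halfline:
  assumes "c > (0::real)"
  shows "has_bochner_integral lborel (\<lambda>v. indicator {0<..} v * exp (- c * v)) (1 / c)"
proof -
  have *: "((\<lambda>v. exp (- c * v)) has_integral 1 / c) {0..}"
    using has_integral_exp_minus_to_infinity[OF assms, of 0] by simp
  hence **: "(\<lambda>v. exp (- c * v)) absolutely_integrable_on {0..}"
    by (intro nonnegative_absolutely_integrable_1) (auto simp: has_integral_iff)
  have ***: "integral UNIV (\<lambda>v. indicator {0..} v * exp (- c * v)) = 1 / c"
  proof -
    have "(\<lambda>v. indicator {0..} v * exp (- c * v)) = (\<lambda>v. if v \<in> {0..} then exp (- c * v) else 0)"
      by (auto simp: indicator_def fun_eq_iff)
    hence "integral UNIV (\<lambda>v. indicator {0..} v * exp (- c * v)) = integral {0..} (\<lambda>v. exp (- c * v))"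
      by (simp only: integral_restrict_UNIV)
    thus ?thesis using * by (simp only: integral_unique)
  qed
  have "has_bochner_integral lborel (\<lambda>v. indicator {0..} v * exp (- c * v)) (1 / c)"
    by (rule has_bochner_integral_lborel_of_absolutely_integrable)
       (use ** *** in \<open>auto simp: set_integrable_def\<close>)
  thus ?thesis
    by (rule has_bochner_integralI_AE) (measurable, rule eventually_mono[OF AE_lborel_singleton[of "0::real"]], simp add: indicator_def)
qed

lemma sums_integral_nonneg:
  fixes f :: "'a \<Rightarrow> real"
  assumes "integrable M f" and meas: "\<And>n. g n \<in> borel_measurable M"
    and sums: "\<And>x. x \<in> space M \<Longrightarrow> (\<lambda>n. g n x) sums f x" and nonneg: "\<And>n x. x \<in> space M \<Longrightarrow> g n x \<ge> 0"
  shows "(\<lambda>n. \<integral>x. g n x \<partial>M) sums (\<integral>x. f x \<partial>M)"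
proof -
  have le: "(\<Sum>n\<in>A. g n x) \<le> f x" if "x \<in> space M" "finite A" for x and A
    using sum_le_suminf[of "\<lambda>n. g n x" A] sums[OF that(1)] nonneg that by (auto simp: sums_iff)
  have fn: "f x \<ge> 0" if "x \<in> space M" for x using le[OF that, of "{}"] by simp
  have int: "integrable M (g n)" for n
    by (rule Bochner_Integration.integrable_bound[OF assms(1) meas])
       (use le[of _ "{n}"] nonneg fn in \<open>auto intro!: AE_I2\<close>)
  have "(\<lambda>N. \<integral>x. (\<Sum>n<N. g n x) \<partial>M) \<longlonglongrightarrow> (\<integral>x. f x \<partial>M)"
  proof (rule integral_dominated_convergence[where w = f])
    show "AE x in M. (\<lambda>N. \<Sum>n<N. g n x) \<longlonglongrightarrow> f x"
      using sums by (auto simp: sums_def)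
    show "AE x in M. norm (\<Sum>n<N. g n x) \<le> f x" for N
      using le nonneg by (auto simp: sum_nonneg intro!: AE_I2)
  qed (use assms in auto)
  thus ?thesis by (simp add: sums_def int)
qed

definition theta_defect :: "nat \<Rightarrow> real \<Rightarrow> real" where
  "theta_defect k v = theta (exp v) ^ k - 1"

lemma theta_defect_measurable [measurable]: "theta_defect k \<in> borel_measurable borel"
  unfolding theta_defect_def theta_def by measurable

lemma theta_defect_nonneg: "theta_defect k v \<ge> 0"
  using theta_ge_1[of "exp v"] one_le_power[of "theta (exp v)" k] by (simp add: theta_defect_def)

lemma theta_defect_sums:
  "(\<lambda>n. real (sum_squares_count k (Suc n)) * exp (- pi * real (Suc n) * exp v)) sums theta_defect k v"
  using sums_sum_squares_count_Suc[of "exp v" k] by (simp add: theta_defect_def mult_ac)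

lemma theta_defect_inversion:
  "theta_defect k (-v) = exp (real k / 2 * v) * (theta_defect k v + 1) - 1"
proof -
  have 1: "sqrt (exp (-v)) = exp (- (v / 2))"
    by (rule real_sqrt_unique) (auto simp: exp_add [symmetric] power2_eq_square)
  have 2: "1 / exp (-v) = exp v" by (simp add: exp_minus inverse_eq_divide)
  have "theta (exp (-v)) = theta (exp v) / exp (- (v / 2))"
    using theta_inversion[of "exp (-v)", unfolded 1 2] by simp
  also have "\<dots> = exp (v / 2) * theta (exp v)"
    by (subst exp_minus) (simp add: field_simps)
  finally have "theta (exp (-v)) = exp (v / 2) * theta (exp v)" .
  thus ?thesis by (simp add: theta_defect_def power_mult_distrib exp_of_nat_mult [symmetric])
qed

text \<open>
Each exponential in the series is compared with its value at \<open>v = 0\<close>, since \<open>n exp v \<ge> n + exp v - 1\<close>.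
\<close>

lemma theta_defect_bound:
  assumes "v \<ge> 0"
  shows "theta_defect k v \<le> exp pi * theta_defect k 0 * exp (- pi * exp v)"
proof -
  have "(\<lambda>n. exp pi * (real (sum_squares_count k (Suc n)) * exp (- pi * real (Suc n) * exp 0)) * exp (- pi * exp v))
          sums (exp pi * theta_defect k 0 * exp (- pi * exp v))"
    by (intro sums_mult sums_mult2 theta_defect_sums)
  moreover have "real (sum_squares_count k (Suc n)) * exp (- pi * real (Suc n) * exp v) \<le>
        exp pi * (real (sum_squares_count k (Suc n)) * exp (- pi * real (Suc n) * exp 0)) * exp (- pi * exp v)" for n
  proof -
    have "0 \<le> pi * (real n * (exp v - 1))" using assms by simp
    hence "- pi * real (Suc n) * exp v \<le> pi + (- pi * real (Suc n) * exp 0) + - pi * exp v"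
      by (simp add: algebra_simps)
    hence "exp (- pi * real (Suc n) * exp v) \<le> exp pi * exp (- pi * real (Suc n) * exp 0) * exp (- pi * exp v)"
      by (simp only: exp_add [symmetric] exp_le_cancel_iff)
    from mult_left_mono[OF this, of "real (sum_squares_count k (Suc n))"] show ?thesis by (simp add: mult_ac)
  qed
  ultimately show ?thesis
    using theta_defect_sums[of k v] by (rule sums_le[rotated 2])
qed

lemma integrable_theta_defect_halfline:
  "integrable lborel (\<lambda>v. indicator {0<..} v * (theta_defect k v * exp (s * v)))"
proof (rule Bochner_Integration.integrable_bound)
  show "integrable lborel (\<lambda>v. exp pi * theta_defect k 0 * (indicator {0<..} v * exp (s * v - pi * exp v)))"
    by (intro integrable_mult_right integrable_double_exp) auto
  show "AE v in lborel. norm (indicator {0<..} v * (theta_defect k v * exp (s * v))) \<le>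
          norm (exp pi * theta_defect k 0 * (indicator {0<..} v * exp (s * v - pi * exp v)))"
  proof (intro AE_I2)
    fix v :: real
    show "norm (indicator {0<..} v * (theta_defect k v * exp (s * v))) \<le>
          norm (exp pi * theta_defect k 0 * (indicator {0<..} v * exp (s * v - pi * exp v)))"
      using mult_right_mono[OF theta_defect_bound[of v k], of "exp (s * v)"] theta_defect_nonneg[of k]
      by (cases "v > 0") (simp_all add: indicator_def exp_diff exp_minus field_simps)
  qed
qed auto

text \<open>
Riemann's symmetric form: the part of the Mellin integral of \<open>\<theta>\<^sup>k - 1\<close> over \<open>t < 1\<close> is folded to \<open>t > 1\<close>, where the integrand
decays doubly exponentially. The resulting function is entire; the polar terms are split off.
\<close>

definition completed_zeta_integral :: "nat \<Rightarrow> complex \<Rightarrow> complex" where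
  "completed_zeta_integral k s =
     (\<integral>v. indicator {0<..} v * of_real (theta_defect k v) * (exp (s * of_real v) + exp ((of_nat k / 2 - s) * of_real v)) \<partial>lborel)"

lemma holomorphic_completed_zeta_integral: "completed_zeta_integral k holomorphic_on UNIV"
  unfolding completed_zeta_integral_def
proof (rule holomorphic_integral_dominated)
  fix z :: complex
  define R where "R = \<bar>Re z\<bar> + 1 + real k"
  let ?g = "\<lambda>v. 2 * (indicator {0<..} v * (theta_defect k v * exp (R * v)))"
  have "norm (indicator {0<..} v * of_real (theta_defect k v) * (exp (w * of_real v) + exp ((of_nat k / 2 - w) * of_real v))) \<le> ?g v"
    if "dist z w < 1" for w v
  proof (cases "v > 0")
    case True
    have "\<bar>Re (z - w)\<bar> < 1" using that abs_Re_le_cmod[of "z - w"] by (simp add: dist_norm)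
    hence "Re w \<le> R" "real k / 2 - Re w \<le> R" by (auto simp: R_def)
    hence "norm (exp (w * of_real v)) \<le> exp (R * v)" "norm (exp ((of_nat k / 2 - w) * of_real v)) \<le> exp (R * v)"
      using True by (auto intro!: mult_right_mono)
    hence "norm (exp (w * of_real v) + exp ((of_nat k / 2 - w) * of_real v)) \<le> 2 * exp (R * v)"
      using norm_triangle_ineq[of "exp (w * of_real v)" "exp ((of_nat k / 2 - w) * of_real v)"] by linarith
    from mult_left_mono[OF this theta_defect_nonneg[of k v]] show ?thesis
      using True theta_defect_nonneg[of k v] by (simp add: norm_mult)
  qed auto
  thus "\<exists>r>0. \<exists>g. integrable lborel g \<and> (\<forall>w\<in>UNIV. dist z w < r \<longrightarrow> (\<forall>v\<in>space lborel.
      norm (indicator {0<..} v * of_real (theta_defect k v) * (exp (w * of_real v) + exp ((of_nat k / 2 - w) * of_real v))) \<le> g v))"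
    by (intro exI[of _ 1] exI[of _ ?g] conjI integrable_mult_right integrable_theta_defect_halfline) auto
qed (auto intro!: holomorphic_intros)

lemma has_bochner_integral_theta_defect:
  assumes "s > real k / 2" "s > 0"
  shows "has_bochner_integral lborel (\<lambda>v. theta_defect k v * exp (s * v))
           (Re (completed_zeta_integral k (of_real s)) - 1 / s + 1 / (s - real k / 2))"
proof -
  define I where "I = (\<lambda>s. \<integral>v. indicator {0<..} v * (theta_defect k v * exp (s * v)) \<partial>lborel)"
  have I: "has_bochner_integral lborel (\<lambda>v. indicator {0<..} v * (theta_defect k v * exp (s * v))) (I s)" for s
    using integrable_theta_defect_halfline[of k s] by (simp add: has_bochner_integral_iff I_def)
  have "has_bochner_integral lborel (\<lambda>v. complex_of_real (indicator {0<..} v * (theta_defect k v * exp (s * v)) +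
          indicator {0<..} v * (theta_defect k v * exp ((real k / 2 - s) * v)))) (of_real (I s + I (real k / 2 - s)))"
    by (intro has_bochner_integral_of_real has_bochner_integral_add I)
  moreover have "complex_of_real (indicator {0<..} v * (theta_defect k v * exp (s * v)) +
          indicator {0<..} v * (theta_defect k v * exp ((real k / 2 - s) * v))) =
        indicator {0<..} v * of_real (theta_defect k v) * (exp (of_real s * of_real v) + exp ((of_nat k / 2 - of_real s) * of_real v))" for v
    by (simp add: indicator_def exp_of_real [symmetric] algebra_simps)
  ultimately have E: "completed_zeta_integral k (of_real s) = of_real (I s + I (real k / 2 - s))"
    unfolding completed_zeta_integral_def by (simp add: has_bochner_integral_iff)
  have "has_bochner_integral lborel (\<lambda>v. indicator {0<..} v * (theta_defect k v * exp ((real k / 2 - s) * v)) +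
           indicator {0<..} v * exp (- (s - real k / 2) * v) - indicator {0<..} v * exp (- s * v))
           (I (real k / 2 - s) + 1 / (s - real k / 2) - 1 / s)"
    using assms by (intro has_bochner_integral_add has_bochner_integral_diff I has_bochner_integral_exp_halfline) auto
  also have "(\<lambda>v. indicator {0<..} v * (theta_defect k v * exp ((real k / 2 - s) * v)) +
           indicator {0<..} v * exp (- (s - real k / 2) * v) - indicator {0<..} v * exp (- s * v)) =
        (\<lambda>v. indicator {0<..} v * (theta_defect k (-v) * exp (- s * v)))"
  proof
    fix v :: real
    have "exp ((real k / 2 - s) * v) = exp (real k / 2 * v) * exp (- s * v)"
         "exp (- (s - real k / 2) * v) = exp (real k / 2 * v) * exp (- s * v)"
      by (simp_all add: exp_add [symmetric] algebra_simps)
    thus "indicator {0<..} v * (theta_defect k v * exp ((real k / 2 - s) * v)) +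
           indicator {0<..} v * exp (- (s - real k / 2) * v) - indicator {0<..} v * exp (- s * v) =
        indicator {0<..} v * (theta_defect k (-v) * exp (- s * v))"
      unfolding theta_defect_inversion by (simp add: algebra_simps)
  qed
  finally have "has_bochner_integral lborel (\<lambda>v. indicator {0<..} (0 + (-1) * v) * (theta_defect k (- (0 + (-1) * v)) * exp (- s * (0 + (-1) * v))))
      ((I (real k / 2 - s) + 1 / (s - real k / 2) - 1 / s) /\<^sub>R \<bar>- 1\<bar>)"
    by (subst lborel_has_bochner_integral_real_affine_iff [symmetric]) auto
  hence "has_bochner_integral lborel (\<lambda>v. indicator {0<..} v * (theta_defect k v * exp (s * v)) + indicator {0<..} (-v) * (theta_defect k v * exp (s * v)))
      (I s + (I (real k / 2 - s) + 1 / (s - real k / 2) - 1 / s))"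
    by (intro has_bochner_integral_add I) simp
  hence "has_bochner_integral lborel (\<lambda>v. theta_defect k v * exp (s * v)) (I s + (I (real k / 2 - s) + 1 / (s - real k / 2) - 1 / s))"
    by (rule has_bochner_integralI_AE) (measurable, rule eventually_mono[OF AE_lborel_singleton[of "0::real"]], simp add: indicator_def)
  moreover have "I s + (I (real k / 2 - s) + 1 / (s - real k / 2) - 1 / s) =
      Re (completed_zeta_integral k (of_real s)) - 1 / s + 1 / (s - real k / 2)"
    unfolding E Re_complex_of_real by linarith
  ultimately show ?thesis by (simp only:)
qed

text \<open>
Nonnegative terms may be integrated termwise without knowing convergence beforehand, so this also proves that the
Dirichlet series converges for \<open>s > k/2\<close>.
\<close>

lemma sum_squares_dirichlet_sums:
  assumes "s > real k / 2" "s > 0"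
  shows "(\<lambda>n. real (sum_squares_count k (Suc n)) * real (Suc n) powr (-s)) sums
           (pi powr s / Gamma s * (Re (completed_zeta_integral k (of_real s)) - 1 / s + 1 / (s - real k / 2)))"
proof -
  have G: "has_bochner_integral lborel (\<lambda>v. real (sum_squares_count k (Suc n)) * exp (s * v - pi * real (Suc n) * exp v))
             (real (sum_squares_count k (Suc n)) * (Gamma s * (pi * real (Suc n)) powr (-s)))" for n
    using assms by (intro has_bochner_integral_mult_right has_bochner_integral_Gamma_log) auto
  have "(\<lambda>n. \<integral>v. real (sum_squares_count k (Suc n)) * exp (s * v - pi * real (Suc n) * exp v) \<partial>lborel)
          sums (\<integral>v. theta_defect k v * exp (s * v) \<partial>lborel)"
  proof (rule sums_integral_nonneg)
    fix v :: real
    have "(\<lambda>n. real (sum_squares_count k (Suc n)) * exp (- pi * real (Suc n) * exp v) * exp (s * v)) sums (theta_defect k v * exp (s * v))"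
      by (intro sums_mult2 theta_defect_sums)
    moreover have "real (sum_squares_count k (Suc n)) * exp (- pi * real (Suc n) * exp v) * exp (s * v) =
        real (sum_squares_count k (Suc n)) * exp (s * v - pi * real (Suc n) * exp v)" for n
      by (simp only: mult.assoc exp_add [symmetric]) (simp add: algebra_simps)
    ultimately show "(\<lambda>n. real (sum_squares_count k (Suc n)) * exp (s * v - pi * real (Suc n) * exp v)) sums (theta_defect k v * exp (s * v))"
      by (simp only:)
  qed (use has_bochner_integral_theta_defect[OF assms] in \<open>auto simp: has_bochner_integral_iff\<close>)
  hence "(\<lambda>n. real (sum_squares_count k (Suc n)) * (Gamma s * (pi * real (Suc n)) powr (-s))) sums
           (Re (completed_zeta_integral k (of_real s)) - 1 / s + 1 / (s - real k / 2))"
    by (simp only: has_bochner_integral_integral_eq[OF G] has_bochner_integral_integral_eq[OF has_bochner_integral_theta_defect[OF assms]])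
  hence "(\<lambda>n. pi powr s / Gamma s * (real (sum_squares_count k (Suc n)) * (Gamma s * (pi * real (Suc n)) powr (-s)))) sums
           (pi powr s / Gamma s * (Re (completed_zeta_integral k (of_real s)) - 1 / s + 1 / (s - real k / 2)))"
    by (rule sums_mult)
  moreover have "pi powr s / Gamma s * (real (sum_squares_count k (Suc n)) * (Gamma s * (pi * real (Suc n)) powr (-s))) =
        real (sum_squares_count k (Suc n)) * real (Suc n) powr (-s)" for n
  proof -
    have "pi powr s * pi powr (-s) = 1" by (simp add: powr_minus)
    moreover have "(pi * real (Suc n)) powr (-s) = pi powr (-s) * real (Suc n) powr (-s)" by (simp add: powr_mult)
    ultimately show ?thesis using Gamma_real_pos[OF assms(2)] by (simp add: mult_ac del: of_nat_Suc)
  qed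
  ultimately show ?thesis by simp
qed

lemma completed_zeta_integral_real: "completed_zeta_integral k (of_real s) = of_real (Re (completed_zeta_integral k (of_real s)))"
proof -
  have "completed_zeta_integral k (of_real s) = (\<integral>v. complex_of_real (indicator {0<..} v * theta_defect k v * (exp (s * v) + exp ((real k / 2 - s) * v))) \<partial>lborel)"
    unfolding completed_zeta_integral_def
    by (intro Bochner_Integration.integral_cong) (auto simp: indicator_def exp_of_real [symmetric])
  thus ?thesis by (simp only: integral_complex_of_real Re_complex_of_real)
qed

lemma norm_sum_squares_dirichlet_term:
  "norm (of_nat (sum_squares_count k (Suc n)) / complex_of_nat (Suc n) powr s) =
     real (sum_squares_count k (Suc n)) * real (Suc n) powr (- Re s)"
  by (simp add: norm_divide norm_powr_real_powr powr_minus field_simps del: of_nat_Suc)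

lemma summable_sum_squares_count:
  assumes "\<sigma> > real k / 2" "\<sigma> > 0"
  shows "summable (\<lambda>n. real (sum_squares_count k (Suc n)) * real (Suc n) powr (- \<sigma>))"
  using sum_squares_dirichlet_sums[OF assms] by (rule sums_summable)

definition sum_squares_dirichlet :: "nat \<Rightarrow> complex \<Rightarrow> complex" where
  "sum_squares_dirichlet k s = (\<Sum>n. of_nat (sum_squares_count k (Suc n)) / of_nat (Suc n) powr s)"

lemma holomorphic_sum_squares_dirichlet:
  "sum_squares_dirichlet k holomorphic_on {s. Re s > real k / 2}"
  unfolding sum_squares_dirichlet_def
proof (rule holomorphic_suminf_dominated)
  show "open {s. Re s > real k / 2}" by (rule open_halfspace_Re_gt)
  fix z assume z: "z \<in> {s. Re s > real k / 2}"
  define r where "r = (Re z - real k / 2) / 2"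
  have r: "r > 0" "Re z - r > real k / 2" using z by (auto simp: r_def field_simps)
  have "norm (of_nat (sum_squares_count k (Suc n)) / of_nat (Suc n) powr w) \<le>
          real (sum_squares_count k (Suc n)) * real (Suc n) powr (- (Re z - r))" if "dist z w < r" for w n
  proof -
    have "\<bar>Re (z - w)\<bar> < r" using that abs_Re_le_cmod[of "z - w"] by (simp add: dist_norm)
    thus ?thesis unfolding norm_sum_squares_dirichlet_term
      by (intro mult_left_mono powr_mono) auto
  qed
  moreover have "Re z - r > 0" using r(2) of_nat_0_le_iff[of k] by linarith
  hence "summable (\<lambda>n. real (sum_squares_count k (Suc n)) * real (Suc n) powr (- (Re z - r)))"
    by (rule summable_sum_squares_count[OF r(2)])
  ultimately show "\<exists>r>0. \<exists>g. summable g \<and> (\<forall>w\<in>{s. real k / 2 < Re s}. dist z w < r \<longrightarrow>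
      (\<forall>n. norm (of_nat (sum_squares_count k (Suc n)) / of_nat (Suc n) powr w) \<le> g n))"
    using r(1) by blast
qed (auto intro!: holomorphic_intros simp del: of_nat_Suc)

text \<open>
Written with the entire function \<open>rGamma\<close>, the right-hand side is holomorphic except at \<open>k/2\<close>: the pole \<open>1/s\<close>
of the completed function is absorbed in \<open>rGamma (s + 1)\<close>.
\<close>

lemma sum_squares_dirichlet_continuation:
  assumes "Re s > real k / 2"
  shows "sum_squares_dirichlet k s = of_real pi powr s *
           (rGamma s * (completed_zeta_integral k s + 1 / (s - of_nat k / 2)) - rGamma (s + 1))"
proof -
  let ?S = "{s. Re s > real k / 2}"
  let ?f = "\<lambda>s. of_real pi powr s * (rGamma s * (completed_zeta_integral k s + 1 / (s - of_nat k / 2)) - rGamma (s + 1))"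
  have "s \<noteq> of_nat k / 2" if "Re s > real k / 2" for s using that by (auto simp: complex_eq_iff)
  hence hol: "?f holomorphic_on ?S"
    by (intro holomorphic_intros holomorphic_on_subset[OF holomorphic_completed_zeta_integral]) auto
  define x0 where "x0 = real k / 2 + 1"
  show ?thesis
  proof (rule analytic_continuation_eq[where f = "sum_squares_dirichlet k" and w = s and S = ?S and U = "of_real ` {real k / 2<..}" and \<xi> = "of_real x0" and g = ?f])
    show "open ?S" by (rule open_halfspace_Re_gt)
    show "connected ?S" by (intro convex_connected convex_halfspace_Re_gt)
    show "complex_of_real x0 islimpt of_real ` {real k / 2<..}"
      by (rule islimpt_of_real_image) (auto simp: x0_def)
    fix z assume "z \<in> complex_of_real ` {real k / 2<..}"
    then obtain x where x: "z = of_real x" "x > real k / 2" by auto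
    have "0 \<le> real k" by simp
    hence x0: "x > 0" using x(2) by linarith
    have "sum_squares_dirichlet k (of_real x) = (\<Sum>n. complex_of_real (real (sum_squares_count k (Suc n)) * real (Suc n) powr (-x)))"
      unfolding sum_squares_dirichlet_def
    proof (intro suminf_cong)
      fix n
      have "complex_of_nat (Suc n) powr of_real x = of_real (real (Suc n) powr x)"
        by (metis powr_of_real of_real_of_nat_eq of_nat_0_le_iff)
      thus "of_nat (sum_squares_count k (Suc n)) / complex_of_nat (Suc n) powr of_real x =
          complex_of_real (real (sum_squares_count k (Suc n)) * real (Suc n) powr (-x))"
        by (simp add: powr_minus divide_inverse del: of_nat_Suc)
    qed
    also have "\<dots> = of_real (pi powr x / Gamma x * (Re (completed_zeta_integral k (of_real x)) - 1 / x + 1 / (x - real k / 2)))"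
      by (rule sums_unique [symmetric, OF sums_of_real[OF sum_squares_dirichlet_sums[OF x(2) x0]]])
    also have "\<dots> = ?f (of_real x)"
    proof -
      have "rGamma (complex_of_real x) = of_real (1 / Gamma x)"
        using x0 by (simp add: rGamma_inverse_Gamma Gamma_complex_of_real field_simps)
      moreover have "rGamma (complex_of_real x + 1) = of_real (1 / Gamma x) / of_real x"
        using rGamma_plus1[of "complex_of_real x"] x0 unfolding calculation
        by (subst eq_divide_eq) (auto simp: mult.commute)
      hence "rGamma (complex_of_real x + 1) = of_real (1 / Gamma x / x)" by simp
      moreover have "complex_of_real pi powr of_real x = of_real (pi powr x)" by (simp add: powr_of_real)
      moreover define R where "R = Re (completed_zeta_integral k (of_real x))"
      have "completed_zeta_integral k (of_real x) = of_real R"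
        unfolding R_def by (rule completed_zeta_integral_real)
      moreover have "pi powr x / Gamma x * (R - 1 / x + 1 / (x - real k / 2)) =
          pi powr x * (1 / Gamma x * (R + 1 / (x - real k / 2)) - 1 / Gamma x / x)"
        by (simp add: algebra_simps)
      ultimately show ?thesis
        unfolding R_def [symmetric] by simp
    qed
    finally show "sum_squares_dirichlet k z = ?f z" by (simp add: x)
  qed (use assms hol holomorphic_sum_squares_dirichlet in \<open>auto simp: x0_def\<close>)
qed

lemma sum_squares_zeta_eq:
  "Re s > real k / 2 \<Longrightarrow> sum_squares_zeta k s = sum_squares_dirichlet k s"
  by (simp add: sum_squares_zeta_def sum_squares_dirichlet_def)

text \<open>
The continuation exists by the previous formula, so the choice in the definition of \<open>sum_squares_zeta\<close> picks
a function with the required properties; it agrees with the series on the half-plane of convergence.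
\<close>

theorem holomorphic_sum_squares_zeta:
  "sum_squares_zeta k holomorphic_on (- {of_nat k / 2})"
proof -
  define P where "P = (\<lambda>f. f holomorphic_on (- {of_nat k / 2}) \<and> (\<forall>w. Re w > real k / 2 \<longrightarrow> f w = sum_squares_dirichlet k w))"
  have "P (\<lambda>s. of_real pi powr s * (rGamma s * (completed_zeta_integral k s + 1 / (s - of_nat k / 2)) - rGamma (s + 1)))"
    unfolding P_def using sum_squares_dirichlet_continuation[of k]
    by (auto intro!: holomorphic_intros holomorphic_on_subset[OF holomorphic_completed_zeta_integral])
  hence "P (SOME f. P f)" by (rule someI[of P])
  then obtain g where g: "g = (SOME f. P f)" "P g" by blast
  have "sum_squares_zeta k s = g s" for s
  proof (cases "Re s > real k / 2")
    case True
    thus ?thesis using g(2) by (simp add: P_def sum_squares_zeta_eq)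
  next
    case False
    thus ?thesis by (simp add: g(1) P_def sum_squares_zeta_def sum_squares_dirichlet_def Let_def)
  qed
  hence "sum_squares_zeta k = g" by (rule ext)
  thus ?thesis using g(2) by (simp add: P_def)
qed

section \<open>The hypergeometric function on the slit plane\<close>

definition hypergeo_coeff :: "complex \<Rightarrow> complex \<Rightarrow> complex \<Rightarrow> nat \<Rightarrow> complex" where
  "hypergeo_coeff a b c n = pochhammer a n * pochhammer b n / (pochhammer c n * fact n)"

lemma tendsto_shifted_ratio: "(\<lambda>n. (a + of_nat n) / (c + of_nat n) :: complex) \<longlonglongrightarrow> 1"
proof -
  have 0: "(\<lambda>n. x / of_nat n :: complex) \<longlonglongrightarrow> 0" for x by (rule lim_const_over_n)
  have "(\<lambda>n. (a / of_nat n + 1) / (c / of_nat n + 1)) \<longlonglongrightarrow> (0 + 1) / (0 + 1)"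
    by (intro tendsto_intros 0) auto
  moreover have "eventually (\<lambda>n. (a / of_nat n + 1) / (c / of_nat n + 1) = (a + of_nat n) / (c + of_nat n)) sequentially"
    using eventually_gt_at_top[of 0] by eventually_elim (auto simp: divide_simps)
  ultimately show ?thesis by (simp add: filterlim_cong)
qed

lemma summable_hypergeo:
  assumes "norm z < 1"
  shows "summable (\<lambda>n. norm (hypergeo_coeff a b c n * z ^ n))"
proof -
  define q where "q = (\<lambda>n. (a + of_nat n) / (c + of_nat n) * ((b + of_nat n) / (1 + of_nat n)) * z)"
  have "(\<lambda>n. norm (q n)) \<longlonglongrightarrow> norm (1 * 1 * z)"
    unfolding q_def by (intro tendsto_intros tendsto_shifted_ratio)
  hence "eventually (\<lambda>n. norm (q n) < (1 + norm z) / 2) sequentially"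
    by (rule order_tendstoD) (use assms in simp)
  then obtain N where N: "\<And>n. n \<ge> N \<Longrightarrow> norm (q n) < (1 + norm z) / 2"
    by (auto simp: eventually_sequentially)
  have step: "hypergeo_coeff a b c (Suc n) * z ^ Suc n = (hypergeo_coeff a b c n * z ^ n) * q n" for n
    by (simp add: hypergeo_coeff_def q_def pochhammer_Suc fact_Suc add_ac mult_ac)
  show ?thesis
  proof (rule summable_ratio_test)
    show "(1 + norm z) / 2 < 1" using assms by simp
    fix n assume "n \<ge> N"
    from mult_left_mono[OF less_imp_le[OF N[OF this]], of "norm (hypergeo_coeff a b c n * z ^ n)"]
    show "norm (norm (hypergeo_coeff a b c (Suc n) * z ^ Suc n)) \<le> (1 + norm z) / 2 * norm (norm (hypergeo_coeff a b c n * z ^ n))"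
      unfolding step by (simp add: norm_mult mult_ac)
  qed
qed

definition hypergeo_fps :: "complex \<Rightarrow> complex \<Rightarrow> complex \<Rightarrow> complex fps" where
  "hypergeo_fps a b c = Abs_fps (hypergeo_coeff a b c)"

lemma hypergeo_fps_conv_radius: "fps_conv_radius (hypergeo_fps a b c) \<ge> 1"
  unfolding fps_conv_radius_def
proof (rule conv_radius_geI_ex)
  fix r :: real assume "0 < r" "ereal r < 1"
  thus "\<exists>z. norm z = r \<and> summable (\<lambda>n. fps_nth (hypergeo_fps a b c) n * z ^ n)"
    using summable_norm_cancel[OF summable_hypergeo[of "of_real r" a b c]]
    by (intro exI[of _ "of_real r"]) (auto simp: hypergeo_fps_def)
qed

lemma hypergeo_fps_eball: "norm z < 1 \<Longrightarrow> z \<in> eball 0 (fps_conv_radius (hypergeo_fps a b c))"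
  using hypergeo_fps_conv_radius[of a b c] by (auto simp: eball_def dist_norm intro: less_le_trans[of _ 1] simp flip: one_ereal_def)

lemma hypergeo_2F1_disc: "norm z < 1 \<Longrightarrow> hypergeo_2F1 a b c z = eval_fps (hypergeo_fps a b c) z"
  by (simp add: hypergeo_2F1_def eval_fps_def hypergeo_fps_def hypergeo_coeff_def)

text \<open>
The two contiguous relations below express the function for a lower parameter by the function for the raised one and its
derivative. They carry Euler's integral, available for \<open>Re c > a > 0\<close> only, to all parameters.
\<close>

lemma hypergeo_fps_c_lower:
  assumes "\<And>n. c \<noteq> - of_nat n"
  shows "fps_const c * hypergeo_fps a b c =
           fps_const c * hypergeo_fps a b (c + 1) + fps_X * fps_deriv (hypergeo_fps a b (c + 1))"
proof (rule fps_ext)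
  fix n
  have nz: "pochhammer c m \<noteq> 0" for m using assms by (auto simp: pochhammer_eq_0_iff)
  have "c * pochhammer (c + 1) n = pochhammer c n * (c + of_nat n)"
    by (metis pochhammer_Suc pochhammer_rec)
  moreover have "pochhammer (c + 1) n \<noteq> 0" "c \<noteq> 0"
    using nz[of "Suc n"] by (auto simp: pochhammer_rec)
  ultimately have "c * hypergeo_coeff a b c n = (c + of_nat n) * hypergeo_coeff a b (c + 1) n"
    using nz[of n] by (simp add: hypergeo_coeff_def divide_simps mult_ac)
  thus "fps_nth (fps_const c * hypergeo_fps a b c) n =
          fps_nth (fps_const c * hypergeo_fps a b (c + 1) + fps_X * fps_deriv (hypergeo_fps a b (c + 1))) n"
    by (cases n) (auto simp: hypergeo_fps_def algebra_simps)
qed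

lemma hypergeo_fps_a_lower:
  assumes "\<And>n. c \<noteq> - of_nat n"
  shows "fps_const (c - a - 1) * hypergeo_fps a b c =
           (fps_const (c - a - 1) - fps_const b * fps_X) * hypergeo_fps (a + 1) b c +
           (fps_X - fps_X * fps_X) * fps_deriv (hypergeo_fps (a + 1) b c)"
proof (rule fps_ext)
  fix n
  have nz: "pochhammer c m \<noteq> 0" for m using assms by (auto simp: pochhammer_eq_0_iff)
  show "fps_nth (fps_const (c - a - 1) * hypergeo_fps a b c) n =
          fps_nth ((fps_const (c - a - 1) - fps_const b * fps_X) * hypergeo_fps (a + 1) b c +
           (fps_X - fps_X * fps_X) * fps_deriv (hypergeo_fps (a + 1) b c)) n"
  proof (cases n)
    case 0
    thus ?thesis by (simp add: hypergeo_fps_def hypergeo_coeff_def)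
  next
    case (Suc m)
    define p where "p = pochhammer (a + 1) m"
    have p: "pochhammer a (Suc m) = a * p" "pochhammer (a + 1) (Suc m) = p * (a + 1 + of_nat m)"
      unfolding p_def by (rule pochhammer_rec, rule pochhammer_Suc)
    define q where "q = p * pochhammer b m / (pochhammer c m * fact m)"
    define d where "d = (c + of_nat m) * (1 + of_nat m)"
    have nzc: "pochhammer c m \<noteq> 0" "c + of_nat m \<noteq> 0"
      using nz[of "Suc m"] by (auto simp: pochhammer_Suc)
    have d: "d \<noteq> 0" using nzc(2) by (auto simp: d_def simp flip: of_nat_Suc)
    have h: "hypergeo_coeff a b c (Suc m) = q * a * (b + of_nat m) / d"
            "hypergeo_coeff (a + 1) b c (Suc m) = q * (a + 1 + of_nat m) * (b + of_nat m) / d"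
            "hypergeo_coeff (a + 1) b c m = q"
      unfolding hypergeo_coeff_def p pochhammer_Suc[of b] pochhammer_Suc[of c] fact_Suc
      by (simp_all add: q_def d_def p_def mult_ac)
    have "(c - a - 1) * (q * a * (b + of_nat m) / d) =
            (c - a - 1) * (q * (a + 1 + of_nat m) * (b + of_nat m) / d) - b * q +
            of_nat (Suc m) * (q * (a + 1 + of_nat m) * (b + of_nat m) / d) - of_nat m * q"
      using d by (simp add: divide_simps) (simp add: d_def algebra_simps)
    hence "(c - a - 1) * hypergeo_coeff a b c (Suc m) =
        (c - a - 1) * hypergeo_coeff (a + 1) b c (Suc m) - b * hypergeo_coeff (a + 1) b c m +
        of_nat (Suc m) * hypergeo_coeff (a + 1) b c (Suc m) - of_nat m * hypergeo_coeff (a + 1) b c m"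
      unfolding h .
    thus ?thesis unfolding Suc
      by (cases m) (simp_all add: hypergeo_fps_def algebra_simps mult.assoc)
  qed
qed

definition slit_plane :: "complex set" where "slit_plane = - {w. Im w = 0 \<and> Re w \<ge> 1}"

lemma slit_plane_iff: "z \<in> slit_plane \<longleftrightarrow> 1 - z \<notin> \<real>\<^sub>\<le>\<^sub>0"
  by (auto simp: slit_plane_def complex_nonpos_Reals_iff)

lemma open_slit_plane: "open slit_plane"
proof -
  have "slit_plane = (\<lambda>z. 1 - z) -` (- \<real>\<^sub>\<le>\<^sub>0)" by (auto simp: slit_plane_iff)
  also have "open \<dots>" by (intro continuous_open_vimage open_Compl closed_nonpos_Reals_complex continuous_intros)
  finally show ?thesis .
qed

definition continues_hypergeo :: "complex \<Rightarrow> complex \<Rightarrow> complex \<Rightarrow> (complex \<Rightarrow> complex) \<Rightarrow> bool" where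
  "continues_hypergeo a b c f \<longleftrightarrow>
     f holomorphic_on slit_plane \<and> (\<forall>w. norm w < 1 \<longrightarrow> f w = eval_fps (hypergeo_fps a b c) w)"

lemma continues_hypergeo_deriv:
  assumes "continues_hypergeo a b c f" "norm w < 1"
  shows "deriv f w = eval_fps (fps_deriv (hypergeo_fps a b c)) w"
proof -
  have "(eval_fps (hypergeo_fps a b c) has_field_derivative eval_fps (fps_deriv (hypergeo_fps a b c)) w) (at w)"
    using hypergeo_fps_eball[OF assms(2)] by (intro has_field_derivative_eval_fps) (simp add: eball_def)
  hence "(f has_field_derivative eval_fps (fps_deriv (hypergeo_fps a b c)) w) (at w)"
    by (rule DERIV_cong_ev[THEN iffD1, rotated 3, OF _ refl _ refl])
       (use assms eventually_nhds_in_open[of "ball 0 1" w] in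
         \<open>auto simp: continues_hypergeo_def elim!: eventually_mono\<close>)
  thus ?thesis by (rule DERIV_imp_deriv)
qed

lemma eval_fps_hypergeo_deriv_ball:
  "norm w < 1 \<Longrightarrow> w \<in> eball 0 (fps_conv_radius (fps_deriv (hypergeo_fps a b c)))"
  using hypergeo_fps_eball[of w a b c] fps_conv_radius_deriv[of "hypergeo_fps a b c"]
  by (auto simp: eball_def intro: less_le_trans)

lemma continues_hypergeo_c_lower:
  assumes "continues_hypergeo a b (c + 1) f" "\<And>n. c \<noteq> - of_nat n"
  shows "continues_hypergeo a b c (\<lambda>z. f z + z * deriv f z / c)"
proof -
  have c: "c \<noteq> 0" using assms(2)[of 0] by simp
  have "f w + w * deriv f w / c = eval_fps (hypergeo_fps a b c) w" if w: "norm w < 1" for w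
  proof -
    note [simp] = hypergeo_fps_eball[OF w, unfolded eball_def, simplified] eval_fps_hypergeo_deriv_ball[OF w, unfolded eball_def, simplified]
    have "eval_fps (fps_const c * hypergeo_fps a b c) w =
          eval_fps (fps_const c * hypergeo_fps a b (c + 1) + fps_X * fps_deriv (hypergeo_fps a b (c + 1))) w"
      using hypergeo_fps_c_lower[OF assms(2)] by simp
    also have "eval_fps (fps_const c * hypergeo_fps a b c) w = c * eval_fps (hypergeo_fps a b c) w"
      by (subst eval_fps_mult) auto
    also have "eval_fps (fps_const c * hypergeo_fps a b (c + 1) + fps_X * fps_deriv (hypergeo_fps a b (c + 1))) w =
        c * eval_fps (hypergeo_fps a b (c + 1)) w + w * eval_fps (fps_deriv (hypergeo_fps a b (c + 1))) w"
      by (subst eval_fps_add) (auto simp: eval_fps_mult intro!: less_le_trans[OF _ fps_conv_radius_mult])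
    finally show ?thesis
      using c assms(1) w continues_hypergeo_deriv[OF assms(1) w] by (simp add: continues_hypergeo_def field_simps)
  qed
  thus ?thesis using assms(1) c open_slit_plane
    by (auto simp: continues_hypergeo_def intro!: holomorphic_intros)
qed

text \<open>
The right-hand side is holomorphic wherever \<open>f\<close> is, so a continuation for \<open>a + 1\<close> gives one for \<open>a\<close>.
\<close>

lemma continues_hypergeo_a_lower:
  assumes "continues_hypergeo (a + 1) b c f" "\<And>n. c \<noteq> - of_nat n" "c \<noteq> a + 1"
  shows "continues_hypergeo a b c (\<lambda>z. ((c - a - 1 - b * z) * f z + (z - z * z) * deriv f z) / (c - a - 1))"
proof -
  have c: "c - a - 1 \<noteq> 0" using assms(3) by (auto simp: algebra_simps)
  have "((c - a - 1 - b * w) * f w + (w - w * w) * deriv f w) / (c - a - 1) = eval_fps (hypergeo_fps a b c) w"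
    if w: "norm w < 1" for w
  proof -
    note [simp] = hypergeo_fps_eball[OF w, unfolded eball_def, simplified] eval_fps_hypergeo_deriv_ball[OF w, unfolded eball_def, simplified]
    let ?P = "fps_const (c - a - 1) - fps_const b * fps_X" and ?Q = "fps_X - fps_X * fps_X :: complex fps"
    have r: "fps_conv_radius ?P = \<infinity>" "fps_conv_radius ?Q = \<infinity>"
      using fps_conv_radius_diff[of "fps_const (c - a - 1)" "fps_const b * fps_X"] fps_conv_radius_mult[of "fps_const b" fps_X]
        fps_conv_radius_diff[of fps_X "fps_X * fps_X :: complex fps"] fps_conv_radius_mult[of fps_X "fps_X :: complex fps"]
      by auto
    have e: "eval_fps ?P w = c - a - 1 - b * w" "eval_fps ?Q w = w - w * w"
      using fps_conv_radius_mult[of "fps_const b" fps_X] fps_conv_radius_mult[of fps_X "fps_X :: complex fps"]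
      by (simp_all add: eval_fps_diff eval_fps_mult)
    have "eval_fps (fps_const (c - a - 1) * hypergeo_fps a b c) w =
          eval_fps (?P * hypergeo_fps (a + 1) b c + ?Q * fps_deriv (hypergeo_fps (a + 1) b c)) w"
      using hypergeo_fps_a_lower[OF assms(2)] by simp
    also have "eval_fps (fps_const (c - a - 1) * hypergeo_fps a b c) w = (c - a - 1) * eval_fps (hypergeo_fps a b c) w"
      by (subst eval_fps_mult) auto
    also have "eval_fps (?P * hypergeo_fps (a + 1) b c + ?Q * fps_deriv (hypergeo_fps (a + 1) b c)) w =
        (c - a - 1 - b * w) * eval_fps (hypergeo_fps (a + 1) b c) w + (w - w * w) * eval_fps (fps_deriv (hypergeo_fps (a + 1) b c)) w"
      by (subst eval_fps_add) (auto simp: eval_fps_mult r e intro!: less_le_trans[OF _ fps_conv_radius_mult])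
    finally show ?thesis
      using c assms(1) w continues_hypergeo_deriv[OF assms(1) w] by (simp add: continues_hypergeo_def field_simps)
  qed
  thus ?thesis using assms(1) c open_slit_plane
    by (auto simp: continues_hypergeo_def intro!: holomorphic_intros)
qed

lemma Re_pos_notin_nonpos_Ints: "Re z > 0 \<Longrightarrow> z \<notin> \<int>\<^sub>\<le>\<^sub>0"
  by (auto elim!: nonpos_Ints_cases)

definition beta_kernel :: "real \<Rightarrow> complex \<Rightarrow> real \<Rightarrow> complex" where
  "beta_kernel p q t = indicator {0<..<1} t * (of_real (t powr (p - 1)) * of_real (1 - t) powr (q - 1))"

lemma beta_kernel_measurable [measurable]: "beta_kernel p q \<in> borel_measurable borel"
  unfolding beta_kernel_def powr_def by measurable

lemma norm_beta_kernel: "norm (beta_kernel p q t) = indicator {0<..<1} t * (t powr (p - 1) * (1 - t) powr (Re q - 1))"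
  by (auto simp: beta_kernel_def indicator_def norm_mult norm_powr_real_powr)

lemma has_bochner_integral_beta_real:
  assumes "p > 0" "x > (0::real)"
  shows "has_bochner_integral lborel (\<lambda>t. indicator {0<..<1} t * (t powr (p - 1) * (1 - t) powr (x - 1))) (Beta p x)"
proof -
  have i: "set_integrable lborel {0..1} (\<lambda>t. t powr (p - 1) * (1 - t) powr (x - 1))"
    using assms by (rule integrable_Beta)
  moreover have "(LINT t:{0..1}|lborel. t powr (p - 1) * (1 - t) powr (x - 1)) = Beta p x"
    using has_integral_Beta_real[OF assms] set_borel_integral_eq_integral(2)[OF i] by (simp add: integral_unique)
  ultimately have h: "has_bochner_integral lborel (\<lambda>t. indicator {0..1} t * (t powr (p - 1) * (1 - t) powr (x - 1))) (Beta p x)"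
    by (simp add: has_bochner_integral_iff set_integrable_def set_lebesgue_integral_def)
  have ae: "AE t in lborel. indicator {0..1} t * (t powr (p - 1) * (1 - t) powr (x - 1)) =
          indicator {0<..<1} t * (t powr (p - 1) * (1 - t) powr (x - 1))"
    using AE_lborel_singleton[of "0::real"] AE_lborel_singleton[of "1::real"]
    by eventually_elim (auto simp: indicator_def)
  show ?thesis by (rule has_bochner_integralI_AE[OF h _ ae]) measurable
qed

lemma integrable_beta_kernel:
  assumes "p > 0" "Re q > 0"
  shows "integrable lborel (beta_kernel p q)"
proof -
  have "integrable lborel (\<lambda>t. norm (beta_kernel p q t))"
    unfolding norm_beta_kernel using has_bochner_integral_beta_real[OF assms] by (simp add: has_bochner_integral_iff)
  thus ?thesis by (subst (asm) integrable_norm_iff) auto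
qed

text \<open>
Only the second exponent is complex; it is continued from the real case.
\<close>

lemma integral_beta_kernel:
  assumes "p > 0" "Re q > 0"
  shows "integral\<^sup>L lborel (beta_kernel p q) = Beta (of_real p) q"
proof (rule analytic_continuation_eq[where S = "{q. Re q > 0}" and w = q and f = "\<lambda>q. integral\<^sup>L lborel (beta_kernel p q)" and g = "Beta (of_real p)" and U = "of_real ` {0<..}" and \<xi> = 1])
  show "(\<lambda>q. integral\<^sup>L lborel (beta_kernel p q)) holomorphic_on {q. Re q > 0}"
  proof (rule holomorphic_integral_dominated)
    fix t show "(\<lambda>q. beta_kernel p q t) holomorphic_on {q. Re q > 0}"
      unfolding beta_kernel_def by (cases "t = 1") (auto intro!: holomorphic_intros)
  next
    fix z :: complex assume z: "z \<in> {q. Re q > 0}"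
    have "norm (beta_kernel p w t) \<le> indicator {0<..<1} t * (t powr (p - 1) * (1 - t) powr (Re z / 2 - 1))"
      if "dist z w < Re z / 2" for w t
    proof -
      have "Re (z - w) \<le> norm (z - w)" by (rule complex_Re_le_cmod)
      hence "Re z / 2 \<le> Re w" using that by (simp add: dist_norm)
      thus ?thesis unfolding norm_beta_kernel
        by (cases "t \<in> {0<..<1}") (auto intro!: mult_left_mono powr_mono')
    qed
    moreover have "integrable lborel (\<lambda>t. indicator {0<..<1} t * (t powr (p - 1) * (1 - t) powr (Re z / 2 - 1)))"
      using has_bochner_integral_beta_real[of p "Re z / 2"] z assms by (simp add: has_bochner_integral_iff)
    ultimately show "\<exists>r>0. \<exists>g. integrable lborel g \<and> (\<forall>w\<in>{q. 0 < Re q}. dist z w < r \<longrightarrow>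
        (\<forall>t\<in>space lborel. norm (beta_kernel p w t) \<le> g t))"
      using z by (intro exI[of _ "Re z / 2"]) auto
  qed (auto intro: open_halfspace_Re_gt)
  show "Beta (of_real p) holomorphic_on {q. Re q > 0}"
    using assms by (intro holomorphic_intros) (use Re_pos_notin_nonpos_Ints[of "of_real p"] Re_pos_notin_nonpos_Ints in auto)
  show "open {q. Re q > 0}" by (rule open_halfspace_Re_gt)
  show "connected {q. Re q > 0}" by (intro convex_connected convex_halfspace_Re_gt)
  show "(1::complex) islimpt of_real ` {0<..}"
    using islimpt_of_real_image[of "{0<..}" 1] by simp
  fix z :: complex assume "z \<in> of_real ` {0<..}"
  then obtain x where x: "x > 0" "z = of_real x" by auto
  have "beta_kernel p z t = of_real (indicator {0<..<1} t * (t powr (p - 1) * (1 - t) powr (x - 1)))" for t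
  proof (cases "t \<in> {0<..<1}")
    case True
    thus ?thesis using powr_of_real[of "1 - t" "x - 1"] by (simp add: beta_kernel_def x)
  qed (auto simp: beta_kernel_def)
  hence "beta_kernel p z = (\<lambda>t. of_real (indicator {0<..<1} t * (t powr (p - 1) * (1 - t) powr (x - 1))))" ..
  hence "integral\<^sup>L lborel (beta_kernel p z) = of_real (integral\<^sup>L lborel (\<lambda>t. indicator {0<..<1} t * (t powr (p - 1) * (1 - t) powr (x - 1))))"
    by (simp only: integral_complex_of_real [symmetric])
  thus "integral\<^sup>L lborel (beta_kernel p z) = Beta (of_real p) z"
    using has_bochner_integral_beta_real[OF assms(1) x(1)] by (simp add: has_bochner_integral_iff x Beta_complex_of_real)
qed (use assms in auto)

lemma beta_kernel_mult_power: "beta_kernel p q t * of_real t ^ n = beta_kernel (p + real n) q t"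
proof (cases "t \<in> {0<..<1}")
  case True
  hence "t powr (p + real n - 1) = t powr (p - 1) * t ^ n"
    by (simp add: powr_add [symmetric] powr_realpow [symmetric] algebra_simps)
  thus ?thesis by (simp add: beta_kernel_def)
qed (auto simp: beta_kernel_def)

lemma integral_beta_kernel_power_series:
  assumes "p > 0" "Re q > 0" and sm: "summable (\<lambda>n. norm (c n))"
  shows "(\<integral>t. beta_kernel p q t * (\<Sum>n. c n * of_real t ^ n) \<partial>lborel) =
           (\<Sum>n. c n * Beta (of_real p + of_nat n) q)"
proof -
  define f where "f = (\<lambda>n t. c n * (beta_kernel p q t * of_real t ^ n))"
  have int: "integrable lborel (f n)" for n
    unfolding f_def beta_kernel_mult_power using assms by (intro integrable_mult_right integrable_beta_kernel) auto
  have nf: "norm (f n t) \<le> norm (c n) * norm (beta_kernel p q t)" for n t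
  proof (cases "t \<in> {0<..<1}")
    case True
    hence "norm (beta_kernel p q t) * t ^ n \<le> norm (beta_kernel p q t) * 1"
      by (intro mult_left_mono power_le_one) auto
    thus ?thesis using True unfolding f_def norm_mult by (intro mult_left_mono) (auto simp: norm_power)
  qed (auto simp: f_def beta_kernel_def)
  have "(\<integral>t. (\<Sum>n. f n t) \<partial>lborel) = (\<Sum>n. \<integral>t. f n t \<partial>lborel)"
  proof (rule integral_suminf[OF int])
    show "AE t in lborel. summable (\<lambda>n. norm (f n t))"
      by (intro AE_I2 summable_comparison_test'[OF summable_mult2[OF sm], of 0]) (use nf in auto)
    show "summable (\<lambda>n. \<integral>t. norm (f n t) \<partial>lborel)"
    proof (rule summable_comparison_test'[OF summable_mult2[OF sm], of 0])
      fix n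
      have "(\<integral>t. norm (f n t) \<partial>lborel) \<le> (\<integral>t. norm (c n) * norm (beta_kernel p q t) \<partial>lborel)"
        using int integrable_beta_kernel[OF assms(1,2)] nf by (intro integral_mono) auto
      thus "norm (\<integral>t. norm (f n t) \<partial>lborel) \<le> norm (c n) * (\<integral>t. norm (beta_kernel p q t) \<partial>lborel)"
        by simp
    qed
  qed
  moreover have "(\<Sum>n. f n t) = beta_kernel p q t * (\<Sum>n. c n * of_real t ^ n)" for t
  proof (cases "t \<in> {0<..<1}")
    case True
    have "norm (c n * of_real t ^ n) \<le> norm (c n)" for n
      using True by (auto simp: norm_mult norm_power intro!: mult_left_le power_le_one)
    hence "summable (\<lambda>n. c n * of_real t ^ n)"
      by (intro summable_comparison_test'[OF sm, of 0]) auto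
    from suminf_mult[OF this, of "beta_kernel p q t"] show ?thesis by (simp add: f_def mult_ac)
  qed (auto simp: f_def beta_kernel_def)
  moreover have "(\<integral>t. f n t \<partial>lborel) = c n * Beta (of_real p + of_nat n) q" for n
    unfolding f_def beta_kernel_mult_power using integral_beta_kernel[of "p + real n" q] assms by simp
  ultimately show ?thesis by simp
qed

lemma one_minus_mult_notin_nonpos:
  assumes "z \<in> slit_plane" "0 \<le> t" "t \<le> (1::real)"
  shows "1 - z * of_real t \<notin> \<real>\<^sub>\<le>\<^sub>0"
proof
  assume "1 - z * of_real t \<in> \<real>\<^sub>\<le>\<^sub>0"
  hence *: "1 \<le> Re z * t" "Im z * t = 0" by (auto simp: complex_nonpos_Reals_iff)
  hence t: "t > 0" using assms(2) by (cases "t = 0") auto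
  have "Re z \<ge> 1"
  proof (rule ccontr)
    assume "\<not> Re z \<ge> 1"
    hence "Re z * t < 1 * t" using t by (intro mult_strict_right_mono) auto
    thus False using * assms(3) by simp
  qed
  thus False using * t assms(1) by (auto simp: slit_plane_def)
qed

text \<open>
Euler's integral: on the unit disc the binomial series of \<open>(1 - z t)\<^bsup>-b\<^esup>\<close> is integrated termwise, and
\<open>1 - z t\<close> avoids the cut of the power for \<open>z\<close> in the slit plane and \<open>0 \<le> t \<le> 1\<close>.
\<close>

lemma continues_hypergeo_Euler:
  assumes p: "p > 0" "Re c > p"
  shows "continues_hypergeo (of_real p) b c
           (\<lambda>z. (\<integral>t. beta_kernel p (c - of_real p) t * (1 - z * of_real t) powr (- b) \<partial>lborel) / Beta (of_real p) (c - of_real p))"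
  unfolding continues_hypergeo_def
proof (intro conjI allI impI)
  define q where "q = c - of_real p"
  have q: "Re q > 0" using p by (simp add: q_def)
  have np: "complex_of_real p \<notin> \<int>\<^sub>\<le>\<^sub>0" "q \<notin> \<int>\<^sub>\<le>\<^sub>0" "c \<notin> \<int>\<^sub>\<le>\<^sub>0"
    using p q by (auto intro!: Re_pos_notin_nonpos_Ints)
  have B: "Beta (of_real p) q \<noteq> 0"
    using np by (simp add: Beta_def q_def Gamma_eq_zero_iff)
  have hol: "(\<lambda>z. \<integral>t. beta_kernel p q t * (1 - z * of_real t) powr (- b) \<partial>lborel) holomorphic_on slit_plane"
  proof (rule holomorphic_integral_dominated[OF open_slit_plane])
    fix t :: real
    show "(\<lambda>z. beta_kernel p q t * (1 - z * of_real t) powr (- b)) holomorphic_on slit_plane"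
    proof (cases "t \<in> {0<..<1}")
      case True
      thus ?thesis by (intro holomorphic_intros) (use one_minus_mult_notin_nonpos[of _ t] in auto)
    qed (auto simp: beta_kernel_def)
  next
    fix z assume "z \<in> slit_plane"
    show "(\<lambda>t. beta_kernel p q t * (1 - z * of_real t) powr (- b)) \<in> borel_measurable lborel"
      unfolding powr_def by measurable
  next
    fix z assume "z \<in> slit_plane"
    then obtain r where r: "r > 0" "cball z r \<subseteq> slit_plane"
      using open_slit_plane open_contains_cball by blast
    have "continuous_on (cball z r \<times> {0..1}) (\<lambda>x. (1 - fst x * of_real (snd x)) powr (- b))"
    proof -
      have "1 - fst x * of_real (snd x) \<notin> \<real>\<^sub>\<le>\<^sub>0" if "x \<in> cball z r \<times> {0..1}" for x :: "complex \<times> real"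
        using one_minus_mult_notin_nonpos[of "fst x" "snd x"] r(2) that by (auto simp: mem_Times_iff)
      moreover have "continuous_on (- \<real>\<^sub>\<le>\<^sub>0) (\<lambda>u::complex. u powr (- b))"
        by (intro holomorphic_on_imp_continuous_on holomorphic_intros) auto
      ultimately show ?thesis
        by (intro continuous_on_compose2[where f = "\<lambda>x. 1 - fst x * of_real (snd x)" and g = "\<lambda>u. u powr (- b)"])
           (auto intro!: continuous_intros simp del: complex_nonpos_Reals_iff)
    qed
    hence "compact ((\<lambda>x. (1 - fst x * of_real (snd x)) powr (- b)) ` (cball z r \<times> {0..1::real}))"
      by (intro compact_continuous_image compact_Times) auto
    then obtain K where K0: "\<forall>x \<in> (\<lambda>x. (1 - fst x * of_real (snd x)) powr (- b)) ` (cball z r \<times> {0..1::real}). norm x \<le> K"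
      using compact_imp_bounded bounded_iff by blast
    have K: "norm ((1 - w * of_real t) powr (- b)) \<le> K" if "w \<in> cball z r" "t \<in> {0..1::real}" for w t
      using K0 that by force
    have "norm (beta_kernel p q t * (1 - w * of_real t) powr (- b)) \<le> norm (beta_kernel p q t) * K"
      if "dist z w < r" for w and t :: real
    proof (cases "t \<in> {0<..<1}")
      case True
      thus ?thesis using that K[of w t] by (auto simp: norm_mult intro!: mult_left_mono)
    qed (auto simp: beta_kernel_def)
    moreover have "integrable lborel (\<lambda>t. norm (beta_kernel p q t) * K)"
      using integrable_beta_kernel[OF p(1) q] by simp
    ultimately show "\<exists>r>0. \<exists>g. integrable lborel g \<and> (\<forall>w\<in>slit_plane. dist z w < r \<longrightarrow>
        (\<forall>t\<in>space lborel. norm (beta_kernel p q t * (1 - w * of_real t) powr (- b)) \<le> g t))"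
      using r(1) by blast
  qed
  show "(\<lambda>z. (\<integral>t. beta_kernel p (c - of_real p) t * (1 - z * of_real t) powr (- b) \<partial>lborel) / Beta (of_real p) (c - of_real p)) holomorphic_on slit_plane"
    using hol B unfolding q_def by (intro holomorphic_intros)
  fix w :: complex assume w: "norm w < 1"
  define d where "d = (\<lambda>n. pochhammer b n / fact n * w ^ n)"
  have sm: "summable (\<lambda>n. norm (d n))"
    using summable_hypergeo[OF w, of 1 b 1] by (simp add: d_def hypergeo_coeff_def pochhammer_fact [symmetric])
  have e1: "beta_kernel p q t * (\<Sum>n. d n * of_real t ^ n) = beta_kernel p q t * (1 - w * of_real t) powr (- b)" for t
  proof (cases "t \<in> {0<..<1}")
    case True
    have "norm (- (w * of_real t)) < 1"
    proof -
      have "norm w * t \<le> norm w * 1" using True by (intro mult_left_mono) auto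
      thus ?thesis using w True by (simp add: norm_mult)
    qed
    from gen_binomial_complex[OF this, of "- b"]
    have "(\<lambda>n. (- b gchoose n) * (- (w * of_real t)) ^ n) sums (1 - w * of_real t) powr (- b)" by simp
    moreover have "(- b gchoose n) * (- (w * of_real t)) ^ n = d n * of_real t ^ n" for n
    proof -
      have "(- 1) ^ n * (- (w * of_real t)) ^ n = (w * of_real t) ^ n"
        by (simp add: power_mult_distrib [symmetric])
      thus ?thesis by (simp add: d_def gbinomial_pochhammer power_mult_distrib mult_ac)
    qed
    ultimately show ?thesis by (simp add: sums_iff)
  qed (auto simp: beta_kernel_def)
  have e2: "d n * Beta (of_real p + of_nat n) q = Beta (of_real p) q * (hypergeo_coeff (of_real p) b c n * w ^ n)" for n
  proof -
    have "Beta (of_real p + of_nat n) q = Beta (of_real p) q * (pochhammer (of_real p) n / pochhammer c n)"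
      using np by (simp add: Beta_def pochhammer_Gamma q_def Gamma_eq_zero_iff add_ac)
    thus ?thesis by (simp add: hypergeo_coeff_def d_def mult_ac)
  qed
  have e3: "(\<Sum>n. Beta (of_real p) q * (hypergeo_coeff (of_real p) b c n * w ^ n)) =
      Beta (of_real p) q * eval_fps (hypergeo_fps (of_real p) b c) w"
    using summable_norm_cancel[OF summable_hypergeo[OF w, of "of_real p" b c]]
    by (subst suminf_mult) (auto simp: eval_fps_def hypergeo_fps_def)
  have "(\<integral>t. beta_kernel p q t * (1 - w * of_real t) powr (- b) \<partial>lborel) =
      Beta (of_real p) q * eval_fps (hypergeo_fps (of_real p) b c) w"
    unfolding e1 [symmetric] integral_beta_kernel_power_series[OF p(1) q sm] e2 e3 ..
  thus "(\<integral>t. beta_kernel p (c - of_real p) t * (1 - w * of_real t) powr (- b) \<partial>lborel) / Beta (of_real p) (c - of_real p)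
      = eval_fps (hypergeo_fps (of_real p) b c) w"
    using B by (simp add: q_def)
qed

text \<open>
Start from Euler's integral for \<open>a + m\<close> and a third parameter of large real part, lower the first parameter
\<open>m\<close> times, then the third.
\<close>

theorem continues_hypergeo_exists:
  assumes "\<And>n. c \<noteq> - of_nat n"
  shows "\<exists>f. continues_hypergeo (of_real a) b c f"
proof -
  \<comment> \<open>the number of lowering steps that separates the given parameter from a positive one\<close>
  define m where "m = nat (\<lceil>- a\<rceil> + 1)"
  have m: "a + real m > 0"
    unfolding m_def by linarith
  have 1: "\<exists>f. continues_hypergeo (of_real (a + real m) - of_nat i) b c' f" if c': "Re c' > a + real m" for c' i
  proof (induction i)
    case 0
    show ?case using continues_hypergeo_Euler[OF m c'] by auto
  next
    case (Suc i)
    then obtain f where f: "continues_hypergeo (of_real (a + real m) - of_nat i) b c' f" by blast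
    let ?a = "of_real (a + real m) - of_nat (Suc i) :: complex"
    have "?a + 1 = of_real (a + real m) - of_nat i" by simp
    hence "continues_hypergeo (?a + 1) b c' f" using f by (simp only:)
    moreover have "c' \<noteq> - of_nat n" for n using c' m by (auto dest: arg_cong[of _ _ Re])
    moreover have "c' \<noteq> ?a + 1" using c' by (auto dest!: arg_cong[of _ _ Re])
    ultimately show ?case using continues_hypergeo_a_lower[of ?a b c' f] by blast
  qed
  have 2: "\<exists>f. continues_hypergeo (of_real a) b c' f" if "Re c' > a + real m" for c'
    using 1[OF that, of m] by simp
  have "\<exists>f. continues_hypergeo (of_real a) b c' f" if "Re c' + real N > a + real m" "\<And>n. c' \<noteq> - of_nat n" for N c'
    using that
  proof (induction N arbitrary: c')
    case 0
    thus ?case using 2[of c'] by simp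
  next
    case (Suc N)
    have "c' + 1 \<noteq> - of_nat n" for n
    proof
      assume "c' + 1 = - of_nat n"
      hence "c' = - of_nat n - 1" by (simp add: eq_diff_eq)
      thus False using Suc.prems(2)[of "Suc n"] by simp
    qed
    then obtain f where "continues_hypergeo (of_real a) b (c' + 1) f"
      using Suc.IH[of "c' + 1"] Suc.prems by (auto simp: add_ac)
    thus ?case using continues_hypergeo_c_lower Suc.prems(2) by blast
  qed
  moreover have "Re c + real (nat \<lceil>a + real m - Re c + 1\<rceil>) > a + real m" by linarith
  ultimately show ?thesis using assms by blast
qed

lemma hypergeo_coeff_commute: "hypergeo_coeff a b c = hypergeo_coeff b a c"
  by (simp add: fun_eq_iff hypergeo_coeff_def mult_ac)

theorem holomorphic_hypergeo_2F1:
  assumes "\<And>n. c \<noteq> - of_nat n"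
  shows "hypergeo_2F1 a (of_real b) c holomorphic_on slit_plane"
proof -
  define P where "P = (\<lambda>f. f holomorphic_on (- {w. Im w = 0 \<and> Re w \<ge> 1}) \<and>
      (\<forall>w. norm w < 1 \<longrightarrow> f w = (\<Sum>n. pochhammer a n * pochhammer (of_real b) n / (pochhammer c n * fact n) * w ^ n)))"
  have "\<exists>f. P f"
    using continues_hypergeo_exists[OF assms, of b a]
    unfolding P_def continues_hypergeo_def slit_plane_def hypergeo_fps_def eval_fps_def
      hypergeo_coeff_commute[of "of_real b" a]
    by (simp add: hypergeo_coeff_def)
  hence "P (SOME f. P f)" by (rule someI_ex)
  then obtain g where g: "g = (SOME f. P f)" "P g" by blast
  have "hypergeo_2F1 a (of_real b) c w = g w" for w
  proof (cases "norm w < 1")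
    case True
    thus ?thesis using g(2) by (simp add: P_def hypergeo_2F1_def)
  next
    case False
    thus ?thesis by (simp add: g(1) P_def hypergeo_2F1_def)
  qed
  hence "hypergeo_2F1 a (of_real b) c = g" by (rule ext)
  thus ?thesis using g(2) by (simp add: P_def slit_plane_def)
qed

section \<open>The power series of the Bessel function I\<close>

text \<open>
The entire function with \<open>I\<^sub>\<nu>(z) = (z/2)\<^sup>\<nu>\<close> times its value at \<open>z\<^sup>2/4\<close>. It is entire in \<open>\<nu>\<close> as well, and free of
branches.
\<close>

definition bessel_series :: "complex \<Rightarrow> complex \<Rightarrow> complex" where
  "bessel_series \<nu> y = (\<Sum>m. rGamma (\<nu> + of_nat m + 1) * y ^ m / fact m)"

lemma bessel_I_eq: "bessel_I \<nu> z = (if \<nu> = 0 then 1 else (z / 2) powr \<nu>) * bessel_series \<nu> (z\<^sup>2 / 4)"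
  by (simp add: bessel_I_def bessel_series_def power_mult power_divide)

lemma rGamma_shift_bounded:
  obtains C where "\<And>\<nu> m. norm \<nu> \<le> R \<Longrightarrow> norm (rGamma (\<nu> + of_nat m + 1 :: complex)) \<le> C"
proof -
  define N where "N = nat \<lceil>R\<rceil>"
  have N: "real N \<ge> R" unfolding N_def by (rule real_nat_ceiling_ge)
  have "\<exists>C. \<forall>\<nu>. norm \<nu> \<le> R \<longrightarrow> norm (rGamma (\<nu> + of_nat m + 1 :: complex)) \<le> C" for m
  proof -
    have "compact ((\<lambda>\<nu>. rGamma (\<nu> + of_nat m + 1 :: complex)) ` cball 0 R)"
      by (intro compact_continuous_image holomorphic_on_imp_continuous_on holomorphic_intros) auto
    then obtain C where "\<forall>x \<in> (\<lambda>\<nu>. rGamma (\<nu> + of_nat m + 1 :: complex)) ` cball 0 R. norm x \<le> C"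
      using compact_imp_bounded bounded_iff by blast
    thus ?thesis by (intro exI[of _ C]) auto
  qed
  then obtain C where C: "\<And>m \<nu>. norm \<nu> \<le> R \<Longrightarrow> norm (rGamma (\<nu> + of_nat m + 1 :: complex)) \<le> C m"
    by metis
  have "norm (rGamma (\<nu> + of_nat m + 1 :: complex)) \<le> (\<Sum>i\<le>N. \<bar>C i\<bar>)" if \<nu>: "norm \<nu> \<le> R" for \<nu> m
  proof -
    have le: "\<bar>C i\<bar> \<le> (\<Sum>i\<le>N. \<bar>C i\<bar>)" if "i \<le> N" for i
      by (rule member_le_sum) (use that in auto)
    show ?thesis
    proof (cases "m \<le> N")
      case True
      thus ?thesis using C[OF \<nu>, of m] le[of m] by linarith
    next
      case False
      define j where "j = m - N"
      have j: "m = N + j" using False by (simp add: j_def)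
      have "rGamma (\<nu> + of_nat N + 1) = pochhammer (\<nu> + of_nat N + 1) j * rGamma (\<nu> + of_nat N + 1 + of_nat j)"
        by (rule pochhammer_rGamma)
      moreover have "norm (pochhammer (\<nu> + of_nat N + 1) j) \<ge> 1"
      proof -
        have "1 \<le> norm (\<nu> + of_nat N + 1 + of_nat i)" for i
        proof -
          have "Re \<nu> \<ge> - R" using \<nu> abs_Re_le_cmod[of \<nu>] by linarith
          hence "1 \<le> Re (\<nu> + of_nat N + 1 + of_nat i)" using N by simp
          also have "\<dots> \<le> norm (\<nu> + of_nat N + 1 + of_nat i)" by (rule complex_Re_le_cmod)
          finally show ?thesis .
        qed
        thus ?thesis unfolding pochhammer_prod prod_norm [symmetric] by (intro prod_ge_1) auto
      qed
      ultimately have "norm (rGamma (\<nu> + of_nat N + 1 + of_nat j)) \<le> norm (rGamma (\<nu> + of_nat N + 1))"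
        using mult_right_mono[of 1 "norm (pochhammer (\<nu> + of_nat N + 1) j)" "norm (rGamma (\<nu> + of_nat N + 1 + of_nat j))"]
        by (simp add: norm_mult)
      thus ?thesis using C[OF \<nu>, of N] le[of N] by (simp add: j add_ac)
    qed
  qed
  thus ?thesis by (rule that)
qed

lemma bessel_series_dominated:
  obtains C where "\<And>\<nu> y m. norm \<nu> \<le> R \<Longrightarrow> norm y \<le> S \<Longrightarrow>
    norm (rGamma (\<nu> + of_nat m + 1) * y ^ m / fact m :: complex) \<le> C * (S ^ m / fact m)"
proof -
  obtain C where C: "\<And>\<nu> m. norm \<nu> \<le> R \<Longrightarrow> norm (rGamma (\<nu> + of_nat m + 1 :: complex)) \<le> C"
    using rGamma_shift_bounded[of R] by blast
  have "norm (rGamma (\<nu> + of_nat m + 1) * y ^ m / fact m) \<le> C * (S ^ m / fact m)"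
    if "norm \<nu> \<le> R" "norm y \<le> S" for \<nu> y :: complex and m
  proof -
    have "norm (rGamma (\<nu> + of_nat m + 1)) * norm y ^ m \<le> C * S ^ m"
      using C[OF that(1), of m] that(2) by (intro mult_mono power_mono) (auto intro: order.trans[OF norm_ge_zero])
    thus ?thesis by (simp add: norm_mult norm_divide norm_power divide_right_mono)
  qed
  thus ?thesis by (rule that)
qed

lemma summable_exp_series: "summable (\<lambda>m. C * (S ^ m / fact m) :: real)"
  using summable_exp[of S] by (intro summable_mult) (simp add: field_simps)

lemma summable_bessel_series: "summable (\<lambda>m. norm (rGamma (\<nu> + of_nat m + 1) * y ^ m / fact m :: complex))"
proof -
  obtain C where "\<And>\<mu> x m. norm \<mu> \<le> norm \<nu> \<Longrightarrow> norm x \<le> norm y \<Longrightarrow>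
      norm (rGamma (\<mu> + of_nat m + 1) * x ^ m / fact m :: complex) \<le> C * (norm y ^ m / fact m)"
    using bessel_series_dominated[of "norm \<nu>" "norm y"] by metis
  hence C: "norm (rGamma (\<nu> + of_nat m + 1) * y ^ m / fact m) \<le> C * (norm y ^ m / fact m)" for m by simp
  show ?thesis by (rule summable_comparison_test'[OF summable_exp_series[of C "norm y"], of 0]) (use C in auto)
qed

lemma holomorphic_bessel_series_order: "(\<lambda>\<nu>. bessel_series \<nu> y) holomorphic_on UNIV"
  unfolding bessel_series_def
proof (rule holomorphic_suminf_dominated)
  fix \<nu> :: complex
  obtain C where C: "\<And>\<mu> m. norm \<mu> \<le> norm \<nu> + 1 \<Longrightarrow> norm (rGamma (\<mu> + of_nat m + 1) * y ^ m / fact m) \<le> C * (norm y ^ m / fact m)"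
    using bessel_series_dominated[of "norm \<nu> + 1" "norm y"] by (metis order.refl)
  have "norm \<mu> \<le> norm \<nu> + 1" if "dist \<nu> \<mu> < 1" for \<mu>
    using that norm_triangle_ineq2[of \<mu> \<nu>] by (simp add: dist_norm norm_minus_commute)
  thus "\<exists>r>0. \<exists>g. summable g \<and> (\<forall>w\<in>UNIV. dist \<nu> w < r \<longrightarrow> (\<forall>m. norm (rGamma (w + of_nat m + 1) * y ^ m / fact m) \<le> g m))"
    using C summable_exp_series[of C "norm y"]
    by (intro exI[of _ "1::real"] conjI exI[of _ "\<lambda>m. C * (norm y ^ m / fact m)"]) auto
qed (auto intro!: holomorphic_intros)

lemma has_field_derivative_bessel_series:
  "(bessel_series \<nu> has_field_derivative bessel_series (\<nu> + 1) y) (at y)"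
proof -
  define c where "c = (\<lambda>m. rGamma (\<nu> + of_nat m + 1) / fact m :: complex)"
  have 1: "bessel_series \<nu> = (\<lambda>y. \<Sum>m. c m * y ^ m)"
    by (simp add: bessel_series_def c_def fun_eq_iff mult_ac)
  have "diffs c m = rGamma (\<nu> + 1 + of_nat m + 1) / fact m" for m
  proof -
    have e: "\<nu> + of_nat (Suc m) + 1 = \<nu> + 1 + of_nat m + 1" by simp
    show ?thesis unfolding diffs_def c_def e fact_Suc by (simp del: of_nat_Suc)
  qed
  hence 2: "bessel_series (\<nu> + 1) y = (\<Sum>m. diffs c m * y ^ m)"
    by (simp add: bessel_series_def mult_ac)
  show ?thesis unfolding 1 2
    by (rule termdiffs_strong_converges_everywhere)
       (use summable_norm_cancel[OF summable_bessel_series[of \<nu>]] in \<open>simp add: c_def mult_ac\<close>)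
qed

lemma holomorphic_bessel_series [holomorphic_intros]:
  assumes "f holomorphic_on A"
  shows "(\<lambda>z. bessel_series \<nu> (f z)) holomorphic_on A"
proof -
  have "bessel_series \<nu> holomorphic_on UNIV"
    using has_field_derivative_bessel_series by (auto simp: holomorphic_on_open)
  thus ?thesis using holomorphic_on_compose_gen[OF assms, of "bessel_series \<nu>" UNIV] by (simp add: o_def)
qed

lemma bessel_series_0: "bessel_series \<nu> 0 = rGamma (\<nu> + 1)"
  unfolding bessel_series_def by (subst suminf_finite[of "{0}"]) auto

lemma bessel_series_recurrence:
  "bessel_series \<nu> y = (\<nu> + 1) * bessel_series (\<nu> + 1) y + y * bessel_series (\<nu> + 2) y"
proof -
  let ?t = "\<lambda>\<nu> m. rGamma (\<nu> + of_nat m + 1) * y ^ m / fact m"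
  have s: "summable (?t \<mu>)" for \<mu> by (rule summable_norm_cancel[OF summable_bessel_series])
  have r: "rGamma (\<nu> + of_nat m + 1) = (\<nu> + 1 + of_nat m) * rGamma (\<nu> + 1 + of_nat m + 1)" for m
    using rGamma_plus1[of "\<nu> + of_nat m + 1"] by (simp add: add_ac)
  have "(\<lambda>m. of_nat (Suc m) * ?t (\<nu> + 1) (Suc m)) sums (y * bessel_series (\<nu> + 2) y)"
  proof -
    have "of_nat (Suc m) * ?t (\<nu> + 1) (Suc m) = y * ?t (\<nu> + 2) m" for m
    proof -
      have e: "\<nu> + 1 + of_nat (Suc m) + 1 = \<nu> + 2 + of_nat m + 1" by simp
      show ?thesis unfolding e fact_Suc power_Suc by (simp del: of_nat_Suc)
    qed
    thus ?thesis using sums_mult[OF summable_sums[OF s[of "\<nu> + 2"]], of y] by (simp add: bessel_series_def)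
  qed
  hence "(\<lambda>m. of_nat m * ?t (\<nu> + 1) m) sums (y * bessel_series (\<nu> + 2) y)"
    by (subst (asm) sums_Suc_iff) simp
  moreover have "(\<lambda>m. (\<nu> + 1) * ?t (\<nu> + 1) m) sums ((\<nu> + 1) * bessel_series (\<nu> + 1) y)"
    using sums_mult[OF summable_sums[OF s[of "\<nu> + 1"]], of "\<nu> + 1"] by (simp only: bessel_series_def)
  ultimately have "(\<lambda>m. (\<nu> + 1) * ?t (\<nu> + 1) m + of_nat m * ?t (\<nu> + 1) m) sums ((\<nu> + 1) * bessel_series (\<nu> + 1) y + y * bessel_series (\<nu> + 2) y)"
    by (rule sums_add[rotated])
  moreover have "(\<nu> + 1) * ?t (\<nu> + 1) m + of_nat m * ?t (\<nu> + 1) m = ?t \<nu> m" for m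
    unfolding r by (simp add: algebra_simps add_divide_distrib)
  ultimately show ?thesis by (simp add: bessel_series_def sums_iff)
qed

text \<open>
Poisson's integral for \<open>I\<^sub>\<nu>\<close>: since \<open>I\<^bsub>-1/2\<^esub>\<close> is a hyperbolic cosine, integrating its power series against a beta kernel
raises the order.
\<close>

lemma bessel_series_Sonine:
  assumes "Re \<nu> > - 1/2"
  shows "bessel_series \<nu> (w\<^sup>2 / 4) = rGamma (\<nu> + 1/2) / of_real (sqrt pi) *
           (\<integral>t. beta_kernel (1/2) (\<nu> + 1/2) t * cosh (w * of_real (sqrt t)) \<partial>lborel)"
proof -
  define c where "c = (\<lambda>m. w ^ (2 * m) / fact (2 * m))"
  have sm: "summable (\<lambda>m. norm (c m))"
  proof -
    have "summable (\<lambda>n. norm w ^ n / fact n)" using summable_exp[of "norm w"] by (simp add: field_simps)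
    hence "summable (\<lambda>m. norm w ^ (2 * m) / fact (2 * m))"
      using summable_reindex[where g = "\<lambda>m. 2 * m"] by (force simp: inj_on_def o_def)
    thus ?thesis by (simp add: c_def norm_divide norm_power)
  qed
  have e: "beta_kernel (1/2) (\<nu> + 1/2) t * (\<Sum>m. c m * of_real t ^ m) = beta_kernel (1/2) (\<nu> + 1/2) t * cosh (w * of_real (sqrt t))" for t
  proof (cases "t \<in> {0<..<1}")
    case True
    have "(\<lambda>n. if even n then (w * of_real (sqrt t)) ^ n /\<^sub>R fact n else 0) sums cosh (w * of_real (sqrt t))"
      by (rule cosh_converges)
    hence "(\<lambda>m. if even (2 * m) then (w * of_real (sqrt t)) ^ (2 * m) /\<^sub>R fact (2 * m) else 0) sums cosh (w * of_real (sqrt t))"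
      by (subst sums_mono_reindex[of "\<lambda>m. 2 * m"]) (auto simp: strict_mono_def elim!: evenE)
    moreover have "(w * of_real (sqrt t)) ^ (2 * m) /\<^sub>R fact (2 * m) = c m * of_real t ^ m" for m
    proof -
      have "complex_of_real (sqrt t) ^ (2 * m) = of_real t ^ m"
        using True by (simp add: power_mult flip: of_real_power)
      thus ?thesis by (simp add: c_def scaleR_conv_of_real power_mult_distrib field_simps)
    qed
    ultimately show ?thesis by (simp add: sums_iff)
  qed (auto simp: beta_kernel_def)
  have "(\<integral>t. beta_kernel (1/2) (\<nu> + 1/2) t * cosh (w * of_real (sqrt t)) \<partial>lborel) =
      (\<Sum>m. c m * Beta (of_real (1/2) + of_nat m) (\<nu> + 1/2))"
    unfolding e [symmetric] by (rule integral_beta_kernel_power_series) (use sm assms in auto)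
  also have "\<dots> = (\<Sum>m. of_real (sqrt pi) * Gamma (\<nu> + 1/2) * (rGamma (\<nu> + of_nat m + 1) * (w\<^sup>2 / 4) ^ m / fact m))"
  proof (intro suminf_cong)
    fix m
    have g: "Gamma (1/2 + of_nat m :: complex) = of_real (sqrt pi) * pochhammer (1/2) m"
      using pochhammer_Gamma[of "1/2 :: complex" m] Re_pos_notin_nonpos_Ints[of "1/2"]
      by (simp add: Gamma_one_half_complex Gamma_eq_zero_iff field_simps)
    have "pochhammer (1/2 :: complex) m \<noteq> 0" using Re_pos_notin_nonpos_Ints[of "1/2"]
      by (auto simp: pochhammer_eq_0_iff dest: arg_cong[of _ _ Re])
    moreover have "fact (2 * m) = (4 ^ m * pochhammer (1/2) m * fact m :: complex)"
      by (simp add: fact_double power_mult)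
    ultimately have "c m * (pochhammer (1/2) m) = (w\<^sup>2 / 4) ^ m / fact m"
    proof -
      assume *: "pochhammer (1/2 :: complex) m \<noteq> 0" "fact (2 * m) = (4 ^ m * pochhammer (1/2) m * fact m :: complex)"
      have "w ^ (2 * m) = (w\<^sup>2) ^ m" by (rule power_mult)
      thus ?thesis unfolding c_def *(2) using *(1) by (simp add: power_divide)
    qed
    note cm = this
    have h: "complex_of_real (1/2) = 1/2" and e: "1/2 + of_nat m + (\<nu> + 1/2) = \<nu> + of_nat m + 1" by simp_all
    have "c m * Beta (of_real (1/2) + of_nat m) (\<nu> + 1/2) =
        c m * (of_real (sqrt pi) * pochhammer (1/2) m * Gamma (\<nu> + 1/2) * rGamma (\<nu> + of_nat m + 1))"
      unfolding Beta_altdef h e g ..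
    also have "\<dots> = of_real (sqrt pi) * Gamma (\<nu> + 1/2) * (rGamma (\<nu> + of_nat m + 1) * (c m * pochhammer (1/2) m))"
      by (simp only: mult_ac)
    finally show "c m * Beta (of_real (1/2) + of_nat m) (\<nu> + 1/2) =
        of_real (sqrt pi) * Gamma (\<nu> + 1/2) * (rGamma (\<nu> + of_nat m + 1) * (w\<^sup>2 / 4) ^ m / fact m)"
      unfolding cm by simp
  qed
  also have "\<dots> = of_real (sqrt pi) * Gamma (\<nu> + 1/2) * bessel_series \<nu> (w\<^sup>2 / 4)"
    unfolding bessel_series_def by (rule suminf_mult) (rule summable_norm_cancel[OF summable_bessel_series])
  finally show ?thesis
    using Re_pos_notin_nonpos_Ints[of "\<nu> + 1/2"] assms by (simp add: rGamma_inverse_Gamma Gamma_eq_zero_iff field_simps)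
qed

lemma norm_cosh_le: "norm (cosh z :: complex) \<le> exp \<bar>Re z\<bar>"
proof -
  have "norm (cosh z) \<le> (exp (Re z) + exp (- Re z)) / 2"
    unfolding cosh_field_def using norm_triangle_ineq[of "exp z" "exp (-z)"] by (simp add: norm_divide)
  also have "\<dots> \<le> exp \<bar>Re z\<bar>" by (simp add: abs_if)
  finally show ?thesis .
qed

lemma norm_bessel_series_le:
  assumes "Re \<nu> > - 1/2"
  shows "norm (bessel_series \<nu> (w\<^sup>2 / 4)) \<le>
           norm (rGamma (\<nu> + 1/2)) * (Gamma (Re \<nu> + 1/2) * rGamma (Re \<nu> + 1)) * exp \<bar>Re w\<bar>"
proof -
  let ?b = "Re \<nu> + 1/2"
  have bb: "has_bochner_integral lborel (\<lambda>t. norm (beta_kernel (1/2) (\<nu> + 1/2) t)) (Beta (1/2) ?b)"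
    unfolding norm_beta_kernel using has_bochner_integral_beta_real[of "1/2" ?b] assms by simp
  have "norm (\<integral>t. beta_kernel (1/2) (\<nu> + 1/2) t * cosh (w * of_real (sqrt t)) \<partial>lborel) \<le>
        (\<integral>t. norm (beta_kernel (1/2) (\<nu> + 1/2) t) * exp \<bar>Re w\<bar> \<partial>lborel)"
  proof (rule order.trans[OF integral_norm_bound integral_mono])
    have le: "norm (beta_kernel (1/2) (\<nu> + 1/2) t * cosh (w * of_real (sqrt t))) \<le> norm (beta_kernel (1/2) (\<nu> + 1/2) t) * exp \<bar>Re w\<bar>" for t
    proof (cases "t \<in> {0<..<1}")
      case True
      have "norm (cosh (w * of_real (sqrt t))) \<le> exp \<bar>Re (w * of_real (sqrt t))\<bar>" by (rule norm_cosh_le)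
      also have "\<bar>Re (w * of_real (sqrt t))\<bar> \<le> \<bar>Re w\<bar>"
        using True by (simp add: abs_mult mult_left_le)
      finally show ?thesis by (simp add: norm_mult mult_left_mono)
    qed (auto simp: beta_kernel_def)
    thus "norm (beta_kernel (1/2) (\<nu> + 1/2) t * cosh (w * of_real (sqrt t))) \<le> norm (beta_kernel (1/2) (\<nu> + 1/2) t) * exp \<bar>Re w\<bar>" for t .
    show "integrable lborel (\<lambda>t. norm (beta_kernel (1/2) (\<nu> + 1/2) t) * exp \<bar>Re w\<bar>)"
      using bb by (auto simp: has_bochner_integral_iff)
    thus "integrable lborel (\<lambda>t. norm (beta_kernel (1/2) (\<nu> + 1/2) t * cosh (w * of_real (sqrt t))))"
      by (intro integrable_norm, rule Bochner_Integration.integrable_bound)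
         (use le in \<open>auto simp: cosh_field_def intro!: AE_I2 order.trans[OF le abs_ge_self]\<close>)
  qed
  also have "\<dots> = Beta (1/2) ?b * exp \<bar>Re w\<bar>" using bb by (auto simp: has_bochner_integral_iff)
  also have "Beta (1/2) ?b = sqrt pi * (Gamma ?b * rGamma (Re \<nu> + 1))"
    by (simp add: Beta_altdef Gamma_one_half_real add_ac)
  finally have "norm (rGamma (\<nu> + 1/2)) / sqrt pi * norm (\<integral>t. beta_kernel (1/2) (\<nu> + 1/2) t * cosh (w * of_real (sqrt t)) \<partial>lborel) \<le>
      norm (rGamma (\<nu> + 1/2)) / sqrt pi * (sqrt pi * (Gamma ?b * rGamma (Re \<nu> + 1)) * exp \<bar>Re w\<bar>)"
    by (intro mult_left_mono) auto
  thus ?thesis unfolding bessel_series_Sonine[OF assms] by (simp add: norm_mult norm_divide mult_ac)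
qed

lemma tendsto_rGamma: "(f \<longlongrightarrow> c) F \<Longrightarrow> ((\<lambda>z. rGamma (f z)) \<longlongrightarrow> rGamma c) F"
  by (rule isCont_tendsto_compose[OF isCont_rGamma[OF continuous_ident]])

text \<open>
Poisson's integral bounds the function only for \<open>Re \<nu> > - 1/2\<close>. The recurrence writes it by the orders
\<open>\<nu> + 1\<close> and \<open>\<nu> + 2\<close>, which reaches all of \<open>Re \<nu> > - 1\<close> at the cost of the factor \<open>1 + \<bar>w\<bar>\<^sup>2\<close>. The exponential
rate \<open>\<bar>Re w\<bar>\<close> is what makes the product with \<open>K\<close> summable.
\<close>

lemma bessel_series_locally_bounded:
  assumes "Re \<nu>0 > - 1"
  obtains r C where "r > 0" "C > 0" "\<And>\<nu> w. dist \<nu>0 \<nu> < r \<Longrightarrow>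
    norm (bessel_series \<nu> (w\<^sup>2 / 4)) \<le> C * (1 + (norm w)\<^sup>2) * exp \<bar>Re w\<bar>"
proof -
  define r where "r = (Re \<nu>0 + 1) / 2"
  have r: "r > 0" using assms by (simp add: r_def)
  define b where "b = (\<lambda>\<nu>::complex. norm (rGamma (\<nu> + 1/2)) * (Gamma (Re \<nu> + 1/2) * rGamma (Re \<nu> + 1)))"
  have Re: "Re \<nu> > - 1" if "\<nu> \<in> cball \<nu>0 r" for \<nu>
  proof -
    have "Re (\<nu>0 - \<nu>) \<le> r" using that complex_Re_le_cmod[of "\<nu>0 - \<nu>"] by (simp add: dist_norm)
    thus ?thesis using assms by (simp add: r_def field_simps)
  qed
  have cont: "continuous_on (cball \<nu>0 r) (\<lambda>\<nu>. b (\<nu> + of_nat j))" if "j \<ge> 1" for j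
  proof -
    have "Re \<nu> + real j + 1 / 2 \<notin> \<int>\<^sub>\<le>\<^sub>0" if "\<nu> \<in> cball \<nu>0 r" for \<nu>
      using Re[OF that] \<open>j \<ge> 1\<close> by (auto elim!: nonpos_Ints_cases)
    thus ?thesis unfolding b_def continuous_on_def
      by (intro ballI tendsto_intros tendsto_rGamma) auto
  qed
  have "compact ((\<lambda>\<nu>. norm (\<nu> + 1) * b (\<nu> + 1) + b (\<nu> + 2)) ` cball \<nu>0 r)"
    using cont[of 1] cont[of 2] by (intro compact_continuous_image continuous_intros) auto
  then obtain C where C: "\<forall>x\<in>(\<lambda>\<nu>. norm (\<nu> + 1) * b (\<nu> + 1) + b (\<nu> + 2)) ` cball \<nu>0 r. norm x \<le> C"
    using compact_imp_bounded bounded_iff by blast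
  have "norm (bessel_series \<nu> (w\<^sup>2 / 4)) \<le> (\<bar>C\<bar> + 1) * (1 + (norm w)\<^sup>2) * exp \<bar>Re w\<bar>" if \<nu>: "dist \<nu>0 \<nu> < r" for \<nu> w
  proof -
    have R: "Re \<nu> > - 1" using Re[of \<nu>] \<nu> by simp
    have bnn: "b (\<nu> + 1) \<ge> 0" "b (\<nu> + 2) \<ge> 0"
      using R by (auto simp: b_def rGamma_inverse_Gamma intro!: mult_nonneg_nonneg less_imp_le[OF Gamma_real_pos])
    have "norm (\<nu> + 1) * b (\<nu> + 1) + b (\<nu> + 2) \<le> \<bar>C\<bar> + 1" using C \<nu> by (auto dest!: bspec[of _ _ \<nu>])
    moreover have "norm (\<nu> + 1) * b (\<nu> + 1) \<ge> 0" using bnn by simp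
    ultimately have le: "norm (\<nu> + 1) * b (\<nu> + 1) \<le> \<bar>C\<bar> + 1" "b (\<nu> + 2) \<le> \<bar>C\<bar> + 1" using bnn by linarith+
    have "norm (bessel_series \<nu> (w\<^sup>2 / 4)) \<le> norm (\<nu> + 1) * norm (bessel_series (\<nu> + 1) (w\<^sup>2 / 4)) +
            (norm w)\<^sup>2 / 4 * norm (bessel_series (\<nu> + 2) (w\<^sup>2 / 4))"
      by (subst bessel_series_recurrence) (rule order.trans[OF norm_triangle_ineq], simp add: norm_mult norm_divide norm_power)
    also have "\<dots> \<le> norm (\<nu> + 1) * (b (\<nu> + 1) * exp \<bar>Re w\<bar>) + (norm w)\<^sup>2 * (b (\<nu> + 2) * exp \<bar>Re w\<bar>)"
      using norm_bessel_series_le[of "\<nu> + 1" w] norm_bessel_series_le[of "\<nu> + 2" w] R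
      by (intro add_mono mult_mono) (auto simp: b_def)
    also have "\<dots> = (norm (\<nu> + 1) * b (\<nu> + 1) + (norm w)\<^sup>2 * b (\<nu> + 2)) * exp \<bar>Re w\<bar>" by (simp add: algebra_simps)
    also have "\<dots> \<le> ((\<bar>C\<bar> + 1) + (norm w)\<^sup>2 * (\<bar>C\<bar> + 1)) * exp \<bar>Re w\<bar>"
      using le by (intro mult_right_mono add_mono mult_left_mono) auto
    finally show ?thesis by (simp add: algebra_simps)
  qed
  thus ?thesis using r by (intro that[of r "\<bar>C\<bar> + 1"]) auto
qed

section \<open>The integral representation of the Bessel function K\<close>

lemma cosh_measurable [measurable]: "(cosh :: real \<Rightarrow> real) \<in> borel_measurable borel"
  by (intro borel_measurable_continuous_onI continuous_intros)

lemma integrable_exp_cosh: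
  assumes "x > 0"
  shows "integrable lborel (\<lambda>v. exp (- x * cosh v + R * \<bar>v\<bar>) :: real)"
proof (rule Bochner_Integration.integrable_bound)
  define h where "h = (\<lambda>v. exp ((\<bar>R\<bar> + 1) * v - (x / 2) * exp v))"
  have h: "integrable lborel h"
    unfolding h_def using has_bochner_integral_Gamma_log[of "\<bar>R\<bar> + 1" "x / 2"] assms by (simp add: has_bochner_integral_iff)
  have "integrable lborel (\<lambda>v. h (0 + (-1) * v))" by (rule lborel_integrable_real_affine[OF h]) simp
  thus "integrable lborel (\<lambda>v. h v + h (- v))" using h by simp
  have *: "exp (- x * cosh v + R * \<bar>v\<bar>) \<le> h v" if "v \<ge> 0" for v
  proof -
    have "(x / 2) * exp v \<le> x * cosh v" using assms by (simp add: cosh_def field_simps)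
    moreover have "R * \<bar>v\<bar> \<le> (\<bar>R\<bar> + 1) * v" using that by (simp add: mult_right_mono)
    ultimately show ?thesis by (simp add: h_def)
  qed
  show "AE v in lborel. norm (exp (- x * cosh v + R * \<bar>v\<bar>)) \<le> norm (h v + h (- v))"
  proof (rule AE_I2)
    fix v :: real
    have "h v \<ge> 0" "h (-v) \<ge> 0" by (auto simp: h_def)
    moreover have "exp (- x * cosh v + R * \<bar>v\<bar>) \<le> h v \<or> exp (- x * cosh v + R * \<bar>v\<bar>) \<le> h (-v)"
      using *[of v] *[of "-v"] by (cases "v \<ge> 0") auto
    ultimately show "norm (exp (- x * cosh v + R * \<bar>v\<bar>)) \<le> norm (h v + h (- v))" by auto
  qed
qed auto

definition bessel_K_integral :: "complex \<Rightarrow> complex \<Rightarrow> complex" where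
  "bessel_K_integral \<nu> z = (\<integral>v. exp (- z * of_real (cosh v) - \<nu> * of_real v) \<partial>lborel) / 2"

lemma norm_bessel_K_integrand:
  assumes "Re z \<ge> x" "\<bar>Re \<nu>\<bar> \<le> R"
  shows "norm (exp (- z * of_real (cosh v) - \<nu> * of_real v)) \<le> exp (- x * cosh v + R * \<bar>v\<bar>)"
proof -
  have "x * cosh v \<le> Re z * cosh v" using assms(1) by (intro mult_right_mono) auto
  moreover have "- (Re \<nu> * v) \<le> R * \<bar>v\<bar>"
  proof -
    have "- (Re \<nu> * v) \<le> \<bar>Re \<nu>\<bar> * \<bar>v\<bar>" by (metis abs_ge_minus_self abs_mult)
    also have "\<dots> \<le> R * \<bar>v\<bar>" using assms(2) by (intro mult_right_mono) auto
    finally show ?thesis .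
  qed
  ultimately have "- (Re z * cosh v) - Re \<nu> * v \<le> - (x * cosh v) + R * \<bar>v\<bar>" by linarith
  thus ?thesis by simp
qed

lemma holomorphic_bessel_K_integral_order:
  assumes "Re z > 0"
  shows "(\<lambda>\<nu>. bessel_K_integral \<nu> z) holomorphic_on UNIV"
  unfolding bessel_K_integral_def
proof (intro holomorphic_on_divide holomorphic_on_const holomorphic_integral_dominated)
  fix \<nu> :: complex
  have "norm (exp (- z * of_real (cosh v) - \<mu> * of_real v)) \<le> exp (- Re z * cosh v + (\<bar>Re \<nu>\<bar> + 1) * \<bar>v\<bar>)"
    if "dist \<nu> \<mu> < 1" for \<mu> v
  proof (rule norm_bessel_K_integrand)
    show "\<bar>Re \<mu>\<bar> \<le> \<bar>Re \<nu>\<bar> + 1"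
      using that abs_Re_le_cmod[of "\<nu> - \<mu>"] by (simp add: dist_norm)
  qed auto
  thus "\<exists>r>0. \<exists>g. integrable lborel g \<and> (\<forall>w\<in>UNIV. dist \<nu> w < r \<longrightarrow>
     (\<forall>v\<in>space lborel. norm (exp (- z * of_real (cosh v) - w * of_real v)) \<le> g v))"
    using integrable_exp_cosh[OF assms, of "\<bar>Re \<nu>\<bar> + 1"] by (intro exI[of _ "1::real"] conjI exI[of _ "\<lambda>v. exp (- Re z * cosh v + (\<bar>Re \<nu>\<bar> + 1) * \<bar>v\<bar>)"]) auto
qed (auto intro!: holomorphic_intros)

lemma holomorphic_bessel_K_integral:
  "bessel_K_integral \<nu> holomorphic_on {z. Re z > 0}"
  unfolding bessel_K_integral_def
proof (intro holomorphic_on_divide holomorphic_on_const holomorphic_integral_dominated)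
  show "open {z. Re z > 0}" by (rule open_halfspace_Re_gt)
  fix z :: complex assume z: "z \<in> {z. Re z > 0}"
  have "norm (exp (- w * of_real (cosh v) - \<nu> * of_real v)) \<le> exp (- (Re z / 2) * cosh v + \<bar>Re \<nu>\<bar> * \<bar>v\<bar>)"
    if "dist z w < Re z / 2" for w v
  proof (rule norm_bessel_K_integrand)
    have "Re (z - w) \<le> norm (z - w)" by (rule complex_Re_le_cmod)
    thus "Re z / 2 \<le> Re w" using that by (simp add: dist_norm)
  qed auto
  thus "\<exists>r>0. \<exists>g. integrable lborel g \<and> (\<forall>w\<in>{z. Re z > 0}. dist z w < r \<longrightarrow>
     (\<forall>v\<in>space lborel. norm (exp (- w * of_real (cosh v) - \<nu> * of_real v)) \<le> g v))"
    using integrable_exp_cosh[of "Re z / 2" "\<bar>Re \<nu>\<bar>"] z by (intro exI[of _ "Re z / 2"] conjI exI[of _ "\<lambda>v. exp (- (Re z / 2) * cosh v + \<bar>Re \<nu>\<bar> * \<bar>v\<bar>)"]) auto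
qed (auto intro!: holomorphic_intros)

text \<open>
Use \<open>cosh v \<ge> 1\<close> and split \<open>Re z = (Re z - \<epsilon>) + \<epsilon>\<close>: the second part keeps the integral convergent, uniformly for orders of bounded real part.
\<close>

lemma bessel_K_integral_bound:
  assumes "\<epsilon> > 0"
  obtains C where "C > 0" "\<And>\<nu> z. Re z \<ge> \<epsilon> \<Longrightarrow> \<bar>Re \<nu>\<bar> \<le> R \<Longrightarrow> norm (bessel_K_integral \<nu> z) \<le> C * exp (- Re z)"
proof -
  define I where "I = (\<integral>v. exp (- \<epsilon> * cosh v + R * \<bar>v\<bar>) \<partial>lborel)"
  have I: "I \<ge> 0" unfolding I_def by (rule Bochner_Integration.integral_nonneg) auto
  have "norm (bessel_K_integral \<nu> z) \<le> (exp \<epsilon> * I + 1) * exp (- Re z)" if "Re z \<ge> \<epsilon>" "\<bar>Re \<nu>\<bar> \<le> R" for \<nu> z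
  proof -
    have le: "norm (exp (- z * of_real (cosh v) - \<nu> * of_real v)) \<le> exp (\<epsilon> - Re z) * exp (- \<epsilon> * cosh v + R * \<bar>v\<bar>)" for v
    proof -
      have "0 \<le> (Re z - \<epsilon>) * (cosh v - 1)" using that cosh_real_ge_1[of v] by simp
      hence "- Re z * cosh v + R * \<bar>v\<bar> \<le> \<epsilon> - Re z + (- \<epsilon> * cosh v + R * \<bar>v\<bar>)" by (simp add: algebra_simps)
      hence "exp (- Re z * cosh v + R * \<bar>v\<bar>) \<le> exp (\<epsilon> - Re z) * exp (- \<epsilon> * cosh v + R * \<bar>v\<bar>)"
        by (simp only: exp_add [symmetric] exp_le_cancel_iff)
      thus ?thesis using norm_bessel_K_integrand[of "Re z" z \<nu> R v] that(2) by linarith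
    qed
    have int: "integrable lborel (\<lambda>v. exp (\<epsilon> - Re z) * exp (- \<epsilon> * cosh v + R * \<bar>v\<bar>))"
      by (intro integrable_mult_right integrable_exp_cosh assms)
    have "norm (\<integral>v. exp (- z * of_real (cosh v) - \<nu> * of_real v) \<partial>lborel) \<le>
            (\<integral>v. norm (exp (- z * of_real (cosh v) - \<nu> * of_real v)) \<partial>lborel)"
      by (rule integral_norm_bound)
    also have "\<dots> \<le> (\<integral>v. exp (\<epsilon> - Re z) * exp (- \<epsilon> * cosh v + R * \<bar>v\<bar>) \<partial>lborel)"
    proof (rule integral_mono[OF _ int])
      show "integrable lborel (\<lambda>v. norm (exp (- z * of_real (cosh v) - \<nu> * of_real v)))"
        by (rule Bochner_Integration.integrable_bound[OF int]) (use le in auto)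
    qed (use le in auto)
    also have "\<dots> = exp \<epsilon> * I * exp (- Re z)" by (simp add: I_def exp_diff exp_minus divide_inverse)
    finally have "norm (\<integral>v. exp (- z * of_real (cosh v) - \<nu> * of_real v) \<partial>lborel) \<le> exp \<epsilon> * I * exp (- Re z)" .
    moreover have "0 \<le> exp \<epsilon> * I * exp (- Re z)" "0 < exp (- Re z)" using I by auto
    ultimately have "norm (\<integral>v. exp (- z * of_real (cosh v) - \<nu> * of_real v) \<partial>lborel) / 2 \<le> (exp \<epsilon> * I + 1) * exp (- Re z)"
      unfolding distrib_right by linarith
    thus ?thesis unfolding bessel_K_integral_def norm_divide by simp
  qed
  thus ?thesis using I by (intro that[of "exp \<epsilon> * I + 1"]) (auto intro!: add_nonneg_pos)
qed

text \<open>
Up to elementary factors this is \<open>K\<close> as a function of \<open>y = x\<^sup>2/4\<close>, namely \<open>2 y\<^bsup>-\<nu>/2\<^esup> K\<^sub>\<nu>(2 \<surd>y)\<close>. Differentiation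
in \<open>y\<close> only shifts the order.
\<close>

definition macdonald :: "real \<Rightarrow> complex \<Rightarrow> complex" where
  "macdonald \<nu> y = (\<integral>v. exp (- of_real (exp v) - y * of_real (exp (- v)) - of_real (\<nu> * v)) \<partial>lborel)"

definition macdonald_real :: "real \<Rightarrow> real \<Rightarrow> real" where
  "macdonald_real \<nu> y = (\<integral>v. exp (- exp v - y * exp (- v) - \<nu> * v) \<partial>lborel)"

lemma macdonald_of_real: "macdonald \<nu> (of_real y) = of_real (macdonald_real \<nu> y)"
proof -
  have "exp (- of_real (exp v) - of_real y * of_real (exp (- v)) - of_real (\<nu> * v)) =
          complex_of_real (exp (- exp v - y * exp (- v) - \<nu> * v))" for v
    by (simp add: exp_of_real [symmetric])
  thus ?thesis unfolding macdonald_def macdonald_real_def by (simp only: integral_complex_of_real)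
qed

lemma norm_macdonald_integrand:
  assumes "Re y \<ge> c" "c > 0" "c \<le> 1"
  shows "norm (exp (- of_real (exp v) - y * of_real (exp (- v)) - of_real (\<nu> * v))) \<le> exp (- (2 * c) * cosh v + \<bar>\<nu>\<bar> * \<bar>v\<bar>)"
proof -
  have "c * exp v \<le> 1 * exp v" "c * exp (-v) \<le> Re y * exp (-v)"
    using assms by (intro mult_right_mono; simp)+
  moreover have "(2 * c) * cosh v = c * exp v + c * exp (- v)" by (simp add: cosh_def algebra_simps)
  moreover have "- (\<nu> * v) \<le> \<bar>\<nu>\<bar> * \<bar>v\<bar>" by (metis abs_ge_minus_self abs_mult)
  ultimately have "- exp v - Re y * exp (- v) - \<nu> * v \<le> - (2 * c) * cosh v + \<bar>\<nu>\<bar> * \<bar>v\<bar>" by linarith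
  thus ?thesis by simp
qed

lemma integrable_macdonald:
  assumes "Re y > 0"
  shows "integrable lborel (\<lambda>v. exp (- of_real (exp v) - y * of_real (exp (- v)) - of_real (\<nu> * v)) :: complex)"
proof (rule Bochner_Integration.integrable_bound[OF integrable_exp_cosh])
  show "AE v in lborel. norm (exp (- of_real (exp v) - y * of_real (exp (- v)) - of_real (\<nu> * v)) :: complex) \<le>
      norm (exp (- (2 * min 1 (Re y)) * cosh v + \<bar>\<nu>\<bar> * \<bar>v\<bar>))"
    using norm_macdonald_integrand[of "min 1 (Re y)" y] assms by auto
qed (use assms in auto)

lemma has_field_derivative_macdonald:
  assumes "Re y > 0"
  shows "(macdonald \<nu> has_field_derivative - macdonald (\<nu> + 1) y) (at y)"
proof -
  let ?f = "\<lambda>y v. exp (- of_real (exp v) - y * of_real (exp (- v)) - of_real (\<nu> * v)) :: complex"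
  have "((\<lambda>y. \<integral>v. ?f y v \<partial>lborel) has_field_derivative (\<integral>v. deriv (\<lambda>y. ?f y v) y \<partial>lborel)) (at y)"
  proof (rule has_field_derivative_integral_dominated[where S = "{y. Re y > 0}"])
    show "open {y. Re y > 0}" by (rule open_halfspace_Re_gt)
    fix z :: complex assume z: "z \<in> {y. Re y > 0}"
    define c where "c = min 1 (Re z / 2)"
    have "norm (?f w v) \<le> exp (- (2 * c) * cosh v + \<bar>\<nu>\<bar> * \<bar>v\<bar>)" if "dist z w < Re z / 2" for w v
    proof (rule norm_macdonald_integrand)
      have "Re (z - w) \<le> norm (z - w)" by (rule complex_Re_le_cmod)
      thus "c \<le> Re w" using that by (simp add: dist_norm c_def)
    qed (use z in \<open>auto simp: c_def\<close>)
    moreover have "integrable lborel (\<lambda>v. exp (- (2 * c) * cosh v + \<bar>\<nu>\<bar> * \<bar>v\<bar>))"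
      using z by (intro integrable_exp_cosh) (auto simp: c_def)
    ultimately show "\<exists>r>0. \<exists>g. integrable lborel g \<and> (\<forall>w\<in>{y. Re y > 0}. dist z w < r \<longrightarrow> (\<forall>v\<in>space lborel. norm (?f w v) \<le> g v))"
      using z by (intro exI[of _ "Re z / 2"] conjI exI[of _ "\<lambda>v. exp (- (2 * c) * cosh v + \<bar>\<nu>\<bar> * \<bar>v\<bar>)"]) auto
  qed (use assms in \<open>auto intro!: holomorphic_intros\<close>)
  moreover have "deriv (\<lambda>y. ?f y v) y = - exp (- of_real (exp v) - y * of_real (exp (- v)) - of_real ((\<nu> + 1) * v))" for v
  proof (rule DERIV_imp_deriv)
    have "((\<lambda>y. ?f y v) has_field_derivative ?f y v * (- of_real (exp (- v)))) (at y)"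
      by (auto intro!: derivative_eq_intros)
    also have "?f y v * (- of_real (exp (- v))) = - (?f y v * exp (of_real (- v)))" by (simp only: exp_of_real) simp
    also have "?f y v * exp (of_real (- v)) = exp (- of_real (exp v) - y * of_real (exp (- v)) - of_real ((\<nu> + 1) * v))"
      by (simp only: exp_add [symmetric], rule arg_cong[of _ _ exp]) (simp add: algebra_simps)
    finally show "((\<lambda>y. ?f y v) has_field_derivative - exp (- of_real (exp v) - y * of_real (exp (- v)) - of_real ((\<nu> + 1) * v))) (at y)" .
  qed
  ultimately show ?thesis unfolding macdonald_def by simp
qed

text \<open>
The integral over the line of the derivative of the integrand vanishes.
\<close>

lemma macdonald_recurrence:
  assumes "Re y > 0"
  shows "macdonald (\<nu> - 1) y = y * macdonald (\<nu> + 1) y - of_real \<nu> * macdonald \<nu> y"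
proof -
  let ?F = "\<lambda>\<nu> v. exp (- of_real (exp v) - y * of_real (exp (- v)) - of_real (\<nu> * v)) :: complex"
  have sh: "?F \<nu> v * of_real (exp v) = ?F (\<nu> - 1) v" "?F \<nu> v * of_real (exp (- v)) = ?F (\<nu> + 1) v" for v
    by (subst exp_of_real [of v, symmetric] exp_of_real [of "- v", symmetric], simp only: exp_add [symmetric],
        rule arg_cong[of _ _ exp], simp add: algebra_simps)+
  define f where "f = (\<lambda>v. - ?F (\<nu> - 1) v + y * ?F (\<nu> + 1) v - of_real \<nu> * ?F \<nu> v)"
  have int: "integrable lborel (?F \<mu>)" for \<mu> by (rule integrable_macdonald[OF assms])
  have lim: "((\<lambda>v. exp (- exp v - c * exp (- v) - \<nu> * v)) \<longlongrightarrow> 0) at_top" "((\<lambda>v. exp (- exp v - c * exp (- v) - \<nu> * v)) \<longlongrightarrow> 0) at_bot"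
    if "c > 0" for c :: real using that by real_asymp+
  have lim': "(?F \<nu> \<longlongrightarrow> 0) at_top" "(?F \<nu> \<longlongrightarrow> 0) at_bot"
    using lim[OF assms] by (subst tendsto_norm_zero_iff [symmetric]; simp)+
  have "(LBINT v=-\<infinity>..\<infinity>. f v) = 0 - 0"
  proof (rule interval_integral_FTC_integrable[where F = "?F \<nu>"])
    fix v :: real
    have "((\<lambda>v. ?F \<nu> v) has_vector_derivative ?F \<nu> v * (- of_real (exp v) + y * of_real (exp (- v)) - of_real \<nu>)) (at v)"
    proof -
      have "((\<lambda>u. exp (- exp u - y * exp (- u) - of_real \<nu> * u)) has_field_derivative
          exp (- exp (of_real v) - y * exp (- of_real v) - of_real \<nu> * of_real v) *
            (- exp (of_real v) + y * exp (- of_real v) - of_real \<nu>)) (at (complex_of_real v))"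
        by (auto intro!: derivative_eq_intros)
      from has_vector_derivative_real_field[OF this]
      show ?thesis by (simp only: exp_of_real of_real_minus [symmetric] of_real_mult)
    qed
    moreover have "?F \<nu> v * (- of_real (exp v) + y * of_real (exp (- v)) - of_real \<nu>) = f v"
      unfolding f_def sh [symmetric] by (simp add: algebra_simps)
    ultimately show "(?F \<nu> has_vector_derivative f v) (at v)" by simp
    show "isCont f v" unfolding f_def by (intro continuous_intros)
  next
    show "set_integrable lborel (einterval (- \<infinity>) \<infinity>) f"
      unfolding f_def set_integrable_def einterval_eq_UNIV indicator_UNIV scaleR_one
      by (intro Bochner_Integration.integrable_diff Bochner_Integration.integrable_add Bochner_Integration.integrable_minus integrable_mult_right int)
    show "((?F \<nu> \<circ> real_of_ereal) \<longlongrightarrow> 0) (at_right (- \<infinity>))" "((?F \<nu> \<circ> real_of_ereal) \<longlongrightarrow> 0) (at_left \<infinity>)"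
      using lim' unfolding ereal_tendsto_simps by simp_all
  qed auto
  hence "(\<integral>v. f v \<partial>lborel) = 0"
    by (simp add: interval_lebesgue_integral_def set_lebesgue_integral_def)
  moreover have hb: "has_bochner_integral lborel (?F \<mu>) (macdonald \<mu> y)" for \<mu>
    using int unfolding has_bochner_integral_iff macdonald_def by blast
  have "has_bochner_integral lborel f (- macdonald (\<nu> - 1) y + y * macdonald (\<nu> + 1) y - of_real \<nu> * macdonald \<nu> y)"
    unfolding f_def by (intro has_bochner_integral_diff has_bochner_integral_add has_bochner_integral_minus has_bochner_integral_mult_right hb)
  hence "(\<integral>v. f v \<partial>lborel) = - macdonald (\<nu> - 1) y + y * macdonald (\<nu> + 1) y - of_real \<nu> * macdonald \<nu> y"
    by (rule has_bochner_integral_integral_eq)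
  ultimately show ?thesis by (simp add: algebra_simps)
qed

lemma has_real_derivative_of_complex:
  assumes "(f has_field_derivative d) (at (complex_of_real y))"
  shows "((\<lambda>x. Re (f (of_real x))) has_real_derivative Re d) (at y)"
proof -
  have "((\<lambda>x. f (of_real x)) has_vector_derivative d) (at y)"
    by (rule has_vector_derivative_real_field[OF assms])
  hence "((\<lambda>x. Re (f (of_real x))) has_vector_derivative Re d) (at y)"
    by (rule bounded_linear.has_vector_derivative[OF bounded_linear_Re])
  thus ?thesis by (simp add: has_real_derivative_iff_has_vector_derivative)
qed

lemma has_real_derivative_macdonald_real:
  assumes "y > 0"
  shows "(macdonald_real \<nu> has_real_derivative - macdonald_real (\<nu> + 1) y) (at y)"
  using has_real_derivative_of_complex[OF has_field_derivative_macdonald[of "of_real y" \<nu>]] assms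
  by (simp add: macdonald_of_real)

lemma macdonald_real_uminus:
  assumes "y > 0"
  shows "macdonald_real (- \<nu>) y = y powr \<nu> * macdonald_real \<nu> y"
proof -
  have "macdonald_real (- \<nu>) y = \<bar>-1\<bar> *\<^sub>R (\<integral>v. exp (- exp (ln y + (-1) * v) - y * exp (- (ln y + (-1) * v)) - (- \<nu>) * (ln y + (-1) * v)) \<partial>lborel)"
    unfolding macdonald_real_def by (rule lborel_integral_real_affine) simp
  also have "\<dots> = (\<integral>v. y powr \<nu> * exp (- exp v - y * exp (- v) - \<nu> * v) \<partial>lborel)"
  proof -
    have "exp (- exp (ln y + (-1) * v) - y * exp (- (ln y + (-1) * v)) - (- \<nu>) * (ln y + (-1) * v)) =
        y powr \<nu> * exp (- exp v - y * exp (- v) - \<nu> * v)" for v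
    proof -
      have "exp (ln y + (-1) * v) = y * exp (- v)" using assms by (simp add: exp_diff exp_minus divide_inverse)
      moreover have "y * exp (- (ln y + (-1) * v)) = exp v" using assms by (simp add: exp_add exp_diff exp_minus)
      ultimately show ?thesis using assms
        by (simp add: powr_def exp_add [symmetric] algebra_simps)
    qed
    thus ?thesis by simp
  qed
  finally show ?thesis by (simp add: macdonald_real_def)
qed

lemma bessel_K_integral_of_real:
  assumes "x > 0"
  shows "bessel_K_integral (of_real \<nu>) (of_real x) = of_real ((x / 2) powr \<nu> * macdonald_real \<nu> (x\<^sup>2 / 4) / 2)"
proof -
  have "macdonald_real \<nu> (x\<^sup>2 / 4) = \<bar>1\<bar> *\<^sub>R (\<integral>v. exp (- exp (ln (x / 2) + 1 * v) - (x\<^sup>2 / 4) * exp (- (ln (x / 2) + 1 * v)) - \<nu> * (ln (x / 2) + 1 * v)) \<partial>lborel)"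
    unfolding macdonald_real_def by (rule lborel_integral_real_affine) simp
  also have "\<dots> = (\<integral>v. (x / 2) powr (- \<nu>) * exp (- x * cosh v - \<nu> * v) \<partial>lborel)"
  proof -
    have "exp (- exp (ln (x / 2) + 1 * v) - (x\<^sup>2 / 4) * exp (- (ln (x / 2) + 1 * v)) - \<nu> * (ln (x / 2) + 1 * v)) =
        (x / 2) powr (- \<nu>) * exp (- x * cosh v - \<nu> * v)" for v
    proof -
      have "exp (ln (x / 2) + 1 * v) = x / 2 * exp v" using assms by (simp add: exp_add)
      moreover have "(x\<^sup>2 / 4) * exp (- (ln (x / 2) + 1 * v)) = x / 2 * exp (- v)"
        using assms by (simp add: exp_add exp_diff exp_minus power2_eq_square field_simps)
      moreover have "x * cosh v = x / 2 * exp v + x / 2 * exp (- v)" by (simp add: cosh_def algebra_simps)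
      moreover have "(x / 2) powr (- \<nu>) = exp (- \<nu> * ln (x / 2))" using assms by (simp add: powr_def)
      ultimately show ?thesis
        by (simp only: exp_add [symmetric]) (simp add: algebra_simps)
    qed
    thus ?thesis by simp
  qed
  finally have "(x / 2) powr \<nu> * macdonald_real \<nu> (x\<^sup>2 / 4) = (\<integral>v. exp (- x * cosh v - \<nu> * v) \<partial>lborel)"
    using assms by (simp add: powr_minus)
  moreover have "bessel_K_integral (of_real \<nu>) (of_real x) = (\<integral>v. complex_of_real (exp (- x * cosh v - \<nu> * v)) \<partial>lborel) / 2"
    unfolding bessel_K_integral_def by (simp add: exp_of_real [symmetric])
  ultimately show ?thesis by (simp only: integral_complex_of_real) simp
qed

section \<open>Agreement of the integral with the definition of K\<close>

lemma tendsto_macdonald_real_0: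
  assumes "\<mu> > 0"
  shows "(macdonald_real (- \<mu>) \<longlongrightarrow> Gamma \<mu>) (at_right 0)"
  unfolding tendsto_at_iff_sequentially comp_def
proof (intro allI impI)
  fix X :: "nat \<Rightarrow> real" assume X: "\<forall>i. X i \<in> {0<..} - {0}" "X \<longlonglongrightarrow> 0"
  have G: "has_bochner_integral lborel (\<lambda>v. exp (\<mu> * v - 1 * exp v)) (Gamma \<mu> * 1 powr (- \<mu>))"
    using assms by (intro has_bochner_integral_Gamma_log) auto
  have "(\<lambda>i. \<integral>v. exp (- exp v - X i * exp (- v) - (- \<mu>) * v) \<partial>lborel) \<longlonglongrightarrow> (\<integral>v. exp (\<mu> * v - 1 * exp v) \<partial>lborel)"
  proof (rule integral_dominated_convergence[where w = "\<lambda>v. exp (\<mu> * v - 1 * exp v)"])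
    show "AE v in lborel. (\<lambda>i. exp (- exp v - X i * exp (- v) - (- \<mu>) * v)) \<longlonglongrightarrow> exp (\<mu> * v - 1 * exp v)"
    proof (rule AE_I2)
      fix v :: real
      have "(\<lambda>i. exp (- exp v - X i * exp (- v) - (- \<mu>) * v)) \<longlonglongrightarrow> exp (- exp v - 0 * exp (- v) - (- \<mu>) * v)"
        by (intro tendsto_intros X)
      thus "(\<lambda>i. exp (- exp v - X i * exp (- v) - (- \<mu>) * v)) \<longlonglongrightarrow> exp (\<mu> * v - 1 * exp v)" by (simp add: algebra_simps)
    qed
    show "AE v in lborel. norm (exp (- exp v - X i * exp (- v) - (- \<mu>) * v)) \<le> exp (\<mu> * v - 1 * exp v)" for i
      using X(1) by (intro AE_I2) (auto intro!: mult_nonneg_nonneg less_imp_le)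
  qed (use G in \<open>auto simp: has_bochner_integral_iff\<close>)
  thus "(\<lambda>i. macdonald_real (- \<mu>) (X i)) \<longlonglongrightarrow> Gamma \<mu>"
    using G by (simp add: macdonald_real_def has_bochner_integral_iff)
qed

text \<open>
Uniqueness for the first order system satisfied by \<open>K\<close> and by the series in \<open>I\<close>. The coefficients blow up at \<open>0\<close> but are
integrable there; on a short interval, integrating both equations bounds the maximum of \<open>\<bar>Y\<bar>\<close> by a fraction of itself.
\<close>

lemma singular_system_unique:
  fixes X Y :: "real \<Rightarrow> real"
  assumes \<nu>: "0 < \<nu>" "\<nu> < 1"
    and X: "\<And>y. y > 0 \<Longrightarrow> (X has_real_derivative - (y powr (- \<nu>)) * Y y) (at y)"
    and Y: "\<And>y. y > 0 \<Longrightarrow> (Y has_real_derivative - (y powr (\<nu> - 1)) * X y) (at y)"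
    and X0: "(X \<longlongrightarrow> 0) (at_right 0)" and Y0: "(Y \<longlongrightarrow> 0) (at_right 0)"
    and y: "0 < y" "y \<le> \<nu> * (1 - \<nu>) / 2"
  shows "Y y = 0"
proof -
  define \<epsilon> where "\<epsilon> = \<nu> * (1 - \<nu>) / 2"
  have \<epsilon>: "\<epsilon> > 0" using \<nu> by (simp add: \<epsilon>_def)
  define X' where "X' = (\<lambda>y. if y = 0 then 0 else X y)"
  define Y' where "Y' = (\<lambda>y. if y = 0 then 0 else Y y)"
  have cont: "continuous_on {0..\<epsilon>} (\<lambda>y. if y = 0 then 0 else Z y)"
    if "\<And>y. y > 0 \<Longrightarrow> \<exists>d. (Z has_real_derivative d) (at y)" "(Z \<longlongrightarrow> 0) (at_right 0)" for Z :: "real \<Rightarrow> real"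
    unfolding continuous_on_def
  proof
    fix y assume y: "y \<in> {0..\<epsilon>}"
    show "((\<lambda>y. if y = 0 then 0 else Z y) \<longlongrightarrow> (if y = 0 then 0 else Z y)) (at y within {0..\<epsilon>})"
    proof (cases "y = 0")
      case True
      have "((\<lambda>y. if y = 0 then 0 else Z y) \<longlongrightarrow> 0) (at_right 0)"
        using that(2) by (rule Lim_transform_eventually) (auto simp: eventually_at_filter)
      thus ?thesis using True \<epsilon> by (simp add: at_within_Icc_at_right)
    next
      case False
      hence "isCont Z y" using that(1)[of y] y DERIV_isCont by fastforce
      hence "(Z \<longlongrightarrow> Z y) (at y within {0..\<epsilon>})"
        using continuous_within_subset isCont_def continuous_within by blast
      moreover have "eventually (\<lambda>y. Z y = (if y = 0 then 0 else Z y)) (at y within {0..\<epsilon>})"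
        using eventually_neq_at_within[of 0 y] by eventually_elim auto
      ultimately show ?thesis using False by (simp add: Lim_transform_eventually)
    qed
  qed
  have cX: "continuous_on {0..\<epsilon>} X'" unfolding X'_def by (rule cont) (use X X0 in blast)+
  have cY: "continuous_on {0..\<epsilon>} Y'" unfolding Y'_def by (rule cont) (use Y Y0 in blast)+
  have bound: "\<bar>A u\<bar> \<le> K * u powr (1 - p) / (1 - p)"
    if A: "continuous_on {0..\<epsilon>} A" "A 0 = 0" and p: "p < 1" and u: "u \<in> {0..\<epsilon>}" and K: "\<And>y. y \<in> {0..\<epsilon>} \<Longrightarrow> \<bar>B y\<bar> \<le> K"
      and der: "\<And>y. y > 0 \<Longrightarrow> (A has_real_derivative - (y powr (- p)) * B y) (at y)" for A B :: "real \<Rightarrow> real" and p K u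
  proof -
    have main: "\<sigma> * A u \<le> K * u powr (1 - p) / (1 - p)" if \<sigma>: "\<sigma> = 1 \<or> \<sigma> = -1" for \<sigma>
    proof -
      have "K * 0 powr (1 - p) / (1 - p) - \<sigma> * A 0 \<le> K * u powr (1 - p) / (1 - p) - \<sigma> * A u"
      proof (rule DERIV_nonneg_imp_increasing_open[of 0 u])
        fix x assume x: "0 < x" "x < u"
        have "((\<lambda>u. K * u powr (1 - p) / (1 - p) - \<sigma> * A u) has_real_derivative
                (K * ((1 - p) * x powr (1 - p - 1)) / (1 - p) - \<sigma> * (- (x powr (- p)) * B x))) (at x)"
          using x by (auto intro!: derivative_eq_intros der)
        moreover have "K * ((1 - p) * x powr (1 - p - 1)) / (1 - p) - \<sigma> * (- (x powr (- p)) * B x) = x powr (- p) * (K + \<sigma> * B x)"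
          using p by (simp add: field_simps)
        moreover have "K + \<sigma> * B x \<ge> 0" using K[of x] x u \<sigma> by (auto simp: abs_le_iff)
        ultimately show "\<exists>d. ((\<lambda>u. K * u powr (1 - p) / (1 - p) - \<sigma> * A u) has_real_derivative d) (at x) \<and> d \<ge> 0"
          by (metis mult_nonneg_nonneg powr_ge_zero)
      next
        show "continuous_on {0..u} (\<lambda>u. K * u powr (1 - p) / (1 - p) - \<sigma> * A u)"
          by (intro continuous_intros continuous_on_powr' continuous_on_subset[OF A(1)]) (use p u in auto)
      qed (use u in auto)
      thus ?thesis using A(2) p by simp
    qed
    show ?thesis using main[of 1] main[of "-1"] by (simp add: abs_le_iff)
  qed
  have dX: "(X' has_real_derivative - (y powr (- \<nu>)) * Y' y) (at y)" if "y > 0" for y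
  proof -
    have "(X' has_real_derivative - (y powr (- \<nu>)) * Y y) (at y)"
      by (rule DERIV_cong_ev[THEN iffD1, rotated 3, OF X[OF that] refl _ refl])
         (use that in \<open>auto simp: X'_def eventually_nhds_metric dist_real_def intro!: exI[of _ y]\<close>)
    thus ?thesis using that by (simp add: Y'_def)
  qed
  have dY: "(Y' has_real_derivative - (y powr (- (1 - \<nu>))) * X' y) (at y)" if "y > 0" for y
  proof -
    have "(Y' has_real_derivative - (y powr (\<nu> - 1)) * X y) (at y)"
      by (rule DERIV_cong_ev[THEN iffD1, rotated 3, OF Y[OF that] refl _ refl])
         (use that in \<open>auto simp: Y'_def eventually_nhds_metric dist_real_def intro!: exI[of _ y]\<close>)
    thus ?thesis using that by (simp add: X'_def)
  qed
  obtain a where a: "a \<in> {0..\<epsilon>}" "\<And>y. y \<in> {0..\<epsilon>} \<Longrightarrow> \<bar>X' y\<bar> \<le> \<bar>X' a\<bar>"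
  proof -
    have "\<exists>a\<in>{0..\<epsilon>}. \<forall>y\<in>{0..\<epsilon>}. \<bar>X' y\<bar> \<le> \<bar>X' a\<bar>"
      by (rule continuous_attains_sup) (use \<epsilon> cX in \<open>auto intro!: continuous_on_rabs\<close>)
    thus ?thesis using that by blast
  qed
  obtain b where b: "b \<in> {0..\<epsilon>}" "\<And>y. y \<in> {0..\<epsilon>} \<Longrightarrow> \<bar>Y' y\<bar> \<le> \<bar>Y' b\<bar>"
  proof -
    have "\<exists>a\<in>{0..\<epsilon>}. \<forall>y\<in>{0..\<epsilon>}. \<bar>Y' y\<bar> \<le> \<bar>Y' a\<bar>"
      by (rule continuous_attains_sup) (use \<epsilon> cY in \<open>auto intro!: continuous_on_rabs\<close>)
    thus ?thesis using that by blast
  qed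
  define M N where "M = \<bar>X' a\<bar>" and "N = \<bar>Y' b\<bar>"
  have "M \<le> N * a powr (1 - \<nu>) / (1 - \<nu>)"
    unfolding M_def N_def by (rule bound[OF cX _ \<nu>(2) a(1) b(2) dX]) (auto simp: X'_def)
  also have "\<dots> \<le> N * \<epsilon> powr (1 - \<nu>) / (1 - \<nu>)"
    using a(1) \<nu> by (intro divide_right_mono mult_left_mono powr_mono2) (auto simp: N_def)
  finally have 1: "M \<le> N * \<epsilon> powr (1 - \<nu>) / (1 - \<nu>)" .
  have "N \<le> M * b powr (1 - (1 - \<nu>)) / (1 - (1 - \<nu>))"
    unfolding M_def N_def by (rule bound[OF cY _ _ b(1) a(2) dY]) (use \<nu> in \<open>auto simp: Y'_def\<close>)
  also have "\<dots> \<le> M * \<epsilon> powr \<nu> / \<nu>"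
    using b(1) \<nu> by (auto intro!: divide_right_mono mult_left_mono powr_mono2 simp: M_def)
  finally have 2: "N \<le> M * \<epsilon> powr \<nu> / \<nu>" .
  have "N \<le> N * \<epsilon> powr (1 - \<nu>) / (1 - \<nu>) * \<epsilon> powr \<nu> / \<nu>"
    by (rule order.trans[OF 2]) (use 1 \<nu> in \<open>intro divide_right_mono mult_right_mono; simp\<close>)
  also have "\<dots> = N * (\<epsilon> powr (1 - \<nu>) * \<epsilon> powr \<nu>) / (\<nu> * (1 - \<nu>))" by (simp add: field_simps)
  also have "\<epsilon> powr (1 - \<nu>) * \<epsilon> powr \<nu> = \<epsilon>" using \<epsilon> by (simp add: powr_add [symmetric])
  also have "N * \<epsilon> / (\<nu> * (1 - \<nu>)) = N / 2" using \<nu> by (simp add: \<epsilon>_def)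
  finally have "N = 0" by (simp add: N_def)
  thus ?thesis using b(2)[of y] y by (auto simp: N_def \<epsilon>_def Y'_def)
qed

definition bessel_series_real :: "real \<Rightarrow> real \<Rightarrow> real" where
  "bessel_series_real \<nu> y = Re (bessel_series (of_real \<nu>) (of_real y))"

lemma bessel_series_of_real: "bessel_series (of_real \<nu>) (of_real y) = of_real (bessel_series_real \<nu> y)"
proof -
  have t: "rGamma (of_real \<nu> + of_nat m + 1) * of_real y ^ m / fact m = complex_of_real (rGamma (\<nu> + of_nat m + 1) * y ^ m / fact m)" for m
    using rGamma_complex_of_real[of "\<nu> + of_nat m + 1"] by simp
  have "summable (\<lambda>m. complex_of_real (rGamma (\<nu> + of_nat m + 1) * y ^ m / fact m))"
    using summable_norm_cancel[OF summable_bessel_series[of "of_real \<nu>" "of_real y"]] unfolding t .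
  hence "bessel_series (of_real \<nu>) (of_real y) = of_real (\<Sum>m. rGamma (\<nu> + of_nat m + 1) * y ^ m / fact m)"
    unfolding bessel_series_def t by (intro suminf_of_real [symmetric]) (simp only: summable_of_real_iff)
  thus ?thesis by (simp add: bessel_series_real_def)
qed

lemma has_real_derivative_bessel_series_real:
  "(bessel_series_real \<nu> has_real_derivative bessel_series_real (\<nu> + 1) y) (at y)"
  unfolding bessel_series_real_def
  using has_real_derivative_of_complex[OF has_field_derivative_bessel_series[of "of_real \<nu>" "of_real y"]] by simp

lemma bessel_series_real_recurrence:
  "bessel_series_real (\<nu> - 1) y = \<nu> * bessel_series_real \<nu> y + y * bessel_series_real (\<nu> + 1) y"
proof -
  have "complex_of_real (bessel_series_real (\<nu> - 1) y) = of_real (\<nu> * bessel_series_real \<nu> y + y * bessel_series_real (\<nu> + 1) y)"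
    using bessel_series_recurrence[of "of_real (\<nu> - 1)" "of_real y"]
    by (simp add: bessel_series_of_real [symmetric] add_ac)
  thus ?thesis by (simp only: of_real_eq_iff)
qed

text \<open>
Both sides, paired with their companions of order \<open>1 - \<nu>\<close>, solve the same singular system and have the same limits at \<open>0\<close> by the
reflection formula \<open>\<Gamma>(\<nu>) \<Gamma>(1 - \<nu>) = \<pi> / sin (\<pi> \<nu>)\<close>.
\<close>

lemma macdonald_real_bessel_series:
  assumes \<nu>: "0 < \<nu>" "\<nu> < 1" and y: "0 < y" "y \<le> \<nu> * (1 - \<nu>) / 2"
  shows "macdonald_real (- \<nu>) y = pi / sin (pi * \<nu>) * (bessel_series_real (- \<nu>) y - y powr \<nu> * bessel_series_real \<nu> y)"
proof -
  define c where "c = pi / sin (pi * \<nu>)"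
  have s: "sin (pi * \<nu>) > 0" using \<nu> by (intro sin_gt_zero) auto
  define X where "X = (\<lambda>y. macdonald_real (\<nu> - 1) y - c * (bessel_series_real (\<nu> - 1) y - y powr (1 - \<nu>) * bessel_series_real (1 - \<nu>) y))"
  define Y where "Y = (\<lambda>y. macdonald_real (- \<nu>) y - c * (bessel_series_real (- \<nu>) y - y powr \<nu> * bessel_series_real \<nu> y))"
  have refl: "Gamma \<nu> * Gamma (1 - \<nu>) = c"
  proof -
    have "complex_of_real (Gamma \<nu> * Gamma (1 - \<nu>)) = Gamma (of_real \<nu>) * Gamma (1 - of_real \<nu>)"
      using Gamma_complex_of_real[of \<nu>] Gamma_complex_of_real[of "1 - \<nu>"] by simp
    also have "\<dots> = of_real c" unfolding Gamma_reflection_complex by (simp add: c_def sin_of_real [symmetric])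
    finally show ?thesis by (simp only: of_real_eq_iff)
  qed
  have G: "Gamma \<nu> > 0" "Gamma (1 - \<nu>) > 0" using \<nu> by (auto intro!: Gamma_real_pos)
  have b0: "bessel_series_real \<mu> 0 = rGamma (\<mu> + 1)" for \<mu>
    using bessel_series_0[of "of_real \<mu>"] rGamma_complex_of_real[of "\<mu> + 1"] by (simp add: bessel_series_real_def)
  have blim: "(bessel_series_real \<mu> \<longlongrightarrow> rGamma (\<mu> + 1)) (at_right 0)" for \<mu>
    using DERIV_isCont[OF has_real_derivative_bessel_series_real[of \<mu> 0]] unfolding isCont_def b0 by (rule filterlim_at_split[THEN iffD1, THEN conjunct2])
  have plim: "((\<lambda>y. y powr p) \<longlongrightarrow> 0) (at_right (0::real))" if "p > 0" for p using that by real_asymp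
  have "Y y = 0"
  proof (rule singular_system_unique[OF \<nu> _ _ _ _ y])
    fix y :: real assume y: "y > 0"
    have "(X has_real_derivative (- macdonald_real (\<nu> - 1 + 1) y - c * (bessel_series_real (\<nu> - 1 + 1) y -
        ((1 - \<nu>) * y powr (1 - \<nu> - 1) * bessel_series_real (1 - \<nu>) y + bessel_series_real (1 - \<nu> + 1) y * y powr (1 - \<nu>))))) (at y)"
      unfolding X_def using y
      by (intro DERIV_diff DERIV_cmult DERIV_mult has_real_derivative_macdonald_real has_real_derivative_bessel_series_real has_real_derivative_powr)
    moreover have "- macdonald_real (\<nu> - 1 + 1) y - c * (bessel_series_real (\<nu> - 1 + 1) y -
        ((1 - \<nu>) * y powr (1 - \<nu> - 1) * bessel_series_real (1 - \<nu>) y + bessel_series_real (1 - \<nu> + 1) y * y powr (1 - \<nu>))) =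
        - (y powr (- \<nu>)) * Y y"
    proof -
      have e1: "y powr (1 - \<nu>) = y powr (- \<nu>) * y" using y by (simp add: powr_diff powr_minus field_simps)
      have e2: "bessel_series_real (- \<nu>) y = (1 - \<nu>) * bessel_series_real (1 - \<nu>) y + y * bessel_series_real (1 - \<nu> + 1) y"
        using bessel_series_real_recurrence[of "1 - \<nu>" y] by simp
      have e3: "y powr (- \<nu>) * y powr \<nu> = 1" using y by (simp add: powr_minus)
      have e4: "\<nu> - 1 + 1 = \<nu>" "1 - \<nu> - 1 = - \<nu>" by simp_all
      show ?thesis unfolding Y_def macdonald_real_uminus[OF y] e1 e2 e4 using e3 by algebra
    qed
    ultimately show "(X has_real_derivative - (y powr (- \<nu>)) * Y y) (at y)" by simp
    have "(Y has_real_derivative (- macdonald_real (- \<nu> + 1) y - c * (bessel_series_real (- \<nu> + 1) y -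
        (\<nu> * y powr (\<nu> - 1) * bessel_series_real \<nu> y + bessel_series_real (\<nu> + 1) y * y powr \<nu>)))) (at y)"
      unfolding Y_def using y
      by (intro DERIV_diff DERIV_cmult DERIV_mult has_real_derivative_macdonald_real has_real_derivative_bessel_series_real has_real_derivative_powr)
    moreover have "- macdonald_real (- \<nu> + 1) y - c * (bessel_series_real (- \<nu> + 1) y -
        (\<nu> * y powr (\<nu> - 1) * bessel_series_real \<nu> y + bessel_series_real (\<nu> + 1) y * y powr \<nu>)) =
        - (y powr (\<nu> - 1)) * X y"
    proof -
      have e1: "y powr \<nu> = y powr (\<nu> - 1) * y" using y by (simp add: powr_diff)
      have e2: "bessel_series_real (\<nu> - 1) y = \<nu> * bessel_series_real \<nu> y + y * bessel_series_real (\<nu> + 1) y"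
        by (rule bessel_series_real_recurrence)
      have e3: "y powr (\<nu> - 1) * y powr (1 - \<nu>) = 1" using y by (simp add: powr_add [symmetric])
      have e4: "macdonald_real (- \<nu> + 1) y = y powr (\<nu> - 1) * macdonald_real (\<nu> - 1) y"
        using macdonald_real_uminus[OF y, of "\<nu> - 1"] by simp
      have e5: "- \<nu> + 1 = 1 - \<nu>" by simp
      show ?thesis unfolding X_def e4 unfolding e1 e2 e5 using e3 by algebra
    qed
    ultimately show "(Y has_real_derivative - (y powr (\<nu> - 1)) * X y) (at y)" by simp
  next
    have "(X \<longlongrightarrow> Gamma (1 - \<nu>) - c * (rGamma (\<nu> - 1 + 1) - 0 * rGamma (1 - \<nu> + 1))) (at_right 0)"
      unfolding X_def using tendsto_macdonald_real_0[of "1 - \<nu>"] \<nu>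
      by (intro tendsto_intros blim plim) auto
    moreover have "Gamma (1 - \<nu>) - c * (rGamma (\<nu> - 1 + 1) - 0 * rGamma (1 - \<nu> + 1)) = 0"
      using G by (simp add: rGamma_inverse_Gamma refl [symmetric])
    ultimately show "(X \<longlongrightarrow> 0) (at_right 0)" by simp
    have "(Y \<longlongrightarrow> Gamma \<nu> - c * (rGamma (- \<nu> + 1) - 0 * rGamma (\<nu> + 1))) (at_right 0)"
      unfolding Y_def using tendsto_macdonald_real_0[of "\<nu>"] \<nu>
      by (intro tendsto_intros blim plim) auto
    moreover have "Gamma \<nu> - c * (rGamma (- \<nu> + 1) - 0 * rGamma (\<nu> + 1)) = 0"
      using G by (simp add: rGamma_inverse_Gamma refl [symmetric])
    ultimately show "(Y \<longlongrightarrow> 0) (at_right 0)" by simp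
  qed
  thus ?thesis by (simp add: Y_def c_def)
qed

definition bessel_K_quotient :: "complex \<Rightarrow> complex \<Rightarrow> complex" where
  "bessel_K_quotient \<nu> z = of_real pi / 2 * (bessel_I (- \<nu>) z - bessel_I \<nu> z) / sin (of_real pi * \<nu>)"

lemma bessel_K_quotient_small:
  assumes \<nu>: "0 < \<nu>" "\<nu> < 1" and x: "0 < x" "x\<^sup>2 / 4 \<le> \<nu> * (1 - \<nu>) / 2"
  shows "bessel_K_quotient (of_real \<nu>) (of_real x) = bessel_K_integral (of_real \<nu>) (of_real x)"
proof -
  define y where "y = x\<^sup>2 / 4"
  have y: "y > 0" using x by (simp add: y_def)
  have yp: "y powr \<nu> = (x / 2) powr \<nu> * (x / 2) powr \<nu>"
    using x by (simp add: y_def power2_eq_square powr_mult [symmetric])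
  have s: "sin (pi * \<nu>) > 0" using \<nu> by (intro sin_gt_zero) auto
  have I: "bessel_I (of_real \<mu>) (of_real x) = of_real ((x / 2) powr \<mu> * bessel_series_real \<mu> y)" if "\<mu> \<noteq> 0" for \<mu>
  proof -
    have "(complex_of_real x / 2) powr of_real \<mu> = of_real ((x / 2) powr \<mu>)"
      using x powr_of_real[of "x / 2" \<mu>] by simp
    moreover have "(complex_of_real x)\<^sup>2 / 4 = of_real y" by (simp add: y_def)
    ultimately show ?thesis unfolding bessel_I_eq using that by (simp add: bessel_series_of_real)
  qed
  have xp: "(x / 2) powr (- \<nu>) * (x / 2) powr \<nu> = 1" using x by (simp add: powr_minus)
  have aux: "m * (pi / s * (E' - P * P * E)) / 2 = pi / 2 * (m * E' - P * E) / s" if "m * P = 1" for m P s E E' :: real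
  proof -
    have "m * (E' - P * P * E) = m * E' - P * E" using that by algebra
    moreover have "m * (pi / s * W) / 2 = pi / 2 * (m * W) / s" for W
      by (simp add: mult.commute mult.left_commute)
    ultimately show ?thesis by (simp only:)
  qed
  have "(x / 2) powr \<nu> * macdonald_real \<nu> y / 2 = (x / 2) powr (- \<nu>) * (y powr \<nu> * macdonald_real \<nu> y) / 2"
  proof -
    have "m * (P * P * g) = P * g" if "m * P = 1" for m P g :: real using that by algebra
    from this[OF xp] show ?thesis unfolding yp by simp
  qed
  also have "\<dots> = pi / 2 * ((x / 2) powr (- \<nu>) * bessel_series_real (- \<nu>) y - (x / 2) powr \<nu> * bessel_series_real \<nu> y) / sin (pi * \<nu>)"
    unfolding macdonald_real_uminus[OF y, symmetric] macdonald_real_bessel_series[OF \<nu> y x(2)[folded y_def]]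
    unfolding yp
    by (rule aux[OF xp])
  finally have e: "(x / 2) powr \<nu> * macdonald_real \<nu> y / 2 =
      pi / 2 * ((x / 2) powr (- \<nu>) * bessel_series_real (- \<nu>) y - (x / 2) powr \<nu> * bessel_series_real \<nu> y) / sin (pi * \<nu>)" .
  have "bessel_K_quotient (of_real \<nu>) (of_real x) =
      of_real (pi / 2 * ((x / 2) powr (- \<nu>) * bessel_series_real (- \<nu>) y - (x / 2) powr \<nu> * bessel_series_real \<nu> y) / sin (pi * \<nu>))"
    using I[of \<nu>] I[of "- \<nu>"] \<nu> by (simp add: bessel_K_quotient_def sin_of_real [symmetric])
  thus ?thesis unfolding bessel_K_integral_of_real[OF x(1)] y_def [symmetric] e .
qed

lemma Re_pos_half_notin: "Re z > 0 \<Longrightarrow> z / 2 \<notin> \<real>\<^sub>\<le>\<^sub>0"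
  by (auto simp: complex_nonpos_Reals_iff)

text \<open>
The formula for real \<open>0 < \<nu> < 1\<close> and small \<open>x > 0\<close> is continued in \<open>z\<close>, then in \<open>\<nu>\<close>.
\<close>

lemma bessel_K_quotient_eq:
  assumes "\<nu> \<notin> \<int>" "Re z > 0"
  shows "bessel_K_quotient \<nu> z = bessel_K_integral \<nu> z"
proof -
  have 1: "bessel_K_quotient (of_real \<nu>) z = bessel_K_integral (of_real \<nu>) z" if \<nu>: "0 < \<nu>" "\<nu> < 1" for \<nu>
  proof -
    define d where "d = sqrt (2 * \<nu> * (1 - \<nu>))"
    have d: "d > 0" "d\<^sup>2 = 2 * \<nu> * (1 - \<nu>)" using \<nu> by (auto simp: d_def)
    have nz: "of_real \<nu> \<noteq> (0::complex)" "- of_real \<nu> \<noteq> (0::complex)" using \<nu> by auto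
    show ?thesis
    proof (rule analytic_continuation_eq[where f = "bessel_K_quotient (of_real \<nu>)" and g = "bessel_K_integral (of_real \<nu>)"
          and S = "{z. Re z > 0}" and U = "of_real ` {0<..<d}" and \<xi> = "of_real (d / 2)" and w = z])
      have "z / 2 \<notin> \<real>\<^sub>\<le>\<^sub>0" if "Re z > 0" for z using that by (rule Re_pos_half_notin)
      thus "bessel_K_quotient (of_real \<nu>) holomorphic_on {z. Re z > 0}"
        unfolding bessel_K_quotient_def bessel_I_eq using nz
        by (auto intro!: holomorphic_intros simp del: complex_nonpos_Reals_iff)
      show "complex_of_real (d / 2) islimpt of_real ` {0<..<d}"
        by (rule islimpt_of_real_image) (use d in auto)
      show "bessel_K_quotient (of_real \<nu>) u = bessel_K_integral (of_real \<nu>) u" if u: "u \<in> of_real ` {0<..<d}" for u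
      proof -
        obtain x where x: "u = of_real x" "0 < x" "x < d" using u by auto
        hence "x\<^sup>2 \<le> d\<^sup>2" by (intro power_mono) auto
        thus ?thesis using bessel_K_quotient_small[OF \<nu>, of x] x d by simp
      qed
    qed (use assms d in \<open>auto simp: open_halfspace_Re_gt convex_halfspace_Re_gt intro!: convex_connected holomorphic_bessel_K_integral\<close>)
  qed
  show ?thesis
  proof (rule analytic_continuation_eq[where f = "\<lambda>\<nu>. bessel_K_quotient \<nu> z" and g = "\<lambda>\<nu>. bessel_K_integral \<nu> z"
        and S = "UNIV - \<int>" and U = "of_real ` {0<..<1}" and \<xi> = "of_real (1 / 2)" and w = \<nu>])
    have "sin (of_real pi * \<nu>) \<noteq> 0" if "\<nu> \<notin> \<int>" for \<nu> :: complex
    proof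
      assume "sin (of_real pi * \<nu>) = 0"
      then obtain n :: int where "of_real pi * \<nu> = of_real (n * pi)" by (auto simp: sin_eq_0)
      hence "\<nu> = of_int n" by simp
      thus False using that by simp
    qed
    moreover have "\<nu> \<noteq> 0 \<and> - \<nu> \<noteq> 0" if "\<nu> \<notin> \<int>" for \<nu> :: complex using that by auto
    moreover have "bessel_K_quotient \<nu> z = of_real pi / 2 * ((z / 2) powr (- \<nu>) * bessel_series (- \<nu>) (z\<^sup>2 / 4) -
        (z / 2) powr \<nu> * bessel_series \<nu> (z\<^sup>2 / 4)) / sin (of_real pi * \<nu>)" if "\<nu> \<notin> \<int>" for \<nu> :: complex
      using that by (auto simp: bessel_K_quotient_def bessel_I_eq)
    moreover have "(\<lambda>\<nu>. bessel_series (- \<nu>) y) holomorphic_on A" "(\<lambda>\<nu>. bessel_series \<nu> y) holomorphic_on A" for y A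
    proof -
      have "(\<lambda>\<nu>::complex. - \<nu>) holomorphic_on A" by (intro holomorphic_intros)
      thus "(\<lambda>\<nu>. bessel_series (- \<nu>) y) holomorphic_on A"
        using holomorphic_on_compose_gen[of "\<lambda>\<nu>. - \<nu>" A "\<lambda>\<nu>. bessel_series \<nu> y" UNIV] holomorphic_bessel_series_order[of y]
        by (simp add: o_def)
      show "(\<lambda>\<nu>. bessel_series \<nu> y) holomorphic_on A"
        using holomorphic_bessel_series_order by (rule holomorphic_on_subset) auto
    qed
    ultimately show "(\<lambda>\<nu>. bessel_K_quotient \<nu> z) holomorphic_on UNIV - \<int>"
      using assms(2) by (subst holomorphic_cong[OF refl]) (auto intro!: holomorphic_intros)
    show "connected (UNIV - \<int> :: complex set)"
      by (intro connected_open_diff_countable) (auto simp: Ints_def)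
    show "complex_of_real (1 / 2) islimpt of_real ` {0<..<1}"
      by (rule islimpt_of_real_image) auto
    show "complex_of_real (1 / 2) \<in> UNIV - \<int>"
    proof -
      have "complex_of_real (1 / 2) \<notin> \<int>"
      proof
        assume "complex_of_real (1 / 2) \<in> \<int>"
        then obtain n :: int where "complex_of_real (1 / 2) = of_int n" by (auto elim: Ints_cases)
        hence "1 / 2 = real_of_int n" by (metis of_real_of_int_eq of_real_eq_iff)
        hence "1 = real_of_int (2 * n)" by simp
        hence "1 = 2 * n" by linarith
        thus False by presburger
      qed
      thus ?thesis by simp
    qed
    show "of_real ` {0<..<1} \<subseteq> UNIV - (\<int> :: complex set)"
    proof -
      have "x \<notin> \<int>" if "0 < x" "x < 1" for x :: real
        using that by (auto elim!: Ints_cases)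
      moreover have "x \<in> \<int>" if "complex_of_real x \<in> \<int>" for x
      proof -
        obtain n :: int where "complex_of_real x = of_int n" using \<open>complex_of_real x \<in> \<int>\<close> by (rule Ints_cases)
        hence "x = of_int n" by (metis of_real_of_int_eq of_real_eq_iff)
        thus ?thesis by simp
      qed
      ultimately show ?thesis by fastforce
    qed
    show "bessel_K_quotient u z = bessel_K_integral u z" if "u \<in> of_real ` {0<..<1}" for u
      using that 1 by auto
  qed (use assms in \<open>auto intro: holomorphic_on_subset[OF holomorphic_bessel_K_integral_order]\<close>)
qed

text \<open>
At integers \<open>K\<close> is defined as a limit over the order; the integral is continuous in the order.
\<close>

theorem bessel_K_eq_integral:
  assumes "Re z > 0"
  shows "bessel_K \<nu> z = bessel_K_integral \<nu> z"
proof (cases "\<nu> \<in> \<int>")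
  case False
  thus ?thesis using bessel_K_quotient_eq[OF False assms] by (simp add: bessel_K_def bessel_K_quotient_def)
next
  case True
  have "isCont (\<lambda>\<nu>. bessel_K_integral \<nu> z) \<nu>"
    using holomorphic_on_imp_continuous_on[OF holomorphic_bessel_K_integral_order[OF assms]]
    by (simp add: continuous_on_eq_continuous_at)
  hence "((\<lambda>\<mu>. bessel_K_integral \<mu> z) \<longlongrightarrow> bessel_K_integral \<nu> z) (at \<nu>)" by (simp add: isCont_def)
  moreover have "eventually (\<lambda>\<mu>. bessel_K_integral \<mu> z = bessel_K_quotient \<mu> z) (at \<nu>)"
    unfolding eventually_at
  proof (intro exI[of _ 1] conjI ballI impI)
    fix \<mu> assume \<mu>: "\<mu> \<noteq> \<nu> \<and> dist \<mu> \<nu> < 1"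
    have "\<mu> \<notin> \<int>"
    proof
      assume "\<mu> \<in> \<int>"
      then obtain m n :: int where "\<mu> = of_int m" "\<nu> = of_int n" using True by (auto elim!: Ints_cases)
      hence "norm (of_int (m - n) :: complex) < 1" "m \<noteq> n" using \<mu> by (auto simp: dist_norm)
      thus False by (simp only: norm_of_int)
    qed
    thus "bessel_K_integral \<mu> z = bessel_K_quotient \<mu> z" using bessel_K_quotient_eq assms by simp
  qed auto
  ultimately have "((\<lambda>\<mu>. bessel_K_quotient \<mu> z) \<longlongrightarrow> bessel_K_integral \<nu> z) (at \<nu>)"
    by (rule Lim_transform_eventually)
  hence "Lim (at \<nu>) (\<lambda>\<mu>. bessel_K_quotient \<mu> z) = bessel_K_integral \<nu> z"
    by (intro tendsto_Lim) auto
  thus ?thesis using True by (simp add: bessel_K_def bessel_K_quotient_def)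
qed

section \<open>Spherical means and the Darboux equation\<close>

text \<open>
A holomorphic solution of a singular linear equation of this shape is even, because the indicial factor \<open>n (n + 2 \<nu>)\<close> has no
positive integer root; its coefficients then obey a two-term recursion. All three spherical means below are identified with
power series in this way.
\<close>

lemma even_ode_solution:
  fixes u :: "complex \<Rightarrow> complex" and v :: "nat \<Rightarrow> complex"
  assumes r: "r > 0" and hol: "u holomorphic_on ball 0 r" and \<nu>: "\<nu> > -1/2"
    and ode: "\<And>w. w \<in> ball 0 r \<Longrightarrow> w * deriv (deriv u) w + of_real (2 * \<nu> + 1) * deriv u w =
                 w * (A * w\<^sup>2 * deriv (deriv u) w + B * w * deriv u w + C * u w)"
    and v0: "v 0 = u 0"
    and v: "\<And>l. v (Suc l) * (of_nat (2 * l + 2) * (of_nat (2 * l + 2) + of_real (2 * \<nu>))) =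
              (A * (of_nat (2 * l) * (of_nat (2 * l) - 1)) + B * of_nat (2 * l) + C) * v l"
    and w: "w \<in> ball 0 r"
  shows "(\<lambda>l. v l * w ^ (2 * l)) sums u w"
proof -
  define F where "F = fps_expansion u 0"
  have F: "u has_fps_expansion F" unfolding F_def
    by (rule has_fps_expansion_fps_expansion[of "ball 0 r"]) (use r hol in auto)
  define D where "D = (\<lambda>w. w * deriv (deriv u) w + of_real (2 * \<nu> + 1) * deriv u w -
                 w * (A * w\<^sup>2 * deriv (deriv u) w + B * w * deriv u w + C * u w))"
  define G where "G = fps_X * fps_deriv (fps_deriv F) + fps_const (of_real (2 * \<nu> + 1)) * fps_deriv F -
     fps_X * (fps_const A * fps_X ^ 2 * fps_deriv (fps_deriv F) + fps_const B * fps_X * fps_deriv F + fps_const C * F)"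
  have "D has_fps_expansion G"
    unfolding D_def G_def by (intro fps_expansion_intros F)
  hence "fps_nth G n = (deriv ^^ n) D 0 / fact n" for n by (rule fps_nth_fps_expansion)
  moreover have "(deriv ^^ n) D 0 = (deriv ^^ n) (\<lambda>_. 0) 0" for n
  proof (rule higher_deriv_cong_ev)
    show "eventually (\<lambda>w. D w = 0) (nhds 0)"
      using eventually_nhds_in_open[of "ball 0 r" 0] r ode by (auto simp: D_def elim!: eventually_mono)
  qed auto
  ultimately have G0: "fps_nth G n = 0" for n by simp
  have even: "fps_nth F (Suc (Suc n)) * (of_nat (n + 2) * (of_nat (n + 2) + of_real (2 * \<nu>))) =
          (A * (of_nat n * (of_nat n - 1)) + B * of_nat n + C) * fps_nth F n" for n
  proof -
    have "fps_nth G (Suc n) = of_nat (n + 2) * (of_nat (n + 1) + of_real (2 * \<nu> + 1)) * fps_nth F (Suc (Suc n)) -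
       (A * (of_nat n * (of_nat n - 1)) + B * of_nat n + C) * fps_nth F n"
    proof (cases n)
      case 0
      thus ?thesis unfolding G_def power2_eq_square mult.assoc by (simp; (simp add: algebra_simps)?)
    next
      case (Suc m)
      show ?thesis unfolding Suc
        unfolding G_def power2_eq_square mult.assoc by (cases m; simp; (simp add: algebra_simps)?)
    qed
    thus ?thesis using G0[of "Suc n"] by (simp add: algebra_simps)
  qed
  have "fps_nth G 0 = of_real (2 * \<nu> + 1) * fps_nth F 1"
    by (simp add: G_def)
  moreover have "complex_of_real (2 * \<nu> + 1) \<noteq> 0" using \<nu> unfolding of_real_eq_0_iff by simp
  ultimately have F1: "fps_nth F 1 = 0" using G0[of 0] by simp
  have nz: "of_nat (n + 2) * (of_nat (n + 2) + of_real (2 * \<nu>)) \<noteq> (0 :: complex)" for n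
  proof -
    have "real (n + 2) + 2 * \<nu> \<noteq> 0" using \<nu> by simp
    hence "complex_of_real (real (n + 2) + 2 * \<nu>) \<noteq> 0" unfolding of_real_eq_0_iff .
    thus ?thesis by (simp del: of_nat_add of_nat_Suc)
  qed
  have odd: "fps_nth F (2 * l + 1) = 0" for l
  proof (induction l)
    case (Suc l)
    thus ?case using even[of "2 * l + 1"] nz[of "2 * l + 1"] by simp
  qed (use F1 in simp)
  have ev: "fps_nth F (2 * l) = v l" for l
  proof (induction l)
    case 0
    show ?case using fps_nth_fps_expansion[OF F, of 0] by (simp add: v0)
  next
    case (Suc l)
    have "fps_nth F (2 * Suc l) * (of_nat (2 * l + 2) * (of_nat (2 * l + 2) + of_real (2 * \<nu>))) =
          v (Suc l) * (of_nat (2 * l + 2) * (of_nat (2 * l + 2) + of_real (2 * \<nu>)))"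
      using even[of "2 * l"] v[of l] Suc by simp
    thus ?case by (simp only: mult_right_cancel[OF nz[of "2 * l"]])
  qed
  have "(\<lambda>n. fps_nth F n * w ^ n) sums u w"
    by (rule has_fps_expansion_imp_sums_complex[OF F, of r]) (use hol w in \<open>auto simp: eball_def\<close>)
  moreover have "fps_nth F n * w ^ n = 0" if "n \<notin> range (\<lambda>l. 2 * l)" for n
  proof -
    have "odd n" using that by (auto elim!: evenE)
    then obtain l where "n = 2 * l + 1" by (rule oddE)
    thus ?thesis using odd by simp
  qed
  ultimately have "(\<lambda>l. fps_nth F (2 * l) * w ^ (2 * l)) sums u w"
    by (subst sums_mono_reindex) (auto simp: strict_mono_def)
  thus ?thesis by (simp add: ev)
qed

text \<open>
The distribution of one coordinate on the unit sphere in dimension \<open>2 \<nu> + 2\<close>, up to normalisation.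
\<close>

definition sphere_weight :: "real \<Rightarrow> real \<Rightarrow> real" where
  "sphere_weight \<nu> x = (1 - x\<^sup>2) powr (\<nu> - 1/2)"

definition sphere_integral :: "real \<Rightarrow> (real \<Rightarrow> complex) \<Rightarrow> complex" where
  "sphere_integral \<nu> f = integral {-1..1} (\<lambda>x. of_real (sphere_weight \<nu> x) * f x)"

lemma continuous_on_sphere_weight:
  assumes "\<nu> > 1/2"
  shows "continuous_on {-1..1} (sphere_weight \<nu>)"
  unfolding sphere_weight_def
  by (intro continuous_on_powr' continuous_intros) (use assms in \<open>auto simp: abs_square_le_1\<close>)

lemma sphere_integrable:
  assumes "\<nu> > 1/2" "continuous_on {-1..1} f"
  shows "(\<lambda>x. complex_of_real (sphere_weight \<nu> x) * f x) integrable_on {-1..1}"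
  by (intro integrable_continuous_real continuous_intros continuous_on_sphere_weight assms)

lemma has_field_derivative_sphere_integral:
  assumes \<nu>: "\<nu> > 1/2" and r: "r > 0"
    and der: "\<And>w x. w \<in> ball 0 r \<Longrightarrow> x \<in> {-1..1} \<Longrightarrow> ((\<lambda>w. g w x) has_field_derivative g' w x) (at w)"
    and cont: "continuous_on (ball 0 r \<times> {-1..1}) (\<lambda>(w, x). g w x)" "continuous_on (ball 0 r \<times> {-1..1}) (\<lambda>(w, x). g' w x)"
    and w: "w \<in> ball (0::complex) r"
  shows "((\<lambda>w. sphere_integral \<nu> (g w)) has_field_derivative sphere_integral \<nu> (g' w)) (at w)"
proof -
  have "((\<lambda>w. integral (cbox (-1) 1) (\<lambda>x. of_real (sphere_weight \<nu> x) * g w x)) has_field_derivative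
          integral (cbox (-1) 1) (\<lambda>x. of_real (sphere_weight \<nu> x) * g' w x)) (at w within ball 0 r)"
  proof (rule leibniz_rule_field_derivative)
    fix w :: complex and x assume "w \<in> ball 0 r" "x \<in> cbox (-1) (1::real)"
    thus "((\<lambda>w. of_real (sphere_weight \<nu> x) * g w x) has_field_derivative of_real (sphere_weight \<nu> x) * g' w x) (at w within ball 0 r)"
      by (intro DERIV_cmult has_field_derivative_at_within[OF der]) auto
  next
    fix w :: complex assume "w \<in> ball 0 r"
    hence "continuous_on {-1..1} (\<lambda>x. g w x)"
    proof -
      assume w: "w \<in> ball 0 r"
      have "continuous_on {-1..1} (\<lambda>x::real. (w, x))"
        by (intro continuous_on_Pair continuous_on_const continuous_on_id)
      moreover have "(\<lambda>x::real. (w, x)) ` {-1..1} \<subseteq> ball 0 r \<times> {-1..1}" using w by auto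
      ultimately show ?thesis using continuous_on_compose2[OF cont(1)] by fastforce
    qed
    thus "(\<lambda>x. of_real (sphere_weight \<nu> x) * g w x) integrable_on cbox (-1) 1"
      using sphere_integrable[OF \<nu>] by simp
  next
    have "continuous_on (ball 0 r \<times> {-1..1}) (\<lambda>p. of_real (sphere_weight \<nu> (snd p)) * (case p of (w, x) \<Rightarrow> g' w x))"
      by (intro continuous_intros cont continuous_on_compose2[OF continuous_on_sphere_weight[OF \<nu>]]) auto
    thus "continuous_on (ball 0 r \<times> cbox (-1) 1) (\<lambda>(w, x). of_real (sphere_weight \<nu> x) * g' w x)"
      by (simp add: case_prod_unfold)
  qed (use w in auto)
  thus ?thesis using w by (simp add: sphere_integral_def at_within_open[OF w])
qed

lemma Re_sphere_argument_pos:
  assumes "w \<in> ball (0::complex) (1/4)" "x \<in> {-1..1}"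
  shows "Re (1 + w\<^sup>2 + 2 * w * of_real x) > 0"
proof -
  have n: "norm w < 1/4" using assms by simp
  have "norm (w\<^sup>2 + 2 * w * of_real x) \<le> (norm w)\<^sup>2 + 2 * norm w * \<bar>x\<bar>"
    using norm_triangle_ineq[of "w\<^sup>2" "2 * w * of_real x"] by (simp add: norm_mult norm_power)
  also have "\<dots> \<le> (1/4)\<^sup>2 + 2 * (1/4) * 1"
    using n assms(2) by (intro add_mono mult_mono power_mono) auto
  finally have "norm (w\<^sup>2 + 2 * w * of_real x) < 1" by (simp add: power2_eq_square)
  thus ?thesis using abs_Re_le_cmod[of "w\<^sup>2 + 2 * w * of_real x"] by simp
qed

text \<open>
Darboux's equation: in dimension \<open>2 \<nu> + 2\<close> the radial Laplacian in \<open>w\<close> of the spherical mean of a function is the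
mean of its Laplacian. For a function \<open>f\<close> of the squared length \<open>q\<close> that Laplacian is \<open>4 q f'' + (4 \<nu> + 4) f'\<close>. The
proof integrates by parts in \<open>x\<close>; the boundary terms vanish since the weight is multiplied by \<open>1 - x\<^sup>2\<close>.
\<close>

lemma sphere_integral_Darboux:
  fixes f :: "complex \<Rightarrow> complex"
  assumes \<nu>: "\<nu> > 1/2"
    and f1: "\<And>q. Re q > 0 \<Longrightarrow> (f has_field_derivative f' q) (at q)"
    and f2: "\<And>q. Re q > 0 \<Longrightarrow> (f' has_field_derivative f'' q) (at q)"
    and f3: "continuous_on {q. Re q > 0} f''"
  defines "q \<equiv> \<lambda>w x. 1 + w\<^sup>2 + 2 * w * complex_of_real x"
  defines "u \<equiv> \<lambda>w. sphere_integral \<nu> (\<lambda>x. f (q w x))"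
  assumes w: "w \<in> ball 0 (1/4)"
  shows "u holomorphic_on ball 0 (1/4)"
    and "deriv u w = sphere_integral \<nu> (\<lambda>x. f' (q w x) * (2 * (w + of_real x)))"
    and "w * deriv (deriv u) w + of_real (2 * \<nu> + 1) * deriv u w =
           w * sphere_integral \<nu> (\<lambda>x. 4 * q w x * f'' (q w x) + of_real (4 * \<nu> + 4) * f' (q w x))"
proof -
  have q: "Re (q w x) > 0" if "w \<in> ball 0 (1/4)" "x \<in> {-1..1}" for w x
    unfolding q_def by (rule Re_sphere_argument_pos[OF that])
  have cq: "continuous_on A (\<lambda>p. q (fst p) (snd p))" for A
    unfolding q_def by (intro continuous_intros)
  have cf: "continuous_on {q. Re q > 0} f" "continuous_on {q. Re q > 0} f'"
    using f1 f2 by (auto intro!: DERIV_atLeastAtMost_imp_continuous_on continuous_at_imp_continuous_on DERIV_isCont)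
  have comp: "continuous_on (ball 0 (1/4) \<times> {-1..1}) (\<lambda>p. h (q (fst p) (snd p)))"
    if "continuous_on {q. Re q > 0} h" for h :: "complex \<Rightarrow> complex"
    by (rule continuous_on_compose2[OF that cq]) (use q in auto)
  have dq: "((\<lambda>w. q w x) has_field_derivative 2 * (w + of_real x)) (at w)" for w x
    unfolding q_def by (auto intro!: derivative_eq_intros simp: power2_eq_square algebra_simps)
  define u1 where "u1 = (\<lambda>w. sphere_integral \<nu> (\<lambda>x. f' (q w x) * (2 * (w + of_real x))))"
  define u2 where "u2 = (\<lambda>w. sphere_integral \<nu> (\<lambda>x. f'' (q w x) * (2 * (w + of_real x)) * (2 * (w + of_real x)) + f' (q w x) * 2))"
  have d1: "(u has_field_derivative u1 w) (at w)" if w: "w \<in> ball 0 (1/4)" for w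
    unfolding u_def u1_def
  proof (rule has_field_derivative_sphere_integral[OF \<nu> _ _ _ _ w])
    fix w x assume "w \<in> ball (0::complex) (1/4)" "x \<in> {-1..1::real}"
    thus "((\<lambda>w. f (q w x)) has_field_derivative f' (q w x) * (2 * (w + of_real x))) (at w)"
      by (intro DERIV_chain2[OF f1 dq] q)
  qed (auto simp: case_prod_unfold intro!: continuous_intros comp cf)
  have d2: "(u1 has_field_derivative u2 w) (at w)" if w: "w \<in> ball 0 (1/4)" for w
    unfolding u1_def u2_def
  proof (rule has_field_derivative_sphere_integral[OF \<nu> _ _ _ _ w])
    fix w x assume "w \<in> ball (0::complex) (1/4)" "x \<in> {-1..1::real}"
    thus "((\<lambda>w. f' (q w x) * (2 * (w + of_real x))) has_field_derivative
             f'' (q w x) * (2 * (w + of_real x)) * (2 * (w + of_real x)) + f' (q w x) * 2) (at w)"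
      by (auto intro!: derivative_eq_intros DERIV_chain2[OF f2 dq] q)
  qed (auto simp: case_prod_unfold intro!: continuous_intros comp cf f3)
  show "u holomorphic_on ball 0 (1/4)" unfolding holomorphic_on_open[OF open_ball] using d1 by blast
  have e1: "deriv u w = u1 w" if "w \<in> ball 0 (1/4)" for w using d1[OF that] by (rule DERIV_imp_deriv)
  show "deriv u w = sphere_integral \<nu> (\<lambda>x. f' (q w x) * (2 * (w + of_real x)))"
    using e1[OF w] by (simp add: u1_def)
  have "deriv (deriv u) w = deriv u1 w"
    by (rule deriv_cong_ev) (use eventually_nhds_in_open[of "ball 0 (1/4)" w] w e1 in \<open>auto elim!: eventually_mono\<close>)
  hence e2: "deriv (deriv u) w = u2 w" using d2[OF w] by (simp add: DERIV_imp_deriv)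
  define P where "P = (\<lambda>x. complex_of_real ((1 - x\<^sup>2) powr (\<nu> + 1/2)) * f' (q w x))"
  define p where "p = (\<lambda>x. of_real (sphere_weight \<nu> x) * (of_real (1 - x\<^sup>2) * (f'' (q w x) * (2 * w)) - of_real ((2 * \<nu> + 1) * x) * f' (q w x)))"
  have cx: "continuous_on {-1..1} (\<lambda>x. h (q w x))" if "continuous_on {q. Re q > 0} h" for h :: "complex \<Rightarrow> complex"
    by (rule continuous_on_compose2[OF that]) (use q[OF w] in \<open>auto simp: q_def intro!: continuous_intros\<close>)
  have "(p has_integral (P 1 - P (-1))) {-1..1}"
  proof (rule fundamental_theorem_of_calculus_interior)
    show "continuous_on {-1..1} P" unfolding P_def
      by (intro continuous_intros continuous_on_powr' cx cf) (use \<nu> in \<open>auto simp: abs_square_le_1\<close>)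
    fix x :: real assume x: "x \<in> {-1<..<1}"
    hence "\<bar>x\<bar> < 1" by auto
    hence x2: "1 - x\<^sup>2 > 0" by (simp add: abs_square_less_1)
    have "((\<lambda>x. (1 - x\<^sup>2) powr (\<nu> + 1/2)) has_real_derivative (\<nu> + 1/2) * (1 - x\<^sup>2) powr (\<nu> + 1/2 - 1) * (- (2 * x))) (at x)"
      by (rule DERIV_chain2[where f = "\<lambda>y. y powr (\<nu> + 1/2)" and g = "\<lambda>x. 1 - x\<^sup>2"])
         (use x2 in \<open>auto intro!: derivative_eq_intros has_real_derivative_powr\<close>)
    also have "(\<nu> + 1/2) * (1 - x\<^sup>2) powr (\<nu> + 1/2 - 1) * (- (2 * x)) = - ((2 * \<nu> + 1) * x * sphere_weight \<nu> x)"
      by (simp add: sphere_weight_def algebra_simps)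
    finally have 1: "((\<lambda>x. complex_of_real ((1 - x\<^sup>2) powr (\<nu> + 1/2))) has_vector_derivative of_real (- ((2 * \<nu> + 1) * x * sphere_weight \<nu> x))) (at x)"
      by (intro has_vector_derivative_of_real) (simp add: has_real_derivative_iff_has_vector_derivative)
    have "((\<lambda>z. f' (1 + w\<^sup>2 + 2 * w * z)) has_field_derivative f'' (1 + w\<^sup>2 + 2 * w * of_real x) * (2 * w)) (at (complex_of_real x))"
      by (rule DERIV_chain2[OF f2]) (use q[OF w, of x] x in \<open>auto simp: q_def intro!: derivative_eq_intros\<close>)
    from has_vector_derivative_real_field[OF this]
    have 2: "((\<lambda>x. f' (q w x)) has_vector_derivative f'' (q w x) * (2 * w)) (at x)" by (simp add: q_def)
    have "(P has_vector_derivative (complex_of_real ((1 - x\<^sup>2) powr (\<nu> + 1/2)) * (f'' (q w x) * (2 * w)) +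
            of_real (- ((2 * \<nu> + 1) * x * sphere_weight \<nu> x)) * f' (q w x))) (at x)"
      unfolding P_def by (rule has_vector_derivative_mult[OF 1 2])
    also have "(1 - x\<^sup>2) powr (\<nu> + 1/2) = sphere_weight \<nu> x * (1 - x\<^sup>2)"
    proof -
      have "(1 - x\<^sup>2) powr (\<nu> - 1/2 + 1) = (1 - x\<^sup>2) powr (\<nu> - 1/2) * (1 - x\<^sup>2)"
        using x2 by (subst powr_add) simp
      moreover have "\<nu> - 1/2 + 1 = \<nu> + 1/2" by simp
      ultimately show ?thesis by (simp only: sphere_weight_def)
    qed
    finally show "(P has_vector_derivative p x) (at x)" by (simp add: p_def algebra_simps)
  qed auto
  hence p0: "integral {-1..1} p = 0" by (simp add: P_def integral_unique)
  have si: "(\<lambda>x. of_real (sphere_weight \<nu> x) * h x) integrable_on {-1..1}" if "continuous_on {-1..1} h" for h :: "real \<Rightarrow> complex"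
    by (rule sphere_integrable[OF \<nu> that])
  have c1: "continuous_on {-1..1} (\<lambda>x. f' (q w x))" and c2: "continuous_on {-1..1} (\<lambda>x. f'' (q w x))" and c3: "continuous_on {-1..1} (\<lambda>x. q w x)"
    using cx[OF cf(2)] cx[OF f3] by (auto simp: q_def intro!: continuous_intros)
  have "w * u2 w + of_real (2 * \<nu> + 1) * u1 w - w * sphere_integral \<nu> (\<lambda>x. 4 * q w x * f'' (q w x) + of_real (4 * \<nu> + 4) * f' (q w x)) =
      integral {-1..1} (\<lambda>x. w * (of_real (sphere_weight \<nu> x) * (f'' (q w x) * (2 * (w + of_real x)) * (2 * (w + of_real x)) + f' (q w x) * 2)) +
        of_real (2 * \<nu> + 1) * (of_real (sphere_weight \<nu> x) * (f' (q w x) * (2 * (w + of_real x)))) -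
        w * (of_real (sphere_weight \<nu> x) * (4 * q w x * f'' (q w x) + of_real (4 * \<nu> + 4) * f' (q w x))))"
    unfolding u1_def u2_def sphere_integral_def
    by (subst Henstock_Kurzweil_Integration.integral_diff Henstock_Kurzweil_Integration.integral_add;
        (intro integrable_add integrable_on_mult_right si continuous_intros c1 c2 c3)?)+
       (simp only: integral_mult_right)
  also have "\<dots> = integral {-1..1} (\<lambda>x. - 2 * p x)"
  proof (rule integral_cong)
    fix x :: real
    have "q w x = 1 + w\<^sup>2 + 2 * w * of_real x" by (simp add: q_def)
    thus "w * (of_real (sphere_weight \<nu> x) * (f'' (q w x) * (2 * (w + of_real x)) * (2 * (w + of_real x)) + f' (q w x) * 2)) +
        of_real (2 * \<nu> + 1) * (of_real (sphere_weight \<nu> x) * (f' (q w x) * (2 * (w + of_real x)))) -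
        w * (of_real (sphere_weight \<nu> x) * (4 * q w x * f'' (q w x) + of_real (4 * \<nu> + 4) * f' (q w x))) = - 2 * p x"
      unfolding p_def of_real_mult of_real_add of_real_diff of_real_numeral of_real_1 of_real_power by algebra
  qed
  also have "\<dots> = 0" using p0 by (simp add: integral_mult_right)
  finally show "w * deriv (deriv u) w + of_real (2 * \<nu> + 1) * deriv u w =
           w * sphere_integral \<nu> (\<lambda>x. 4 * q w x * f'' (q w x) + of_real (4 * \<nu> + 4) * f' (q w x))"
    using e1[OF w] e2 by simp
qed

text \<open>
By its recurrence, \<open>macdonald\<close> is an eigenfunction of the radial Laplacian with eigenvalue \<open>4 y0\<close>, so its mean satisfies the
modified Bessel equation in \<open>w\<close> and is the solution regular at \<open>w = 0\<close>. This is where the product \<open>I K\<close> comes from.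
\<close>

lemma macdonald_sphere_average:
  assumes \<nu>: "\<nu> > 1/2" and y0: "y0 > (0::real)" and w: "w \<in> ball 0 (1/4)"
  shows "sphere_integral \<nu> (\<lambda>x. macdonald \<nu> (of_real y0 * (1 + w\<^sup>2 + 2 * w * of_real x))) =
           sphere_integral \<nu> (\<lambda>_. 1) * macdonald \<nu> (of_real y0) * Gamma (of_real \<nu> + 1) * bessel_series (of_real \<nu>) (of_real y0 * w\<^sup>2)"
proof -
  define f where "f = (\<lambda>q. macdonald \<nu> (of_real y0 * q))"
  define f' where "f' = (\<lambda>q. - of_real y0 * macdonald (\<nu> + 1) (of_real y0 * q))"
  define f'' where "f'' = (\<lambda>q. of_real (y0\<^sup>2) * macdonald (\<nu> + 2) (of_real y0 * q))"
  have der: "((\<lambda>q. macdonald \<mu> (of_real y0 * q)) has_field_derivative - of_real y0 * macdonald (\<mu> + 1) (of_real y0 * q)) (at q)"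
    if "Re q > 0" for \<mu> q
    by (rule DERIV_chain2[OF has_field_derivative_macdonald, THEN DERIV_cong])
       (use that y0 in \<open>auto intro!: derivative_eq_intros\<close>)
  have f1: "(f has_field_derivative f' q) (at q)" if "Re q > 0" for q
    unfolding f_def f'_def by (rule der[OF that])
  have f2: "(f' has_field_derivative f'' q) (at q)" if "Re q > 0" for q
    unfolding f'_def f''_def
    by (rule DERIV_cong[OF DERIV_cmult[OF der[OF that, of "\<nu> + 1"], of "- of_real y0"]])
       (simp add: power2_eq_square mult.assoc add.assoc)
  have f3: "continuous_on {q. Re q > 0} f''"
    unfolding f''_def using der[of _ "\<nu> + 2"]
    by (intro continuous_intros continuous_at_imp_continuous_on ballI DERIV_isCont) auto
  define u where "u = (\<lambda>w. sphere_integral \<nu> (\<lambda>x. f (1 + w\<^sup>2 + 2 * w * complex_of_real x)))"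
  note D = sphere_integral_Darboux[OF \<nu> f1 f2 f3, folded u_def]
  have eq: "4 * q * f'' q + of_real (4 * \<nu> + 4) * f' q = of_real (4 * y0) * f q" if "Re q > 0" for q
  proof -
    have "macdonald \<nu> (of_real y0 * q) = of_real y0 * q * macdonald (\<nu> + 2) (of_real y0 * q) - of_real (\<nu> + 1) * macdonald (\<nu> + 1) (of_real y0 * q)"
      using macdonald_recurrence[of "of_real y0 * q" "\<nu> + 1"] that y0 by (simp add: add_ac)
    thus ?thesis unfolding f_def f'_def f''_def power2_eq_square of_real_mult of_real_add of_real_numeral of_real_1
      by algebra
  qed
  have ode: "w * deriv (deriv u) w + of_real (2 * \<nu> + 1) * deriv u w = w * (0 * w\<^sup>2 * deriv (deriv u) w + 0 * w * deriv u w + of_real (4 * y0) * u w)"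
    if w: "w \<in> ball 0 (1/4)" for w
  proof -
    have "sphere_integral \<nu> (\<lambda>x. 4 * (1 + w\<^sup>2 + 2 * w * complex_of_real x) * f'' (1 + w\<^sup>2 + 2 * w * complex_of_real x) +
             of_real (4 * \<nu> + 4) * f' (1 + w\<^sup>2 + 2 * w * complex_of_real x)) = of_real (4 * y0) * u w"
      unfolding u_def sphere_integral_def integral_mult_right [symmetric]
    proof (rule integral_cong)
      fix x :: real assume x: "x \<in> {-1..1}"
      show "of_real (sphere_weight \<nu> x) * (4 * (1 + w\<^sup>2 + 2 * w * of_real x) * f'' (1 + w\<^sup>2 + 2 * w * of_real x) +
             of_real (4 * \<nu> + 4) * f' (1 + w\<^sup>2 + 2 * w * of_real x)) =
          of_real (4 * y0) * (of_real (sphere_weight \<nu> x) * f (1 + w\<^sup>2 + 2 * w * of_real x))"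
        unfolding eq[OF Re_sphere_argument_pos[OF w x]] by (rule mult.left_commute)
    qed
    thus ?thesis using D(3)[OF _ _ w] by simp
  qed
  define v where "v = (\<lambda>l. u 0 * of_real y0 ^ l / (fact l * pochhammer (of_real \<nu> + 1) l) :: complex)"
  have nz: "of_real \<nu> + 1 + of_nat l \<noteq> (0::complex)" for l
    using \<nu> by (auto simp: complex_eq_iff)
  have pnz: "pochhammer (of_real \<nu> + 1 :: complex) l \<noteq> 0" for l
    using nz by (auto simp: pochhammer_eq_0_iff eq_neg_iff_add_eq_0)
  have sums: "(\<lambda>l. v l * w ^ (2 * l)) sums u w"
  proof (rule even_ode_solution[where r = "1/4" and \<nu> = \<nu> and A = 0 and B = 0 and C = "of_real (4 * y0)"])
    show "v 0 = u 0" by (simp add: v_def)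
    fix l
    have e1: "v (Suc l) = v l * of_real y0 / ((of_nat l + 1) * (of_real \<nu> + 1 + of_nat l))"
      by (simp add: v_def pochhammer_Suc fact_Suc mult_ac add_ac)
    have e2: "(of_nat l + 1) * (of_real \<nu> + 1 + of_nat l) \<noteq> (0::complex)"
      using nz[of l] of_nat_neq_0[of l, where 'a = complex] by (simp add: add.commute)
    have e3: "of_nat (2 * l + 2) * (of_nat (2 * l + 2) + of_real (2 * \<nu>)) = 4 * ((of_nat l + 1) * (of_real \<nu> + 1 + of_nat l) :: complex)"
      by (simp add: algebra_simps)
    show "v (Suc l) * (of_nat (2 * l + 2) * (of_nat (2 * l + 2) + of_real (2 * \<nu>))) =
        (0 * (of_nat (2 * l) * (of_nat (2 * l) - 1)) + 0 * of_nat (2 * l) + of_real (4 * y0)) * v l"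
    proof -
      have "X / N * (4 * N) = 4 * X" if "N \<noteq> 0" for X N :: complex using that by simp
      from this[OF e2] show ?thesis
        unfolding e3 e1 by (simp only: of_real_mult of_real_numeral mult_zero_left add_0 mult_ac)
    qed
  qed (use D(1) w ode \<nu> in auto)
  have "Gamma (of_real \<nu> + 1 :: complex) \<noteq> 0"
    using Re_pos_notin_nonpos_Ints[of "of_real \<nu> + 1"] \<nu> by (simp add: Gamma_eq_zero_iff)
  have "u 0 * Gamma (of_real \<nu> + 1) * (rGamma (of_real \<nu> + of_nat m + 1) * (of_real y0 * w\<^sup>2) ^ m / fact m) = v m * w ^ (2 * m)" for m
  proof -
    have "rGamma (of_real \<nu> + 1 :: complex) = pochhammer (of_real \<nu> + 1) m * rGamma (of_real \<nu> + 1 + of_nat m)"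
      by (rule pochhammer_rGamma)
    moreover have "Gamma (of_real \<nu> + 1) * rGamma (of_real \<nu> + 1 :: complex) = 1"
      using \<open>Gamma (of_real \<nu> + 1 :: complex) \<noteq> 0\<close> by (simp add: rGamma_inverse_Gamma)
    moreover have "complex_of_real \<nu> + 1 + of_nat m = of_real \<nu> + of_nat m + 1" by simp
    ultimately have "Gamma (of_real \<nu> + 1) * (pochhammer (of_real \<nu> + 1) m * rGamma (of_real \<nu> + of_nat m + 1 :: complex)) = 1"
      by (simp only:)
    hence "Gamma (of_real \<nu> + 1) * rGamma (of_real \<nu> + of_nat m + 1 :: complex) = 1 / pochhammer (of_real \<nu> + 1) m"
      using pnz[of m] by (subst eq_divide_eq) (simp add: mult_ac)
    moreover have "(of_real y0 * w\<^sup>2) ^ m = of_real y0 ^ m * w ^ (2 * m)"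
      by (simp add: power_mult_distrib power_mult)
    ultimately show ?thesis unfolding v_def by (simp add: mult_ac)
  qed
  hence "(\<lambda>m. v m * w ^ (2 * m)) sums (u 0 * Gamma (of_real \<nu> + 1) * bessel_series (of_real \<nu>) (of_real y0 * w\<^sup>2))"
    using sums_mult[OF summable_sums[OF summable_norm_cancel[OF summable_bessel_series[of "of_real \<nu>" "of_real y0 * w\<^sup>2"]]], of "u 0 * Gamma (of_real \<nu> + 1)"]
    by (simp add: bessel_series_def)
  hence "u w = u 0 * Gamma (of_real \<nu> + 1) * bessel_series (of_real \<nu>) (of_real y0 * w\<^sup>2)"
    using sums by (simp add: sums_iff)
  moreover have "u 0 = sphere_integral \<nu> (\<lambda>_. 1) * macdonald \<nu> (of_real y0)"
    by (simp add: u_def f_def sphere_integral_def)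
  ultimately show ?thesis by (simp add: u_def f_def)
qed

text \<open>
The Laplacian of \<open>q\<^bsup>-\<kappa>\<^esup>\<close> is \<open>4 \<kappa> (\<kappa> - \<nu>) q\<^bsup>-\<kappa> - 1\<^esup>\<close>. The mean of the new power is eliminated in
favour of \<open>y\<close> and its derivative, using that \<open>q - w \<cdot> dq/dw = 1 - w\<^sup>2\<close>.
\<close>

lemma power_sphere_ode:
  fixes \<kappa> :: complex
  assumes \<nu>: "\<nu> > 1/2"
  defines "y \<equiv> \<lambda>w. sphere_integral \<nu> (\<lambda>x. (1 + w\<^sup>2 + 2 * w * of_real x) powr (- \<kappa>))"
  assumes w: "w \<in> ball 0 (1/4)"
  shows "y holomorphic_on ball 0 (1/4)"
    and "(1 - w\<^sup>2) * (w * deriv (deriv y) w + of_real (2 * \<nu> + 1) * deriv y w) =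
           4 * (\<kappa> - of_real \<nu>) * w * (\<kappa> * y w + w * deriv y w)"
proof -
  define f where "f = (\<lambda>q. q powr (- \<kappa>) :: complex)"
  define f' where "f' = (\<lambda>q. - \<kappa> * q powr (- \<kappa> - 1) :: complex)"
  define f'' where "f'' = (\<lambda>q. \<kappa> * (\<kappa> + 1) * q powr (- \<kappa> - 2) :: complex)"
  have H: "q \<notin> \<real>\<^sub>\<le>\<^sub>0" if "Re q > 0" for q :: complex using that by (auto simp: complex_nonpos_Reals_iff)
  have f1: "(f has_field_derivative f' q) (at q)" if "Re q > 0" for q
    unfolding f_def f'_def using H[OF that] by (auto intro!: derivative_eq_intros)
  have f2: "(f' has_field_derivative f'' q) (at q)" if "Re q > 0" for q
    unfolding f'_def f''_def using H[OF that] by (auto intro!: derivative_eq_intros simp: algebra_simps)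
  have f3: "continuous_on {q. Re q > 0} f''"
    unfolding f''_def using H by (intro holomorphic_on_imp_continuous_on holomorphic_intros) auto
  note D = sphere_integral_Darboux[OF \<nu> f1 f2 f3, unfolded f_def, folded y_def]
  show "y holomorphic_on ball 0 (1/4)" by (rule D(1)[OF _ _ w])
  define q where "q = (\<lambda>x. 1 + w\<^sup>2 + 2 * w * complex_of_real x)"
  have q: "Re (q x) > 0" if "x \<in> {-1..1}" for x
    unfolding q_def by (rule Re_sphere_argument_pos[OF w that])
  have qnz: "q x \<noteq> 0" if "x \<in> {-1..1}" for x using q[OF that] by auto
  define Y where "Y = sphere_integral \<nu> (\<lambda>x. q x powr (- \<kappa> - 1))"
  have p1: "q x powr (- \<kappa>) = q x * q x powr (- \<kappa> - 1)" if "x \<in> {-1..1}" for x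
    using qnz[OF that] by (simp add: powr_diff)
  have p2: "q x powr (- \<kappa> - 1) = q x * q x powr (- \<kappa> - 2)" if "x \<in> {-1..1}" for x
  proof -
    have "q x powr (- \<kappa> - 2 + 1) = q x powr (- \<kappa> - 2) * q x" using qnz[OF that] by (subst powr_add) simp
    moreover have "- \<kappa> - 2 + 1 = - \<kappa> - 1" by simp
    ultimately show ?thesis by (simp only: mult.commute)
  qed
  have 1: "w * deriv (deriv y) w + of_real (2 * \<nu> + 1) * deriv y w = w * (4 * \<kappa> * (\<kappa> - of_real \<nu>) * Y)"
  proof -
    have "sphere_integral \<nu> (\<lambda>x. 4 * q x * f'' (q x) + of_real (4 * \<nu> + 4) * f' (q x)) = 4 * \<kappa> * (\<kappa> - of_real \<nu>) * Y"
      unfolding Y_def sphere_integral_def integral_mult_right [symmetric]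
    proof (rule integral_cong)
      fix x :: real assume x: "x \<in> {-1..1}"
      show "of_real (sphere_weight \<nu> x) * (4 * q x * f'' (q x) + of_real (4 * \<nu> + 4) * f' (q x)) =
              4 * \<kappa> * (\<kappa> - of_real \<nu>) * (of_real (sphere_weight \<nu> x) * q x powr (- \<kappa> - 1))"
        unfolding f'_def f''_def p2[OF x] by (simp add: algebra_simps)
    qed
    thus ?thesis using D(3)[OF _ _ w] unfolding q_def by simp
  qed
  have ci: "continuous_on {-1..1} (\<lambda>x. q x powr c)" for c
  proof -
    have "continuous_on {q. Re q > 0} (\<lambda>q. q powr c)"
      using H by (intro holomorphic_on_imp_continuous_on holomorphic_intros) auto
    thus ?thesis by (rule continuous_on_compose2) (use q in \<open>auto simp: q_def intro!: continuous_intros\<close>)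
  qed
  have 2: "w * deriv y w = - \<kappa> * y w + \<kappa> * (1 - w\<^sup>2) * Y"
  proof -
    have "w * deriv y w = sphere_integral \<nu> (\<lambda>x. - \<kappa> * q x powr (- \<kappa>) + \<kappa> * (1 - w\<^sup>2) * q x powr (- \<kappa> - 1))"
    proof -
      have d: "deriv y w = sphere_integral \<nu> (\<lambda>x. f' (q x) * (2 * (w + of_real x)))"
        unfolding q_def by (rule D(2)[OF _ _ w])
      show ?thesis unfolding d sphere_integral_def integral_mult_right [symmetric]
      proof (rule integral_cong)
        fix x :: real assume x: "x \<in> {-1..1}"
        have "2 * w * (w + of_real x) = q x - (1 - w\<^sup>2)" by (simp add: q_def power2_eq_square algebra_simps)
        thus "w * (of_real (sphere_weight \<nu> x) * (f' (q x) * (2 * (w + of_real x)))) =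
           of_real (sphere_weight \<nu> x) * (- \<kappa> * q x powr (- \<kappa>) + \<kappa> * (1 - w\<^sup>2) * q x powr (- \<kappa> - 1))"
          unfolding f'_def p1[OF x] by algebra
      qed
    qed
    also have "\<dots> = integral {-1..1} (\<lambda>x. - \<kappa> * (of_real (sphere_weight \<nu> x) * q x powr (- \<kappa>)) +
        \<kappa> * (1 - w\<^sup>2) * (of_real (sphere_weight \<nu> x) * q x powr (- \<kappa> - 1)))"
      unfolding sphere_integral_def by (simp add: algebra_simps)
    also have "\<dots> = - \<kappa> * sphere_integral \<nu> (\<lambda>x. q x powr (- \<kappa>)) + \<kappa> * (1 - w\<^sup>2) * Y"
      unfolding sphere_integral_def Y_def
      by (subst Henstock_Kurzweil_Integration.integral_add)
         (intro integrable_on_mult_right sphere_integrable[OF \<nu>] ci, intro integrable_on_mult_right sphere_integrable[OF \<nu>] ci, simp only: integral_mult_right)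
    finally show ?thesis by (simp add: y_def q_def)
  qed
  show "(1 - w\<^sup>2) * (w * deriv (deriv y) w + of_real (2 * \<nu> + 1) * deriv y w) =
           4 * (\<kappa> - of_real \<nu>) * w * (\<kappa> * y w + w * deriv y w)"
    unfolding 1 2 by (simp add: algebra_simps)
qed

text \<open>
The power \<open>q\<^bsup>-\<nu>\<^esup>\<close> of the squared length is harmonic in dimension \<open>2 \<nu> + 2\<close>, so this is the mean value property.
\<close>

lemma power_sphere_average_harmonic:
  assumes \<nu>: "\<nu> > 1/2" and w: "w \<in> ball 0 (1/4)"
  shows "sphere_integral \<nu> (\<lambda>x. (1 + w\<^sup>2 + 2 * w * of_real x) powr (- of_real \<nu>)) = sphere_integral \<nu> (\<lambda>_. 1)"
proof -
  define y where "y = (\<lambda>w. sphere_integral \<nu> (\<lambda>x. (1 + w\<^sup>2 + 2 * w * of_real x) powr (- of_real \<nu>)))"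
  note D = power_sphere_ode[OF \<nu>, of _ "of_real \<nu>", folded y_def]
  have sq: "1 - w\<^sup>2 \<noteq> 0" if "w \<in> ball (0::complex) (1/4)" for w
    using that by (auto simp: power2_eq_1_iff)
  have "(\<lambda>l. (if l = 0 then y 0 else 0) * w ^ (2 * l)) sums y w"
  proof (rule even_ode_solution[where r = "1/4" and \<nu> = \<nu> and A = 0 and B = 0 and C = 0])
    show "y holomorphic_on ball 0 (1/4)" by (rule D(1)[OF w])
    show "u * deriv (deriv y) u + of_real (2 * \<nu> + 1) * deriv y u = u * (0 * u\<^sup>2 * deriv (deriv y) u + 0 * u * deriv y u + 0 * y u)"
      if "u \<in> ball 0 (1/4)" for u using D(2)[OF that] sq[OF that] by simp
  qed (use w \<nu> in auto)
  moreover have "(\<lambda>l. (if l = 0 then y 0 else 0) * w ^ (2 * l)) sums y 0"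
  proof -
    have "(\<lambda>l. (if l = 0 then y 0 else 0) * w ^ (2 * l)) = (\<lambda>l. if l = 0 then y 0 else 0)" by auto
    thus ?thesis using sums_single[of 0 "\<lambda>l. y 0"] by simp
  qed
  ultimately have "y w = y 0" by (rule sums_unique2)
  thus ?thesis by (simp add: y_def)
qed

text \<open>
The mean is a hypergeometric function of \<open>w\<^sup>2\<close> with parameters \<open>\<nu> + k/2\<close>, \<open>k/2\<close>; multiplying by \<open>(1 - w\<^sup>2)\<^bsup>k - 1\<^esup>\<close> passes to
the parameters of the theorem (Euler's transformation). The proof does both at once, by deriving the equation of the product.
\<close>

lemma power_sphere_average:
  assumes \<nu>: "\<nu> > 1/2" and k: "k \<ge> 2" and w: "w \<in> ball 0 (1/4)"
  shows "(1 - w\<^sup>2) ^ (k - 1) * sphere_integral \<nu> (\<lambda>x. (1 + w\<^sup>2 + 2 * w * of_real x) powr (- (of_real \<nu> + of_nat k / 2))) =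
           sphere_integral \<nu> (\<lambda>_. 1) * hypergeo_2F1 (of_real \<nu> + 1 - of_nat k / 2) (1 - of_nat k / 2) (of_real \<nu> + 1) (w\<^sup>2)"
proof -
  define \<kappa> where "\<kappa> = of_real \<nu> + (of_nat k / 2 :: complex)"
  define y where "y = (\<lambda>w. sphere_integral \<nu> (\<lambda>x. (1 + w\<^sup>2 + 2 * w * of_real x) powr (- \<kappa>)))"
  define m where "m = (of_nat k - 1 :: complex)"
  note D = power_sphere_ode[OF \<nu>, of _ \<kappa>, folded y_def]
  define q where "q = (\<lambda>w::complex. 1 - w\<^sup>2)"
  have q: "q w \<noteq> 0" if "w \<in> ball (0::complex) (1/4)" for w
    using that by (auto simp: q_def power2_eq_1_iff)
  have dq: "(q has_field_derivative (- 2 * w)) (at w)" for w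
    unfolding q_def by (auto intro!: derivative_eq_intros)
  define e where "e = (\<lambda>w. q w ^ (k - 1))"
  have de: "(e has_field_derivative e w * (- 2 * m * w / q w)) (at w)" if w: "w \<in> ball 0 (1/4)" for w
  proof -
    obtain j where j: "k - 1 = Suc j" using k by (cases "k - 1") auto
    have m: "m = of_nat (Suc j)" using j k by (simp add: m_def of_nat_diff flip: j)
    have "(e has_field_derivative (of_nat (Suc j) * q w ^ j * (- 2 * w))) (at w)"
      unfolding e_def j by (rule DERIV_cong[OF DERIV_power_Suc[OF dq]]) simp
    moreover have "of_nat (Suc j) * q w ^ j * (- 2 * w) = e w * (- 2 * m * w / q w)"
      unfolding e_def j m using q[OF w] by (simp add: field_simps)
    ultimately show ?thesis by (simp only:)
  qed
  define y1 y2 where "y1 = deriv y" and "y2 = deriv (deriv y)"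
  have hy: "y holomorphic_on ball 0 (1/4)" by (rule D(1)[OF w])
  have dy: "(y has_field_derivative y1 w) (at w)" "(y1 has_field_derivative y2 w) (at w)" if "w \<in> ball 0 (1/4)" for w
    using holomorphic_derivI[OF hy open_ball that] holomorphic_derivI[OF holomorphic_deriv[OF hy open_ball] open_ball that]
    by (auto simp: y1_def y2_def)
  define u where "u = (\<lambda>w. e w * y w)"
  define u1 where "u1 = (\<lambda>w. e w * (y1 w - 2 * m * w / q w * y w))"
  define u2 where "u2 = (\<lambda>w. e w * (y2 w - 4 * m * w / q w * y1 w + (4 * m * (m - 1) * w\<^sup>2 / (q w)\<^sup>2 - 2 * m / q w) * y w))"
  have du: "(u has_field_derivative u1 w) (at w)" if w: "w \<in> ball 0 (1/4)" for w
    unfolding u_def u1_def by (rule DERIV_mult[OF de[OF w] dy(1)[OF w], THEN DERIV_cong]) (simp add: algebra_simps)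
  have du1: "(u1 has_field_derivative u2 w) (at w)" if w: "w \<in> ball 0 (1/4)" for w
  proof -
    have "((\<lambda>w. 2 * m * w / q w) has_field_derivative (2 * m / q w + 4 * m * w\<^sup>2 / (q w)\<^sup>2)) (at w)"
      using q[OF w] by (auto intro!: derivative_eq_intros dq simp: power2_eq_square field_simps)
    hence "(u1 has_field_derivative (e w * (- 2 * m * w / q w) * (y1 w - 2 * m * w / q w * y w) +
        (y2 w - ((2 * m / q w + 4 * m * w\<^sup>2 / (q w)\<^sup>2) * y w + y1 w * (2 * m * w / q w))) * e w)) (at w)"
      unfolding u1_def by (intro DERIV_mult DERIV_diff de dy w)
    moreover have "e w * (- 2 * m * w / q w) * (y1 w - 2 * m * w / q w * y w) +
        (y2 w - ((2 * m / q w + 4 * m * w\<^sup>2 / (q w)\<^sup>2) * y w + y1 w * (2 * m * w / q w))) * e w = u2 w"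
      unfolding u2_def using q[OF w] by (simp add: power2_eq_square field_simps)
    ultimately show ?thesis by simp
  qed
  have hu: "u holomorphic_on ball 0 (1/4)" unfolding holomorphic_on_open[OF open_ball] using du by blast
  have eu: "deriv u w = u1 w" if "w \<in> ball 0 (1/4)" for w using du[OF that] by (rule DERIV_imp_deriv)
  have eu1: "deriv (deriv u) w = u2 w" if w: "w \<in> ball 0 (1/4)" for w
  proof -
    have "deriv (deriv u) w = deriv u1 w"
      by (rule deriv_cong_ev) (use eventually_nhds_in_open[of "ball 0 (1/4)" w] w eu in \<open>auto elim!: eventually_mono\<close>)
    thus ?thesis using du1[OF w] by (simp add: DERIV_imp_deriv)
  qed
  define a b c where "a = of_real \<nu> + 1 - (of_nat k / 2 :: complex)" and "b = 1 - (of_nat k / 2 :: complex)" and "c = of_real \<nu> + (1 :: complex)"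
  have ode: "w * deriv (deriv u) w + of_real (2 * \<nu> + 1) * deriv u w =
      w * (1 * w\<^sup>2 * deriv (deriv u) w + (1 + 2 * a + 2 * b) * w * deriv u w + (4 * a * b) * u w)" if w: "w \<in> ball 0 (1/4)" for w
  proof -
    define Q where "Q = q w"
    have Q: "Q \<noteq> 0" "Q = 1 - w\<^sup>2" using q[OF w] by (auto simp: Q_def q_def)
    \<comment> \<open>the denominators are cleared so that the equation for \<open>u\<close> becomes a polynomial consequence of the one for \<open>y\<close>\<close>
    define V1 V2 where "V1 = Q * y1 w - 2 * m * w * y w" and "V2 = Q\<^sup>2 * y2 w - 4 * m * w * Q * y1 w + (4 * m * (m - 1) * w\<^sup>2 - 2 * m * Q) * y w"
    have u1: "u1 w = e w / Q * V1" and u2: "u2 w = e w / Q\<^sup>2 * V2"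
      using Q(1) by (simp_all add: u1_def u2_def V1_def V2_def Q_def [symmetric] power2_eq_square field_simps)
    have yo: "Q * (w * y2 w + of_real (2 * \<nu> + 1) * y1 w) = 4 * (\<kappa> - of_real \<nu>) * w * (\<kappa> * y w + w * y1 w)"
    proof -
      have "sphere_integral \<nu> (\<lambda>x. (1 + w\<^sup>2 + 2 * w * of_real x) powr (- \<kappa>)) = y w" by (simp add: y_def)
      from D(2)[OF w, unfolded this] show ?thesis unfolding Q(2) y1_def y2_def .
    qed
    define n where "n = complex_of_real \<nu>"
    define K where "K = (of_nat k :: complex)"
    have yo': "Q * (w * y2 w + (2 * n + 1) * y1 w) = 2 * K * w * ((n + K / 2) * y w + w * y1 w)"
      using yo by (simp add: \<kappa>_def n_def K_def)
    have "w * V2 + (2 * n + 1) * Q * V1 = w * (w\<^sup>2 * V2 + (1 + 2 * a + 2 * b) * w * Q * V1 + 4 * a * b * Q\<^sup>2 * y w)"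
    proof -
      have ab: "1 + 2 * a + 2 * b = 2 * n + 5 - 2 * K" "4 * a * b = (2 * n + 2 - K) * (2 - K)" and m: "m = K - 1"
        by (simp_all add: a_def b_def n_def K_def m_def algebra_simps)
      have yo2: "Q * (w * y2 w + (2 * n + 1) * y1 w) = K * w * ((2 * n + K) * y w + 2 * w * y1 w)"
        using yo' by (simp add: algebra_simps)
      have w2: "w\<^sup>2 = 1 - Q" using Q(2) by simp
      show ?thesis unfolding ab m V1_def V2_def using yo2 w2 by algebra
    qed
    hence "e w / Q\<^sup>2 * (w * V2 + (2 * n + 1) * Q * V1) = e w / Q\<^sup>2 * (w * (w\<^sup>2 * V2 + (1 + 2 * a + 2 * b) * w * Q * V1 + 4 * a * b * Q\<^sup>2 * y w))"
      by simp
    moreover have "e w / Q = e w / Q\<^sup>2 * Q" "e w = e w / Q\<^sup>2 * Q\<^sup>2" using Q(1) by (simp_all add: power2_eq_square)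
    moreover have "of_real (2 * \<nu> + 1) = 2 * n + 1" by (simp add: n_def)
    ultimately show ?thesis unfolding eu[OF w] eu1[OF w] u1 u2 unfolding u_def by algebra
  qed
  define v where "v = (\<lambda>l. u 0 * hypergeo_coeff a b c l)"
  have nz: "c + of_nat l \<noteq> 0" for l using \<nu> by (auto simp: complex_eq_iff c_def)
  have sums: "(\<lambda>l. v l * w ^ (2 * l)) sums u w"
  proof (rule even_ode_solution[where r = "1/4" and \<nu> = \<nu> and A = 1 and B = "1 + 2 * a + 2 * b" and C = "4 * a * b"])
    show "v 0 = u 0" by (simp add: v_def hypergeo_coeff_def)
    fix l
    have e1: "v (Suc l) = v l * ((a + of_nat l) * (b + of_nat l)) / ((c + of_nat l) * (of_nat l + 1))"
      by (simp add: v_def hypergeo_coeff_def pochhammer_Suc fact_Suc mult_ac add_ac)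
    have e2: "(c + of_nat l) * (of_nat l + 1) \<noteq> (0::complex)"
      using nz[of l] of_nat_neq_0[of l, where 'a = complex] by (simp add: add.commute)
    have e3: "of_nat (2 * l + 2) * (of_nat (2 * l + 2) + of_real (2 * \<nu>)) = 4 * ((c + of_nat l) * (of_nat l + 1))"
      by (simp add: c_def algebra_simps)
    have e4: "1 * (of_nat (2 * l) * (of_nat (2 * l) - 1)) + (1 + 2 * a + 2 * b) * of_nat (2 * l) + 4 * a * b = 4 * ((a + of_nat l) * (b + of_nat l))"
      by (simp add: algebra_simps)
    show "v (Suc l) * (of_nat (2 * l + 2) * (of_nat (2 * l + 2) + of_real (2 * \<nu>))) =
        (1 * (of_nat (2 * l) * (of_nat (2 * l) - 1)) + (1 + 2 * a + 2 * b) * of_nat (2 * l) + 4 * a * b) * v l"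
    proof -
      have "X / N * (4 * N) = 4 * X" if "N \<noteq> 0" for X N :: complex using that by simp
      from this[OF e2] show ?thesis unfolding e3 e1 e4 by (simp only: mult_ac)
    qed
  qed (use w ode \<nu> hu in auto)
  have w2: "norm (w\<^sup>2) < 1"
  proof -
    have "norm w ^ 2 < 1 ^ 2" using w by (intro power_strict_mono) auto
    thus ?thesis by (simp add: norm_power)
  qed
  have "(\<lambda>l. hypergeo_coeff a b c l * (w\<^sup>2) ^ l) sums hypergeo_2F1 a b c (w\<^sup>2)"
    using summable_sums[OF summable_norm_cancel[OF summable_hypergeo[OF w2, of a b c]]]
    by (simp add: hypergeo_2F1_disc[OF w2] eval_fps_def hypergeo_fps_def)
  hence "(\<lambda>l. v l * w ^ (2 * l)) sums (u 0 * hypergeo_2F1 a b c (w\<^sup>2))"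
    using sums_mult[of _ _ "u 0"] by (simp add: v_def power_mult mult.assoc)
  hence "u w = u 0 * hypergeo_2F1 a b c (w\<^sup>2)" using sums sums_unique2 by blast
  moreover have "u 0 = sphere_integral \<nu> (\<lambda>_. 1)" by (simp add: u_def e_def q_def y_def)
  ultimately show ?thesis by (simp add: u_def e_def q_def y_def \<kappa>_def a_def b_def c_def)
qed

section \<open>The diagonal identity and its average\<close>

definition sphere_integral_real :: "real \<Rightarrow> (real \<Rightarrow> real) \<Rightarrow> real" where
  "sphere_integral_real \<nu> f = (\<integral>x. indicator {-1..1} x * (sphere_weight \<nu> x * f x) \<partial>lborel)"

lemma sphere_weight_measurable [measurable]: "sphere_weight \<nu> \<in> borel_measurable borel"
  unfolding sphere_weight_def by measurable

lemma sphere_weight_nonneg: "sphere_weight \<nu> x \<ge> 0"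
  by (simp add: sphere_weight_def)

lemma sphere_integrable_real:
  assumes "\<nu> > 1/2" "continuous_on {-1..1} f"
  shows "integrable lborel (\<lambda>x. indicator {-1..1} x * (sphere_weight \<nu> x * f x))"
proof -
  have "set_integrable lborel {-1..1} (\<lambda>x. sphere_weight \<nu> x * f x)"
    by (intro borel_integrable_atLeastAtMost' continuous_intros continuous_on_sphere_weight assms)
  thus ?thesis by (simp add: set_integrable_def)
qed

lemma sphere_integral_of_real:
  assumes "\<nu> > 1/2" "continuous_on {-1..1} f"
  shows "sphere_integral \<nu> (\<lambda>x. of_real (f x)) = of_real (sphere_integral_real \<nu> f)"
proof -
  have i: "set_integrable lborel {-1..1} (\<lambda>x. sphere_weight \<nu> x * f x)"
    by (intro borel_integrable_atLeastAtMost' continuous_intros continuous_on_sphere_weight assms)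
  have c: "(\<lambda>x. sphere_weight \<nu> x * f x) integrable_on {-1..1}"
    by (intro integrable_continuous_real continuous_intros continuous_on_sphere_weight assms)
  have "sphere_integral \<nu> (\<lambda>x. of_real (f x)) = integral {-1..1} (of_real \<circ> (\<lambda>x. sphere_weight \<nu> x * f x))"
    by (simp add: sphere_integral_def o_def)
  also have "\<dots> = of_real (integral {-1..1} (\<lambda>x. sphere_weight \<nu> x * f x))"
    by (rule integral_linear[OF c bounded_linear_of_real])
  also have "integral {-1..1} (\<lambda>x. sphere_weight \<nu> x * f x) = sphere_integral_real \<nu> f"
    using set_borel_integral_eq_integral(2)[OF i] by (simp add: sphere_integral_real_def set_lebesgue_integral_def)
  finally show ?thesis .
qed

lemma sphere_integral_real_1_pos:
  assumes "\<nu> > 1/2"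
  shows "sphere_integral_real \<nu> (\<lambda>_. 1) > 0"
proof -
  let ?f = "\<lambda>x. sphere_weight \<nu> x * 1"
  have "set_integrable lborel {-1..1} ?f"
    by (intro borel_integrable_atLeastAtMost' continuous_intros continuous_on_sphere_weight assms)
  hence e: "sphere_integral_real \<nu> (\<lambda>_. 1) = integral {-1..1} ?f"
    using set_borel_integral_eq_integral(2)[of "{-1..1}" ?f] by (simp add: sphere_integral_real_def set_lebesgue_integral_def)
  have c: "continuous_on {-1..1} ?f"
    by (intro continuous_intros continuous_on_sphere_weight assms)
  have "integral {-1..1} ?f \<noteq> 0"
    using integral_eq_0_iff[OF c] sphere_weight_nonneg[of \<nu>] by (auto simp: sphere_weight_def dest!: bspec[of _ _ 0])
  moreover have "integral {-1..1} ?f \<ge> 0"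
    by (intro integral_nonneg integrable_continuous_real c) (auto simp: sphere_weight_nonneg)
  ultimately show ?thesis using e by simp
qed

text \<open>
The point with parameter \<open>x\<close> on the segment from \<open>b\<^sup>2\<close> at \<open>-1\<close> to \<open>a\<^sup>2\<close> at \<open>1\<close>.
\<close>

definition segment_point :: "real \<Rightarrow> real \<Rightarrow> real \<Rightarrow> real" where
  "segment_point a b x = (a\<^sup>2 + b\<^sup>2 + (a\<^sup>2 - b\<^sup>2) * x) / 2"

lemma segment_point_pos:
  assumes "a > 0" "b > 0" "x \<in> {-1..1}"
  shows "segment_point a b x > 0"
proof -
  have "segment_point a b x = a\<^sup>2 * ((1 + x) / 2) + b\<^sup>2 * ((1 - x) / 2)" by (simp add: segment_point_def field_simps)
  moreover have "a\<^sup>2 * ((1 + x) / 2) \<ge> 0" "b\<^sup>2 * ((1 - x) / 2) \<ge> 0" using assms by auto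
  moreover have "x > -1 \<or> x < 1" by auto
  hence "a\<^sup>2 * ((1 + x) / 2) > 0 \<or> b\<^sup>2 * ((1 - x) / 2) > 0" using assms by auto
  ultimately show ?thesis by linarith
qed

lemma continuous_on_segment_point: "continuous_on A (segment_point a b)"
  unfolding segment_point_def by (intro continuous_intros) auto

lemma segment_point_eq:
  assumes "a + b \<noteq> 0"
  shows "segment_point a b x = ((a + b)\<^sup>2 / 4) * (1 + ((a - b) / (a + b))\<^sup>2 + 2 * ((a - b) / (a + b)) * x)"
  using assms by (simp add: segment_point_def power2_eq_square divide_simps) (simp add: algebra_simps)

lemma continuous_on_powr_segment_point:
  assumes "a > 0" "b > 0"
  shows "continuous_on {-1..1} (\<lambda>x. segment_point a b x powr p)"
  using segment_point_pos[OF assms]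
  by (intro continuous_intros continuous_on_segment_point) (auto simp: less_imp_neq[symmetric])

lemma continuous_on_macdonald_segment_point:
  assumes "a > 0" "b > 0" "c > 0"
  shows "continuous_on {-1..1} (\<lambda>x. macdonald_real \<nu> (c * segment_point a b x))"
proof -
  have "continuous_on {0<..} (macdonald_real \<nu>)"
    using has_real_derivative_macdonald_real[of _ \<nu>]
    by (intro continuous_at_imp_continuous_on ballI DERIV_isCont) auto
  thus ?thesis
    by (rule continuous_on_compose2)
       (use segment_point_pos[OF assms(1,2)] assms(3) in \<open>auto intro!: continuous_intros continuous_on_segment_point\<close>)
qed

text \<open>
Integrate \<open>\<theta>\<^sup>k - 1\<close> against \<open>exp (\<sigma> v - \<pi> \<gamma> exp v)\<close> termwise, which gives the series in \<open>n + \<gamma>\<close>. Under \<open>v \<mapsto> - v\<close> and the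
inversion formula the same integral becomes the series of \<open>K\<close>-type integrals, plus the two Gamma integrals that come from the
constant terms of \<open>\<theta>\<^sup>k\<close>.
\<close>

lemma diagonal_identity:
  fixes \<nu> \<gamma> :: real and k :: nat
  assumes \<nu>: "\<nu> > 0" and \<gamma>: "\<gamma> > (0::real)"
  defines "\<sigma> \<equiv> \<nu> + real k / 2"
  shows "(\<lambda>n. real (sum_squares_count k (Suc n)) * (real (Suc n) + \<gamma>) powr (- \<sigma>)) sums
           (\<Sum>n. real (sum_squares_count k (Suc n)) * (real (Suc n) + \<gamma>) powr (- \<sigma>))" (is ?A)
    and "(\<lambda>n. real (sum_squares_count k (Suc n)) * ((pi * real (Suc n)) powr \<nu> * macdonald_real \<nu> (pi\<^sup>2 * real (Suc n) * \<gamma>))) sums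
          (Gamma \<sigma> * pi powr (- \<sigma>) * (\<gamma> powr (- \<sigma>) + (\<Sum>n. real (sum_squares_count k (Suc n)) * (real (Suc n) + \<gamma>) powr (- \<sigma>))) -
           Gamma \<nu> * pi powr (- \<nu>) * \<gamma> powr (- \<nu>))" (is ?B)
proof -
  have \<sigma>: "\<sigma> > real k / 2" "\<sigma> > 0" using \<nu> by (auto simp: \<sigma>_def add_pos_nonneg)
  let ?r = "\<lambda>n. real (sum_squares_count k (Suc n))"
  let ?Bf = "\<lambda>v. theta_defect k v * exp (\<sigma> * v - pi * \<gamma> * exp v)"
  have hB: "integrable lborel ?Bf"
  proof (rule Bochner_Integration.integrable_bound)
    show "integrable lborel (\<lambda>v. theta_defect k v * exp (\<sigma> * v))"
      using has_bochner_integral_theta_defect[OF \<sigma>] by (simp add: has_bochner_integral_iff)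
    have "exp (\<sigma> * v - pi * \<gamma> * exp v) \<le> exp (\<sigma> * v)" for v using \<gamma> by simp
    thus "AE v in lborel. norm (?Bf v) \<le> norm (theta_defect k v * exp (\<sigma> * v))"
      using theta_defect_nonneg by (auto simp: abs_mult intro!: mult_left_mono)
  qed auto
  have tB: "has_bochner_integral lborel (\<lambda>v. ?r n * exp (\<sigma> * v - pi * (real (Suc n) + \<gamma>) * exp v))
              (?r n * (Gamma \<sigma> * (pi * (real (Suc n) + \<gamma>)) powr (- \<sigma>)))" for n
    using \<sigma> \<gamma> by (intro has_bochner_integral_mult_right has_bochner_integral_Gamma_log) (auto intro!: mult_pos_pos add_pos_pos simp del: of_nat_Suc)
  have sB: "(\<lambda>n. \<integral>v. ?r n * exp (\<sigma> * v - pi * (real (Suc n) + \<gamma>) * exp v) \<partial>lborel) sums (\<integral>v. ?Bf v \<partial>lborel)"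
  proof (rule sums_integral_nonneg[OF hB])
    fix v :: real
    have "(\<lambda>n. ?r n * exp (- pi * real (Suc n) * exp v) * exp (\<sigma> * v - pi * \<gamma> * exp v)) sums ?Bf v"
      by (intro sums_mult2 theta_defect_sums)
    moreover have "?r n * exp (- pi * real (Suc n) * exp v) * exp (\<sigma> * v - pi * \<gamma> * exp v) = ?r n * exp (\<sigma> * v - pi * (real (Suc n) + \<gamma>) * exp v)" for n
      by (simp only: mult.assoc exp_add [symmetric]) (simp add: algebra_simps)
    ultimately show "(\<lambda>n. ?r n * exp (\<sigma> * v - pi * (real (Suc n) + \<gamma>) * exp v)) sums ?Bf v" by (simp only:)
  qed auto
  have "(\<lambda>n. ?r n * (Gamma \<sigma> * (pi * (real (Suc n) + \<gamma>)) powr (- \<sigma>))) sums (\<integral>v. ?Bf v \<partial>lborel)"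
    using sB by (simp only: has_bochner_integral_integral_eq[OF tB])
  moreover have "?r n * (Gamma \<sigma> * (pi * (real (Suc n) + \<gamma>)) powr (- \<sigma>)) = Gamma \<sigma> * pi powr (- \<sigma>) * (?r n * (real (Suc n) + \<gamma>) powr (- \<sigma>))" for n
    using \<gamma> by (subst powr_mult) (auto simp: mult_ac)
  ultimately have sB': "(\<lambda>n. Gamma \<sigma> * pi powr (- \<sigma>) * (?r n * (real (Suc n) + \<gamma>) powr (- \<sigma>))) sums (\<integral>v. ?Bf v \<partial>lborel)"
    by (simp only:)
  have nz: "Gamma \<sigma> * pi powr (- \<sigma>) \<noteq> 0" using Gamma_real_pos[OF \<sigma>(2)] by simp
  have "summable (\<lambda>n. ?r n * (real (Suc n) + \<gamma>) powr (- \<sigma>))"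
    using sums_summable[OF sB'] nz by (simp only: summable_cmult_iff simp_thms)
  thus A: ?A by (rule summable_sums)
  have Bval: "(\<integral>v. ?Bf v \<partial>lborel) = Gamma \<sigma> * pi powr (- \<sigma>) * (\<Sum>n. ?r n * (real (Suc n) + \<gamma>) powr (- \<sigma>))"
    using sums_unique2[OF sB' sums_mult[OF A]] .
  let ?A' = "\<lambda>v. theta_defect k v * exp (- pi * \<gamma> * exp (- v) - \<nu> * v)"
  have "has_bochner_integral lborel (\<lambda>v. ?Bf v + exp (\<sigma> * v - pi * \<gamma> * exp v) - exp (\<nu> * v - pi * \<gamma> * exp v))
     ((\<integral>v. ?Bf v \<partial>lborel) + Gamma \<sigma> * (pi * \<gamma>) powr (- \<sigma>) - Gamma \<nu> * (pi * \<gamma>) powr (- \<nu>))"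
    using \<sigma> \<nu> \<gamma> hB by (intro has_bochner_integral_add has_bochner_integral_diff has_bochner_integral_Gamma_log has_bochner_integral_integrable) auto
  also have "(\<lambda>v. ?Bf v + exp (\<sigma> * v - pi * \<gamma> * exp v) - exp (\<nu> * v - pi * \<gamma> * exp v)) = (\<lambda>v. ?A' (0 + (-1) * v))"
  proof
    fix v :: real
    have "exp (\<sigma> * v - pi * \<gamma> * exp v) = exp (real k / 2 * v) * exp (\<nu> * v - pi * \<gamma> * exp v)"
      by (simp add: exp_add [symmetric] \<sigma>_def algebra_simps)
    moreover have "?A' (0 + (-1) * v) = theta_defect k (-v) * exp (\<nu> * v - pi * \<gamma> * exp v)" by (simp add: algebra_simps)
    ultimately show "?Bf v + exp (\<sigma> * v - pi * \<gamma> * exp v) - exp (\<nu> * v - pi * \<gamma> * exp v) = ?A' (0 + (-1) * v)"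
      unfolding theta_defect_inversion by (simp add: algebra_simps)
  qed
  finally have hA: "has_bochner_integral lborel ?A' ((\<integral>v. ?Bf v \<partial>lborel) + Gamma \<sigma> * (pi * \<gamma>) powr (- \<sigma>) - Gamma \<nu> * (pi * \<gamma>) powr (- \<nu>))"
    by (subst lborel_has_bochner_integral_real_affine_iff[of "-1" _ _ 0]) auto
  have sA: "(\<lambda>n. \<integral>v. ?r n * exp (- pi * real (Suc n) * exp v - pi * \<gamma> * exp (- v) - \<nu> * v) \<partial>lborel) sums (\<integral>v. ?A' v \<partial>lborel)"
  proof (rule sums_integral_nonneg)
    fix v :: real
    have "(\<lambda>n. ?r n * exp (- pi * real (Suc n) * exp v) * exp (- pi * \<gamma> * exp (- v) - \<nu> * v)) sums ?A' v"
      by (intro sums_mult2 theta_defect_sums)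
    moreover have "?r n * exp (- pi * real (Suc n) * exp v) * exp (- pi * \<gamma> * exp (- v) - \<nu> * v) = ?r n * exp (- pi * real (Suc n) * exp v - pi * \<gamma> * exp (- v) - \<nu> * v)" for n
      by (simp only: mult.assoc exp_add [symmetric]) (simp add: algebra_simps)
    ultimately show "(\<lambda>n. ?r n * exp (- pi * real (Suc n) * exp v - pi * \<gamma> * exp (- v) - \<nu> * v)) sums ?A' v" by (simp only:)
  qed (use hA in \<open>auto simp: has_bochner_integral_iff\<close>)
  have tA: "(\<integral>v. ?r n * exp (- pi * real (Suc n) * exp v - pi * \<gamma> * exp (- v) - \<nu> * v) \<partial>lborel) =
      ?r n * ((pi * real (Suc n)) powr \<nu> * macdonald_real \<nu> (pi\<^sup>2 * real (Suc n) * \<gamma>))" for n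
  proof -
    define c where "c = pi * real (Suc n)"
    have c: "c > 0" by (simp add: c_def)
    have "(\<integral>v. exp (- c * exp v - pi * \<gamma> * exp (- v) - \<nu> * v) \<partial>lborel) =
        \<bar>1\<bar> *\<^sub>R (\<integral>v. exp (- c * exp (- ln c + 1 * v) - pi * \<gamma> * exp (- (- ln c + 1 * v)) - \<nu> * (- ln c + 1 * v)) \<partial>lborel)"
      by (rule lborel_integral_real_affine) simp
    also have "\<dots> = (\<integral>v. c powr \<nu> * exp (- exp v - pi * c * \<gamma> * exp (- v) - \<nu> * v) \<partial>lborel)"
    proof -
      have "exp (- c * exp (- ln c + 1 * v) - pi * \<gamma> * exp (- (- ln c + 1 * v)) - \<nu> * (- ln c + 1 * v)) =
          c powr \<nu> * exp (- exp v - pi * c * \<gamma> * exp (- v) - \<nu> * v)" for v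
      proof -
        have "c * exp (- ln c + 1 * v) = exp v" using c by (simp add: exp_diff)
        moreover have "exp (- (- ln c + 1 * v)) = c * exp (- v)" using c by (simp add: exp_diff exp_minus divide_inverse)
        moreover have "c powr \<nu> = exp (\<nu> * ln c)" using c by (simp add: powr_def)
        ultimately show ?thesis
          by (simp only: exp_add [symmetric] mult_minus_left) (simp add: algebra_simps)
      qed
      thus ?thesis by simp
    qed
    finally have "(\<integral>v. exp (- c * exp v - pi * \<gamma> * exp (- v) - \<nu> * v) \<partial>lborel) = c powr \<nu> * macdonald_real \<nu> (pi * c * \<gamma>)"
      by (simp add: macdonald_real_def)
    thus ?thesis by (simp add: c_def power2_eq_square mult.assoc del: of_nat_Suc)
  qed
  have "(\<integral>v. ?A' v \<partial>lborel) = Gamma \<sigma> * pi powr (- \<sigma>) * (\<gamma> powr (- \<sigma>) + (\<Sum>n. ?r n * (real (Suc n) + \<gamma>) powr (- \<sigma>))) -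
           Gamma \<nu> * pi powr (- \<nu>) * \<gamma> powr (- \<nu>)"
    unfolding has_bochner_integral_integral_eq[OF hA] Bval using \<gamma> by (simp add: powr_mult algebra_simps)
  thus ?B using sA unfolding tA by (simp only:)
qed

text \<open>
All terms of both series are nonnegative, so integrating over \<open>x\<close> commutes with summation; boundedness of
\<open>\<Sum> r\<^sub>k(n) (n + \<gamma>)\<^bsup>-\<sigma>\<^esup>\<close> by its value at \<open>\<gamma> = 0\<close> makes everything integrable.
\<close>

lemma averaged_identity:
  fixes \<nu> a b :: real and k :: nat
  assumes \<nu>: "\<nu> > 1/2" and ab: "a > 0" "b > 0"
  defines "\<sigma> \<equiv> \<nu> + real k / 2"
  defines "A \<equiv> \<lambda>n. sphere_integral_real \<nu> (\<lambda>x. (real (Suc n) + segment_point a b x) powr (- \<sigma>))"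
  shows "summable (\<lambda>n. real (sum_squares_count k (Suc n)) * A n)" (is ?A)
    and "(\<lambda>n. real (sum_squares_count k (Suc n)) * ((pi * real (Suc n)) powr \<nu> *
             sphere_integral_real \<nu> (\<lambda>x. macdonald_real \<nu> (pi\<^sup>2 * real (Suc n) * segment_point a b x)))) sums
          (Gamma \<sigma> * pi powr (- \<sigma>) * (sphere_integral_real \<nu> (\<lambda>x. segment_point a b x powr (- \<sigma>)) +
             (\<Sum>n. real (sum_squares_count k (Suc n)) * A n)) -
           Gamma \<nu> * pi powr (- \<nu>) * sphere_integral_real \<nu> (\<lambda>x. segment_point a b x powr (- \<nu>)))" (is ?B)
proof -
  let ?r = "\<lambda>n. real (sum_squares_count k (Suc n))" and ?g = "segment_point a b"
  let ?I = "\<lambda>f x. indicator {-1..1} x * (sphere_weight \<nu> x * f x) :: real"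
  have \<nu>0: "\<nu> > 0" and \<sigma>: "\<sigma> > real k / 2" "\<sigma> > 0" using \<nu> by (auto simp: \<sigma>_def add_pos_nonneg)
  note gpos = segment_point_pos[OF ab]
  have [measurable]: "?g \<in> borel_measurable borel" unfolding segment_point_def by measurable
  define Z where "Z = (\<lambda>x. \<Sum>n. ?r n * (real (Suc n) + ?g x) powr (- \<sigma>))"
  have [measurable]: "Z \<in> borel_measurable borel" unfolding Z_def by measurable
  have Zs: "(\<lambda>n. ?r n * (real (Suc n) + ?g x) powr (- \<sigma>)) sums Z x" if "x \<in> {-1..1}" for x
    using diagonal_identity(1)[OF \<nu>0 gpos[OF that], of k] by (simp add: Z_def \<sigma>_def)
  define Zm where "Zm = (\<Sum>n. ?r n * real (Suc n) powr (- \<sigma>))"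
  have Zle: "0 \<le> Z x" "Z x \<le> Zm" if x: "x \<in> {-1..1}" for x
  proof -
    show "0 \<le> Z x" by (rule sums_le[OF _ sums_zero Zs[OF x]]) auto
    have "(real (Suc n) + ?g x) powr (- \<sigma>) \<le> real (Suc n) powr (- \<sigma>)" for n
      using gpos[OF x] \<sigma> by (intro powr_mono2') auto
    thus "Z x \<le> Zm"
      unfolding Zm_def
      by (intro sums_le[OF _ Zs[OF x] summable_sums[OF summable_sum_squares_count[OF \<sigma>]]] mult_left_mono of_nat_0_le_iff)
  qed
  have iZ: "integrable lborel (?I Z)"
  proof (rule Bochner_Integration.integrable_bound[OF sphere_integrable_real[OF \<nu>, of "\<lambda>_. Zm"]])
    show "AE x in lborel. norm (?I Z x) \<le> norm (?I (\<lambda>_. Zm) x)"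
      using Zle sphere_weight_nonneg[of \<nu>]
      by (intro AE_I2) (auto simp: indicator_def abs_mult intro!: mult_left_mono order.trans[OF Zle(2) abs_ge_self])
  qed auto
  have "(\<lambda>n. \<integral>x. ?I (\<lambda>x. ?r n * (real (Suc n) + ?g x) powr (- \<sigma>)) x \<partial>lborel) sums (\<integral>x. ?I Z x \<partial>lborel)"
  proof (rule sums_integral_nonneg[OF iZ])
    fix x :: real
    show "(\<lambda>n. ?I (\<lambda>x. ?r n * (real (Suc n) + ?g x) powr (- \<sigma>)) x) sums ?I Z x"
      using Zs[of x] by (cases "x \<in> {-1..1}") (auto intro!: sums_mult)
  qed (auto simp: sphere_weight_nonneg)
  moreover have pull: "(\<integral>x. ?I (\<lambda>x. c * f x) x \<partial>lborel) = c * sphere_integral_real \<nu> f" for c f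
    unfolding sphere_integral_real_def by (simp only: mult.left_commute[of _ c] integral_mult_right_zero)
  ultimately have sZ: "(\<lambda>n. ?r n * A n) sums (\<integral>x. ?I Z x \<partial>lborel)"
    unfolding A_def by (simp only:)
  thus ?A by (rule sums_summable)
  have eZ: "(\<integral>x. ?I Z x \<partial>lborel) = (\<Sum>n. ?r n * A n)" using sZ by (rule sums_unique)
  define R where "R = (\<lambda>x. Gamma \<sigma> * pi powr (- \<sigma>) * (?g x powr (- \<sigma>) + Z x) - Gamma \<nu> * pi powr (- \<nu>) * ?g x powr (- \<nu>))"
  have hb: "has_bochner_integral lborel (?I (\<lambda>x. ?g x powr p)) (sphere_integral_real \<nu> (\<lambda>x. ?g x powr p))" for p
    using sphere_integrable_real[OF \<nu> continuous_on_powr_segment_point[OF ab]]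
    by (simp add: has_bochner_integral_iff sphere_integral_real_def)
  have "has_bochner_integral lborel (\<lambda>x. Gamma \<sigma> * pi powr (- \<sigma>) * (?I (\<lambda>x. ?g x powr (- \<sigma>)) x + ?I Z x) -
          Gamma \<nu> * pi powr (- \<nu>) * ?I (\<lambda>x. ?g x powr (- \<nu>)) x)
      (Gamma \<sigma> * pi powr (- \<sigma>) * (sphere_integral_real \<nu> (\<lambda>x. ?g x powr (- \<sigma>)) + (\<Sum>n. ?r n * A n)) -
           Gamma \<nu> * pi powr (- \<nu>) * sphere_integral_real \<nu> (\<lambda>x. ?g x powr (- \<nu>)))"
    using iZ eZ by (intro has_bochner_integral_add has_bochner_integral_diff has_bochner_integral_mult_right hb)
      (simp add: has_bochner_integral_iff)
  moreover have "(\<lambda>x. Gamma \<sigma> * pi powr (- \<sigma>) * (?I (\<lambda>x. ?g x powr (- \<sigma>)) x + ?I Z x) -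
          Gamma \<nu> * pi powr (- \<nu>) * ?I (\<lambda>x. ?g x powr (- \<nu>)) x) = ?I R"
    unfolding R_def by (rule ext) (simp add: algebra_simps)
  ultimately have hR: "has_bochner_integral lborel (?I R)
      (Gamma \<sigma> * pi powr (- \<sigma>) * (sphere_integral_real \<nu> (\<lambda>x. ?g x powr (- \<sigma>)) + (\<Sum>n. ?r n * A n)) -
           Gamma \<nu> * pi powr (- \<nu>) * sphere_integral_real \<nu> (\<lambda>x. ?g x powr (- \<nu>)))"
    by (simp only:)
  have [measurable]: "macdonald_real \<nu> \<in> borel_measurable borel"
    unfolding macdonald_real_def by (rule lborel.borel_measurable_lebesgue_integral) measurable
  have mnn: "macdonald_real \<nu> y \<ge> 0" for y unfolding macdonald_real_def by (rule Bochner_Integration.integral_nonneg) auto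
  have "(\<lambda>n. \<integral>x. ?I (\<lambda>x. (?r n * (pi * real (Suc n)) powr \<nu>) * macdonald_real \<nu> (pi\<^sup>2 * real (Suc n) * ?g x)) x \<partial>lborel) sums (\<integral>x. ?I R x \<partial>lborel)"
  proof (rule sums_integral_nonneg)
    fix x :: real
    show "(\<lambda>n. ?I (\<lambda>x. (?r n * (pi * real (Suc n)) powr \<nu>) * macdonald_real \<nu> (pi\<^sup>2 * real (Suc n) * ?g x)) x) sums ?I R x"
    proof (cases "x \<in> {-1..1}")
      case True
      have "(\<lambda>n. ?r n * ((pi * real (Suc n)) powr \<nu> * macdonald_real \<nu> (pi\<^sup>2 * real (Suc n) * ?g x))) sums R x"
        using diagonal_identity(2)[OF \<nu>0 gpos[OF True], of k] by (simp add: R_def Z_def \<sigma>_def)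
      thus ?thesis using True by (auto intro!: sums_mult simp: mult.assoc)
    qed auto
  qed (use hR mnn in \<open>auto simp: has_bochner_integral_iff sphere_weight_nonneg\<close>)
  thus ?B unfolding pull has_bochner_integral_integral_eq[OF hR] by (simp only: mult.assoc)
qed

section \<open>The identity for real parameters near the diagonal\<close>

text \<open>
The hypergeometric part of the summand on the right-hand side of the theorem, for roots \<open>a\<close>, \<open>b\<close> in place of \<open>\<surd>(n + \<alpha>)\<close>, \<open>\<surd>(n + \<beta>)\<close>, divided by
\<open>(a\<^sup>2 - b\<^sup>2)\<^sup>\<nu>\<close>; this factor does not depend on \<open>n\<close>.
\<close>

definition hyp_kernel :: "nat \<Rightarrow> complex \<Rightarrow> complex \<Rightarrow> complex \<Rightarrow> complex" where
  "hyp_kernel k \<nu> a b = 1 / (a * b) * (a + b) powr (- 2 * \<nu>) * (1 / a + 1 / b) ^ (k - 2) *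
     hypergeo_2F1 (\<nu> + 1 - of_nat k / 2) (1 - of_nat k / 2) (\<nu> + 1) (((a - b) / (a + b))\<^sup>2)"

lemma continuous_on_quadratic_powr:
  fixes \<rho> p x :: real
  assumes "\<bar>\<rho>\<bar> < 1/4"
  shows "continuous_on {-1..1} (\<lambda>x. (1 + \<rho>\<^sup>2 + 2 * \<rho> * x) powr p)" "x \<in> {-1..1} \<Longrightarrow> 1 + \<rho>\<^sup>2 + 2 * \<rho> * x > 0"
proof -
  have *: "1 + \<rho>\<^sup>2 + 2 * \<rho> * x > 0" if "x \<in> {-1..1}" for x
    using Re_sphere_argument_pos[of "of_real \<rho>" x] that assms by simp
  thus "x \<in> {-1..1} \<Longrightarrow> 1 + \<rho>\<^sup>2 + 2 * \<rho> * x > 0" .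
  show "continuous_on {-1..1} (\<lambda>x. (1 + \<rho>\<^sup>2 + 2 * \<rho> * x) powr p)"
    by (intro continuous_intros) (use * in \<open>auto simp: less_imp_neq[symmetric]\<close>)
qed

lemma sphere_integral_segment_power:
  assumes "\<nu> > 1/2" and ab: "a > 0" "b > 0" "\<bar>a - b\<bar> < (a + b) / 4"
  shows "complex_of_real (sphere_integral_real \<nu> (\<lambda>x. segment_point a b x powr (- p))) =
           of_real (((a + b)\<^sup>2 / 4) powr (- p)) *
           sphere_integral \<nu> (\<lambda>x. (1 + (of_real ((a - b) / (a + b)))\<^sup>2 + 2 * of_real ((a - b) / (a + b)) * of_real x) powr (- of_real p))"
proof -
  define \<rho> where "\<rho> = (a - b) / (a + b)"
  have \<rho>: "\<bar>\<rho>\<bar> < 1/4" using ab by (simp add: \<rho>_def field_simps)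
  have "sphere_integral \<nu> (\<lambda>x. (1 + (of_real \<rho>)\<^sup>2 + 2 * of_real \<rho> * of_real x) powr (- of_real p)) =
        sphere_integral \<nu> (\<lambda>x. of_real ((1 + \<rho>\<^sup>2 + 2 * \<rho> * x) powr (- p)))"
    unfolding sphere_integral_def
  proof (rule integral_cong)
    fix x :: real assume "x \<in> {-1..1}"
    thus "of_real (sphere_weight \<nu> x) * (1 + (of_real \<rho>)\<^sup>2 + 2 * of_real \<rho> * of_real x) powr (- of_real p) =
          complex_of_real (sphere_weight \<nu> x) * of_real ((1 + \<rho>\<^sup>2 + 2 * \<rho> * x) powr (- p))"
      using powr_of_real[of "1 + \<rho>\<^sup>2 + 2 * \<rho> * x" "- p"] continuous_on_quadratic_powr(2)[OF \<rho>, of x] by simp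
  qed
  also have "\<dots> = of_real (sphere_integral_real \<nu> (\<lambda>x. (1 + \<rho>\<^sup>2 + 2 * \<rho> * x) powr (- p)))"
    by (rule sphere_integral_of_real[OF assms(1) continuous_on_quadratic_powr(1)[OF \<rho>]])
  finally have e: "sphere_integral \<nu> (\<lambda>x. (1 + (of_real \<rho>)\<^sup>2 + 2 * of_real \<rho> * of_real x) powr (- of_real p)) =
      complex_of_real (sphere_integral_real \<nu> (\<lambda>x. (1 + \<rho>\<^sup>2 + 2 * \<rho> * x) powr (- p)))" .
  have "sphere_integral_real \<nu> (\<lambda>x. segment_point a b x powr (- p)) =
      ((a + b)\<^sup>2 / 4) powr (- p) * sphere_integral_real \<nu> (\<lambda>x. (1 + \<rho>\<^sup>2 + 2 * \<rho> * x) powr (- p))"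
  proof -
    have "indicator {-1..1} x * (sphere_weight \<nu> x * segment_point a b x powr (- p)) =
        ((a + b)\<^sup>2 / 4) powr (- p) * (indicator {-1..1} x * (sphere_weight \<nu> x * (1 + \<rho>\<^sup>2 + 2 * \<rho> * x) powr (- p)))" for x
    proof (cases "x \<in> {-1..1}")
      case True
      have "segment_point a b x = ((a + b)\<^sup>2 / 4) * (1 + \<rho>\<^sup>2 + 2 * \<rho> * x)"
        using segment_point_eq[of a b x] ab by (simp add: \<rho>_def)
      hence "segment_point a b x powr (- p) = ((a + b)\<^sup>2 / 4) powr (- p) * (1 + \<rho>\<^sup>2 + 2 * \<rho> * x) powr (- p)"
        using continuous_on_quadratic_powr(2)[OF \<rho> True] by (simp only:) (subst powr_mult, auto)
      thus ?thesis by simp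
    qed auto
    thus ?thesis unfolding sphere_integral_real_def by (simp only: integral_mult_right_zero)
  qed
  thus ?thesis unfolding \<rho>_def [symmetric] e by (simp only: of_real_mult)
qed

lemma hyp_kernel_average:
  assumes \<nu>: "\<nu> > 1/2" and k: "k \<ge> 2" and ab: "a > 0" "b > 0" "\<bar>a - b\<bar> < (a + b) / 4"
  shows "complex_of_real (sphere_integral_real \<nu> (\<lambda>x. segment_point a b x powr (- (\<nu> + real k / 2)))) =
           of_real (sphere_integral_real \<nu> (\<lambda>_. 1) * 2 powr (2 * \<nu> + 2 - real k)) * hyp_kernel k (of_real \<nu>) (of_real a) (of_real b)"
proof -
  obtain j where j: "k = Suc (Suc j)" using k by (metis Suc_le_D numeral_2_eq_2 Suc_le_mono)
  define s where "s = a + b"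
  have s: "s > 0" using ab by (simp add: s_def)
  define \<rho> where "\<rho> = (a - b) / s"
  have \<rho>: "\<bar>\<rho>\<bar> < 1/4" using ab by (simp add: \<rho>_def s_def field_simps)
  define F where "F = hypergeo_2F1 (of_real \<nu> + 1 - of_nat k / 2) (1 - of_nat k / 2) (of_real \<nu> + 1) ((of_real \<rho>)\<^sup>2)"
  define J where "J = sphere_integral \<nu> (\<lambda>x. (1 + (of_real \<rho>)\<^sup>2 + 2 * of_real \<rho> * of_real x) powr (- of_real (\<nu> + real k / 2)))"
  define W where "W = sphere_integral_real \<nu> (\<lambda>_. 1)"
  have q: "1 - \<rho>\<^sup>2 = 4 * (a * b) / s\<^sup>2"
    using s by (simp add: \<rho>_def power2_eq_square field_simps) (simp add: s_def algebra_simps)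
  have J: "(1 - (of_real \<rho>)\<^sup>2) ^ (k - 1) * J = of_real W * F"
  proof -
    have "sphere_integral \<nu> (\<lambda>_. 1) = of_real W"
      using sphere_integral_of_real[OF \<nu>, of "\<lambda>_. 1"] by (simp add: W_def)
    moreover have "of_real (\<nu> + real k / 2) = of_real \<nu> + (of_nat k / 2 :: complex)" by simp
    ultimately show ?thesis
      using power_sphere_average[OF \<nu> k, of "of_real \<rho>"] \<rho> unfolding J_def F_def by (simp only:) simp
  qed
  have Jr: "of_real ((1 - \<rho>\<^sup>2) ^ (k - 1)) * J = of_real W * F" using J by simp
  have "1 - \<rho>\<^sup>2 \<noteq> 0" using q ab s by simp
  hence "(1 - \<rho>\<^sup>2) ^ (k - 1) \<noteq> 0" by simp
  hence J': "J = of_real (W / (1 - \<rho>\<^sup>2) ^ (k - 1)) * F"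
    using Jr
  proof -
    have "J = of_real (W / X) * F" if "X \<noteq> 0" "of_real X * J = of_real W * F" for X :: real
      using that by (simp add: nonzero_eq_divide_eq mult.commute)
    thus ?thesis using \<open>(1 - \<rho>\<^sup>2) ^ (k - 1) \<noteq> 0\<close> Jr by blast
  qed
  have pw: "(s\<^sup>2 / 4) powr (- (\<nu> + real k / 2)) / (1 - \<rho>\<^sup>2) ^ (k - 1) =
      2 powr (2 * \<nu> + 2 - real k) * (1 / (a * b) * s powr (- 2 * \<nu>) * (1 / a + 1 / b) ^ (k - 2))"
  proof -
    have "s\<^sup>2 / 4 = (s / 2) powr 2" using s by (simp add: powr_numeral power2_eq_square)
    hence "(s\<^sup>2 / 4) powr (- (\<nu> + real k / 2)) = (s / 2) powr (- 2 * \<nu> - real k)"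
      by (simp add: powr_powr algebra_simps)
    also have "\<dots> = (s / 2) powr (- 2 * \<nu>) / (s / 2) ^ k"
      using s by (simp add: powr_diff powr_realpow)
    also have "(s / 2) powr (- 2 * \<nu>) = s powr (- 2 * \<nu>) * 2 powr (2 * \<nu>)"
    proof -
      have "(s / 2) powr (- q) = s powr (- q) * 2 powr q" for q :: real
        using s by (simp add: powr_divide powr_minus_divide)
      from this[of "2 * \<nu>"] show ?thesis by (simp only: mult_minus_left)
    qed
    finally have 1: "(s\<^sup>2 / 4) powr (- (\<nu> + real k / 2)) = s powr (- 2 * \<nu>) * 2 powr (2 * \<nu>) / (s / 2) ^ k" .
    have "(2::real) powr (2 * \<nu> + 2 - real k) = 2 powr (2 * \<nu> - real j)" by (simp add: j)
    also have "\<dots> = 2 powr (2 * \<nu>) / 2 ^ j" by (simp add: powr_diff powr_realpow)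
    finally have 2: "2 powr (2 * \<nu> + 2 - real k) = 2 powr (2 * \<nu>) / 2 ^ j" .
    have 3: "1 / a + 1 / b = s / (a * b)" using ab by (simp add: s_def field_simps)
    define m where "m = a * b"
    have m: "m > 0" using ab by (simp add: m_def)
    have "1 / (s / 2) ^ k / (4 * m / s\<^sup>2) ^ Suc j = 1 / 2 ^ j * (1 / m * (s / m) ^ j)"
    proof -
      have "1 / (s / 2) ^ k / (4 * m / s\<^sup>2) ^ Suc j = (1 / (s / 2) / (4 * m / s\<^sup>2)) ^ j * (1 / (s / 2)\<^sup>2 / (4 * m / s\<^sup>2))"
      proof -
        have "1 / X ^ Suc (Suc j) / Y ^ Suc j = (1 / X / Y) ^ j * (1 / X\<^sup>2 / Y)" for X Y :: real
          by (simp add: power_divide power_mult_distrib power2_eq_square mult_ac)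
        thus ?thesis unfolding j .
      qed
      also have "1 / (s / 2)\<^sup>2 / (4 * m / s\<^sup>2) = 1 / m" using s m by (simp add: power_divide)
      also have "1 / (s / 2) / (4 * m / s\<^sup>2) = s / m / 2" using s m by (simp add: power2_eq_square)
      finally show ?thesis by (simp add: power_divide)
    qed
    note 4 = this
    have 5: "S * T / p / q = T / u * (1 / m * S * v)" if "1 / p / q = 1 / u * (1 / m * v)" for S T p q u v :: real
    proof -
      have "S * T / p / q = S * T * (1 / p / q)" by simp
      thus ?thesis unfolding that by simp
    qed
    have 6: "k - 1 = Suc j" "k - 2 = j" by (simp_all add: j)
    show ?thesis unfolding 1 2 3 q m_def [symmetric] 6 by (rule 5[OF 4])
  qed
  have "complex_of_real (sphere_integral_real \<nu> (\<lambda>x. segment_point a b x powr (- (\<nu> + real k / 2)))) =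
      of_real ((s\<^sup>2 / 4) powr (- (\<nu> + real k / 2))) * J"
    using sphere_integral_segment_power[OF \<nu> ab, of "\<nu> + real k / 2"] unfolding s_def [symmetric] \<rho>_def [symmetric] J_def .
  also have "\<dots> = of_real (W * ((s\<^sup>2 / 4) powr (- (\<nu> + real k / 2)) / (1 - \<rho>\<^sup>2) ^ (k - 1))) * F"
    unfolding J' by simp
  also have "\<dots> = of_real (W * 2 powr (2 * \<nu> + 2 - real k)) * (of_real (1 / (a * b) * s powr (- 2 * \<nu>) * (1 / a + 1 / b) ^ (k - 2)) * F)"
    unfolding pw by simp
  also have "of_real (1 / (a * b) * s powr (- 2 * \<nu>) * (1 / a + 1 / b) ^ (k - 2)) * F = hyp_kernel k (of_real \<nu>) (of_real a) (of_real b)"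
  proof -
    have "complex_of_real (s powr (- 2 * \<nu>)) = (of_real a + of_real b) powr (- 2 * of_real \<nu>)"
      using powr_of_real[of s "- 2 * \<nu>"] s by (simp add: s_def)
    moreover have "(complex_of_real \<rho>)\<^sup>2 = ((of_real a - of_real b) / (of_real a + of_real b))\<^sup>2"
      by (simp add: \<rho>_def s_def)
    ultimately show ?thesis unfolding hyp_kernel_def F_def by simp
  qed
  finally show ?thesis by (simp add: W_def)
qed

text \<open>
The summand on the left-hand side divided by \<open>(a\<^sup>2 - b\<^sup>2)\<^sup>\<nu>\<close>, with \<open>K\<close> as an integral. It has no branch in \<open>a - b\<close>.
\<close>

definition bessel_product_term :: "nat \<Rightarrow> complex \<Rightarrow> complex \<Rightarrow> complex \<Rightarrow> nat \<Rightarrow> complex" where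
  "bessel_product_term k \<nu> a b n = of_nat (sum_squares_count k (Suc n)) *
     (of_real (pi * sqrt (real (Suc n)) / 2) powr \<nu> *
      bessel_series \<nu> (of_real (pi\<^sup>2 * real (Suc n)) * (a - b)\<^sup>2 / 4) *
      (a + b) powr (- \<nu>) * bessel_K_integral \<nu> (of_real (pi * sqrt (real (Suc n))) * (a + b)))"

definition kernel_const :: "nat \<Rightarrow> complex \<Rightarrow> complex" where
  "kernel_const k \<nu> = Gamma (\<nu> + of_nat k / 2) / (of_real pi powr (of_nat k / 2) * 2 ^ (k - 1) * Gamma (\<nu> + 1))"

definition kernel_term :: "nat \<Rightarrow> complex \<Rightarrow> complex \<Rightarrow> complex \<Rightarrow> nat \<Rightarrow> complex" where
  "kernel_term k \<nu> a b n = of_nat (sum_squares_count k (Suc n)) *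
     (hyp_kernel k \<nu> (csqrt (of_nat (Suc n) + a\<^sup>2)) (csqrt (of_nat (Suc n) + b\<^sup>2)) -
      2 powr (of_nat k - 2 - 2 * \<nu>) / of_nat (Suc n) powr (\<nu> + of_nat k / 2))"

definition zeta_term :: "nat \<Rightarrow> complex \<Rightarrow> complex" where
  "zeta_term k \<nu> = 2 powr (- 2 * \<nu> - 1) * Gamma (\<nu> + of_nat k / 2) /
     (of_real pi powr (of_nat k / 2) * Gamma (\<nu> + 1)) * sum_squares_zeta k (\<nu> + of_nat k / 2)"

lemma bessel_product_term_average:
  fixes \<nu> a b :: real
  assumes \<nu>: "\<nu> > 1/2" and ab: "a > 0" "b > 0" "\<bar>a - b\<bar> < (a + b) / 4"
  defines "W \<equiv> sphere_integral_real \<nu> (\<lambda>_. 1)"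
  shows "bessel_product_term k (of_real \<nu>) (of_real a) (of_real b) n =
     of_real ((pi / 4) powr \<nu> / (2 * W * Gamma (\<nu> + 1)) * (real (sum_squares_count k (Suc n)) * ((pi * real (Suc n)) powr \<nu> *
             sphere_integral_real \<nu> (\<lambda>x. macdonald_real \<nu> (pi\<^sup>2 * real (Suc n) * segment_point a b x)))))"
proof -
  define N where "N = real (Suc n)"
  have N: "N > 0" by (simp add: N_def)
  define s where "s = a + b"
  have s: "s > 0" using ab by (simp add: s_def)
  define \<rho> where "\<rho> = (a - b) / s"
  have \<rho>: "\<bar>\<rho>\<bar> < 1/4" using ab by (simp add: \<rho>_def s_def field_simps)
  define y0 where "y0 = pi\<^sup>2 * N * s\<^sup>2 / 4"
  have y0: "y0 > 0" using N s by (simp add: y0_def)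
  define S where "S = sphere_integral_real \<nu> (\<lambda>x. macdonald_real \<nu> (pi\<^sup>2 * N * segment_point a b x))"
  define M where "M = macdonald_real \<nu> y0"
  define B where "B = bessel_series (of_real \<nu>) (of_real (pi\<^sup>2 * N) * (of_real a - of_real b)\<^sup>2 / 4)"
  have W: "W > 0" unfolding W_def by (rule sphere_integral_real_1_pos[OF \<nu>])
  have G: "Gamma (\<nu> + 1) > 0" using \<nu> by (intro Gamma_real_pos) auto
  have "complex_of_real S = sphere_integral \<nu> (\<lambda>x. of_real (macdonald_real \<nu> (pi\<^sup>2 * N * segment_point a b x)))"
    unfolding S_def using ab N
    by (intro sphere_integral_of_real[symmetric] \<nu> continuous_on_macdonald_segment_point) auto
  also have "\<dots> = sphere_integral \<nu> (\<lambda>x. macdonald \<nu> (of_real y0 * (1 + (of_real \<rho>)\<^sup>2 + 2 * of_real \<rho> * of_real x)))"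
  proof -
    have "pi\<^sup>2 * N * segment_point a b x = y0 * (1 + \<rho>\<^sup>2 + 2 * \<rho> * x)" for x
      using segment_point_eq[of a b x] s by (simp add: s_def \<rho>_def y0_def)
    hence "complex_of_real (macdonald_real \<nu> (pi\<^sup>2 * N * segment_point a b x)) =
        macdonald \<nu> (of_real y0 * (1 + (of_real \<rho>)\<^sup>2 + 2 * of_real \<rho> * of_real x))" for x
      unfolding macdonald_of_real [symmetric] by simp
    thus ?thesis by (simp only:)
  qed
  also have "\<dots> = sphere_integral \<nu> (\<lambda>_. 1) * macdonald \<nu> (of_real y0) * Gamma (of_real \<nu> + 1) * bessel_series (of_real \<nu>) (of_real y0 * (of_real \<rho>)\<^sup>2)"
    using \<rho> by (intro macdonald_sphere_average \<nu> y0) simp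
  also have "of_real y0 * (of_real \<rho>)\<^sup>2 = of_real (pi\<^sup>2 * N) * (complex_of_real a - of_real b)\<^sup>2 / 4"
  proof -
    have "y0 * \<rho>\<^sup>2 = pi\<^sup>2 * N * (a - b)\<^sup>2 / 4" using s by (simp add: y0_def \<rho>_def power_divide)
    hence "complex_of_real (y0 * \<rho>\<^sup>2) = of_real (pi\<^sup>2 * N * (a - b)\<^sup>2 / 4)" by (simp only:)
    thus ?thesis by simp
  qed
  also have "sphere_integral \<nu> (\<lambda>_. 1) = complex_of_real W"
    using sphere_integral_of_real[OF \<nu>, of "\<lambda>_. 1"] by (simp add: W_def)
  also have "Gamma (complex_of_real \<nu> + 1) = of_real (Gamma (\<nu> + 1))"
    using Gamma_complex_of_real[of "\<nu> + 1"] by simp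
  finally have S: "complex_of_real S = of_real W * of_real M * of_real (Gamma (\<nu> + 1)) * B"
    unfolding macdonald_of_real M_def B_def .
  define p where "p = (pi * sqrt N / 2) powr \<nu>"
  have K: "bessel_K_integral (of_real \<nu>) (of_real (pi * sqrt N) * (of_real a + of_real b)) = of_real (p * s powr \<nu> * M / 2)"
  proof -
    have "pi * sqrt N * s > 0" using N s by simp
    note bessel_K_integral_of_real[OF this, of \<nu>]
    moreover have "(pi * sqrt N * s)\<^sup>2 / 4 = y0" using N by (simp add: y0_def power_mult_distrib)
    moreover have "(pi * sqrt N * s / 2) powr \<nu> = p * s powr \<nu>"
    proof -
      have "(x * s / 2) powr \<nu> = (x / 2) powr \<nu> * s powr \<nu>" if "x > 0" for x
        using powr_mult[of "x / 2" s \<nu>] that s by simp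
      thus ?thesis unfolding p_def using N by simp
    qed
    moreover have "complex_of_real (pi * sqrt N * s) = of_real (pi * sqrt N) * (of_real a + of_real b)" by (simp add: s_def)
    ultimately show ?thesis unfolding M_def by (simp only:)
  qed
  have P1: "complex_of_real (pi * sqrt N / 2) powr of_real \<nu> = of_real p"
    unfolding p_def using N by (intro powr_of_real) simp
  have P2: "(complex_of_real a + of_real b) powr (- of_real \<nu>) = of_real (s powr (- \<nu>))"
    using powr_of_real[of s "- \<nu>"] s by (simp add: s_def)
  have pp: "p * p = (pi / 4) powr \<nu> * (pi * N) powr \<nu>"
  proof -
    have "p * p = (pi * sqrt N / 2 * (pi * sqrt N / 2)) powr \<nu>" unfolding p_def by (rule powr_mult[symmetric])
    also have "pi * sqrt N / 2 * (pi * sqrt N / 2) = pi / 4 * (pi * N)" using N by simp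
    also have "\<dots> powr \<nu> = (pi / 4) powr \<nu> * (pi * N) powr \<nu>" by (rule powr_mult)
    finally show ?thesis .
  qed
  have ss: "s powr (- \<nu>) * s powr \<nu> = 1" using s by (simp add: powr_minus)
  define R where "R = real (sum_squares_count k (Suc n))"
  have "bessel_product_term k (of_real \<nu>) (of_real a) (of_real b) n =
     of_real R * (of_real p * B * of_real (s powr (- \<nu>)) * of_real (p * s powr \<nu> * M / 2))"
    unfolding bessel_product_term_def N_def [symmetric] K P1 P2 B_def R_def of_real_of_nat_eq by (rule refl)
  also have "\<dots> = of_real (R * ((p * p) * (s powr (- \<nu>) * s powr \<nu>)) / 2) * (of_real M * B)" by simp
  also have "of_real M * B = of_real S / of_real (W * Gamma (\<nu> + 1))" unfolding S using W G by simp
  also have "of_real (R * ((p * p) * (s powr (- \<nu>) * s powr \<nu>)) / 2) * (of_real S / of_real (W * Gamma (\<nu> + 1))) =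
      complex_of_real ((pi / 4) powr \<nu> / (2 * W * Gamma (\<nu> + 1)) * (R * ((pi * N) powr \<nu> * S)))"
    unfolding pp ss by (simp add: mult_ac)
  finally show ?thesis unfolding R_def S_def N_def .
qed

text \<open>
Adding \<open>n\<close> to all points of the segment from \<open>b\<^sup>2\<close> to \<open>a\<^sup>2\<close> gives a segment of the same kind, so the mean of \<open>(n + \<gamma>)\<^bsup>-\<sigma>\<^esup>\<close> is again a
hypergeometric value. The relative distance of the roots only decreases.
\<close>

lemma shifted_roots:
  fixes a b m :: real
  assumes "a > 0" "b > 0" "\<bar>a - b\<bar> < (a + b) / 4" "m \<ge> 0"
  defines "A \<equiv> sqrt (m + a\<^sup>2)" and "B \<equiv> sqrt (m + b\<^sup>2)"
  shows "A > 0" "B > 0" "\<bar>A - B\<bar> < (A + B) / 4" "m + segment_point a b x = segment_point A B x"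
proof -
  show A: "A > 0" and B: "B > 0" using assms by (auto simp: A_def B_def add_nonneg_pos)
  have q: "A\<^sup>2 = m + a\<^sup>2" "B\<^sup>2 = m + b\<^sup>2" using assms by (auto simp: A_def B_def)
  show "m + segment_point a b x = segment_point A B x"
    unfolding segment_point_def q by (simp add: field_simps)
  have "A \<ge> a" "B \<ge> b" using assms by (auto simp: A_def B_def real_le_rsqrt)
  hence "a + b \<le> A + B" by simp
  have e: "(A - B) * (A + B) = (a - b) * (a + b)" using q by (simp add: algebra_simps power2_eq_square)
  have "\<bar>A - B\<bar> * (A + B) = \<bar>a - b\<bar> * (a + b)"
    using arg_cong[OF e, of abs] A B assms(1,2) by (simp add: abs_mult)
  also have "\<dots> < (a + b) / 4 * (a + b)" using assms by (intro mult_strict_right_mono) auto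
  also have "\<dots> \<le> (A + B) / 4 * (A + B)" using \<open>a + b \<le> A + B\<close> assms by (intro mult_mono) auto
  finally show "\<bar>A - B\<bar> < (A + B) / 4" using A B by (simp add: mult_less_cancel_right)
qed

text \<open>
For \<open>\<nu> > 1/2\<close> the terms subtracted in \<open>kernel_term\<close> form a convergent series, which sums to the \<open>\<zeta>\<^sub>k\<close> term; the two cancel.
\<close>

theorem base_identity:
  fixes \<nu> a b :: real
  assumes \<nu>: "\<nu> > 1/2" and k: "k \<ge> 2" and ab: "a > 0" "b > 0" "\<bar>a - b\<bar> < (a + b) / 4"
  shows "(\<lambda>n. bessel_product_term k (of_real \<nu>) (of_real a) (of_real b) n) sums
     (- ((of_real a + of_real b) powr (- 2 * of_real \<nu>) / (2 * of_real \<nu>)) + zeta_term k (of_real \<nu>) +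
      kernel_const k (of_real \<nu>) * (hyp_kernel k (of_real \<nu>) (of_real a) (of_real b) +
        (\<Sum>n. kernel_term k (of_real \<nu>) (of_real a) (of_real b) n)))"
proof -
  let ?r = "\<lambda>n. real (sum_squares_count k (Suc n))"
  define \<sigma> where "\<sigma> = \<nu> + real k / 2"
  define W where "W = sphere_integral_real \<nu> (\<lambda>_. 1)"
  define D where "D = (pi / 4) powr \<nu> / (2 * W * Gamma (\<nu> + 1))"
  define s where "s = a + b"
  have s: "s > 0" using ab by (simp add: s_def)
  have W: "W > 0" unfolding W_def by (rule sphere_integral_real_1_pos[OF \<nu>])
  have G: "Gamma (\<nu> + 1) > 0" using \<nu> by (intro Gamma_real_pos) auto
  have \<sigma>: "\<sigma> > real k / 2" "\<sigma> > 0" using \<nu> by (auto simp: \<sigma>_def add_pos_nonneg)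
  define A where "A = (\<lambda>n. sphere_integral_real \<nu> (\<lambda>x. (real (Suc n) + segment_point a b x) powr (- \<sigma>)))"
  define H where "H = (\<lambda>n. hyp_kernel k (of_real \<nu>) (csqrt (of_nat (Suc n) + (of_real a)\<^sup>2)) (csqrt (of_nat (Suc n) + (of_real b)\<^sup>2)))"
  define S0 where "S0 = sphere_integral_real \<nu> (\<lambda>x. segment_point a b x powr (- \<sigma>))"
  define S1 where "S1 = sphere_integral_real \<nu> (\<lambda>x. segment_point a b x powr (- \<nu>))"
  define w where "w = W * 2 powr (2 * \<nu> + 2 - real k)"
  have w: "w > 0" using W by (simp add: w_def)
  have S0: "complex_of_real S0 = of_real w * hyp_kernel k (of_real \<nu>) (of_real a) (of_real b)"
    unfolding S0_def \<sigma>_def w_def W_def by (rule hyp_kernel_average[OF \<nu> k ab])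
  have A: "complex_of_real (A n) = of_real w * H n" for n
  proof -
    have m: "real (Suc n) \<ge> 0" by simp
    note sr = shifted_roots[OF ab m]
    have "csqrt (of_nat (Suc n) + (of_real x)\<^sup>2) = of_real (sqrt (real (Suc n) + x\<^sup>2))" for x
      using csqrt_of_real_nonneg[of "complex_of_real (real (Suc n) + x\<^sup>2)"] by simp
    hence "H n = hyp_kernel k (of_real \<nu>) (of_real (sqrt (real (Suc n) + a\<^sup>2))) (of_real (sqrt (real (Suc n) + b\<^sup>2)))"
      unfolding H_def by (simp only:)
    thus ?thesis unfolding A_def sr(4) \<sigma>_def w_def W_def using hyp_kernel_average[OF \<nu> k sr(1-3)] by (simp only:)
  qed
  have S1: "S1 = W * (s\<^sup>2 / 4) powr (- \<nu>)"
  proof -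
    have "of_real ((a - b) / (a + b)) \<in> ball (0::complex) (1/4)" using ab by (simp add: norm_divide field_simps del: of_real_divide of_real_add of_real_diff)
    from power_sphere_average_harmonic[OF \<nu> this]
    have "complex_of_real S1 = of_real ((s\<^sup>2 / 4) powr (- \<nu>)) * sphere_integral \<nu> (\<lambda>_. 1)"
      unfolding S1_def s_def sphere_integral_segment_power[OF \<nu> ab] by (simp only:)
    also have "sphere_integral \<nu> (\<lambda>_. 1) = complex_of_real W"
      using sphere_integral_of_real[OF \<nu>, of "\<lambda>_. 1"] by (simp add: W_def)
    finally have "complex_of_real S1 = complex_of_real (W * (s\<^sup>2 / 4) powr (- \<nu>))" by simp
    thus ?thesis by (simp only: of_real_eq_iff)
  qed
  have sA: "summable (\<lambda>n. ?r n * A n)"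
    unfolding A_def \<sigma>_def by (rule averaged_identity(1)[OF \<nu> ab(1,2)])
  define SA where "SA = (\<Sum>n. ?r n * A n)"
  define Q where "Q = pi powr (real k / 2)"
  have Q: "Q > 0" by (simp add: Q_def)
  define C where "C = Gamma \<sigma> / (Q * 2 ^ (k - 1) * Gamma (\<nu> + 1))"
  have C: "kernel_const k (of_real \<nu>) = of_real C"
  proof -
    have "complex_of_real \<nu> + of_nat k / 2 = of_real \<sigma>" "complex_of_real \<nu> + 1 = of_real (\<nu> + 1)" by (auto simp: \<sigma>_def)
    moreover have "of_real pi powr (of_nat k / 2) = complex_of_real Q"
      using powr_of_real[of pi "real k / 2"] by (simp add: Q_def)
    ultimately show ?thesis unfolding kernel_const_def C_def by (simp only: Gamma_complex_of_real) simp
  qed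
  have pi\<sigma>: "pi powr (- \<sigma>) = pi powr (- \<nu>) / Q" by (simp add: \<sigma>_def Q_def powr_diff)
  have p4: "(pi / 4) powr \<nu> * pi powr (- \<nu>) = 4 powr (- \<nu>)" by (simp add: powr_divide powr_minus_divide)
  have four: "(4::real) powr \<nu> = 2 powr (2 * \<nu>)" using powr_powr[of 2 2 \<nu>] by simp
  have c1: "D * (Gamma \<sigma> * pi powr (- \<sigma>)) * w = C"
  proof -
    have "(2::real) powr (2 * \<nu> + 2 - real k) = 2 powr (2 * \<nu> + (2 - real k))" by (simp only: add_diff_eq)
    also have "\<dots> = 4 powr \<nu> * 2 powr (2 - real k)" unfolding four by (rule powr_add)
    also have "(2::real) powr (2 - real k) = 2 powr (1 - real (k - 1))" using k by (simp add: of_nat_diff)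
    also have "\<dots> = 2 / 2 ^ (k - 1)" by (simp only: powr_diff powr_realpow) (simp add: powr_realpow)
    finally have 2: "2 powr (2 * \<nu> + 2 - real k) = 4 powr \<nu> * (2 / 2 ^ (k - 1))" .
    have "D * (Gamma \<sigma> * pi powr (- \<sigma>)) * w =
        ((pi / 4) powr \<nu> * pi powr (- \<nu>)) * 4 powr \<nu> * (Gamma \<sigma> / (Q * 2 ^ (k - 1) * Gamma (\<nu> + 1))) * (W / W)"
      unfolding D_def pi\<sigma> w_def 2 by (simp add: mult_ac)
    also have "\<dots> = C" unfolding p4 C_def using W by (simp add: powr_minus)
    finally show ?thesis .
  qed
  have c2: "D * (Gamma \<nu> * pi powr (- \<nu>) * S1) = s powr (- 2 * \<nu>) / (2 * \<nu>)"
  proof -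
    have "s\<^sup>2 = s powr 2" using s by (simp add: powr_numeral)
    hence "(s\<^sup>2) powr (- \<nu>) = s powr (2 * (- \<nu>))" by (simp only: powr_powr)
    hence "(s\<^sup>2 / 4) powr (- \<nu>) = s powr (- 2 * \<nu>) / 4 powr (- \<nu>)"
      by (simp add: powr_divide)
    moreover have "Gamma (\<nu> + 1) = \<nu> * Gamma \<nu>"
      using \<nu> by (intro Gamma_plus1) (auto elim!: nonpos_Ints_cases)
    moreover have "Gamma \<nu> > 0" using \<nu> by (intro Gamma_real_pos) auto
    moreover have "P / (2 * W * (\<nu> * g)) * (g * q * (W * (S / t))) = P * q / t * (S / (2 * \<nu>))"
      if "g > 0" for P g q S t :: real
      using that W by (simp add: mult_ac)
    ultimately have "D * (Gamma \<nu> * pi powr (- \<nu>) * S1) = ((pi / 4) powr \<nu> * pi powr (- \<nu>)) / 4 powr (- \<nu>) * (s powr (- 2 * \<nu>) / (2 * \<nu>))"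
      unfolding D_def S1 by (simp only:)
    thus ?thesis unfolding p4 by simp
  qed
  define E where "E = Gamma \<sigma> * pi powr (- \<sigma>)"
  have "(\<lambda>n. D * (?r n * ((pi * real (Suc n)) powr \<nu> *
             sphere_integral_real \<nu> (\<lambda>x. macdonald_real \<nu> (pi\<^sup>2 * real (Suc n) * segment_point a b x))))) sums
          (D * (E * (S0 + SA) - Gamma \<nu> * pi powr (- \<nu>) * S1))"
    unfolding SA_def E_def A_def S0_def S1_def \<sigma>_def by (rule sums_mult[OF averaged_identity(2)[OF \<nu> ab(1,2)]])
  hence "(\<lambda>n. complex_of_real (D * (?r n * ((pi * real (Suc n)) powr \<nu> *
             sphere_integral_real \<nu> (\<lambda>x. macdonald_real \<nu> (pi\<^sup>2 * real (Suc n) * segment_point a b x)))))) sums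
          of_real (D * (E * (S0 + SA) - Gamma \<nu> * pi powr (- \<nu>) * S1))"
    by (rule sums_of_real)
  hence main: "(\<lambda>n. bessel_product_term k (of_real \<nu>) (of_real a) (of_real b) n) sums
       of_real (D * (E * (S0 + SA) - Gamma \<nu> * pi powr (- \<nu>) * S1))"
    unfolding D_def W_def bessel_product_term_average[OF \<nu> ab, symmetric] .
  have cSA: "(\<lambda>n. of_nat (sum_squares_count k (Suc n)) * H n) sums (of_real SA / of_real w)"
  proof -
    have "(\<lambda>n. complex_of_real (?r n * A n)) sums of_real SA"
      unfolding SA_def by (intro sums_of_real summable_sums sA)
    hence "(\<lambda>n. complex_of_real (?r n * A n) / of_real w) sums (of_real SA / of_real w)" by (rule sums_divide)
    moreover have "complex_of_real (?r n * A n) / of_real w = of_nat (sum_squares_count k (Suc n)) * H n" for n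
      using w by (simp only: of_real_mult A) simp
    ultimately show ?thesis by (simp only:)
  qed
  define c where "c = 2 powr (of_nat k - 2 - 2 * complex_of_real \<nu>)"
  have "(\<lambda>n. of_nat (sum_squares_count k (Suc n)) / of_nat (Suc n) powr (of_real \<nu> + of_nat k / 2)) sums
         sum_squares_zeta k (of_real \<nu> + of_nat k / 2)"
  proof -
    have r: "Re (complex_of_real \<nu> + of_nat k / 2) = \<sigma>" by (simp add: \<sigma>_def)
    have "summable (\<lambda>n. of_nat (sum_squares_count k (Suc n)) / complex_of_nat (Suc n) powr (of_real \<nu> + of_nat k / 2))"
      by (rule summable_norm_cancel) (use summable_sum_squares_count[OF \<sigma>] in \<open>simp only: norm_sum_squares_dirichlet_term r\<close>)
    thus ?thesis using \<sigma> r by (simp add: sum_squares_zeta_eq sum_squares_dirichlet_def summable_sums)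
  qed
  from sums_diff[OF cSA sums_mult[OF this, of c]]
  have "(\<lambda>n. kernel_term k (of_real \<nu>) (of_real a) (of_real b) n) sums
      (of_real SA / of_real w - c * sum_squares_zeta k (of_real \<nu> + of_nat k / 2))"
    unfolding kernel_term_def H_def c_def [symmetric] by (simp add: algebra_simps)
  hence ks: "(\<Sum>n. kernel_term k (of_real \<nu>) (of_real a) (of_real b) n) =
      of_real SA / of_real w - c * sum_squares_zeta k (of_real \<nu> + of_nat k / 2)"
    by (simp add: sums_iff)
  have z: "kernel_const k (of_real \<nu>) * (c * sum_squares_zeta k (of_real \<nu> + of_nat k / 2)) = zeta_term k (of_real \<nu>)"
  proof -
    have "c = 2 powr (- 2 * of_real \<nu> - 1 + of_nat (k - 1))" unfolding c_def using k by (simp add: of_nat_diff algebra_simps)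
    also have "\<dots> = 2 powr (- 2 * of_real \<nu> - 1) * 2 ^ (k - 1)" unfolding powr_add by (simp add: powr_nat)
    finally have "c = 2 powr (- 2 * of_real \<nu> - 1) * 2 ^ (k - 1)" .
    thus ?thesis unfolding kernel_const_def zeta_term_def by simp
  qed
  have "complex_of_real (D * (E * (S0 + SA) - Gamma \<nu> * pi powr (- \<nu>) * S1)) =
      - of_real (D * (Gamma \<nu> * pi powr (- \<nu>) * S1)) + of_real (D * E * w) * (of_real S0 / of_real w + of_real SA / of_real w)"
  proof -
    have "x * (y * (p + q) - t) = - (x * t) + (x * y * u) * (p / u + q / u)" if "u \<noteq> 0" for x y p q t u :: complex
      using that by (simp add: field_simps)
    from this[of "of_real w" "of_real D" "of_real E" "of_real S0" "of_real SA" "of_real (Gamma \<nu> * pi powr (- \<nu>) * S1)"]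
    show ?thesis using w by simp
  qed
  also have "of_real (D * E * w) = kernel_const k (of_real \<nu>)" unfolding E_def c1 C ..
  also have "complex_of_real S0 / of_real w = hyp_kernel k (of_real \<nu>) (of_real a) (of_real b)"
    unfolding S0 using w by simp
  also have "complex_of_real SA / of_real w = (\<Sum>n. kernel_term k (of_real \<nu>) (of_real a) (of_real b) n) + c * sum_squares_zeta k (of_real \<nu> + of_nat k / 2)"
    unfolding ks by simp
  also have "complex_of_real (D * (Gamma \<nu> * pi powr (- \<nu>) * S1)) = (of_real a + of_real b) powr (- 2 * of_real \<nu>) / (2 * of_real \<nu>)"
    unfolding c2 using powr_of_real[of s "- 2 * \<nu>"] s by (simp add: s_def)
  finally have "complex_of_real (D * (E * (S0 + SA) - Gamma \<nu> * pi powr (- \<nu>) * S1)) =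
     - ((of_real a + of_real b) powr (- 2 * of_real \<nu>) / (2 * of_real \<nu>)) + zeta_term k (of_real \<nu>) +
      kernel_const k (of_real \<nu>) * (hyp_kernel k (of_real \<nu>) (of_real a) (of_real b) +
        (\<Sum>n. kernel_term k (of_real \<nu>) (of_real a) (of_real b) n))"
    unfolding z [symmetric] by (simp only: distrib_left add_ac)
  with main show ?thesis by (simp only:)
qed

section \<open>Bounds and holomorphy of the kernel\<close>

text \<open>
If the square were on the cut, the quotient would be real of modulus at least \<open>1\<close>, which contradicts positivity of the real
parts of \<open>a\<close> and \<open>b\<close>.
\<close>

lemma quotient_square_in_slit_plane:
  assumes "Re a > 0" "Re b > 0"
  shows "((a - b) / (a + b))\<^sup>2 \<in> slit_plane"
proof (rule ccontr)
  define \<rho> where "\<rho> = (a - b) / (a + b)"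
  assume "((a - b) / (a + b))\<^sup>2 \<notin> slit_plane"
  hence "Im (\<rho>\<^sup>2) = 0" "Re (\<rho>\<^sup>2) \<ge> 1" by (auto simp: slit_plane_def \<rho>_def)
  hence im: "Re \<rho> * Im \<rho> = 0" and re: "Re \<rho> * Re \<rho> - Im \<rho> * Im \<rho> \<ge> 1" by (auto simp: power2_eq_square)
  have "Im \<rho> = 0"
  proof (rule ccontr)
    assume "Im \<rho> \<noteq> 0"
    hence "Re \<rho> = 0" using im by simp
    thus False using re zero_le_square[of "Im \<rho>"] by simp
  qed
  define r where "r = Re \<rho>"
  have r: "\<rho> = of_real r" using \<open>Im \<rho> = 0\<close> by (simp add: complex_eq_iff r_def)
  have "r * r \<ge> 1" using re r by simp
  hence "r \<ge> 1 \<or> r \<le> -1" using abs_square_less_1[of r] by (auto simp: power2_eq_square abs_less_iff)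
  have "Re (a + b) > 0" using assms by simp
  hence "a + b \<noteq> 0" by force
  hence "a - b = of_real r * (a + b)" using r by (simp add: \<rho>_def field_simps)
  hence "Re (a - b) = Re (of_real r * (a + b))" by (rule arg_cong)
  hence "Re a - Re b = r * (Re a + Re b)" by simp
  hence "Re a * (1 - r) = Re b * (1 + r)" by (simp add: algebra_simps)
  note e = this
  from \<open>r \<ge> 1 \<or> r \<le> -1\<close> show False
  proof
    assume "r \<ge> 1"
    hence "Re a * (1 - r) \<le> 0" "Re b * (1 + r) > 0" using assms by (auto intro: mult_nonneg_nonpos mult_pos_pos)
    thus False using e by simp
  next
    assume "r \<le> -1"
    hence "Re b * (1 + r) \<le> 0" "Re a * (1 - r) > 0" using assms by (auto intro: mult_nonneg_nonpos mult_pos_pos)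
    thus False using e by simp
  qed
qed

lemma Re_csqrt_pos:
  assumes "z \<notin> \<real>\<^sub>\<le>\<^sub>0"
  shows "Re (csqrt z) > 0"
proof (rule ccontr)
  assume "\<not> Re (csqrt z) > 0"
  hence "Re (csqrt z) = 0" using csqrt_principal[of z] by auto
  hence "z = - of_real ((Im (csqrt z))\<^sup>2)"
    using power2_csqrt[of z] by (auto simp: complex_eq_iff power2_eq_square simp del: csqrt.sel power2_csqrt)
  thus False using assms by (metis complex_nonpos_Reals_iff Im_complex_of_real Re_complex_of_real neg_le_0_iff_le uminus_complex.simps zero_le_power2 neg_equal_0_iff_equal)
qed

lemma shifted_square_notin_nonpos_Reals:
  assumes "Re a > 0" "t \<ge> 0"
  shows "of_real t + a\<^sup>2 \<notin> \<real>\<^sub>\<le>\<^sub>0"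
proof
  assume "of_real t + a\<^sup>2 \<in> \<real>\<^sub>\<le>\<^sub>0"
  hence "Re a * Im a = 0" "t + (Re a * Re a - Im a * Im a) \<le> 0"
    by (auto simp: complex_nonpos_Reals_iff power2_eq_square)
  moreover have "Re a * Re a > 0" using assms by simp
  ultimately show False using assms by auto
qed

lemma Re_pos_neq_uminus_nat:
  assumes "Re c > 0"
  shows "c \<noteq> - of_nat n"
proof
  assume "c = - of_nat n"
  hence "Re c = - real n" by simp
  thus False using assms by simp
qed

text \<open>
The majorant is itself a hypergeometric series, with real positive parameters.
\<close>

lemma norm_hypergeo_coeff_le:
  assumes "norm a \<le> R" "norm b \<le> R" "Re c \<ge> \<delta>" "\<delta> > 0" "norm z \<le> x"
  shows "norm (hypergeo_coeff a b c n * z ^ n) \<le> norm (hypergeo_coeff (of_real R) (of_real R) (of_real \<delta>) n * of_real x ^ n)"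
proof -
  have R: "R \<ge> 0" and x: "x \<ge> 0" using assms order_trans[OF norm_ge_zero] by blast+
  have up: "norm (pochhammer a n) \<le> norm (pochhammer (complex_of_real R) n)" if "norm a \<le> R" for a :: complex
  proof -
    have "norm (\<Prod>i = 0..<n. a + of_nat i) \<le> (\<Prod>i = 0..<n. norm (complex_of_real R + of_nat i))"
      unfolding prod_norm [symmetric]
    proof (rule prod_mono, safe)
      fix i
      have "norm (a + of_nat i) \<le> R + real i" using norm_triangle_ineq[of a "of_nat i"] that by simp
      also have "\<dots> = norm (complex_of_real (R + real i))" using R by (simp only: norm_of_real)
      finally show "norm (a + of_nat i) \<le> norm (complex_of_real R + of_nat i)" by simp
    qed auto
    thus ?thesis by (simp add: pochhammer_prod prod_norm)
  qed
  have lo: "norm (pochhammer (complex_of_real \<delta>) n) \<le> norm (pochhammer c n)"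
    unfolding pochhammer_prod prod_norm [symmetric]
  proof (rule prod_mono, safe)
    fix i
    have "norm (complex_of_real (\<delta> + real i)) = \<delta> + real i" using assms by (simp only: norm_of_real)
    also have "\<dots> \<le> Re (c + of_nat i)" using assms by simp
    also have "\<dots> \<le> norm (c + of_nat i)" by (rule complex_Re_le_cmod)
    finally show "norm (complex_of_real \<delta> + of_nat i) \<le> norm (c + of_nat i)" by simp
  qed auto
  have pos: "norm (pochhammer (complex_of_real \<delta>) n) > 0"
  proof -
    have "complex_of_real \<delta> \<noteq> - of_nat m" for m
      using assms(4) by (intro Re_pos_neq_uminus_nat) simp
    thus ?thesis by (auto simp: pochhammer_eq_0_iff)
  qed
  have zp: "norm z ^ n \<le> x ^ n" using assms by (intro power_mono) auto
  have g: "(p * q / (r * f)) * y \<le> (p' * q' / (r' * f)) * y'"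
    if "0 \<le> p" "p \<le> p'" "0 \<le> q" "q \<le> q'" "0 < r'" "r' \<le> r" "0 < f" "0 \<le> y" "y \<le> y'"
    for p p' q q' r r' f y y' :: real
    using that by (intro mult_mono frac_le mult_nonneg_nonneg divide_nonneg_nonneg mult_pos_pos) auto
  show ?thesis
    unfolding hypergeo_coeff_def norm_mult norm_divide norm_power norm_fact norm_of_real abs_of_nonneg[OF x]
    by (rule g[OF norm_ge_zero up[OF assms(1)] norm_ge_zero up[OF assms(2)] pos lo _ _ zp]) (use x assms in auto)
qed

lemma hypergeo_2F1_bounded:
  assumes "\<delta> > 0"
  obtains C where "C > 0" "\<And>a b c z. norm a \<le> R \<Longrightarrow> norm b \<le> R \<Longrightarrow> Re c \<ge> \<delta> \<Longrightarrow> norm z \<le> 1/4 \<Longrightarrow>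
    norm (hypergeo_2F1 a b c z) \<le> C"
proof
  let ?g = "\<lambda>n. norm (hypergeo_coeff (of_real R) (of_real R) (of_real \<delta>) n * of_real (1/4) ^ n)"
  have s: "summable ?g" by (rule summable_hypergeo) simp
  show "(\<Sum>n. ?g n) + 1 > 0" using suminf_nonneg[OF s] by (simp add: add_nonneg_pos)
  fix a b c z :: complex
  assume *: "norm a \<le> R" "norm b \<le> R" "Re c \<ge> \<delta>" "norm z \<le> 1/4"
  have "norm (\<Sum>n. hypergeo_coeff a b c n * z ^ n) \<le> (\<Sum>n. ?g n)"
    by (rule norm_suminf_le[OF _ s]) (rule norm_hypergeo_coeff_le[OF *(1-3) assms *(4)])
  moreover have "hypergeo_2F1 a b c z = (\<Sum>n. hypergeo_coeff a b c n * z ^ n)"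
    using * by (simp add: hypergeo_2F1_def hypergeo_coeff_def)
  ultimately show "norm (hypergeo_2F1 a b c z) \<le> (\<Sum>n. ?g n) + 1" by simp
qed

lemma holomorphic_hypergeo_2F1_order:
  assumes z: "norm z \<le> 1/4"
  shows "(\<lambda>\<nu>. hypergeo_2F1 (\<nu> + p) q (\<nu> + 1) z) holomorphic_on {\<nu>. Re \<nu> > -1}"
proof -
  have "(\<lambda>\<nu>. \<Sum>n. hypergeo_coeff (\<nu> + p) q (\<nu> + 1) n * z ^ n) holomorphic_on {\<nu>. Re \<nu> > -1}"
  proof (rule holomorphic_suminf_dominated)
    show "open {\<nu>. Re \<nu> > -1}" by (rule open_halfspace_Re_gt)
    have nz: "pochhammer (\<nu> + 1) n \<noteq> 0" if "Re \<nu> > -1" for \<nu> :: complex and n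
      using Re_pos_neq_uminus_nat[of "\<nu> + 1"] that by (auto simp: pochhammer_eq_0_iff)
    show "(\<lambda>\<nu>. hypergeo_coeff (\<nu> + p) q (\<nu> + 1) n * z ^ n) holomorphic_on {\<nu>. Re \<nu> > -1}" for n
      unfolding hypergeo_coeff_def pochhammer_prod
      using nz by (intro holomorphic_intros) (auto simp: pochhammer_prod)
    fix \<nu> :: complex assume \<nu>: "\<nu> \<in> {\<nu>. Re \<nu> > -1}"
    define \<delta> where "\<delta> = (Re \<nu> + 1) / 2"
    have \<delta>: "\<delta> > 0" using \<nu> by (simp add: \<delta>_def)
    define R where "R = norm \<nu> + \<delta> + norm p + norm q"
    have "norm (hypergeo_coeff (w + p) q (w + 1) n * z ^ n) \<le>
        norm (hypergeo_coeff (of_real R) (of_real R) (of_real \<delta>) n * of_real (1/4) ^ n)"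
      if w: "dist \<nu> w < \<delta>" for w n
    proof (rule norm_hypergeo_coeff_le[OF _ _ _ \<delta> z])
      have "norm (w + p) \<le> norm \<nu> + norm (w - \<nu>) + norm p"
        by (smt (verit) norm_triangle_ineq norm_triangle_sub)
      thus "norm (w + p) \<le> R" using w norm_ge_zero[of q] unfolding R_def by (simp add: dist_norm norm_minus_commute del: norm_ge_zero)
      show "norm q \<le> R" using \<delta> by (simp add: R_def)
      show "Re (w + 1) \<ge> \<delta>" using w abs_Re_le_cmod[of "\<nu> - w"] by (simp add: dist_norm \<delta>_def abs_le_iff field_simps)
    qed
    moreover have "summable (\<lambda>n. norm (hypergeo_coeff (of_real R) (of_real R) (of_real \<delta>) n * of_real (1/4) ^ n))"
      by (rule summable_hypergeo) simp
    ultimately show "\<exists>r>0. \<exists>g. summable g \<and> (\<forall>w\<in>{\<nu>. Re \<nu> > -1}. dist \<nu> w < r \<longrightarrow>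
        (\<forall>n. norm (hypergeo_coeff (w + p) q (w + 1) n * z ^ n) \<le> g n))"
      using \<delta> by blast
  qed
  moreover have "hypergeo_2F1 (\<nu> + p) q (\<nu> + 1) z = (\<Sum>n. hypergeo_coeff (\<nu> + p) q (\<nu> + 1) n * z ^ n)" for \<nu>
    using z by (simp add: hypergeo_2F1_def hypergeo_coeff_def)
  ultimately show ?thesis by simp
qed

lemma holomorphic_hyp_kernel_order:
  assumes "Re a > 0" "Re b > 0" "norm (((a - b) / (a + b))\<^sup>2) \<le> 1/4"
  shows "(\<lambda>\<nu>. hyp_kernel k \<nu> a b) holomorphic_on {\<nu>. Re \<nu> > -1}"
proof -
  have "(\<lambda>\<nu>. hypergeo_2F1 (\<nu> + (1 - of_nat k / 2)) (1 - of_nat k / 2) (\<nu> + 1) (((a - b) / (a + b))\<^sup>2)) holomorphic_on {\<nu>. Re \<nu> > -1}"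
    by (rule holomorphic_hypergeo_2F1_order[OF assms(3)])
  hence "(\<lambda>\<nu>. hypergeo_2F1 (\<nu> + 1 - of_nat k / 2) (1 - of_nat k / 2) (\<nu> + 1) (((a - b) / (a + b))\<^sup>2)) holomorphic_on {\<nu>. Re \<nu> > -1}"
    by (simp only: add_diff_eq)
  thus ?thesis unfolding hyp_kernel_def by (intro holomorphic_intros)
qed

lemma holomorphic_hyp_kernel:
  assumes fg: "f holomorphic_on S" "g holomorphic_on S" and pos: "\<And>z. z \<in> S \<Longrightarrow> Re (f z) > 0" "\<And>z. z \<in> S \<Longrightarrow> Re (g z) > 0"
    and \<nu>: "Re \<nu> > -1"
  shows "(\<lambda>z. hyp_kernel k \<nu> (f z) (g z)) holomorphic_on S"
proof -
  have ps: "Re (f z + g z) > 0" if "z \<in> S" for z using pos[OF that] by simp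
  have nz: "f z \<noteq> 0" "g z \<noteq> 0" "f z + g z \<noteq> 0" "f z + g z \<notin> \<real>\<^sub>\<le>\<^sub>0" if "z \<in> S" for z
    using pos[OF that] ps[OF that] by (auto simp: complex_nonpos_Reals_iff complex_eq_iff)
  define q where "q = (1 - real k / 2)"
  have "hypergeo_2F1 (\<nu> + 1 - of_nat k / 2) (of_real q) (\<nu> + 1) holomorphic_on slit_plane"
  proof (rule holomorphic_hypergeo_2F1)
    fix n show "\<nu> + 1 \<noteq> - of_nat n" using \<nu> by (intro Re_pos_neq_uminus_nat) simp
  qed
  hence "(hypergeo_2F1 (\<nu> + 1 - of_nat k / 2) (of_real q) (\<nu> + 1) \<circ> (\<lambda>z. ((f z - g z) / (f z + g z))\<^sup>2)) holomorphic_on S"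
    by (intro holomorphic_on_compose_gen[where t = slit_plane] holomorphic_intros fg nz)
       (use quotient_square_in_slit_plane pos in auto)
  moreover have "of_real q = (1 - of_nat k / 2 :: complex)" by (simp add: q_def)
  ultimately have "(\<lambda>z. hypergeo_2F1 (\<nu> + 1 - of_nat k / 2) (1 - of_nat k / 2) (\<nu> + 1) (((f z - g z) / (f z + g z))\<^sup>2)) holomorphic_on S"
    by (simp only: o_def)
  thus ?thesis unfolding hyp_kernel_def
    by (intro holomorphic_intros fg) (use nz in auto)
qed

text \<open>
Homogeneity reduces the kernel at \<open>\<surd>(n + a\<^sup>2)\<close>, \<open>\<surd>(n + b\<^sup>2)\<close> to its values near \<open>(1, 1)\<close>.
\<close>

lemma hyp_kernel_scale:
  assumes t: "t > 0" and k: "k \<ge> 2"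
  shows "hyp_kernel k \<nu> (of_real t * a) (of_real t * b) = of_real t powr (- 2 * \<nu> - of_nat k) * hyp_kernel k \<nu> a b"
proof -
  obtain j where j: "k = Suc (Suc j)" using k by (metis Suc_le_D numeral_2_eq_2 Suc_le_mono)
  define T where "T = complex_of_real t"
  have T: "T \<noteq> 0" "T \<in> \<real>" "Re T \<ge> 0" using t by (auto simp: T_def)
  have 1: "T powr (- 2 * \<nu> - of_nat k) = T powr (- 2 * \<nu>) * (1 / T\<^sup>2) * (1 / T) ^ j"
    unfolding powr_diff powr_complexpow[OF T(1)] by (simp add: j power2_eq_square power_divide)
  have 2: "(T * a + T * b) powr (- 2 * \<nu>) = T powr (- 2 * \<nu>) * (a + b) powr (- 2 * \<nu>)"
    using powr_times_real_left[OF T(2,3), of "a + b" "- 2 * \<nu>"] by (simp only: distrib_left)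
  have 3: "1 / (T * a) + 1 / (T * b) = (1 / T) * (1 / a + 1 / b)" by (simp add: distrib_left)
  have 4: "(T * a - T * b) / (T * a + T * b) = (a - b) / (a + b)"
    using T by (simp add: distrib_left [symmetric] right_diff_distrib [symmetric])
  have 5: "1 / (T * a * (T * b)) = 1 / T\<^sup>2 * (1 / (a * b))" by (simp add: power2_eq_square)
  show ?thesis unfolding hyp_kernel_def T_def [symmetric] 1 2 3 4 5 power_mult_distrib by (simp add: j mult_ac)
qed

lemma hyp_kernel_1_1:
  assumes k: "k \<ge> 2"
  shows "hyp_kernel k \<nu> 1 1 = 2 powr (of_nat k - 2 - 2 * \<nu>)"
proof -
  have "hypergeo_2F1 a b c 0 = 1" for a b c
  proof -
    have "(\<lambda>n. pochhammer a n * pochhammer b n / (pochhammer c n * fact n) * 0 ^ n) sums 1"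
      using powser_sums_zero[of "\<lambda>n. pochhammer a n * pochhammer b n / (pochhammer c n * fact n)"] by simp
    thus ?thesis by (simp add: hypergeo_2F1_def sums_iff)
  qed
  hence "hyp_kernel k \<nu> 1 1 = 2 powr (- 2 * \<nu>) * 2 ^ (k - 2)" by (simp add: hyp_kernel_def)
  also have "\<dots> = 2 powr (- 2 * \<nu> + of_nat (k - 2))" unfolding powr_add by (simp add: powr_nat)
  also have "- 2 * \<nu> + of_nat (k - 2) = of_nat k - 2 - 2 * \<nu>" using k by (simp add: of_nat_diff)
  finally show ?thesis .
qed

lemma csqrt_near_1:
  assumes "norm u \<le> 1/8"
  shows "Re (csqrt (1 + u)) \<ge> 1/2" "norm (csqrt (1 + u)) \<le> 2"
proof -
  define x where "x = csqrt (1 + u)"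
  have sq: "x\<^sup>2 = 1 + u" by (simp add: x_def)
  have "Re (x\<^sup>2) \<ge> 7/8" unfolding sq using assms abs_Re_le_cmod[of u] by simp
  moreover have "Re (x\<^sup>2) = Re x * Re x - Im x * Im x" by (simp add: power2_eq_square)
  ultimately have "Re x * Re x \<ge> 7/8" using zero_le_square[of "Im x"] by linarith
  moreover have "Re x \<ge> 0" using csqrt_principal[of "1 + u"] by (auto simp: x_def simp del: csqrt.sel)
  ultimately show "Re x \<ge> 1/2" using mult_mono[of "Re x" "1/2" "Re x" "1/2"] by (cases "Re x \<ge> 1/2") auto
  have "(norm x)\<^sup>2 = norm (1 + u)" by (simp add: norm_power [symmetric] sq)
  also have "\<dots> \<le> 2\<^sup>2" using norm_triangle_ineq[of 1 u] assms by simp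
  finally show "norm x \<le> 2" by (rule power2_le_imp_le) simp
qed

lemma norm_powr_le_exp:
  fixes z w :: complex
  assumes "0 < l" "l \<le> norm z" "norm z \<le> u"
  shows "norm (z powr w) \<le> exp (norm w * (\<bar>ln l\<bar> + \<bar>ln u\<bar> + pi))"
proof -
  have z: "z \<noteq> 0" using assms by auto
  have "ln l \<le> ln (norm z)" "ln (norm z) \<le> ln u" using assms z by (subst ln_le_cancel_iff; auto)+
  hence "\<bar>Re (Ln z)\<bar> \<le> \<bar>ln l\<bar> + \<bar>ln u\<bar>" using z by auto
  moreover have "\<bar>Im (Ln z)\<bar> \<le> pi" using Im_Ln_le_pi[OF z] mpi_less_Im_Ln[OF z] by auto
  ultimately have "norm (Ln z) \<le> \<bar>ln l\<bar> + \<bar>ln u\<bar> + pi" using cmod_le[of "Ln z"] by linarith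
  hence "norm (w * Ln z) \<le> norm w * (\<bar>ln l\<bar> + \<bar>ln u\<bar> + pi)" by (simp add: norm_mult mult_left_mono)
  hence "exp (norm (w * Ln z)) \<le> exp (norm w * (\<bar>ln l\<bar> + \<bar>ln u\<bar> + pi))" by simp
  moreover have "norm (z powr w) \<le> exp (norm (w * Ln z))" using z norm_exp[of "w * Ln z"] by (simp add: powr_def)
  ultimately show ?thesis by linarith
qed

lemma hyp_kernel_bounded_near_1:
  assumes "\<delta> > 0"
  obtains C where "C > 0" "\<And>\<nu> u v. norm \<nu> \<le> R \<Longrightarrow> Re \<nu> + 1 \<ge> \<delta> \<Longrightarrow> norm u \<le> 1/8 \<Longrightarrow> norm v \<le> 1/8 \<Longrightarrow>
    norm (hyp_kernel k \<nu> (csqrt (1 + u)) (csqrt (1 + v))) \<le> C"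
proof -
  obtain B where B: "B > 0" "\<And>a b c z. norm a \<le> R + 1 + real k \<Longrightarrow> norm b \<le> R + 1 + real k \<Longrightarrow> Re c \<ge> \<delta> \<Longrightarrow> norm z \<le> 1/4 \<Longrightarrow>
    norm (hypergeo_2F1 a b c z) \<le> B" using hypergeo_2F1_bounded[OF assms, where R = "R + 1 + real k"] by blast
  define P where "P = exp (2 * R * (\<bar>ln 1\<bar> + \<bar>ln 4\<bar> + pi))"
  show ?thesis
  proof (rule that[of "4 * P * 4 ^ (k - 2) * B"])
    show "4 * P * 4 ^ (k - 2) * B > 0" using B by (simp add: P_def)
    fix \<nu> u v :: complex assume *: "norm \<nu> \<le> R" "Re \<nu> + 1 \<ge> \<delta>" "norm u \<le> 1/8" "norm v \<le> 1/8"
    define x where "x = csqrt (1 + u)"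
    define y where "y = csqrt (1 + v)"
    have x: "Re x \<ge> 1/2" "norm x \<le> 2" and y: "Re y \<ge> 1/2" "norm y \<le> 2"
      using csqrt_near_1 * by (auto simp: x_def y_def simp del: csqrt.sel)
    have x': "norm x \<ge> 1/2" and y': "norm y \<ge> 1/2" using x y complex_Re_le_cmod[of x] complex_Re_le_cmod[of y] by linarith+
    have s: "norm (x + y) \<ge> 1" using x y complex_Re_le_cmod[of "x + y"] by simp
    have s': "norm (x + y) \<le> 4" using x y norm_triangle_ineq[of x y] by simp
    have n: "norm (1 / (x * y)) \<le> 4"
      using mult_mono[OF x' y'] by (simp add: norm_mult norm_divide divide_simps) 
    have p: "norm ((x + y) powr (- 2 * \<nu>)) \<le> P"
    proof -
      have "norm ((x + y) powr (- 2 * \<nu>)) \<le> exp (norm (- 2 * \<nu>) * (\<bar>ln 1\<bar> + \<bar>ln 4\<bar> + pi))"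
        by (rule norm_powr_le_exp[OF _ s s']) simp
      also have "\<dots> \<le> P" unfolding P_def using *(1) by (simp add: norm_mult mult_right_mono del: ln_one)
      finally show ?thesis .
    qed
    have q: "norm (1 / x + 1 / y) \<le> 4"
    proof -
      have "norm (1 / x) \<le> 2" "norm (1 / y) \<le> 2" using x' y' by (auto simp: norm_divide divide_simps)
      thus ?thesis using norm_triangle_ineq[of "1 / x" "1 / y"] by linarith
    qed
    have h: "norm (hypergeo_2F1 (\<nu> + 1 - of_nat k / 2) (1 - of_nat k / 2) (\<nu> + 1) (((x - y) / (x + y))\<^sup>2)) \<le> B"
    proof (rule B(2))
      have R0: "R \<ge> 0" using *(1) norm_ge_zero[of \<nu>] by linarith
      have t: "norm (1 - of_nat k / 2 :: complex) \<le> 1 + real k"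
      proof -
        have "norm (1 - of_nat k / 2 :: complex) \<le> norm (1::complex) + norm (of_nat k / 2 :: complex)" by (rule norm_triangle_ineq4)
        also have "\<dots> \<le> 1 + real k" by (simp add: norm_divide)
        finally show ?thesis .
      qed
      thus "norm (1 - of_nat k / 2 :: complex) \<le> R + 1 + real k" using R0 by linarith
      have "norm (\<nu> + (1 - of_nat k / 2)) \<le> R + 1 + real k"
        using norm_triangle_ineq[of \<nu> "1 - of_nat k / 2"] t *(1) by linarith
      thus "norm (\<nu> + 1 - of_nat k / 2 :: complex) \<le> R + 1 + real k" by (simp only: add_diff_eq)
      show "Re (\<nu> + 1) \<ge> \<delta>" using *(2) by simp
      have nz: "x + y \<noteq> 0" using s by auto
      have "(x - y) / (x + y) = (u - v) / (x + y)\<^sup>2"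
      proof -
        have "(x - y) * (x + y) = u - v" by (simp add: x_def y_def algebra_simps power2_eq_square [symmetric] flip: power2_eq_square)
        thus ?thesis using nz by (metis nonzero_divide_mult_cancel_right power2_eq_square times_divide_times_eq mult_divide_mult_cancel_right)
      qed
      moreover have "norm ((u - v) / (x + y)\<^sup>2) \<le> 1/4"
      proof -
        have "norm (u - v) \<le> 1/4" using *(3,4) norm_triangle_ineq4[of u v] by linarith
        moreover have "1 \<le> (norm (x + y))\<^sup>2" using s by (simp add: one_le_power)
        ultimately have "norm (u - v) / (norm (x + y))\<^sup>2 \<le> (1/4) / 1" by (intro frac_le) auto
        thus ?thesis by (simp add: norm_divide norm_power)
      qed
      ultimately have "norm ((x - y) / (x + y)) \<le> 1/4" by simp
      hence "(norm ((x - y) / (x + y)))\<^sup>2 \<le> (1/4)\<^sup>2" by (intro power_mono) auto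
      thus "norm (((x - y) / (x + y))\<^sup>2) \<le> 1/4" by (simp only: norm_power) (simp add: power2_eq_square)
    qed
    show "norm (hyp_kernel k \<nu> (csqrt (1 + u)) (csqrt (1 + v))) \<le> 4 * P * 4 ^ (k - 2) * B"
      unfolding hyp_kernel_def x_def [symmetric] y_def [symmetric] norm_mult norm_power
      by (intro mult_mono power_mono n p q h mult_nonneg_nonneg norm_ge_zero zero_le_power) (use B in \<open>auto simp: P_def\<close>)
  qed
qed

section \<open>Convergence and holomorphy of the two series\<close>

text \<open>
Cauchy's inequality bounds the derivative on the disc of half the radius.
\<close>

lemma lipschitz_at_center:
  fixes f :: "complex \<Rightarrow> complex"
  assumes r: "r > 0" and f: "f holomorphic_on ball 0 r" and C: "\<And>z. z \<in> ball 0 r \<Longrightarrow> norm (f z) \<le> C"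
    and h: "norm h \<le> r / 2"
  shows "norm (f h - f 0) \<le> 4 * C / r * norm h"
proof -
  have "norm (f h - f 0) \<le> 4 * C / r * norm (h - 0)"
  proof (rule field_differentiable_bound[where S = "cball 0 (r / 2)" and f' = "deriv f"])
    fix z :: complex assume z: "z \<in> cball 0 (r / 2)"
    have sub: "cball z (r / 4) \<subseteq> ball 0 r"
    proof
      fix x assume "x \<in> cball z (r / 4)"
      hence "norm x \<le> r / 2 + r / 4" using z norm_triangle_ineq2[of x z] by (auto simp: dist_norm norm_minus_commute)
      thus "x \<in> ball 0 r" using r by simp
    qed
    have "z \<in> ball 0 r" using z r by simp
    thus "(f has_field_derivative deriv f z) (at z within cball 0 (r / 2))"
      using holomorphic_derivI[OF f open_ball] has_field_derivative_at_within by blast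
    have "norm ((deriv ^^ 1) f z) \<le> fact 1 * C / (r / 4) ^ 1"
    proof (rule Cauchy_inequality)
      show "f holomorphic_on ball z (r / 4)" using f sub ball_subset_cball by (meson holomorphic_on_subset order_trans)
      show "continuous_on (cball z (r / 4)) f" using f sub holomorphic_on_imp_continuous_on holomorphic_on_subset by blast
      fix x assume "norm (z - x) = r / 4"
      hence "x \<in> cball z (r / 4)" by (simp add: dist_norm)
      thus "norm (f x) \<le> C" using sub C by blast
    qed (use r in auto)
    thus "norm (deriv f z) \<le> 4 * C / r" by (simp add: mult.commute)
  qed (use h r in auto)
  thus ?thesis by simp
qed

text \<open>
The finitely many terms without a bound are bounded on a compact disc by continuity.
\<close>

lemma holomorphic_suminf_eventually_dominated:
  fixes f :: "complex \<Rightarrow> nat \<Rightarrow> complex"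
  assumes S: "open S"
    and hol: "\<And>n. (\<lambda>z. f z n) holomorphic_on S"
    and dom: "\<And>z. z \<in> S \<Longrightarrow> \<exists>r>0. \<exists>g N. summable g \<and>
                (\<forall>w\<in>S. dist z w < r \<longrightarrow> (\<forall>n\<ge>N. norm (f w n) \<le> g n))"
  shows "(\<lambda>z. \<Sum>n. f z n) holomorphic_on S"
proof (rule holomorphic_suminf_dominated[OF S hol])
  fix z assume z: "z \<in> S"
  then obtain r g N where *: "r > 0" "summable g" "\<And>w n. w \<in> S \<Longrightarrow> dist z w < r \<Longrightarrow> n \<ge> N \<Longrightarrow> norm (f w n) \<le> g n"
    using dom[OF z] by blast
  obtain e where e: "e > 0" "cball z e \<subseteq> S" using S z open_contains_cball by blast
  have "\<forall>n. \<exists>B. \<forall>w\<in>cball z e. norm (f w n) \<le> B"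
  proof
    fix n
    have "continuous_on (cball z e) (\<lambda>w. f w n)"
      using hol[of n] e(2) holomorphic_on_imp_continuous_on holomorphic_on_subset by blast
    hence "compact ((\<lambda>w. f w n) ` cball z e)" by (rule compact_continuous_image) simp
    thus "\<exists>B. \<forall>w\<in>cball z e. norm (f w n) \<le> B" by (auto dest: compact_imp_bounded simp: bounded_iff)
  qed
  then obtain B where B: "\<And>n w. w \<in> cball z e \<Longrightarrow> norm (f w n) \<le> B n" by metis
  define h where "h = (\<lambda>n. if n < N then B n else g n)"
  have "summable h"
    by (rule summable_cong[THEN iffD1, OF _ *(2)]) (auto simp: h_def intro!: eventually_mono[OF eventually_ge_at_top[of N]])
  moreover have "norm (f w n) \<le> h n" if "w \<in> S" "dist z w < min r e" for w n
    using that B[of w n] *(3)[of w n] by (auto simp: h_def)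
  ultimately show "\<exists>r>0. \<exists>g. summable g \<and> (\<forall>w\<in>S. dist z w < r \<longrightarrow> (\<forall>n. norm (f w n) \<le> g n))"
    using *(1) e(1) by (intro exI[of _ "min r e"] conjI exI[of _ h]) auto
qed

lemma csqrt_of_real_mult:
  assumes "x \<ge> 0"
  shows "csqrt (of_real x * z) = of_real (sqrt x) * csqrt z"
proof -
  have "csqrt (of_real x * z) = csqrt (of_real x) * csqrt z"
    unfolding csqrt_conv_powr using assms by (intro powr_times_real_left) auto
  thus ?thesis using csqrt_of_real_nonneg[of "of_real x"] assms by simp
qed

lemma csqrt_shifted_square:
  assumes "x > 0"
  shows "csqrt (of_real x + a\<^sup>2) = of_real (sqrt x) * csqrt (1 + of_real (1 / x) * a\<^sup>2)"
proof -
  have "of_real x + a\<^sup>2 = of_real x * (1 + of_real (1 / x) * a\<^sup>2)" using assms by (simp add: distrib_left)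
  thus ?thesis using csqrt_of_real_mult[of x] assms by (simp only: less_imp_le)
qed

text \<open>
The subtracted term in \<open>kernel_term\<close> is the value of the scaled kernel at \<open>h = 1 / n = 0\<close>.
\<close>

lemma kernel_term_scaled:
  assumes k: "k \<ge> 2"
  shows "kernel_term k \<nu> a b n = of_nat (sum_squares_count k (Suc n)) * of_nat (Suc n) powr (- \<nu> - of_nat k / 2) *
    (hyp_kernel k \<nu> (csqrt (1 + of_real (1 / real (Suc n)) * a\<^sup>2)) (csqrt (1 + of_real (1 / real (Suc n)) * b\<^sup>2)) - hyp_kernel k \<nu> 1 1)"
proof -
  define x where "x = real (Suc n)"
  have x: "x > 0" by (simp add: x_def)
  have X: "of_nat (Suc n) = complex_of_real x" by (simp add: x_def)
  have 1: "complex_of_real (sqrt x) powr (- 2 * \<nu> - of_nat k) = of_real x powr (- \<nu> - of_nat k / 2)"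
  proof -
    have L: "Ln (of_real (sqrt x)) = of_real (ln x) / 2" "Ln (complex_of_real x) = of_real (ln x)"
      using x by (simp_all add: Ln_of_real ln_sqrt)
    have "(- 2 * \<nu> - of_nat k) * (of_real (ln x) / 2) = (- \<nu> - of_nat k / 2) * of_real (ln x)" by (simp add: field_simps)
    moreover have "complex_of_real (sqrt x) \<noteq> 0" "complex_of_real x \<noteq> 0" using x by auto
    ultimately show ?thesis unfolding powr_def L by (simp only: if_False)
  qed
  have 2: "2 powr (of_nat k - 2 - 2 * \<nu>) / of_real x powr (\<nu> + of_nat k / 2) = of_real x powr (- \<nu> - of_nat k / 2) * hyp_kernel k \<nu> 1 1"
  proof -
    have "- \<nu> - of_nat k / 2 = - (\<nu> + of_nat k / 2)" by simp
    hence "complex_of_real x powr (- \<nu> - of_nat k / 2) = inverse (of_real x powr (\<nu> + of_nat k / 2))" by (simp only: powr_minus)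
    moreover have "y / z = inverse z * y" for y z :: complex by (simp add: divide_inverse)
    ultimately show ?thesis unfolding hyp_kernel_1_1[OF k] by (simp only:)
  qed
  have s: "sqrt x > 0" using x by simp
  have A: "csqrt (of_nat (Suc n) + c\<^sup>2) = of_real (sqrt x) * csqrt (1 + of_real (1 / x) * c\<^sup>2)" for c
    unfolding X by (rule csqrt_shifted_square[OF x])
  define H where "H = hyp_kernel k \<nu> (csqrt (1 + of_real (1 / x) * a\<^sup>2)) (csqrt (1 + of_real (1 / x) * b\<^sup>2))"
  have B: "hyp_kernel k \<nu> (csqrt (of_nat (Suc n) + a\<^sup>2)) (csqrt (of_nat (Suc n) + b\<^sup>2)) = of_real x powr (- \<nu> - of_nat k / 2) * H"
    unfolding A H_def hyp_kernel_scale[OF s k] 1 ..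
  show ?thesis
    unfolding kernel_term_def B unfolding X 2 x_def [symmetric] H_def [symmetric]
    by (simp only: right_diff_distrib mult.assoc)
qed

text \<open>
By scaling, a term is \<open>r\<^sub>k(n) n\<^bsup>-\<nu> - k/2\<^esup>\<close> times the increment between \<open>0\<close> and \<open>h = 1 / n\<close> of a function that is holomorphic and
bounded near \<open>0\<close>, uniformly in the parameters. The increment gains a factor \<open>1 / n\<close>, which is why the series converges for
\<open>Re \<nu> > - 1\<close>.
\<close>

lemma kernel_term_dominated:
  assumes k: "k \<ge> 2" and \<nu>0: "Re \<nu>0 > -1"
  obtains N g where "summable g" "\<And>\<nu> (a::complex) (b::complex) n. dist \<nu>0 \<nu> < (Re \<nu>0 + 1) / 2 \<Longrightarrow> norm a \<le> M \<Longrightarrow> norm b \<le> M \<Longrightarrow> n \<ge> N \<Longrightarrow>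
    norm (kernel_term k \<nu> a b n) \<le> g n"
proof -
  define \<delta> where "\<delta> = (Re \<nu>0 + 1) / 2"
  have \<delta>: "\<delta> > 0" using \<nu>0 by (simp add: \<delta>_def)
  obtain C where C: "C > 0" "\<And>\<nu> u v. norm \<nu> \<le> norm \<nu>0 + \<delta> \<Longrightarrow> Re \<nu> + 1 \<ge> \<delta> \<Longrightarrow> norm u \<le> 1/8 \<Longrightarrow> norm v \<le> 1/8 \<Longrightarrow>
    norm (hyp_kernel k \<nu> (csqrt (1 + u)) (csqrt (1 + v))) \<le> C"
    using hyp_kernel_bounded_near_1[OF \<delta>, where R = "norm \<nu>0 + \<delta>"] by blast
  \<comment> \<open>for \<open>\<bar>h\<bar> < r\<close> the arguments \<open>1 + h a\<^sup>2\<close>, \<open>1 + h b\<^sup>2\<close> are within \<open>1/8\<close> of \<open>1\<close>\<close>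
  define r where "r = 1 / (8 * (M\<^sup>2 + 1))"
  have r: "r > 0" by (simp add: r_def add_nonneg_pos)
  define N where "N = nat \<lceil>2 / r\<rceil>"
  define \<sigma> where "\<sigma> = real k / 2 + \<delta>"
  have \<sigma>: "\<sigma> > real k / 2" "\<sigma> > 0" using \<delta> by (auto simp: \<sigma>_def add_nonneg_pos)
  show ?thesis
  proof (rule that[of "\<lambda>n. 4 * C / r * (real (sum_squares_count k (Suc n)) * real (Suc n) powr (- \<sigma>))" N])
    show "summable (\<lambda>n. 4 * C / r * (real (sum_squares_count k (Suc n)) * real (Suc n) powr (- \<sigma>)))"
      by (intro summable_mult summable_sum_squares_count \<sigma>)
    fix \<nu> a b :: complex and n assume \<nu>: "dist \<nu>0 \<nu> < (Re \<nu>0 + 1) / 2" and ab: "norm a \<le> M" "norm b \<le> M" and n: "n \<ge> N"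
    have d: "norm (\<nu> - \<nu>0) < \<delta>" using \<nu> by (simp add: \<delta>_def dist_norm norm_minus_commute)
    have \<nu>n: "norm \<nu> \<le> norm \<nu>0 + \<delta>" using d norm_triangle_sub[of \<nu> \<nu>0] by linarith
    have \<nu>r: "Re \<nu> + 1 \<ge> \<delta>" using d abs_Re_le_cmod[of "\<nu> - \<nu>0"] by (simp add: \<delta>_def abs_le_iff field_simps)
    define g where "g = (\<lambda>h. hyp_kernel k \<nu> (csqrt (1 + h * a\<^sup>2)) (csqrt (1 + h * b\<^sup>2)))"
    have small: "norm (h * x\<^sup>2) \<le> 1/8" if "h \<in> ball 0 r" "norm x \<le> M" for h x :: complex
    proof -
      have "norm (h * x\<^sup>2) \<le> r * M\<^sup>2"
        unfolding norm_mult norm_power using that r by (intro mult_mono power_mono) auto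
      also have "1 / (8 * q) * (q - 1) \<le> 1/8" if "q > 0" for q :: real using that by (simp add: field_simps)
      from this[of "M\<^sup>2 + 1"] have "r * M\<^sup>2 \<le> 1/8" by (simp add: r_def add_nonneg_pos)
      finally show ?thesis .
    qed
    have "g holomorphic_on ball 0 r"
      unfolding g_def
    proof (intro holomorphic_hyp_kernel holomorphic_intros)
      fix h :: complex assume h: "h \<in> ball 0 r"
      have "1 + u \<notin> \<real>\<^sub>\<le>\<^sub>0" if "norm u \<le> 1/8" for u :: complex
        using that abs_Re_le_cmod[of u] by (auto simp: complex_nonpos_Reals_iff abs_le_iff)
      thus "1 + h * a\<^sup>2 \<notin> \<real>\<^sub>\<le>\<^sub>0" "1 + h * b\<^sup>2 \<notin> \<real>\<^sub>\<le>\<^sub>0" using small[OF h] ab by auto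
      show "Re (csqrt (1 + h * a\<^sup>2)) > 0" "Re (csqrt (1 + h * b\<^sup>2)) > 0"
        using csqrt_near_1(1)[OF small[OF h ab(1)]] csqrt_near_1(1)[OF small[OF h ab(2)]] by linarith+
    qed (use \<nu>r \<delta> in auto)
    moreover have "norm (g h) \<le> C" if "h \<in> ball 0 r" for h
      unfolding g_def using small[OF that] ab by (intro C(2) \<nu>n \<nu>r) auto
    moreover have x: "norm (complex_of_real (1 / real (Suc n))) = 1 / real (Suc n)" by (simp only: norm_of_real) simp
    moreover have "1 / real (Suc n) \<le> r / 2"
    proof -
      have "2 / r \<le> real N" unfolding N_def by (rule real_nat_ceiling_ge)
      hence "2 / r \<le> real (Suc n)" using n by simp
      thus ?thesis using r by (simp add: field_simps del: of_nat_Suc)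
    qed
    ultimately have "norm (g (of_real (1 / real (Suc n))) - g 0) \<le> 4 * C / r * (1 / real (Suc n))"
      using lipschitz_at_center[OF r, of g C "of_real (1 / real (Suc n))"] by (simp only:)
    moreover have "g 0 = hyp_kernel k \<nu> 1 1" by (simp add: g_def)
    ultimately have "norm (hyp_kernel k \<nu> (csqrt (1 + of_real (1 / real (Suc n)) * a\<^sup>2)) (csqrt (1 + of_real (1 / real (Suc n)) * b\<^sup>2)) - hyp_kernel k \<nu> 1 1)
        \<le> 4 * C / r * (1 / real (Suc n))" (is "norm ?D \<le> _") by (simp only: g_def)
    moreover have "norm (kernel_term k \<nu> a b n) = real (sum_squares_count k (Suc n)) * real (Suc n) powr (- Re \<nu> - real k / 2) * norm ?D"
    proof -
      have "norm (complex_of_nat (Suc n) powr (- \<nu> - of_nat k / 2)) = real (Suc n) powr (- Re \<nu> - real k / 2)"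
        by (subst norm_powr_real_powr) auto
      thus ?thesis unfolding kernel_term_scaled[OF k] norm_mult by (simp only: norm_of_nat)
    qed
    ultimately have "norm (kernel_term k \<nu> a b n) \<le>
        real (sum_squares_count k (Suc n)) * real (Suc n) powr (- Re \<nu> - real k / 2) * (4 * C / r * (1 / real (Suc n)))"
      by (simp only:) (intro mult_left_mono mult_nonneg_nonneg; simp)
    also have "\<dots> = 4 * C / r * (real (sum_squares_count k (Suc n)) * (real (Suc n) powr (- Re \<nu> - real k / 2) / real (Suc n)))" by simp
    also have "real (Suc n) powr (- Re \<nu> - real k / 2) / real (Suc n) = real (Suc n) powr (- Re \<nu> - real k / 2 - 1)"
      by (simp add: powr_diff del: of_nat_Suc)
    also have "4 * C / r * (real (sum_squares_count k (Suc n)) * real (Suc n) powr (- Re \<nu> - real k / 2 - 1)) \<le>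
        4 * C / r * (real (sum_squares_count k (Suc n)) * real (Suc n) powr (- \<sigma>))"
      using C(1) r \<nu>r by (intro mult_left_mono powr_mono) (auto simp: \<sigma>_def)
    finally show "norm (kernel_term k \<nu> a b n) \<le> 4 * C / r * (real (sum_squares_count k (Suc n)) * real (Suc n) powr (- \<sigma>))" .
  qed
qed

lemma power_exp_bound:
  fixes c X :: real
  assumes "c > 0" "X > 0"
  shows "exp (- c * X) \<le> fact m / (c * X) ^ m"
proof -
  have "(c * X) ^ m / fact m \<le> exp (c * X)"
    unfolding exp_def using assms summable_exp_generic[of "c * X"]
    by (intro order_trans[OF _ sum_le_suminf[of _ "{m}"]]) (auto simp: divide_inverse)
  thus ?thesis using assms by (simp add: exp_minus field_simps)
qed

text \<open>
With \<open>X = \<pi> \<surd>n\<close>, the factors \<open>I\<close> and \<open>K\<close> contribute \<open>exp (X \<bar>Re (a - b)\<bar> - X Re (a + b))\<close>, which is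
\<open>exp (- 2 X min (Re a) (Re b))\<close> and beats all powers of \<open>n\<close>.
\<close>

lemma bessel_product_term_dominated:
  assumes \<nu>0: "Re \<nu>0 > -1" and \<epsilon>: "\<epsilon> > 0"
  obtains \<rho> g where "\<rho> > 0" "summable g"
    "\<And>\<nu> a b n. dist \<nu>0 \<nu> < \<rho> \<Longrightarrow> Re a \<ge> \<epsilon> \<Longrightarrow> Re b \<ge> \<epsilon> \<Longrightarrow> norm a \<le> M \<Longrightarrow> norm b \<le> M \<Longrightarrow>
      norm (bessel_product_term k \<nu> a b n) \<le> g n"
proof -
  obtain rB CB where B: "rB > 0" "CB > 0" "\<And>\<nu> w. dist \<nu>0 \<nu> < rB \<Longrightarrow>
    norm (bessel_series \<nu> (w\<^sup>2 / 4)) \<le> CB * (1 + (norm w)\<^sup>2) * exp \<bar>Re w\<bar>"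
    using bessel_series_locally_bounded[OF \<nu>0] by blast
  define R where "R = norm \<nu>0 + 1"
  have R: "R \<ge> 0" by (simp add: R_def)
  obtain CK where K: "CK > 0" "\<And>\<nu> z. Re z \<ge> \<epsilon> \<Longrightarrow> \<bar>Re \<nu>\<bar> \<le> R \<Longrightarrow> norm (bessel_K_integral \<nu> z) \<le> CK * exp (- Re z)"
    using bessel_K_integral_bound[OF \<epsilon>, of R] by blast
  define q where "q = nat \<lceil>R\<rceil>"
  have q: "R \<le> real q" unfolding q_def by (rule real_nat_ceiling_ge)
  define P where "P = exp (R * (\<bar>ln (2 * \<epsilon>)\<bar> + \<bar>ln (2 * M)\<bar> + pi))"
  \<comment> \<open>the powers \<open>X\<^sup>q X\<^sup>2\<close> are absorbed, and \<open>X\<^bsup>-(k + 2)\<^esup>\<close> is left over for convergence\<close>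
  define m where "m = q + 2 + (k + 2)"
  define D where "D = CB * (1 + 4 * M\<^sup>2) * P * CK"
  have D: "D \<ge> 0" using B K by (simp add: D_def P_def)
  define E where "E = D * (fact m / (2 * \<epsilon>) ^ m)"
  have E: "E \<ge> 0" using D \<epsilon> by (simp add: E_def)
  define \<sigma> where "\<sigma> = real k / 2 + 1"
  show ?thesis
  proof (rule that[of "min rB 1" "\<lambda>n. E * (real (sum_squares_count k (Suc n)) * real (Suc n) powr (- \<sigma>))"])
    show "min rB 1 > 0" using B by simp
    show "summable (\<lambda>n. E * (real (sum_squares_count k (Suc n)) * real (Suc n) powr (- \<sigma>)))"
      by (intro summable_mult summable_sum_squares_count) (auto simp: \<sigma>_def add_nonneg_pos)
    fix \<nu> a b :: complex and n
    assume \<nu>: "dist \<nu>0 \<nu> < min rB 1" and ab: "Re a \<ge> \<epsilon>" "Re b \<ge> \<epsilon>" "norm a \<le> M" "norm b \<le> M"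
    have \<nu>B: "dist \<nu>0 \<nu> < rB" using \<nu> by simp
    have \<nu>R: "norm \<nu> \<le> R" using \<nu> norm_triangle_sub[of \<nu> \<nu>0] by (simp add: R_def dist_norm norm_minus_commute)
    hence \<nu>R': "\<bar>Re \<nu>\<bar> \<le> R" using abs_Re_le_cmod[of \<nu>] by linarith
    define N where "N = real (Suc n)"
    have N: "N \<ge> 1" by (simp add: N_def)
    define X where "X = pi * sqrt N"
    have sN: "sqrt N \<ge> 1" using N by simp
    have X2: "X \<ge> 2" using mult_mono[OF pi_ge_two sN] by (simp add: X_def)
    have XN: "X \<ge> sqrt N" using pi_ge_two sN mult_right_mono[of 1 pi "sqrt N"] by (simp add: X_def)
    have n1: "norm (complex_of_real (X / 2) powr \<nu>) \<le> X ^ q"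
    proof -
      have "norm (complex_of_real (X / 2) powr \<nu>) = (X / 2) powr Re \<nu>" using X2 by (subst norm_powr_real_powr) auto
      also have "\<dots> \<le> (X / 2) powr real q" using X2 \<nu>R' q by (intro powr_mono) auto
      also have "\<dots> = (X / 2) ^ q" using X2 by (intro powr_realpow) auto
      also have "\<dots> \<le> X ^ q" using X2 by (intro power_mono) auto
      finally show ?thesis .
    qed
    have n2: "norm (bessel_series \<nu> (of_real (pi\<^sup>2 * N) * (a - b)\<^sup>2 / 4)) \<le> CB * ((1 + 4 * M\<^sup>2) * X\<^sup>2) * exp (X * \<bar>Re (a - b)\<bar>)"
    proof -
      have "complex_of_real (pi\<^sup>2 * N) = (of_real X)\<^sup>2"
        unfolding of_real_power [symmetric] X_def using N by (simp add: power_mult_distrib)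
      hence "of_real (pi\<^sup>2 * N) * (a - b)\<^sup>2 / 4 = (of_real X * (a - b))\<^sup>2 / 4" by (simp only: power_mult_distrib)
      hence "norm (bessel_series \<nu> (of_real (pi\<^sup>2 * N) * (a - b)\<^sup>2 / 4)) \<le>
          CB * (1 + (norm (of_real X * (a - b)))\<^sup>2) * exp \<bar>Re (of_real X * (a - b))\<bar>"
        using B(3)[OF \<nu>B, of "of_real X * (a - b)"] by (simp only:)
      also have "\<bar>Re (of_real X * (a - b))\<bar> = X * \<bar>Re (a - b)\<bar>" using X2 by (simp add: abs_mult flip: minus_complex.simps)
      also have "CB * (1 + (norm (of_real X * (a - b)))\<^sup>2) * exp (X * \<bar>Re (a - b)\<bar>) \<le> CB * ((1 + 4 * M\<^sup>2) * X\<^sup>2) * exp (X * \<bar>Re (a - b)\<bar>)"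
      proof (intro mult_right_mono mult_left_mono)
        have "norm (a - b) \<le> 2 * M" using ab norm_triangle_ineq4[of a b] by linarith
        hence "(norm (of_real X * (a - b)))\<^sup>2 \<le> (X * (2 * M))\<^sup>2"
          unfolding norm_mult using X2 by (intro power_mono mult_mono) auto
        also have "\<dots> = 4 * M\<^sup>2 * X\<^sup>2" by (simp add: power_mult_distrib)
        moreover have "1 \<le> X\<^sup>2" using X2 by (simp add: one_le_power)
        ultimately show "1 + (norm (of_real X * (a - b)))\<^sup>2 \<le> (1 + 4 * M\<^sup>2) * X\<^sup>2" unfolding distrib_right by linarith
      qed (use B in auto)
      finally show ?thesis .
    qed
    have n3: "norm ((a + b) powr (- \<nu>)) \<le> P"
    proof -
      have "2 * \<epsilon> \<le> Re (a + b)" using ab by simp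
      hence l: "2 * \<epsilon> \<le> norm (a + b)" using complex_Re_le_cmod[of "a + b"] by linarith
      have u: "norm (a + b) \<le> 2 * M" using ab norm_triangle_ineq[of a b] by linarith
      have "norm ((a + b) powr (- \<nu>)) \<le> exp (norm (- \<nu>) * (\<bar>ln (2 * \<epsilon>)\<bar> + \<bar>ln (2 * M)\<bar> + pi))"
        by (rule norm_powr_le_exp[OF _ l u]) (use \<epsilon> in simp)
      also have "\<dots> \<le> P" unfolding P_def exp_le_cancel_iff norm_minus_cancel
        using \<nu>R by (intro mult_right_mono) auto
      finally show ?thesis .
    qed
    have Re1: "Re (of_real X * (a + b)) = X * (Re a + Re b)" by simp
    have n4: "norm (bessel_K_integral \<nu> (of_real X * (a + b))) \<le> CK * exp (- (X * (Re a + Re b)))"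
    proof -
      have "1 * \<epsilon> \<le> X * (Re a + Re b)" using X2 ab \<epsilon> by (intro mult_mono) auto
      thus ?thesis using K(2)[OF _ \<nu>R', of "of_real X * (a + b)"] unfolding Re1 by simp
    qed
    have e: "exp (X * \<bar>Re (a - b)\<bar>) * exp (- (X * (Re a + Re b))) \<le> fact m / (2 * \<epsilon> * X) ^ m"
    proof -
      have "\<bar>Re (a - b)\<bar> - (Re a + Re b) \<le> - (2 * \<epsilon>)" using ab by (simp add: abs_if)
      hence "X * (\<bar>Re (a - b)\<bar> - (Re a + Re b)) \<le> X * (- (2 * \<epsilon>))" using X2 by (intro mult_left_mono) auto
      hence "exp (X * \<bar>Re (a - b)\<bar>) * exp (- (X * (Re a + Re b))) \<le> exp (- (2 * \<epsilon>) * X)"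
        unfolding exp_add [symmetric] exp_le_cancel_iff by (simp add: algebra_simps)
      also have "\<dots> \<le> fact m / (2 * \<epsilon> * X) ^ m" using \<epsilon> X2 by (intro power_exp_bound) auto
      finally show ?thesis .
    qed
    have xp: "X ^ q * X\<^sup>2 * (fact m / (2 * \<epsilon> * X) ^ m) \<le> fact m / (2 * \<epsilon>) ^ m * N powr (- \<sigma>)"
    proof -
      have "X ^ m = X ^ q * X\<^sup>2 * X ^ (k + 2)" unfolding m_def by (simp only: power_add mult.assoc)
      hence "X ^ q * X\<^sup>2 * (fact m / (2 * \<epsilon> * X) ^ m) = fact m / (2 * \<epsilon>) ^ m * (1 / X ^ (k + 2))"
        using X2 unfolding power_mult_distrib by simp
      moreover have "1 / X ^ (k + 2) \<le> N powr (- \<sigma>)"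
      proof -
        have "N powr \<sigma> = (sqrt N) ^ (k + 2)"
        proof -
          have "sqrt N = N powr (1/2)" using N by (simp add: powr_half_sqrt)
          hence "(sqrt N) ^ (k + 2) = (N powr (1/2)) powr real (k + 2)" using N by (subst powr_realpow) auto
          also have "\<dots> = N powr \<sigma>" unfolding powr_powr by (rule arg_cong[of _ _ "(powr) N"]) (simp add: \<sigma>_def field_simps)
          finally show ?thesis ..
        qed
        also have "\<dots> \<le> X ^ (k + 2)" using XN sN by (intro power_mono) auto
        finally have "N powr \<sigma> \<le> X ^ (k + 2)" .
        moreover have "N powr \<sigma> > 0" using N by simp
        ultimately have "1 / X ^ (k + 2) \<le> 1 / N powr \<sigma>" by (intro frac_le) auto
        thus ?thesis by (simp add: powr_minus_divide)
      qed
      moreover have "fact m / (2 * \<epsilon>) ^ m \<ge> 0" using \<epsilon> by simp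
      ultimately show ?thesis by (simp only: mult_left_mono)
    qed
    define r where "r = real (sum_squares_count k (Suc n))"
    define u where "u = exp (X * \<bar>Re (a - b)\<bar>)"
    define v where "v = exp (- (X * (Re a + Re b)))"
    have "norm (bessel_product_term k \<nu> a b n) \<le> r * (X ^ q * (CB * ((1 + 4 * M\<^sup>2) * X\<^sup>2) * u) * P * (CK * v))"
      unfolding bessel_product_term_def norm_mult[of "of_nat _"] norm_of_nat N_def [symmetric] X_def [symmetric] r_def [symmetric]
      unfolding norm_mult[of "_ * _"] norm_mult[of "_ powr _" "bessel_series _ _"]
      using n1 n2 n3 n4 X2 B(2) K(1) unfolding u_def [symmetric] v_def [symmetric]
      by (intro mult_left_mono mult_mono mult_nonneg_nonneg) (auto simp: r_def u_def v_def P_def)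
    also have "\<dots> = r * (D * (X ^ q * X\<^sup>2 * (u * v)))" by (simp add: D_def)
    also have "\<dots> \<le> r * (D * (X ^ q * X\<^sup>2 * (fact m / (2 * \<epsilon> * X) ^ m)))"
      using e D X2 unfolding u_def [symmetric] v_def [symmetric] by (intro mult_left_mono) (auto simp: r_def)
    also have "\<dots> \<le> r * (D * (fact m / (2 * \<epsilon>) ^ m * N powr (- \<sigma>)))"
      using xp D by (intro mult_left_mono) (auto simp: r_def)
    also have "\<dots> = E * (r * N powr (- \<sigma>))" by (simp add: E_def)
    finally show "norm (bessel_product_term k \<nu> a b n) \<le> E * (real (sum_squares_count k (Suc n)) * real (Suc n) powr (- \<sigma>))"
      unfolding r_def N_def .
  qed
qed

lemma summable_bessel_product_term:
  assumes "Re \<nu> > -1" "Re a > 0" "Re b > 0"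
  shows "summable (\<lambda>n. bessel_product_term k \<nu> a b n)"
proof -
  have e: "min (Re a) (Re b) > 0" using assms by simp
  obtain \<rho> g where h: "\<rho> > 0" "summable g" "\<And>\<mu> x y n. dist \<nu> \<mu> < \<rho> \<Longrightarrow> Re x \<ge> min (Re a) (Re b) \<Longrightarrow> Re y \<ge> min (Re a) (Re b) \<Longrightarrow>
      norm x \<le> max (norm a) (norm b) \<Longrightarrow> norm y \<le> max (norm a) (norm b) \<Longrightarrow> norm (bessel_product_term k \<mu> x y n) \<le> g n"
    using bessel_product_term_dominated[OF assms(1) e, of "max (norm a) (norm b)" k] by blast
  show ?thesis by (rule summable_comparison_test'[OF h(2), of 0]) (rule h(3); use h(1) in simp)
qed

lemma summable_kernel_term:
  assumes "k \<ge> 2" "Re \<nu> > -1"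
  shows "summable (\<lambda>n. kernel_term k \<nu> a b n)"
proof -
  obtain N g where h: "summable g" "\<And>\<mu> x y n. dist \<nu> \<mu> < (Re \<nu> + 1) / 2 \<Longrightarrow>
      norm x \<le> max (norm a) (norm b) \<Longrightarrow> norm y \<le> max (norm a) (norm b) \<Longrightarrow> n \<ge> N \<Longrightarrow> norm (kernel_term k \<mu> x y n) \<le> g n"
    by (rule kernel_term_dominated[OF assms, where M = "max (norm a) (norm b)", OF that])
  show ?thesis by (rule summable_comparison_test'[OF h(1), of N]) (rule h(2); use assms(2) in simp)
qed

definition bessel_product_sum :: "nat \<Rightarrow> complex \<Rightarrow> complex \<Rightarrow> complex \<Rightarrow> complex" where
  "bessel_product_sum k \<nu> a b = (\<Sum>n. bessel_product_term k \<nu> a b n)"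

definition kernel_sum :: "nat \<Rightarrow> complex \<Rightarrow> complex \<Rightarrow> complex \<Rightarrow> complex" where
  "kernel_sum k \<nu> a b = hyp_kernel k \<nu> a b + (\<Sum>n. kernel_term k \<nu> a b n)"

lemma holomorphic_bessel_product_sum_order:
  assumes a: "Re a > 0" and b: "Re b > 0"
  shows "(\<lambda>\<nu>. bessel_product_sum k \<nu> a b) holomorphic_on {\<nu>. Re \<nu> > -1}"
  unfolding bessel_product_sum_def
proof (rule holomorphic_suminf_dominated)
  show "open {\<nu>. Re \<nu> > -1}" by (rule open_halfspace_Re_gt)
  have z: "Re (of_real (pi * sqrt (real (Suc n))) * (a + b)) > 0" for n
    using a b by (simp del: of_nat_Suc)
  have sub: "(\<lambda>\<nu>. bessel_series \<nu> y) holomorphic_on {\<nu>. Re \<nu> > -1}" for y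
    using holomorphic_bessel_series_order by (rule holomorphic_on_subset) simp
  have sub': "(\<lambda>\<nu>. bessel_K_integral \<nu> (of_real (pi * sqrt (real (Suc n))) * (a + b))) holomorphic_on {\<nu>. Re \<nu> > -1}" for n
    using holomorphic_bessel_K_integral_order[OF z] by (rule holomorphic_on_subset) simp
  show "(\<lambda>\<nu>. bessel_product_term k \<nu> a b n) holomorphic_on {\<nu>. Re \<nu> > -1}" for n
    unfolding bessel_product_term_def
    by (intro holomorphic_intros sub sub')
  fix \<nu> :: complex assume "\<nu> \<in> {\<nu>. Re \<nu> > -1}"
  hence \<nu>: "Re \<nu> > -1" by simp
  have e: "min (Re a) (Re b) > 0" using a b by simp
  obtain \<rho> g where h: "\<rho> > 0" "summable g" "\<And>\<mu> x y n. dist \<nu> \<mu> < \<rho> \<Longrightarrow> Re x \<ge> min (Re a) (Re b) \<Longrightarrow> Re y \<ge> min (Re a) (Re b) \<Longrightarrow>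
      norm x \<le> max (norm a) (norm b) \<Longrightarrow> norm y \<le> max (norm a) (norm b) \<Longrightarrow> norm (bessel_product_term k \<mu> x y n) \<le> g n"
    using bessel_product_term_dominated[OF \<nu> e, of "max (norm a) (norm b)" k] by blast
  have "norm (bessel_product_term k w a b n) \<le> g n" if "dist \<nu> w < \<rho>" for w n
    by (rule h(3)[OF that]) simp_all
  thus "\<exists>r>0. \<exists>g. summable g \<and> (\<forall>w\<in>{\<nu>. Re \<nu> > -1}. dist \<nu> w < r \<longrightarrow> (\<forall>n. norm (bessel_product_term k w a b n) \<le> g n))"
    using h(1,2) by blast
qed

lemma holomorphic_bessel_product_sum:
  assumes \<nu>: "Re \<nu> > -1" and S: "open S" and fg: "f holomorphic_on S" "g holomorphic_on S"
    and pos: "\<And>z. z \<in> S \<Longrightarrow> Re (f z) > 0" "\<And>z. z \<in> S \<Longrightarrow> Re (g z) > 0"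
  shows "(\<lambda>z. bessel_product_sum k \<nu> (f z) (g z)) holomorphic_on S"
  unfolding bessel_product_sum_def
proof (rule holomorphic_suminf_dominated[OF S])
  fix n
  have "Re (of_real (pi * sqrt (real (Suc n))) * (f z + g z)) > 0" if "z \<in> S" for z
    using pos[OF that] by (simp del: of_nat_Suc)
  hence "(bessel_K_integral \<nu> \<circ> (\<lambda>z. of_real (pi * sqrt (real (Suc n))) * (f z + g z))) holomorphic_on S"
    by (intro holomorphic_on_compose_gen[OF _ holomorphic_bessel_K_integral] holomorphic_intros fg) auto
  moreover have "f z + g z \<notin> \<real>\<^sub>\<le>\<^sub>0" if "z \<in> S" for z using pos[OF that] by (auto simp: complex_nonpos_Reals_iff)
  ultimately show "(\<lambda>z. bessel_product_term k \<nu> (f z) (g z) n) holomorphic_on S"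
    unfolding bessel_product_term_def o_def by (intro holomorphic_intros fg) auto
next
  fix z assume z: "z \<in> S"
  define \<epsilon> where "\<epsilon> = min (Re (f z)) (Re (g z)) / 2"
  define M where "M = max (norm (f z)) (norm (g z)) + \<epsilon>"
  have \<epsilon>: "\<epsilon> > 0" using pos[OF z] by (simp add: \<epsilon>_def)
  obtain \<rho> h where h: "\<rho> > 0" "summable h" "\<And>\<mu> x y n. dist \<nu> \<mu> < \<rho> \<Longrightarrow> Re x \<ge> \<epsilon> \<Longrightarrow> Re y \<ge> \<epsilon> \<Longrightarrow>
      norm x \<le> M \<Longrightarrow> norm y \<le> M \<Longrightarrow> norm (bessel_product_term k \<mu> x y n) \<le> h n"
    using bessel_product_term_dominated[OF \<nu> \<epsilon>, of M k] by blast
  have near: "\<exists>d>0. \<forall>w\<in>S. dist z w < d \<longrightarrow> dist (u w) (u z) < \<epsilon>" if "u holomorphic_on S" for u :: "complex \<Rightarrow> complex"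
    using holomorphic_on_imp_continuous_on[OF that] z \<epsilon> unfolding continuous_on_iff by (metis dist_commute)
  obtain d1 d2 where d: "d1 > 0" "d2 > 0" "\<And>w. w \<in> S \<Longrightarrow> dist z w < d1 \<Longrightarrow> dist (f w) (f z) < \<epsilon>"
     "\<And>w. w \<in> S \<Longrightarrow> dist z w < d2 \<Longrightarrow> dist (g w) (g z) < \<epsilon>" using near[OF fg(1)] near[OF fg(2)] by blast
  have b: "Re x \<ge> \<epsilon> \<and> norm x \<le> M" if "dist x y < \<epsilon>" "Re y \<ge> 2 * \<epsilon>" "norm y + \<epsilon> \<le> M" for x y :: complex
    using that abs_Re_le_cmod[of "y - x"] norm_triangle_sub[of x y] by (auto simp: dist_norm norm_minus_commute)
  have "norm (bessel_product_term k \<nu> (f w) (g w) n) \<le> h n" if "w \<in> S" "dist z w < min d1 d2" for w n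
  proof -
    have "Re (f z) \<ge> 2 * \<epsilon>" "norm (f z) + \<epsilon> \<le> M" "Re (g z) \<ge> 2 * \<epsilon>" "norm (g z) + \<epsilon> \<le> M" by (auto simp: \<epsilon>_def M_def)
    moreover have "dist (f w) (f z) < \<epsilon>" "dist (g w) (g z) < \<epsilon>" using that d by auto
    ultimately have "Re (f w) \<ge> \<epsilon> \<and> norm (f w) \<le> M" "Re (g w) \<ge> \<epsilon> \<and> norm (g w) \<le> M" by - ((rule b; assumption)+)
    thus ?thesis using h(1) by (intro h(3)) simp_all
  qed
  thus "\<exists>r>0. \<exists>h. summable h \<and> (\<forall>w\<in>S. dist z w < r \<longrightarrow> (\<forall>n. norm (bessel_product_term k \<nu> (f w) (g w) n) \<le> h n))"
    using h(2) d(1,2) by (intro exI[of _ "min d1 d2"] conjI exI[of _ h]) simp_all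
qed

lemma holomorphic_kernel_sum:
  assumes k: "k \<ge> 2" and \<nu>: "Re \<nu> > -1" and S: "open S" and fg: "f holomorphic_on S" "g holomorphic_on S"
    and pos: "\<And>z. z \<in> S \<Longrightarrow> Re (f z) > 0" "\<And>z. z \<in> S \<Longrightarrow> Re (g z) > 0"
  shows "(\<lambda>z. kernel_sum k \<nu> (f z) (g z)) holomorphic_on S"
proof -
  have "(\<lambda>z. \<Sum>n. kernel_term k \<nu> (f z) (g z) n) holomorphic_on S"
  proof (rule holomorphic_suminf_eventually_dominated[OF S])
    fix n
    have nn: "of_nat (Suc n) + (f z)\<^sup>2 \<notin> \<real>\<^sub>\<le>\<^sub>0" "of_nat (Suc n) + (g z)\<^sup>2 \<notin> \<real>\<^sub>\<le>\<^sub>0" if "z \<in> S" for z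
      using shifted_square_notin_nonpos_Reals[OF pos(1)[OF that], of "real (Suc n)"]
        shifted_square_notin_nonpos_Reals[OF pos(2)[OF that], of "real (Suc n)"] by simp_all
    show "(\<lambda>z. kernel_term k \<nu> (f z) (g z) n) holomorphic_on S"
      unfolding kernel_term_def
      by (intro holomorphic_intros holomorphic_hyp_kernel fg) (use nn Re_csqrt_pos \<nu> in \<open>auto simp del: csqrt.sel\<close>)
  next
    fix z assume z: "z \<in> S"
    define M where "M = max (norm (f z)) (norm (g z)) + 1"
    obtain N h where h: "summable h" "\<And>\<mu> x y n. dist \<nu> \<mu> < (Re \<nu> + 1) / 2 \<Longrightarrow>
        norm x \<le> M \<Longrightarrow> norm y \<le> M \<Longrightarrow> n \<ge> N \<Longrightarrow> norm (kernel_term k \<mu> x y n) \<le> h n"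
      by (rule kernel_term_dominated[OF k \<nu>, where M = M, OF that])
    have near: "\<exists>d>0. \<forall>w\<in>S. dist z w < d \<longrightarrow> dist (u w) (u z) < 1" if "u holomorphic_on S" for u :: "complex \<Rightarrow> complex"
      using holomorphic_on_imp_continuous_on[OF that] z zero_less_one unfolding continuous_on_iff by (metis dist_commute)
    obtain d1 d2 where d: "d1 > 0" "d2 > 0" "\<And>w. w \<in> S \<Longrightarrow> dist z w < d1 \<Longrightarrow> dist (f w) (f z) < 1"
       "\<And>w. w \<in> S \<Longrightarrow> dist z w < d2 \<Longrightarrow> dist (g w) (g z) < 1" using near[OF fg(1)] near[OF fg(2)] by blast
    have b: "norm x \<le> M" if "dist x y < 1" "norm y + 1 \<le> M" for x y :: complex
      using that norm_triangle_sub[of x y] by (auto simp: dist_norm norm_minus_commute)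
    have "norm (kernel_term k \<nu> (f w) (g w) n) \<le> h n" if "w \<in> S" "dist z w < min d1 d2" "n \<ge> N" for w n
    proof -
      have "norm (f z) + 1 \<le> M" "norm (g z) + 1 \<le> M" by (auto simp: M_def)
      moreover have "dist (f w) (f z) < 1" "dist (g w) (g z) < 1" using that d by auto
      ultimately have "norm (f w) \<le> M" "norm (g w) \<le> M" by - ((rule b; assumption)+)
      thus ?thesis using \<nu> that(3) by (intro h(2)) simp_all
    qed
    thus "\<exists>r>0. \<exists>h N. summable h \<and> (\<forall>w\<in>S. dist z w < r \<longrightarrow> (\<forall>n\<ge>N. norm (kernel_term k \<nu> (f w) (g w) n) \<le> h n))"
      using h(1) d(1,2) by (intro exI[of _ "min d1 d2"] conjI exI[of _ h] exI[of _ N]) simp_all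
  qed
  thus ?thesis unfolding kernel_sum_def by (intro holomorphic_intros holomorphic_hyp_kernel fg pos \<nu>)
qed

lemma holomorphic_kernel_sum_order:
  fixes a b :: real
  assumes k: "k \<ge> 2" and ab: "a > 0" "b > 0" "\<bar>a - b\<bar> < (a + b) / 4"
  shows "(\<lambda>\<nu>. kernel_sum k \<nu> (of_real a) (of_real b)) holomorphic_on {\<nu>. Re \<nu> > -1}"
proof -
  have hyp: "(\<lambda>\<nu>. hyp_kernel k \<nu> (of_real x) (of_real y)) holomorphic_on {\<nu>. Re \<nu> > -1}"
    if xy: "x > 0" "y > 0" "\<bar>x - y\<bar> < (x + y) / 4" for x y :: real
  proof (rule holomorphic_hyp_kernel_order)
    have "\<bar>(x - y) / (x + y)\<bar> \<le> 1/4" using xy by (simp add: abs_divide field_simps)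
    hence "\<bar>(x - y) / (x + y)\<bar>\<^sup>2 \<le> (1/4)\<^sup>2" by (intro power_mono) auto
    also have "(1/4)\<^sup>2 \<le> (1/4 :: real)" by (simp add: power2_eq_square)
    finally have "norm (complex_of_real (((x - y) / (x + y))\<^sup>2)) \<le> 1/4" unfolding norm_of_real power_abs .
    thus "norm (((complex_of_real x - of_real y) / (of_real x + of_real y))\<^sup>2) \<le> 1/4" by simp
  qed (use xy in auto)
  have "(\<lambda>\<nu>. \<Sum>n. kernel_term k \<nu> (of_real a) (of_real b) n) holomorphic_on {\<nu>. Re \<nu> > -1}"
  proof (rule holomorphic_suminf_eventually_dominated)
    show "open {\<nu>. Re \<nu> > -1}" by (rule open_halfspace_Re_gt)
    fix n
    have m: "real (Suc n) \<ge> 0" by simp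
    note sr = shifted_roots(1-3)[OF ab m]
    have "csqrt (of_nat (Suc n) + (of_real x)\<^sup>2) = of_real (sqrt (real (Suc n) + x\<^sup>2))" for x
      using csqrt_of_real_nonneg[of "complex_of_real (real (Suc n) + x\<^sup>2)"] by simp
    hence "(\<lambda>\<nu>. hyp_kernel k \<nu> (csqrt (of_nat (Suc n) + (of_real a)\<^sup>2)) (csqrt (of_nat (Suc n) + (of_real b)\<^sup>2))) holomorphic_on {\<nu>. Re \<nu> > -1}"
      using hyp[OF sr] by (simp only:)
    moreover have "complex_of_nat (Suc n) powr z \<noteq> 0" for z by (simp del: of_nat_Suc)
    ultimately show "(\<lambda>\<nu>. kernel_term k \<nu> (of_real a) (of_real b) n) holomorphic_on {\<nu>. Re \<nu> > -1}"
      unfolding kernel_term_def by (intro holomorphic_intros) auto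
  next
    fix \<nu> :: complex assume "\<nu> \<in> {\<nu>. Re \<nu> > -1}"
    hence \<nu>: "Re \<nu> > -1" by simp
    define M where "M = max a b"
    obtain N h where h: "summable h" "\<And>\<mu> x y n. dist \<nu> \<mu> < (Re \<nu> + 1) / 2 \<Longrightarrow>
        norm x \<le> M \<Longrightarrow> norm y \<le> M \<Longrightarrow> n \<ge> N \<Longrightarrow> norm (kernel_term k \<mu> x y n) \<le> h n"
      by (rule kernel_term_dominated[OF k \<nu>, where M = M, OF that])
    have "norm (complex_of_real a) \<le> M" "norm (complex_of_real b) \<le> M" using ab by (auto simp: M_def)
    note M = this
    have "norm (kernel_term k w (of_real a) (of_real b) n) \<le> h n" if "dist \<nu> w < (Re \<nu> + 1) / 2" "n \<ge> N" for w n
      by (rule h(2)[OF that(1) M that(2)])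
    moreover have "(Re \<nu> + 1) / 2 > 0" using \<nu> by simp
    ultimately show "\<exists>r>0. \<exists>h N. summable h \<and> (\<forall>w\<in>{\<nu>. Re \<nu> > -1}. dist \<nu> w < r \<longrightarrow>
        (\<forall>n\<ge>N. norm (kernel_term k w (of_real a) (of_real b) n) \<le> h n))"
      using h(1) by blast
  qed
  thus ?thesis unfolding kernel_sum_def by (intro holomorphic_intros hyp ab)
qed

section \<open>Continuation to all parameters\<close>

lemma holomorphic_kernel_const:
  assumes "k \<ge> 2"
  shows "kernel_const k holomorphic_on {\<nu>. Re \<nu> > -1}"
proof -
  have 1: "\<nu> + of_nat k / 2 \<notin> \<int>\<^sub>\<le>\<^sub>0" "\<nu> + 1 \<notin> \<int>\<^sub>\<le>\<^sub>0" if "Re \<nu> > -1" for \<nu> :: complex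
    using that assms by (auto intro!: Re_pos_notin_nonpos_Ints)
  hence "Gamma (\<nu> + 1) \<noteq> 0" if "Re \<nu> > -1" for \<nu> :: complex using that by (simp add: Gamma_eq_zero_iff)
  thus ?thesis unfolding kernel_const_def using 1 by (intro holomorphic_intros) auto
qed

lemma holomorphic_zeta_term:
  assumes "k \<ge> 2"
  shows "zeta_term k holomorphic_on {\<nu>. Re \<nu> > -1} - {0}"
proof -
  have "(sum_squares_zeta k \<circ> (\<lambda>\<nu>. \<nu> + of_nat k / 2)) holomorphic_on {\<nu>. Re \<nu> > -1} - {0}"
    by (intro holomorphic_on_compose_gen[OF _ holomorphic_sum_squares_zeta] holomorphic_intros) auto
  moreover have "kernel_const k holomorphic_on {\<nu>. Re \<nu> > -1} - {0}"
    using holomorphic_kernel_const[OF assms] by (rule holomorphic_on_subset) auto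
  ultimately have "(\<lambda>\<nu>. 2 powr (- 2 * \<nu> - 1) * 2 ^ (k - 1) * kernel_const k \<nu> * sum_squares_zeta k (\<nu> + of_nat k / 2))
      holomorphic_on {\<nu>. Re \<nu> > -1} - {0}"
    unfolding o_def by (intro holomorphic_intros)
  moreover have "2 powr (- 2 * \<nu> - 1) * 2 ^ (k - 1) * kernel_const k \<nu> * sum_squares_zeta k (\<nu> + of_nat k / 2) = zeta_term k \<nu>" for \<nu>
    by (simp add: kernel_const_def zeta_term_def)
  ultimately show ?thesis by (simp only: cong: holomorphic_cong) 
qed

text \<open>
Continuation in the order, along the half-plane punctured at the pole \<open>\<nu> = 0\<close> of the separate terms.
\<close>

lemma identity_near_diagonal_nonzero:
  fixes a b :: real
  assumes k: "k \<ge> 2" and ab: "a > 0" "b > 0" "\<bar>a - b\<bar> < (a + b) / 4" and \<nu>: "Re \<nu> > -1" "\<nu> \<noteq> 0"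
  shows "bessel_product_sum k \<nu> (of_real a) (of_real b) =
    zeta_term k \<nu> - of_real (a + b) powr (- 2 * \<nu>) / (2 * \<nu>) + kernel_const k \<nu> * kernel_sum k \<nu> (of_real a) (of_real b)"
proof (rule analytic_continuation_eq[where f = "\<lambda>\<nu>. bessel_product_sum k \<nu> (of_real a) (of_real b)" and w = \<nu> and
      g = "\<lambda>\<nu>. zeta_term k \<nu> - of_real (a + b) powr (- 2 * \<nu>) / (2 * \<nu>) + kernel_const k \<nu> * kernel_sum k \<nu> (of_real a) (of_real b)"])
  let ?S = "{\<nu>. Re \<nu> > -1} - {0::complex}"
  have sub: "?S \<subseteq> {\<nu>. Re \<nu> > -1}" by auto
  show "(\<lambda>\<nu>. bessel_product_sum k \<nu> (of_real a) (of_real b)) holomorphic_on ?S"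
    using holomorphic_bessel_product_sum_order[of "of_real a" "of_real b" k] ab sub by (auto intro: holomorphic_on_subset)
  have "(\<lambda>\<nu>. kernel_sum k \<nu> (of_real a) (of_real b)) holomorphic_on ?S" "kernel_const k holomorphic_on ?S"
    using holomorphic_kernel_sum_order[OF k ab] holomorphic_kernel_const[OF k] sub by (blast intro: holomorphic_on_subset)+
  thus "(\<lambda>\<nu>. zeta_term k \<nu> - of_real (a + b) powr (- 2 * \<nu>) / (2 * \<nu>) + kernel_const k \<nu> * kernel_sum k \<nu> (of_real a) (of_real b)) holomorphic_on ?S"
    by (intro holomorphic_intros holomorphic_zeta_term[OF k]) auto
  have op: "open {\<nu>. Re \<nu> > -1}" by (rule open_halfspace_Re_gt)
  show "open ?S" using op by (intro open_Diff) auto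
  show "connected ?S"
  proof (rule connected_open_delete)
    show "open {\<nu>. Re \<nu> > -1}" by (rule op)
    show "connected {\<nu>. Re \<nu> > -1}" by (intro convex_connected convex_halfspace_Re_gt)
  qed simp
  show "of_real ` {1/2<..} \<subseteq> ?S" by auto
  show "complex_of_real 1 \<in> ?S" by simp
  show "complex_of_real 1 islimpt of_real ` {1/2<..}" by (rule islimpt_of_real_image) auto
  show "\<nu> \<in> ?S" using \<nu> by simp
next
  fix z assume "z \<in> complex_of_real ` {1/2<..}"
  then obtain x where x: "z = of_real x" "x > 1/2" by auto
  show "bessel_product_sum k z (of_real a) (of_real b) =
      zeta_term k z - of_real (a + b) powr (- 2 * z) / (2 * z) + kernel_const k z * kernel_sum k z (of_real a) (of_real b)"
    using base_identity[OF x(2) k ab] unfolding x(1) bessel_product_sum_def kernel_sum_def of_real_add by (simp add: sums_iff)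
qed

text \<open>
The first two terms of the right-hand side, normalised, with their limit at \<open>\<nu> = 0\<close>. Since
\<open>(1 - s\<^bsup>-2\<nu>\<^esup>) / (2 \<nu>)\<close> tends to \<open>Ln s\<close>, only the constant in the limit has to be taken from the identity itself.
\<close>

definition principal_part :: "nat \<Rightarrow> complex \<Rightarrow> complex \<Rightarrow> complex" where
  "principal_part k \<nu> s = (if \<nu> = 0 then Lim (at 0) (\<lambda>\<mu>. zeta_term k \<mu> - 1 / (2 * \<mu>)) + Ln s
     else zeta_term k \<nu> - s powr (- 2 * \<nu>) / (2 * \<nu>))"

lemma eventually_at_0_order: "eventually (\<lambda>\<mu>. \<mu> \<noteq> 0 \<and> Re \<mu> > -1) (at (0::complex))"
proof -
  have "eventually (\<lambda>\<mu>. \<mu> \<in> {\<mu>. Re \<mu> > -1}) (at (0::complex))"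
    by (intro eventually_at_in_open' open_halfspace_Re_gt) simp
  moreover have "eventually (\<lambda>\<mu>. \<mu> \<noteq> 0) (at (0::complex))" by (rule eventually_neq_at_within)
  ultimately show ?thesis by eventually_elim simp
qed

lemma tendsto_at_0_of_holomorphic:
  assumes "f holomorphic_on {\<nu>. Re \<nu> > -1}"
  shows "(f \<longlongrightarrow> f 0) (at 0)"
proof -
  have "isCont f 0"
    by (rule continuous_on_interior[OF holomorphic_on_imp_continuous_on[OF assms]])
       (simp add: interior_open[OF open_halfspace_Re_gt])
  thus ?thesis by (simp add: isCont_def)
qed

text \<open>
The limit exists because, by the identity for \<open>a = b = 1/2\<close>, the expression is a difference of functions of \<open>\<nu>\<close> that are
holomorphic at \<open>0\<close>.
\<close>

lemma tendsto_zeta_term_pole: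
  assumes k: "k \<ge> 2"
  shows "((\<lambda>\<mu>. zeta_term k \<mu> - 1 / (2 * \<mu>)) \<longlongrightarrow> Lim (at 0) (\<lambda>\<mu>. zeta_term k \<mu> - 1 / (2 * \<mu>))) (at 0)"
proof -
  let ?h = "complex_of_real (1/2)"
  define f where "f = (\<lambda>\<mu>. bessel_product_sum k \<mu> ?h ?h - kernel_const k \<mu> * kernel_sum k \<mu> ?h ?h)"
  have "f holomorphic_on {\<nu>. Re \<nu> > -1}"
    unfolding f_def
    by (intro holomorphic_intros holomorphic_bessel_product_sum_order holomorphic_kernel_sum_order holomorphic_kernel_const k) auto
  hence "(f \<longlongrightarrow> f 0) (at 0)" by (rule tendsto_at_0_of_holomorphic)
  moreover have "eventually (\<lambda>\<mu>. f \<mu> = zeta_term k \<mu> - 1 / (2 * \<mu>)) (at 0)"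
    using eventually_at_0_order
  proof eventually_elim
    case (elim \<mu>)
    have "bessel_product_sum k \<mu> ?h ?h = zeta_term k \<mu> - of_real (1/2 + 1/2) powr (- 2 * \<mu>) / (2 * \<mu>) + kernel_const k \<mu> * kernel_sum k \<mu> ?h ?h"
      by (rule identity_near_diagonal_nonzero[OF k]) (use elim in auto)
    thus ?case by (simp add: f_def)
  qed
  ultimately have "((\<lambda>\<mu>. zeta_term k \<mu> - 1 / (2 * \<mu>)) \<longlongrightarrow> f 0) (at 0)" by (simp add: filterlim_cong)
  moreover from this have "Lim (at 0) (\<lambda>\<mu>. zeta_term k \<mu> - 1 / (2 * \<mu>)) = f 0" by (intro tendsto_Lim) auto
  ultimately show ?thesis by simp
qed

lemma tendsto_principal_part:
  assumes k: "k \<ge> 2" and s: "s \<noteq> 0"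
  shows "((\<lambda>\<mu>. principal_part k \<mu> s) \<longlongrightarrow> principal_part k 0 s) (at 0)"
proof -
  have "((\<lambda>\<mu>. s powr (- 2 * \<mu>)) has_field_derivative (- 2 * Ln s)) (at 0)"
  proof -
    have "((\<lambda>\<mu>. s powr (- 2 * \<mu>)) has_field_derivative (Ln s * s powr (- 2 * 0)) * (- 2)) (at 0)"
      by (rule DERIV_chain2[OF has_field_derivative_powr_right[OF s]]) (auto intro!: derivative_eq_intros)
    thus ?thesis using s by (simp add: mult.commute)
  qed
  hence "((\<lambda>\<mu>. (s powr (- 2 * \<mu>) - 1) / \<mu>) \<longlongrightarrow> - 2 * Ln s) (at 0)"
    using s by (simp add: has_field_derivative_iff)
  hence "((\<lambda>\<mu>. zeta_term k \<mu> - 1 / (2 * \<mu>) - (s powr (- 2 * \<mu>) - 1) / \<mu> / 2) \<longlongrightarrow>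
      Lim (at 0) (\<lambda>\<mu>. zeta_term k \<mu> - 1 / (2 * \<mu>)) - (- 2 * Ln s) / 2) (at 0)"
    by (intro tendsto_intros tendsto_zeta_term_pole[OF k]) auto
  moreover have "Lim (at 0) (\<lambda>\<mu>. zeta_term k \<mu> - 1 / (2 * \<mu>)) - (- 2 * Ln s) / 2 = principal_part k 0 s"
    by (simp add: principal_part_def)
  moreover have "eventually (\<lambda>\<mu>. zeta_term k \<mu> - 1 / (2 * \<mu>) - (s powr (- 2 * \<mu>) - 1) / \<mu> / 2 = principal_part k \<mu> s) (at 0)"
    using eventually_at_0_order
  proof eventually_elim
    case (elim \<mu>)
    have "z - 1 / (2 * \<mu>) - (w - 1) / \<mu> / 2 = z - w / (2 * \<mu>)" for z w
      using elim by (simp add: field_simps)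
    thus ?case using elim by (simp only: principal_part_def if_False)
  qed
  ultimately show ?thesis by (simp only: filterlim_cong)
qed

lemma identity_near_diagonal:
  fixes a b :: real
  assumes k: "k \<ge> 2" and ab: "a > 0" "b > 0" "\<bar>a - b\<bar> < (a + b) / 4" and \<nu>: "Re \<nu> > -1"
  shows "bessel_product_sum k \<nu> (of_real a) (of_real b) =
    principal_part k \<nu> (of_real a + of_real b) + kernel_const k \<nu> * kernel_sum k \<nu> (of_real a) (of_real b)"
proof (cases "\<nu> = 0")
  case False
  thus ?thesis using identity_near_diagonal_nonzero[OF k ab \<nu> False] by (simp add: principal_part_def)
next
  case True
  let ?L = "\<lambda>\<mu>. bessel_product_sum k \<mu> (of_real a) (of_real b)"
  let ?R = "\<lambda>\<mu>. kernel_const k \<mu> * kernel_sum k \<mu> (of_real a) (of_real b)"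
  have "(\<lambda>\<mu>. ?L \<mu> - ?R \<mu>) holomorphic_on {\<nu>. Re \<nu> > -1}"
    by (intro holomorphic_intros holomorphic_bessel_product_sum_order holomorphic_kernel_sum_order holomorphic_kernel_const k ab)
       (use ab in auto)
  hence "((\<lambda>\<mu>. ?L \<mu> - ?R \<mu>) \<longlongrightarrow> ?L 0 - ?R 0) (at 0)" by (rule tendsto_at_0_of_holomorphic)
  moreover have "eventually (\<lambda>\<mu>. ?L \<mu> - ?R \<mu> = principal_part k \<mu> (of_real a + of_real b)) (at 0)"
    using eventually_at_0_order
  proof eventually_elim
    case (elim \<mu>)
    thus ?case using identity_near_diagonal_nonzero[OF k ab, of \<mu>] by (simp add: principal_part_def)
  qed
  ultimately have "((\<lambda>\<mu>. principal_part k \<mu> (of_real a + of_real b)) \<longlongrightarrow> ?L 0 - ?R 0) (at 0)"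
    by (simp only: filterlim_cong)
  moreover have "((\<lambda>\<mu>. principal_part k \<mu> (of_real a + of_real b)) \<longlongrightarrow> principal_part k 0 (of_real a + of_real b)) (at 0)"
    using ab by (intro tendsto_principal_part[OF k]) (simp flip: of_real_add)
  ultimately have "?L 0 - ?R 0 = principal_part k 0 (of_real a + of_real b)"
    by (rule tendsto_unique[OF at_neq_bot])
  thus ?thesis unfolding True by (simp add: algebra_simps)
qed

lemma holomorphic_principal_part:
  assumes "f holomorphic_on S" "\<And>z. z \<in> S \<Longrightarrow> Re (f z) > 0"
  shows "(\<lambda>z. principal_part k \<nu> (f z)) holomorphic_on S"
proof -
  have "f z \<notin> \<real>\<^sub>\<le>\<^sub>0" if "z \<in> S" for z using assms(2)[OF that] by (auto simp: complex_nonpos_Reals_iff)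
  thus ?thesis
    unfolding principal_part_def by (cases "\<nu> = 0") (auto intro!: holomorphic_intros assms)
qed

text \<open>
The interval of admissible \<open>a\<close> for fixed \<open>b > 0\<close> accumulates at \<open>b\<close>, which allows continuation in \<open>a\<close>; afterwards every
\<open>b > 0\<close> is admissible, which allows continuation in \<open>b\<close>.
\<close>

theorem normalised_identity:
  assumes k: "k \<ge> 2" and \<nu>: "Re \<nu> > -1" and ab: "Re a > 0" "Re b > 0"
  shows "bessel_product_sum k \<nu> a b = principal_part k \<nu> (a + b) + kernel_const k \<nu> * kernel_sum k \<nu> a b"
proof -
  let ?H = "{z. Re z > 0}"
  have H: "open ?H" "connected ?H" by (auto intro!: open_halfspace_Re_gt convex_connected convex_halfspace_Re_gt)
  have hol: "(\<lambda>z. bessel_product_sum k \<nu> (f z) (g z)) holomorphic_on ?H"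
    "(\<lambda>z. principal_part k \<nu> (f z + g z) + kernel_const k \<nu> * kernel_sum k \<nu> (f z) (g z)) holomorphic_on ?H"
    if "f holomorphic_on ?H" "g holomorphic_on ?H" "\<And>z. z \<in> ?H \<Longrightarrow> Re (f z) > 0" "\<And>z. z \<in> ?H \<Longrightarrow> Re (g z) > 0" for f g
    using that(3,4)
    by (intro holomorphic_intros holomorphic_bessel_product_sum holomorphic_principal_part holomorphic_kernel_sum k \<nu> H that; simp add: add_pos_pos)+
  have 1: "bessel_product_sum k \<nu> x (of_real y) = principal_part k \<nu> (x + of_real y) + kernel_const k \<nu> * kernel_sum k \<nu> x (of_real y)"
    if x: "Re x > 0" and y: "y > 0" for x and y :: real
  proof (rule analytic_continuation_eq[where f = "\<lambda>x. bessel_product_sum k \<nu> x (of_real y)" and S = ?H and w = x and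
        g = "\<lambda>x. principal_part k \<nu> (x + of_real y) + kernel_const k \<nu> * kernel_sum k \<nu> x (of_real y)"])
    define U where "U = {a. 0 < a \<and> \<bar>a - y\<bar> < (a + y) / 4}"
    have oU: "open U" unfolding U_def by (intro open_Collect_conj open_Collect_less continuous_intros) auto
    have yU: "y \<in> U" using y by (simp add: U_def)
    show "of_real ` U \<subseteq> ?H" by (auto simp: U_def)
    show "complex_of_real y islimpt of_real ` U" by (rule islimpt_of_real_image[OF oU yU])
    show "complex_of_real y \<in> ?H" using y by simp
    fix z assume "z \<in> complex_of_real ` U"
    then obtain a where a: "z = of_real a" "a > 0" "\<bar>a - y\<bar> < (a + y) / 4" by (auto simp: U_def)
    show "bessel_product_sum k \<nu> z (of_real y) = principal_part k \<nu> (z + of_real y) + kernel_const k \<nu> * kernel_sum k \<nu> z (of_real y)"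
      unfolding a(1) by (rule identity_near_diagonal[OF k a(2) y a(3) \<nu>])
  next
    show "(\<lambda>x. bessel_product_sum k \<nu> x (of_real y)) holomorphic_on ?H"
      by (rule hol(1)[of "\<lambda>x. x" "\<lambda>_. of_real y"]) (use y in auto)
    show "(\<lambda>x. principal_part k \<nu> (x + of_real y) + kernel_const k \<nu> * kernel_sum k \<nu> x (of_real y)) holomorphic_on ?H"
      by (rule hol(2)[of "\<lambda>x. x" "\<lambda>_. of_real y"]) (use y in auto)
  qed (use x H in auto)
  show ?thesis
  proof (rule analytic_continuation_eq[where f = "\<lambda>b. bessel_product_sum k \<nu> a b" and S = ?H and w = b and
        g = "\<lambda>b. principal_part k \<nu> (a + b) + kernel_const k \<nu> * kernel_sum k \<nu> a b"])
    show "of_real ` {0<..} \<subseteq> ?H" by auto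
    show "complex_of_real 1 islimpt of_real ` {0<..}" by (rule islimpt_of_real_image) auto
    show "complex_of_real 1 \<in> ?H" by simp
    fix z assume "z \<in> complex_of_real ` {0<..}"
    thus "bessel_product_sum k \<nu> a z = principal_part k \<nu> (a + z) + kernel_const k \<nu> * kernel_sum k \<nu> a z"
      using 1[OF ab(1)] by auto
  next
    show "(\<lambda>b. bessel_product_sum k \<nu> a b) holomorphic_on ?H"
      by (rule hol(1)[of "\<lambda>_. a" "\<lambda>b. b"]) (use ab in auto)
    show "(\<lambda>b. principal_part k \<nu> (a + b) + kernel_const k \<nu> * kernel_sum k \<nu> a b) holomorphic_on ?H"
      by (rule hol(2)[of "\<lambda>_. a" "\<lambda>b. b"]) (use ab in auto)
  qed (use ab H in auto)
qed

section \<open>Branches of the powers, and the theorem\<close>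

lemma Re_csqrt_sq: "2 * (Re (csqrt z))\<^sup>2 = norm z + Re z"
proof -
  define x where "x = csqrt z"
  have z: "z = x\<^sup>2" by (simp add: x_def)
  have "norm z = (Re x)\<^sup>2 + (Im x)\<^sup>2" unfolding z norm_power cmod_power2 ..
  moreover have "Re z = (Re x)\<^sup>2 - (Im x)\<^sup>2" unfolding z by (simp add: power2_eq_square)
  ultimately show ?thesis unfolding x_def [symmetric] by simp
qed

text \<open>
By \<open>Re_csqrt_sq\<close> the real parts of the roots are compared through \<open>norm z + Re z\<close>. Shifting the point \<open>q\<^sup>2 \<beta>\<close>
to the left by a nonnegative amount does not increase this expression.
\<close>

lemma Re_csqrt_less_of_contraction:
  assumes q: "0 < q" "q < 1" and m: "m \<ge> 0" and \<alpha>: "of_real m + \<alpha> = of_real (q\<^sup>2) * (of_real m + \<beta>)"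
    and \<beta>: "Re (csqrt \<beta>) > 0"
  shows "Re (csqrt \<alpha>) < Re (csqrt \<beta>)"
proof -
  have q2: "q\<^sup>2 < 1" using q by (simp add: power_less_one_iff)
  have \<alpha>': "\<alpha> = of_real (q\<^sup>2) * \<beta> - of_real ((1 - q\<^sup>2) * m)" using \<alpha> by (simp add: algebra_simps)
  have nn: "(1 - q\<^sup>2) * m \<ge> 0" using q2 m by simp
  have "norm \<alpha> \<le> q\<^sup>2 * norm \<beta> + (1 - q\<^sup>2) * m"
  proof -
    have "norm \<alpha> \<le> norm (of_real (q\<^sup>2) * \<beta>) + norm (complex_of_real ((1 - q\<^sup>2) * m))"
      unfolding \<alpha>' by (rule norm_triangle_ineq4)
    also have "norm (complex_of_real ((1 - q\<^sup>2) * m)) = (1 - q\<^sup>2) * m" unfolding norm_of_real using nn by simp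
    also have "norm (of_real (q\<^sup>2) * \<beta>) = q\<^sup>2 * norm \<beta>" unfolding norm_mult norm_of_real by simp
    finally show ?thesis .
  qed
  moreover have "Re \<alpha> = q\<^sup>2 * Re \<beta> - (1 - q\<^sup>2) * m" unfolding \<alpha>' by (simp del: of_real_power)
  ultimately have "norm \<alpha> + Re \<alpha> \<le> q\<^sup>2 * (norm \<beta> + Re \<beta>)" by (simp add: distrib_left)
  also have "\<dots> < 1 * (norm \<beta> + Re \<beta>)"
    using q2 \<beta> Re_csqrt_sq[of \<beta>] by (intro mult_strict_right_mono) (auto simp flip: Re_csqrt_sq simp del: csqrt.sel)
  finally have "norm \<alpha> + Re \<alpha> < 1 * (norm \<beta> + Re \<beta>)" .
  have "(Re (csqrt \<alpha>))\<^sup>2 < (Re (csqrt \<beta>))\<^sup>2"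
  proof -
    have "X < Y" if "n < 1 * m" "2 * X = n" "2 * Y = m" for X Y m n :: real using that by linarith
    from this[OF \<open>norm \<alpha> + Re \<alpha> < 1 * (norm \<beta> + Re \<beta>)\<close> Re_csqrt_sq Re_csqrt_sq] show ?thesis .
  qed
  thus ?thesis by (rule power2_less_imp_less) (rule less_imp_le[OF \<beta>])
qed

text \<open>
Both sides have the same exponential, since \<open>(A - B) (A + B) = \<alpha> - \<beta>\<close>, and the left one is principal. For
\<open>m = 0\<close> the imaginary part of the right one has modulus below \<open>\<pi>\<close> because \<open>Re (A - B) \<ge> 0\<close>. As \<open>m\<close> grows it cannot reach \<open>\<pm> \<pi>\<close>,
because then \<open>(A - B) / (A + B)\<close> would be negative, that is \<open>A = q B\<close> with \<open>0 < q < 1\<close>, which contradicts the assumption on the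
real parts. The condition \<open>Re (A - B) \<ge> 0\<close> itself may fail for \<open>m > 0\<close>.
\<close>

lemma Ln_shifted_quotient:
  fixes \<alpha> \<beta> :: complex and m :: real
  assumes le: "Re (csqrt \<alpha>) \<ge> Re (csqrt \<beta>)" and \<beta>: "Re (csqrt \<beta>) > 0" and ne: "\<alpha> \<noteq> \<beta>" and m: "m \<ge> 0"
  defines "A \<equiv> csqrt (of_real m + \<alpha>)" and "B \<equiv> csqrt (of_real m + \<beta>)"
  shows "Ln ((A - B) / (A + B)) = Ln (\<alpha> - \<beta>) - 2 * Ln (A + B)"
proof -
  have \<alpha>: "Re (csqrt \<alpha>) > 0" using le \<beta> by linarith
  define a where "a = (\<lambda>t::real. csqrt (of_real t + \<alpha>))"
  define b where "b = (\<lambda>t::real. csqrt (of_real t + \<beta>))"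
  have notin: "of_real t + z \<notin> \<real>\<^sub>\<le>\<^sub>0" if "t \<ge> 0" "Re (csqrt z) > 0" for t z
    using shifted_square_notin_nonpos_Reals[OF that(2,1)] by simp
  have pa: "Re (a t) > 0" and pb: "Re (b t) > 0" if "t \<ge> 0" for t
    unfolding a_def b_def by (intro Re_csqrt_pos notin that \<alpha> \<beta>)+
  have ps: "Re (a t + b t) > 0" if "t \<ge> 0" for t using pa[OF that] pb[OF that] by simp
  have prod: "(a t - b t) * (a t + b t) = \<alpha> - \<beta>" for t
  proof -
    have "(a t)\<^sup>2 - (b t)\<^sup>2 = \<alpha> - \<beta>" by (simp add: a_def b_def)
    thus ?thesis by (simp add: power2_eq_square algebra_simps)
  qed
  \<comment> \<open>the imaginary part of the right-hand side as a function of the shift\<close>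
  define \<phi> where "\<phi> = (\<lambda>t. Im (Ln (\<alpha> - \<beta>) - 2 * Ln (a t + b t)))"
  have ex: "exp (Ln (\<alpha> - \<beta>) - 2 * Ln (a t + b t)) = (a t - b t) / (a t + b t)" if "t \<ge> 0" for t
  proof -
    have s: "a t + b t \<noteq> 0" using ps[OF that] by force
    have "exp (2 * Ln (a t + b t)) = (a t + b t) * (a t + b t)" using s by (simp add: exp_double power2_eq_square)
    hence "exp (Ln (\<alpha> - \<beta>) - 2 * Ln (a t + b t)) = (\<alpha> - \<beta>) / ((a t + b t) * (a t + b t))" using ne by (simp add: exp_diff)
    thus ?thesis using s prod[of t] by (metis nonzero_mult_divide_mult_cancel_right)
  qed
  have npos: "(a t - b t) / (a t + b t) \<notin> \<real>\<^sub>\<le>\<^sub>0" if t: "t \<ge> 0" for t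
  proof
    assume "(a t - b t) / (a t + b t) \<in> \<real>\<^sub>\<le>\<^sub>0"
    then obtain x where x: "(a t - b t) / (a t + b t) = of_real x" "x \<le> 0" by (auto elim!: nonpos_Reals_cases)
    have s: "a t + b t \<noteq> 0" using ps[OF t] by force
    have "a t - b t \<noteq> 0" using prod[of t] ne by auto
    hence "x \<noteq> 0" using x s by auto
    hence x0: "x < 0" using x by simp
    have "a t - b t = of_real x * (a t + b t)" using x s by (simp add: field_simps)
    hence e: "of_real (1 - x) * a t = of_real (1 + x) * b t" by (simp add: algebra_simps)
    from arg_cong[OF this, of Re] have "(1 - x) * Re (a t) = (1 + x) * Re (b t)" by simp
    moreover have "(1 - x) * Re (a t) > 0" using x0 pa[OF t] by simp
    ultimately have "1 + x > 0" using pb[OF t] by (simp add: zero_less_mult_iff)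
    define q where "q = (1 + x) / (1 - x)"
    have q: "0 < q" "q < 1" using x0 \<open>1 + x > 0\<close> by (auto simp: q_def)
    have "a t = of_real q * b t"
    proof -
      have "complex_of_real (1 - x) \<noteq> 0" using x0 by (simp only: of_real_eq_0_iff)
      moreover have "u = p / r * v" if "r \<noteq> 0" "r * u = p * v" for u v p r :: complex
        using that by (simp add: field_simps)
      ultimately show ?thesis using e unfolding q_def of_real_divide by blast
    qed
    hence "(a t)\<^sup>2 = of_real (q\<^sup>2) * (b t)\<^sup>2" by (simp add: power_mult_distrib)
    hence "of_real t + \<alpha> = of_real (q\<^sup>2) * (of_real t + \<beta>)" by (simp add: a_def b_def)
    from Re_csqrt_less_of_contraction[OF q t this \<beta>] show False using le by simp
  qed
  have \<phi>ne: "\<phi> t \<noteq> pi" "\<phi> t \<noteq> - pi" if t: "t \<ge> 0" for t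
  proof -
    have "w \<in> \<real>\<^sub>\<le>\<^sub>0" if "exp z = w" "Im z = pi \<or> Im z = - pi" for z w
      using that by (auto simp: complex_nonpos_Reals_iff Re_exp Im_exp)
    thus "\<phi> t \<noteq> pi" "\<phi> t \<noteq> - pi" using ex[OF t] npos[OF t] unfolding \<phi>_def by blast+
  qed
  have cont: "continuous_on {0..} \<phi>"
    unfolding \<phi>_def a_def b_def
  proof (intro continuous_intros)
    fix t :: real assume t: "t \<in> {0..}"
    show "csqrt (of_real t + \<alpha>) + csqrt (of_real t + \<beta>) \<notin> \<real>\<^sub>\<le>\<^sub>0"
      using ps[of t] t by (auto simp: a_def b_def complex_nonpos_Reals_iff simp del: csqrt.sel)
  next
    have "continuous_on {0..} (\<lambda>t. csqrt (complex_of_real t + z))" if "Re (csqrt z) > 0" for z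
      using notin[OF _ that] by (intro continuous_on_compose2[OF continuous_on_csqrt] continuous_intros) auto
    thus "continuous_on {0..} (\<lambda>x. csqrt (complex_of_real x + \<alpha>))" "continuous_on {0..} (\<lambda>x. csqrt (complex_of_real x + \<beta>))"
      using \<alpha> \<beta> by blast+
  qed
  have \<phi>0: "\<bar>\<phi> 0\<bar> < pi"
  proof -
    have a0: "a 0 = csqrt \<alpha>" "b 0 = csqrt \<beta>" by (simp_all add: a_def b_def)
    have d: "a 0 - b 0 \<noteq> 0" using prod[of 0] ne by auto
    have s: "a 0 + b 0 \<noteq> 0" using ps[of 0] by force
    have "Re (a 0 - b 0) \<ge> 0" using le by (simp add: a0 del: csqrt.sel)
    hence 1: "\<bar>Im (Ln (a 0 - b 0))\<bar> \<le> pi / 2" using Re_Ln_pos_le[OF d] by simp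
    have 2: "\<bar>Im (Ln (a 0 + b 0))\<bar> < pi / 2" using ps[of 0] by (intro Re_Ln_pos_lt_imp) simp
    have "Ln ((a 0 - b 0) * (a 0 + b 0)) = Ln (a 0 - b 0) + Ln (a 0 + b 0)"
      using 1 2 by (intro Ln_times_simple d s) (auto simp: abs_le_iff abs_less_iff)
    hence "\<phi> 0 = Im (Ln (a 0 - b 0)) - Im (Ln (a 0 + b 0))" unfolding \<phi>_def prod by simp
    thus ?thesis using 1 2 by (auto simp: abs_le_iff abs_less_iff)
  qed
  have "\<bar>\<phi> m\<bar> < pi"
  proof (rule ccontr)
    assume "\<not> \<bar>\<phi> m\<bar> < pi"
    moreover have c: "continuous_on {0..m} \<phi>" using cont by (rule continuous_on_subset) auto
    ultimately have "\<phi> m \<ge> pi \<or> \<phi> m \<le> - pi" by (auto simp: abs_less_iff)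
    thus False
    proof
      assume "\<phi> m \<ge> pi"
      then obtain t where "t \<ge> 0" "\<phi> t = pi" using IVT'[of \<phi> 0 pi m, OF _ _ m c] \<phi>0 by (auto simp: abs_less_iff)
      thus False using \<phi>ne by blast
    next
      assume "\<phi> m \<le> - pi"
      then obtain t where "t \<ge> 0" "\<phi> t = - pi" using IVT2'[of \<phi> m "- pi" 0, OF _ _ m c] \<phi>0 by (auto simp: abs_less_iff)
      thus False using \<phi>ne by blast
    qed
  qed
  hence "Ln (exp (Ln (\<alpha> - \<beta>) - 2 * Ln (a m + b m))) = Ln (\<alpha> - \<beta>) - 2 * Ln (a m + b m)"
    unfolding \<phi>_def by (intro Ln_exp) (auto simp: abs_less_iff)
  thus ?thesis unfolding ex[OF m] by (simp add: a_def b_def A_def B_def)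
qed

lemma powr_shifted_quotient:
  assumes "Re (csqrt \<alpha>) \<ge> Re (csqrt \<beta>)" "Re (csqrt \<beta>) > 0" "\<alpha> \<noteq> \<beta>" "m \<ge> 0"
  defines "A \<equiv> csqrt (of_real m + \<alpha>)" and "B \<equiv> csqrt (of_real m + \<beta>)"
  shows "((A - B) / (A + B)) powr \<nu> = (\<alpha> - \<beta>) powr \<nu> * (A + B) powr (- 2 * \<nu>)"
proof -
  have "Re A > 0" "Re B > 0"
    using shifted_square_notin_nonpos_Reals[OF assms(2,4)] shifted_square_notin_nonpos_Reals[of "csqrt \<alpha>" m] assms(1-4)
    unfolding A_def B_def by (auto intro!: Re_csqrt_pos simp del: csqrt.sel)
  hence s: "A + B \<noteq> 0" by (auto simp: complex_eq_iff)
  have "A - B \<noteq> 0"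
  proof
    assume "A - B = 0"
    hence "A\<^sup>2 = B\<^sup>2" by simp
    thus False using assms(3) by (simp add: A_def B_def)
  qed
  moreover have "\<nu> * (Ln (\<alpha> - \<beta>) - 2 * Ln (A + B)) = \<nu> * Ln (\<alpha> - \<beta>) + - 2 * \<nu> * Ln (A + B)" by (simp add: algebra_simps)
  ultimately show ?thesis
    using s assms(3) Ln_shifted_quotient[OF assms(1-4)] unfolding A_def [symmetric] B_def [symmetric]
    by (simp add: powr_def exp_add [symmetric])
qed

lemma powr_csqrt_diff:
  assumes le: "Re (csqrt \<alpha>) \<ge> Re (csqrt \<beta>)" and \<beta>: "Re (csqrt \<beta>) > 0" and ne: "\<alpha> \<noteq> \<beta>"
  shows "(csqrt \<alpha> - csqrt \<beta>) powr \<nu> = (\<alpha> - \<beta>) powr \<nu> * (csqrt \<alpha> + csqrt \<beta>) powr (- \<nu>)"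
proof -
  define s where "s = csqrt \<alpha> + csqrt \<beta>"
  define d where "d = csqrt \<alpha> - csqrt \<beta>"
  have s: "Re s > 0" using le \<beta> by (simp add: s_def del: csqrt.sel)
  hence s0: "s \<noteq> 0" by force
  have ds: "d * s = \<alpha> - \<beta>"
  proof -
    have "d * s = (csqrt \<alpha>)\<^sup>2 - (csqrt \<beta>)\<^sup>2" by (simp add: d_def s_def power2_eq_square algebra_simps del: power2_csqrt)
    thus ?thesis by simp
  qed
  hence d0: "d \<noteq> 0" using ne by auto
  have "Re d \<ge> 0" using le by (simp add: d_def del: csqrt.sel)
  hence 1: "\<bar>Im (Ln d)\<bar> \<le> pi / 2" using Re_Ln_pos_le[OF d0] by simp
  have 2: "\<bar>Im (Ln s)\<bar> < pi / 2" using s by (rule Re_Ln_pos_lt_imp)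
  have "Ln (d * s) = Ln d + Ln s" using 1 2 by (intro Ln_times_simple d0 s0) (auto simp: abs_le_iff abs_less_iff)
  hence "\<nu> * Ln d = \<nu> * Ln (\<alpha> - \<beta>) + - \<nu> * Ln s" unfolding ds by (simp add: algebra_simps)
  thus ?thesis using d0 s0 ne unfolding d_def [symmetric] s_def [symmetric] by (simp add: powr_def exp_add [symmetric])
qed

theorem mainTheorem4:
  fixes k :: nat and \<alpha> \<beta> \<nu> :: complex
  assumes "k \<ge> 2"
    and "Re (csqrt \<alpha>) \<ge> Re (csqrt \<beta>)" and "Re (csqrt \<beta>) > 0"
    and "Re \<nu> > -1"
    and "\<alpha> = \<beta> \<Longrightarrow> Re \<nu> > 0"
  shows
    "let two_terms = (\<lambda>\<mu>.
           - (1 / (2 * \<mu>)) * ((csqrt \<alpha> - csqrt \<beta>) / (csqrt \<alpha> + csqrt \<beta>)) powr \<mu>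
           + 2 powr (- 2 * \<mu> - 1) * (\<alpha> - \<beta>) powr \<mu> * Gamma (\<mu> + of_nat k / 2)
               / (of_real pi powr (of_nat k / 2) * Gamma (\<mu> + 1))
               * sum_squares_zeta k (\<mu> + of_nat k / 2));
         C = Gamma (\<nu> + of_nat k / 2)
               / (of_real pi powr (of_nat k / 2) * 2 ^ (k - 1) * Gamma (\<nu> + 1))
     in \<exists>T S.
        (if \<nu> = 0 then (two_terms \<longlongrightarrow> T) (at 0) else T = two_terms \<nu>) \<and>
        (\<lambda>n. let m = of_nat (Suc n) :: complex; a = csqrt (m + \<alpha>); b = csqrt (m + \<beta>) in
           of_nat (sum_squares_count k (Suc n)) *
           (1 / (a * b) * ((a - b) / (a + b)) powr \<nu> * (1 / a + 1 / b) ^ (k - 2)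
              * hypergeo_2F1 (\<nu> + 1 - of_nat k / 2) (1 - of_nat k / 2) (\<nu> + 1)
                  (((a - b) / (a + b))\<^sup>2)
            - 2 powr (of_nat k - 2 - 2 * \<nu>) * (\<alpha> - \<beta>) powr \<nu> / m powr (\<nu> + of_nat k / 2)))
          sums S \<and>
        (\<lambda>n. let m = of_nat (Suc n) :: complex in
           of_nat (sum_squares_count k (Suc n))
           * bessel_I \<nu> (of_real pi * (csqrt (m * \<alpha>) - csqrt (m * \<beta>)))
           * bessel_K \<nu> (of_real pi * (csqrt (m * \<alpha>) + csqrt (m * \<beta>))))
          sums
          (T
           + C / (csqrt \<alpha> * csqrt \<beta>)
               * ((csqrt \<alpha> - csqrt \<beta>) / (csqrt \<alpha> + csqrt \<beta>)) powr \<nu>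
               * (1 / csqrt \<alpha> + 1 / csqrt \<beta>) ^ (k - 2)
               * hypergeo_2F1 (\<nu> + 1 - of_nat k / 2) (1 - of_nat k / 2) (\<nu> + 1)
                   (((csqrt \<alpha> - csqrt \<beta>) / (csqrt \<alpha> + csqrt \<beta>))\<^sup>2)
           + C * S)"
proof (cases "\<alpha> = \<beta>")
  case True
  \<comment> \<open>all terms vanish, since \<open>0 powr \<nu> = 0\<close>\<close>
  hence \<nu>: "Re \<nu> > 0" by (rule assms(5))
  hence "\<nu> \<noteq> 0" by force
  thus ?thesis unfolding True Let_def
    by (intro exI[of _ 0]) (simp add: bessel_I_eq)
next
  case ne: False
  define a where "a = csqrt \<alpha>"
  define b where "b = csqrt \<beta>"
  define P where "P = (\<lambda>\<mu>. (\<alpha> - \<beta>) powr \<mu>)"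
  have ab: "Re a > 0" "Re b > 0" using assms(2,3) by (auto simp: a_def b_def simp del: csqrt.sel)
  have sq: "a\<^sup>2 = \<alpha>" "b\<^sup>2 = \<beta>" by (simp_all add: a_def b_def)
  have s0: "a + b \<noteq> 0" using ab by (auto simp: complex_eq_iff)
  have quot: "((csqrt (of_real m + \<alpha>) - csqrt (of_real m + \<beta>)) / (csqrt (of_real m + \<alpha>) + csqrt (of_real m + \<beta>))) powr \<mu> =
      P \<mu> * (csqrt (of_real m + \<alpha>) + csqrt (of_real m + \<beta>)) powr (- 2 * \<mu>)" if "m \<ge> 0" for m \<mu>
    unfolding P_def by (rule powr_shifted_quotient[OF assms(2,3) ne that])
  have quot0: "((a - b) / (a + b)) powr \<mu> = P \<mu> * (a + b) powr (- 2 * \<mu>)" for \<mu>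
    using quot[of 0 \<mu>] by (simp add: a_def b_def)
  have kern: "1 / (x * y) * ((x - y) / (x + y)) powr \<nu> * (1 / x + 1 / y) ^ (k - 2)
       * hypergeo_2F1 (\<nu> + 1 - of_nat k / 2) (1 - of_nat k / 2) (\<nu> + 1) (((x - y) / (x + y))\<^sup>2) = P \<nu> * hyp_kernel k \<nu> x y"
    if "((x - y) / (x + y)) powr \<nu> = P \<nu> * (x + y) powr (- 2 * \<nu>)" for x y
    unfolding hyp_kernel_def that by (simp only: mult_ac)
  define T where "T = P \<nu> * principal_part k \<nu> (a + b)"
  define S where "S = P \<nu> * (\<Sum>n. kernel_term k \<nu> a b n)"
  define two where "two = (\<lambda>\<mu>. - (1 / (2 * \<mu>)) * ((a - b) / (a + b)) powr \<mu>
           + 2 powr (- 2 * \<mu> - 1) * (\<alpha> - \<beta>) powr \<mu> * Gamma (\<mu> + of_nat k / 2)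
               / (of_real pi powr (of_nat k / 2) * Gamma (\<mu> + 1))
               * sum_squares_zeta k (\<mu> + of_nat k / 2))"
  have two: "two \<mu> = P \<mu> * principal_part k \<mu> (a + b)" if "\<mu> \<noteq> 0" for \<mu>
  proof -
    have "- (1 / c) * (p * w) + t * p * g / h * z = p * (t * g / h * z - w / c)" for c p w t g h z :: complex
      by (simp add: algebra_simps)
    thus ?thesis using that unfolding two_def quot0 principal_part_def zeta_term_def P_def by (simp only: if_False)
  qed
  have T: "if \<nu> = 0 then (two \<longlongrightarrow> T) (at 0) else T = two \<nu>"
  proof (cases "\<nu> = 0")
    case True
    have "(P \<longlongrightarrow> P 0) (at 0)"
    proof -
      have "P holomorphic_on {\<nu>. Re \<nu> > -1}" unfolding P_def by (intro holomorphic_intros)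
      thus ?thesis by (rule tendsto_at_0_of_holomorphic)
    qed
    hence "((\<lambda>\<mu>. P \<mu> * principal_part k \<mu> (a + b)) \<longlongrightarrow> P 0 * principal_part k 0 (a + b)) (at 0)"
      by (intro tendsto_mult tendsto_principal_part[OF assms(1) s0])
    moreover have "eventually (\<lambda>\<mu>. P \<mu> * principal_part k \<mu> (a + b) = two \<mu>) (at 0)"
      using eventually_neq_at_within[of 0] by eventually_elim (rule two[symmetric])
    ultimately show ?thesis using True by (simp add: filterlim_cong T_def)
  qed (simp add: T_def two)
  have X: "of_nat (Suc n) = complex_of_real (real (Suc n))" for n by simp
  have term1: "of_nat (sum_squares_count k (Suc n)) *
      (1 / (x * y) * ((x - y) / (x + y)) powr \<nu> * (1 / x + 1 / y) ^ (k - 2)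
         * hypergeo_2F1 (\<nu> + 1 - of_nat k / 2) (1 - of_nat k / 2) (\<nu> + 1) (((x - y) / (x + y))\<^sup>2)
       - 2 powr (of_nat k - 2 - 2 * \<nu>) * (\<alpha> - \<beta>) powr \<nu> / of_nat (Suc n) powr (\<nu> + of_nat k / 2)) = P \<nu> * kernel_term k \<nu> a b n"
    if xy: "x = csqrt (of_nat (Suc n) + \<alpha>)" "y = csqrt (of_nat (Suc n) + \<beta>)" for x y n
  proof -
    have q: "((x - y) / (x + y)) powr \<nu> = P \<nu> * (x + y) powr (- 2 * \<nu>)"
      unfolding xy X by (rule quot) simp
    have g: "r * (p * h - t * p / w) = p * (r * (h - t / w))" for r p h t w :: complex by (simp add: algebra_simps)
    show ?thesis unfolding kern[OF q] kernel_term_def sq P_def [symmetric] xy [symmetric]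
      by (rule g)
  qed
  have sS: "(\<lambda>n. P \<nu> * kernel_term k \<nu> a b n) sums S"
    unfolding S_def by (intro sums_mult summable_sums summable_kernel_term assms)
  have term2: "of_nat (sum_squares_count k (Suc n))
           * bessel_I \<nu> (of_real pi * (csqrt (of_nat (Suc n) * \<alpha>) - csqrt (of_nat (Suc n) * \<beta>)))
           * bessel_K \<nu> (of_real pi * (csqrt (of_nat (Suc n) * \<alpha>) + csqrt (of_nat (Suc n) * \<beta>))) = P \<nu> * bessel_product_term k \<nu> a b n" for n
  proof -
    define N where "N = real (Suc n)"
    have N: "N > 0" by (simp add: N_def)
    define Y where "Y = complex_of_real (pi * sqrt N)"
    have cs: "csqrt (of_nat (Suc n) * z) = of_real (sqrt N) * csqrt z" for z
      unfolding X N_def [symmetric] using N by (intro csqrt_of_real_mult) simp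
    have arg1: "of_real pi * (csqrt (of_nat (Suc n) * \<alpha>) - csqrt (of_nat (Suc n) * \<beta>)) = Y * (a - b)"
      and arg2: "of_real pi * (csqrt (of_nat (Suc n) * \<alpha>) + csqrt (of_nat (Suc n) * \<beta>)) = Y * (a + b)"
      unfolding cs by (simp_all add: a_def b_def Y_def algebra_simps)
    have d0: "a - b \<noteq> 0" using sq ne by auto
    have Y0: "Y \<noteq> 0" using N by (simp add: Y_def)
    have "Re (Y * (a + b)) > 0" using N ab unfolding Y_def by simp
    hence K: "bessel_K \<nu> (Y * (a + b)) = bessel_K_integral \<nu> (Y * (a + b))" by (rule bessel_K_eq_integral)
    have ser: "(Y * (a - b))\<^sup>2 / 4 = of_real (pi\<^sup>2 * N) * (a - b)\<^sup>2 / 4"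
    proof -
      have "Y\<^sup>2 = of_real (pi\<^sup>2 * N)" unfolding Y_def of_real_power [symmetric] using N by (simp add: power_mult_distrib)
      thus ?thesis by (simp only: power_mult_distrib)
    qed
    have pw: "(if \<nu> = 0 then 1 else (Y * (a - b) / 2) powr \<nu>) = of_real (pi * sqrt N / 2) powr \<nu> * (P \<nu> * (a + b) powr (- \<nu>))"
    proof -
      have "Y * (a - b) / 2 = of_real (pi * sqrt N / 2) * (a - b)" by (simp add: Y_def)
      hence "(Y * (a - b) / 2) powr \<nu> = of_real (pi * sqrt N / 2) powr \<nu> * (a - b) powr \<nu>"
        by (simp only:) (rule powr_times_real_left, use N in simp_all)
      also have "(a - b) powr \<nu> = P \<nu> * (a + b) powr (- \<nu>)"
        unfolding a_def b_def P_def by (rule powr_csqrt_diff[OF assms(2,3) ne])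
      finally have "(Y * (a - b) / 2) powr \<nu> = of_real (pi * sqrt N / 2) powr \<nu> * (P \<nu> * (a + b) powr (- \<nu>))" .
      moreover have "(Y * (a - b) / 2) powr 0 = 1" using Y0 d0 by simp
      ultimately show ?thesis by (cases "\<nu> = 0") simp_all
    qed
    show ?thesis
      unfolding arg1 arg2 K bessel_I_eq pw ser bessel_product_term_def N_def [symmetric] Y_def [symmetric]
      by (simp only: mult_ac)
  qed
  define C where "C = kernel_const k \<nu>"
  have "(\<lambda>n. P \<nu> * bessel_product_term k \<nu> a b n) sums (P \<nu> * bessel_product_sum k \<nu> a b)"
    unfolding bessel_product_sum_def by (intro sums_mult summable_sums summable_bessel_product_term assms ab)
  also have "P \<nu> * bessel_product_sum k \<nu> a b = T + C * (P \<nu> * hyp_kernel k \<nu> a b) + C * S"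
    unfolding normalised_identity[OF assms(1,4) ab] kernel_sum_def T_def S_def C_def by (simp add: algebra_simps)
  also have "C * (P \<nu> * hyp_kernel k \<nu> a b) = C / (a * b) * ((a - b) / (a + b)) powr \<nu> * (1 / a + 1 / b) ^ (k - 2)
       * hypergeo_2F1 (\<nu> + 1 - of_nat k / 2) (1 - of_nat k / 2) (\<nu> + 1) (((a - b) / (a + b))\<^sup>2)"
    unfolding kern[OF quot0, symmetric] by (simp add: mult_ac)
  finally have main: "(\<lambda>n. P \<nu> * bessel_product_term k \<nu> a b n) sums
      (T + C / (a * b) * ((a - b) / (a + b)) powr \<nu> * (1 / a + 1 / b) ^ (k - 2)
       * hypergeo_2F1 (\<nu> + 1 - of_nat k / 2) (1 - of_nat k / 2) (\<nu> + 1) (((a - b) / (a + b))\<^sup>2) + C * S)" .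
  show ?thesis
    unfolding Let_def a_def [symmetric] b_def [symmetric] two_def [symmetric] kernel_const_def [symmetric] C_def [symmetric]
      term1[OF refl refl] term2
    using T sS main by blast
qed

end
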